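(* Let $N=2n$ or $N=2n+1$ with $n\ge 1$. For any $1\leqslant k\leqslant n$ the Casimir element $$\mathrm{tr}\,(F_1-k+1)(F_2-k+2)\cdots (F_{2k}+k)\,A^{(2k)}\in \mathrm{U}(\mathfrak{o}_N)^{\mathrm{O}_N}$$ (the $i$-th factor being $F_i-k+i$ for $i=1,\dots,2k$) has image under the Harish-Chandra isomorphism $\chi$ equal to $(-1)^k\,e_k(l_1^2,\dots,l_n^2\,|\,a)$.
   Context: Everything is over $\mathbb{C}$. Put $i'=N-i+1$ for $1\le i\le N$. The Lie algebra $\mathfrak{o}_N\subset\mathfrak{gl}_N$ is spanned by $F_{ij}=E_{ij}-E_{j'i'}$, where $E_{ij}$ is the standard basis of $\mathfrak{gl}_N$; $\mathrm{O}_N$ is the corresponding orthogonal group (preserving the bilinear form $\langle e_i,e_j\rangle=\delta_{i j'}$ on $\mathbb{C}^N$), and $\mathrm{U}(\mathfrak{o}_N)^{\mathrm{O}_N}$ is the algebra of invariants of its adjoint action on the universal enveloping algebra. In the algebra $\mathrm{U}(\mathfrak{o}_N)\otimes(\mathrm{End}\,\mathbb{C}^N)^{\otimes m}$ put, for $a=1,\dots,m$, $F_a=\sum_{i,j=1}^N F_{ij}\otimes 1^{\otimes(a-1)}\otimes e_{ij}\otimes 1^{\otimes(m-a)}$, where $e_{ij}$ are the matrix units. Scalars $u$ in $F_a+u$ mean $u\cdot 1$. The trace $\mathrm{tr}$ is taken over all $m$ copies of $\mathrm{End}\,\mathbb{C}^N$ (here $m=2k$), so it takes values in $\mathrm{U}(\mathfrak{o}_N)$.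 The operator $A^{(m)}=\frac1{m!}\sum_{\pi\in\mathfrak{S}_m}\mathrm{sgn}(\pi)P_\pi$ on $(\mathbb{C}^N)^{\otimes m}$ is the anti-symmetrizer, where $P_\pi$ is the operator permuting the tensor factors by $\pi$ (it is the image of the anti-symmetrizer of the Brauer algebra $\mathcal{B}_m(N)$). Harish-Chandra isomorphism: for $\lambda=(\lambda_1,\dots,\lambda_n)\in\mathbb{C}^n$ let $L(\lambda)$ be the irreducible highest weight representation of $\mathfrak{o}_N$ generated by a nonzero vector $\xi$ with $F_{ij}\xi=0$ for $1\le i<j\le N$ and $F_{ii}\xi=\lambda_i\xi$ for $1\le i\le n$. Any $z\in\mathrm{U}(\mathfrak{o}_N)^{\mathrm{O}_N}$ acts on $L(\lambda)$ as a scalar $\chi(z)$. Put $l_i=\lambda_i+n-i+\varepsilon$ with $\varepsilon=0$ if $N=2n$ and $\varepsilon=\frac12$ if $N=2n+1$. Then $\chi(z)$ is a symmetric polynomial in $l_1^2,\dots,l_n^2$ and $z\mapsto\chi(z)$ is an algebra isomorphism $\mathrm{U}(\mathfrak{o}_N)^{\mathrm{O}_N}\to\mathbb{C}[l_1^2,\dots,l_n^2]^{\mathfrak{S}_n}$. Factorial elementary symmetric polynomials, for a sequence $a=(a_1,a_2,\dots)$: $$e_k(z_1,\dots,z_n\,|\,a)=\sum_{1\le p_1<\dots<p_k\le n}(z_{p_1}-a_{p_1})(z_{p_2}-a_{p_2-1})\cdots(z_{p_k}-a_{p_k-k+1}).$$ Here $a=(\varepsilon^2,(\varepsilon+1)^2,(\varepsilon+2)^2,\dots)$,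 i.e. $a_i=(\varepsilon+i-1)^2$. *)

theory Defs
  imports
    "HOL-Algebra.QuotRing"
    "HOL-Library.Poly_Mapping"
    "HOL-Combinatorics.Permutations"
    "Jordan_Normal_Form.Matrix"
    "Jordan_Normal_Form.Gauss_Jordan_Elimination"
begin

section \<open>Free associative algebras\<close>

text \<open>
  The free algebra over the complex numbers is the monoid algebra of the free monoid.
  The free monoid is written additively, because the convolution product on
  polynomial mappings is defined for additive monoids of exponents.
\<close>

datatype 'g fmon = FMon (letters: "'g list")

instantiation fmon :: (type) monoid_add
begin

definition zero_fmon :: "'g fmon" where "zero_fmon = FMon []"

definition plus_fmon :: "'g fmon \<Rightarrow> 'g fmon \<Rightarrow> 'g fmon"
  where "plus_fmon u v = FMon (letters u @ letters v)"

instance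
  by standard (simp_all add: zero_fmon_def plus_fmon_def)

end

type_synonym 'g free_poly = "'g fmon \<Rightarrow>\<^sub>0 complex"

definition letter :: "'g \<Rightarrow> 'g free_poly"
  where "letter x = Poly_Mapping.single (FMon [x]) 1"

definition const :: "complex \<Rightarrow> 'g free_poly"
  where "const c = Poly_Mapping.single 0 c"

definition free_algebra :: "'g set \<Rightarrow> 'g free_poly ring"
  where "free_algebra X =
    \<lparr>carrier = {p. \<forall>w\<in>Poly_Mapping.keys p. set (letters w) \<subseteq> X},
     monoid.mult = (*), one = 1, zero = 0, add = (+)\<rparr>"

definition free_map :: "('g \<Rightarrow> 'h) \<Rightarrow> 'g free_poly \<Rightarrow> 'h free_poly"
  where "free_map f p =
    (\<Sum>w\<in>Poly_Mapping.keys p.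
       Poly_Mapping.single (FMon (map f (letters w))) (Poly_Mapping.lookup p w))"


section \<open>Universal enveloping algebra of a Lie algebra of matrices\<close>

definition env_relations :: "complex mat set \<Rightarrow> complex mat free_poly set"
  where "env_relations g =
      {letter (x + y) - letter x - letter y | x y. x \<in> g \<and> y \<in> g}
    \<union> {letter (c \<cdot>\<^sub>m x) - const c * letter x | c x. x \<in> g}
    \<union> {letter x * letter y - letter y * letter x - letter (x * y - y * x) | x y. x \<in> g \<and> y \<in> g}"

definition env_ideal :: "complex mat set \<Rightarrow> complex mat free_poly set"
  where "env_ideal g = Idl\<^bsub>free_algebra g\<^esub> (env_relations g)"

type_synonym env_elt = "complex mat free_poly set"

definition env :: "complex mat set \<Rightarrow> env_elt ring"
  where "env g = free_algebra g Quot env_ideal g"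

definition env_class :: "complex mat set \<Rightarrow> complex mat free_poly \<Rightarrow> env_elt"
  where "env_class g p = env_ideal g +>\<^bsub>free_algebra g\<^esub> p"

definition env_scalar :: "complex mat set \<Rightarrow> complex \<Rightarrow> env_elt"
  where "env_scalar g c = env_class g (const c)"

definition env_of :: "complex mat set \<Rightarrow> complex mat \<Rightarrow> env_elt"
  where "env_of g x = env_class g (letter x)"

text \<open>
  A Lie algebra automorphism \<open>\<phi>\<close> of \<open>g\<close> induces an automorphism of the free algebra
  preserving the ideal, so the induced automorphism of the enveloping algebra sends a coset
  to its image under \<open>free_map \<phi>\<close>.
\<close>

definition env_map :: "(complex mat \<Rightarrow> complex mat) \<Rightarrow> env_elt \<Rightarrow> env_elt"
  where "env_map \<phi> z = free_map \<phi> ` z"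


section \<open>The orthogonal Lie algebra and the orthogonal group\<close>

text \<open>All indices run over \<open>1..N\<close>; library matrices are indexed from \<open>0\<close>.\<close>

definition flip :: "nat \<Rightarrow> nat \<Rightarrow> nat"
  where "flip N i = N - i + 1"

definition gl_basis :: "nat \<Rightarrow> nat \<Rightarrow> nat \<Rightarrow> complex mat"
  where "gl_basis N i j = mat N N (\<lambda>(r, s). if r + 1 = i \<and> s + 1 = j then 1 else 0)"

definition so_gen :: "nat \<Rightarrow> nat \<Rightarrow> nat \<Rightarrow> complex mat"
  where "so_gen N i j = gl_basis N i j - gl_basis N (flip N j) (flip N i)"

definition so_algebra :: "nat \<Rightarrow> complex mat set"
  where "so_algebra N =
    {mat N N (\<lambda>(r, s). \<Sum>i=1..N. \<Sum>j=1..N. c i j * so_gen N i j $$ (r, s)) | c. True}"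

definition form_matrix :: "nat \<Rightarrow> complex mat"
  where "form_matrix N = mat N N (\<lambda>(r, s). if r + 1 = flip N (s + 1) then 1 else 0)"

definition orthogonal_group :: "nat \<Rightarrow> complex mat set"
  where "orthogonal_group N =
    {g \<in> carrier_mat N N. transpose_mat g * form_matrix N * g = form_matrix N}"

definition Ad :: "complex mat \<Rightarrow> complex mat \<Rightarrow> complex mat"
  where "Ad g x = g * x * the (mat_inverse g)"

definition orthogonal_invariants :: "nat \<Rightarrow> env_elt set"
  where "orthogonal_invariants N =
    {z \<in> carrier (env (so_algebra N)). \<forall>g\<in>orthogonal_group N. env_map (Ad g) z = z}"


section \<open>The algebra \<open>U(o_N) \<otimes> (End C^N)^{\<otimes>m}\<close>\<close>

text \<open>
  Operators on the \<open>m\<close>-th tensor power are given by their matrices in the basis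
  \<open>e_I = e_{I 1} \<otimes> \<dots> \<otimes> e_{I m}\<close> indexed by \<open>I : {1..m} \<rightarrow> {1..N}\<close>, and the tensor product of
  \<open>R\<close> with the algebra of these matrices is identified with the matrices over \<open>R\<close>
  (entry \<open>A\<^bsub>I J\<^esub> x\<close> for \<open>x \<otimes> A\<close>).
\<close>

definition matrix_ring :: "('r, 'b) ring_scheme \<Rightarrow> 'x set \<Rightarrow> ('x \<times> 'x \<Rightarrow> 'r) ring"
  where "matrix_ring R X =
    \<lparr>carrier = X \<times> X \<rightarrow>\<^sub>E carrier R,
     monoid.mult = (\<lambda>A B. \<lambda>(I, J)\<in>X \<times> X. \<Oplus>\<^bsub>R\<^esub>K\<in>X. A (I, K) \<otimes>\<^bsub>R\<^esub> B (K, J)),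
     one = (\<lambda>(I, J)\<in>X \<times> X. if I = J then \<one>\<^bsub>R\<^esub> else \<zero>\<^bsub>R\<^esub>),
     zero = (\<lambda>(I, J)\<in>X \<times> X. \<zero>\<^bsub>R\<^esub>),
     add = (\<lambda>A B. \<lambda>(I, J)\<in>X \<times> X. A (I, J) \<oplus>\<^bsub>R\<^esub> B (I, J))\<rparr>"

definition multi_indices :: "nat \<Rightarrow> nat \<Rightarrow> (nat \<Rightarrow> nat) set"
  where "multi_indices N m = {1..m} \<rightarrow>\<^sub>E {1..N}"

type_synonym tensor_op = "(nat \<Rightarrow> nat) \<Rightarrow> (nat \<Rightarrow> nat) \<Rightarrow> complex"

definition tensor_ops :: "nat \<Rightarrow> (nat \<Rightarrow> nat \<Rightarrow> nat \<Rightarrow> complex) \<Rightarrow> tensor_op"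
  where "tensor_ops m M I J = (\<Prod>b=1..m. M b (I b) (J b))"

definition unit_op :: "nat \<Rightarrow> nat \<Rightarrow> nat \<Rightarrow> nat \<Rightarrow> complex"
  where "unit_op i j p q = (if p = i \<and> q = j then 1 else 0)"

definition id_op :: "nat \<Rightarrow> nat \<Rightarrow> complex"
  where "id_op p q = (if p = q then 1 else 0)"

definition env_tensor :: "nat \<Rightarrow> nat \<Rightarrow> ((nat \<Rightarrow> nat) \<times> (nat \<Rightarrow> nat) \<Rightarrow> env_elt) ring"
  where "env_tensor N m = matrix_ring (env (so_algebra N)) (multi_indices N m)"

definition pure_tensor ::
  "nat \<Rightarrow> nat \<Rightarrow> env_elt \<Rightarrow> tensor_op \<Rightarrow> (nat \<Rightarrow> nat) \<times> (nat \<Rightarrow> nat) \<Rightarrow> env_elt"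
  where "pure_tensor N m x A =
    (\<lambda>(I, J)\<in>multi_indices N m \<times> multi_indices N m.
       env_scalar (so_algebra N) (A I J) \<otimes>\<^bsub>env (so_algebra N)\<^esub> x)"

definition F_op :: "nat \<Rightarrow> nat \<Rightarrow> nat \<Rightarrow> (nat \<Rightarrow> nat) \<times> (nat \<Rightarrow> nat) \<Rightarrow> env_elt"
  where "F_op N m a =
    (\<Oplus>\<^bsub>env_tensor N m\<^esub>i\<in>{1..N}. \<Oplus>\<^bsub>env_tensor N m\<^esub>j\<in>{1..N}.
       pure_tensor N m (env_of (so_algebra N) (so_gen N i j))
         (tensor_ops m (\<lambda>b. if b = a then unit_op i j else id_op)))"

definition scalar_op :: "nat \<Rightarrow> nat \<Rightarrow> complex \<Rightarrow> (nat \<Rightarrow> nat) \<times> (nat \<Rightarrow> nat) \<Rightarrow> env_elt"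
  where "scalar_op N m u =
    pure_tensor N m (env_scalar (so_algebra N) u) (tensor_ops m (\<lambda>b. id_op))"

text \<open>\<open>P\<^sub>\<pi>\<close> moves the \<open>b\<close>-th tensor factor to position \<open>\<pi> b\<close>.\<close>

definition perm_op :: "nat \<Rightarrow> (nat \<Rightarrow> nat) \<Rightarrow> tensor_op"
  where "perm_op m \<pi> I J = (if \<forall>b\<in>{1..m}. I (\<pi> b) = J b then 1 else 0)"

definition antisymmetrizer :: "nat \<Rightarrow> tensor_op"
  where "antisymmetrizer m I J =
    (1 / fact m) * (\<Sum>\<pi> | \<pi> permutes {1..m}. of_int (sign \<pi>) * perm_op m \<pi> I J)"

definition env_trace :: "nat \<Rightarrow> nat \<Rightarrow> ((nat \<Rightarrow> nat) \<times> (nat \<Rightarrow> nat) \<Rightarrow> env_elt) \<Rightarrow> env_elt"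
  where "env_trace N m A = (\<Oplus>\<^bsub>env (so_algebra N)\<^esub>I\<in>multi_indices N m. A (I, I))"

definition ordered_prod :: "('r, 'b) ring_scheme \<Rightarrow> 'r list \<Rightarrow> 'r"
  where "ordered_prod R xs = foldr (\<lambda>x y. x \<otimes>\<^bsub>R\<^esub> y) xs \<one>\<^bsub>R\<^esub>"

definition casimir :: "nat \<Rightarrow> nat \<Rightarrow> env_elt"
  where "casimir N k =
    env_trace N (2 * k)
      (ordered_prod (env_tensor N (2 * k))
         (map (\<lambda>i. F_op N (2 * k) i \<oplus>\<^bsub>env_tensor N (2 * k)\<^esub>
                     scalar_op N (2 * k) (of_nat i - of_nat k)) [1..<2 * k + 1])
       \<otimes>\<^bsub>env_tensor N (2 * k)\<^esub>
       pure_tensor N (2 * k) \<one>\<^bsub>env (so_algebra N)\<^esub> (antisymmetrizer (2 * k)))"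


section \<open>Highest weight representations\<close>

text \<open>
  The representation space is a subspace \<open>V\<close> of an ambient complex vector space, so that
  for one type \<open>'v\<close> the dimension can vary with the highest weight.
\<close>

definition lie_representation ::
  "complex mat set \<Rightarrow> (complex \<Rightarrow> 'v \<Rightarrow> 'v) \<Rightarrow> 'v set \<Rightarrow>
   (complex mat \<Rightarrow> 'v \<Rightarrow> 'v::ab_group_add) \<Rightarrow> bool"
  where "lie_representation g scale V \<rho> \<longleftrightarrow>
    vector_space scale \<and> module.subspace scale V \<and>
    (\<forall>x\<in>g. \<forall>v\<in>V. \<rho> x v \<in> V) \<and>
    (\<forall>x\<in>g. \<forall>v\<in>V. \<forall>w\<in>V. \<rho> x (v + w) = \<rho> x v + \<rho> x w) \<and>
    (\<forall>x\<in>g. \<forall>c. \<forall>v\<in>V. \<rho> x (scale c v) = scale c (\<rho> x v)) \<and>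
    (\<forall>x\<in>g. \<forall>y\<in>g. \<forall>v\<in>V. \<rho> (x + y) v = \<rho> x v + \<rho> y v) \<and>
    (\<forall>c. \<forall>x\<in>g. \<forall>v\<in>V. \<rho> (c \<cdot>\<^sub>m x) v = scale c (\<rho> x v)) \<and>
    (\<forall>x\<in>g. \<forall>y\<in>g. \<forall>v\<in>V. \<rho> (x * y - y * x) v = \<rho> x (\<rho> y v) - \<rho> y (\<rho> x v))"

definition subrepresentation ::
  "complex mat set \<Rightarrow> (complex \<Rightarrow> 'v \<Rightarrow> 'v) \<Rightarrow> 'v set \<Rightarrow>
   (complex mat \<Rightarrow> 'v \<Rightarrow> 'v::ab_group_add) \<Rightarrow> 'v set \<Rightarrow> bool"
  where "subrepresentation g scale V \<rho> W \<longleftrightarrow>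
    module.subspace scale W \<and> W \<subseteq> V \<and> (\<forall>x\<in>g. \<forall>v\<in>W. \<rho> x v \<in> W)"

definition irreducible_representation ::
  "complex mat set \<Rightarrow> (complex \<Rightarrow> 'v \<Rightarrow> 'v) \<Rightarrow> 'v set \<Rightarrow>
   (complex mat \<Rightarrow> 'v \<Rightarrow> 'v::ab_group_add) \<Rightarrow> bool"
  where "irreducible_representation g scale V \<rho> \<longleftrightarrow>
    lie_representation g scale V \<rho> \<and> V \<noteq> {0} \<and>
    (\<forall>W. subrepresentation g scale V \<rho> W \<longrightarrow> W = {0} \<or> W = V)"

definition highest_weight_irrep ::
  "nat \<Rightarrow> (nat \<Rightarrow> complex) \<Rightarrow> (complex \<Rightarrow> 'v \<Rightarrow> 'v) \<Rightarrow> 'v set \<Rightarrow>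
   (complex mat \<Rightarrow> 'v \<Rightarrow> 'v::ab_group_add) \<Rightarrow> 'v \<Rightarrow> bool"
  where "highest_weight_irrep N lam scale V \<rho> \<xi> \<longleftrightarrow>
    irreducible_representation (so_algebra N) scale V \<rho> \<and>
    \<xi> \<in> V \<and> \<xi> \<noteq> 0 \<and>
    (\<forall>W. subrepresentation (so_algebra N) scale V \<rho> W \<and> \<xi> \<in> W \<longrightarrow> W = V) \<and>
    (\<forall>i j. 1 \<le> i \<and> i < j \<and> j \<le> N \<longrightarrow> \<rho> (so_gen N i j) \<xi> = 0) \<and>
    (\<forall>i. 1 \<le> i \<and> i \<le> N div 2 \<longrightarrow> \<rho> (so_gen N i i) \<xi> = scale (lam i) \<xi>)"

definition free_action ::
  "(complex \<Rightarrow> 'v \<Rightarrow> 'v) \<Rightarrow> ('g \<Rightarrow> 'v \<Rightarrow> 'v::ab_group_add) \<Rightarrow> 'g free_poly \<Rightarrow> 'v \<Rightarrow> 'v"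
  where "free_action scale \<rho> p v =
    (\<Sum>w\<in>Poly_Mapping.keys p. scale (Poly_Mapping.lookup p w) (foldr \<rho> (letters w) v))"

text \<open>
  All representatives of an element of the enveloping algebra act in the same way on a
  vector of a representation.
\<close>

definition env_action ::
  "(complex \<Rightarrow> 'v \<Rightarrow> 'v) \<Rightarrow> (complex mat \<Rightarrow> 'v \<Rightarrow> 'v::ab_group_add) \<Rightarrow> env_elt \<Rightarrow> 'v \<Rightarrow> 'v"
  where "env_action scale \<rho> z v = the_elem ((\<lambda>p. free_action scale \<rho> p v) ` z)"

text \<open>
  \<open>f\<close> is the Harish-Chandra image of \<open>z\<close>, regarded as a function of the highest weight:
  for every \<open>\<lambda>\<close>, \<open>z\<close> acts on \<open>L(\<lambda>)\<close> as multiplication by \<open>f \<lambda>\<close>.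
  The type argument is the type of the vectors of the representations considered.
\<close>

definition harish_chandra_image ::
  "'v::ab_group_add itself \<Rightarrow> nat \<Rightarrow> env_elt \<Rightarrow> ((nat \<Rightarrow> complex) \<Rightarrow> complex) \<Rightarrow> bool"
  where "harish_chandra_image T N z f \<longleftrightarrow>
    (\<forall>lam scale (V :: 'v set) \<rho> \<xi>. highest_weight_irrep N lam scale V \<rho> \<xi> \<longrightarrow>
       (\<forall>v\<in>V. env_action scale \<rho> z v = scale (f lam) v))"


section \<open>Factorial elementary symmetric polynomials\<close>

definition factorial_elem_sym ::
  "nat \<Rightarrow> nat \<Rightarrow> (nat \<Rightarrow> complex) \<Rightarrow> (nat \<Rightarrow> complex) \<Rightarrow> complex"
  where "factorial_elem_sym n k z a =
    (\<Sum>p | p \<in> {1..k} \<rightarrow>\<^sub>E {1..n} \<and> strict_mono_on {1..k} p.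
       \<Prod>j=1..k. z (p j) - a (p j - j + 1))"

definition rho_shift :: "nat \<Rightarrow> complex"
  where "rho_shift N = (if even N then 0 else 1 / 2)"

definition shifted_weight :: "nat \<Rightarrow> (nat \<Rightarrow> complex) \<Rightarrow> nat \<Rightarrow> complex"
  where "shifted_weight N lam i = lam i + of_nat (N div 2) - of_nat i + rho_shift N"

definition shift_sequence :: "nat \<Rightarrow> nat \<Rightarrow> complex"
  where "shift_sequence N i = (rho_shift N + of_nat i - 1)\<^sup>2"

end

theory Submission
  imports Defs
begin

text \<open>
  Adjoin anticommuting variables \<open>e\<^sub>1, \<dots>, e\<^sub>N, f\<^sub>1, \<dots>, f\<^sub>N\<close> and put \<open>Z = \<Sum> F\<^sub>i\<^sub>j e\<^sub>i f\<^sub>j\<close> and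
  \<open>T = \<Sum> e\<^sub>i f\<^sub>i\<close>.  Up to a factorial, the Casimir element is the coefficient of the top form in
  \<open>T\<^bsup>N-2k\<^esup> \<Prod> (Z + u T)\<close>, where \<open>u\<close> runs over \<open>-k+1, \<dots>, k\<close>.  With \<open>X = \<Sum> F\<^sub>i\<^sub>j e\<^sub>i e\<^sub>j\<^sub>'\<close> and
  \<open>Y = \<Sum> F\<^sub>i\<^sub>j f\<^sub>i\<^sub>' f\<^sub>j\<close> one has \<open>[Z, X] = -2 T X\<close> and \<open>[Z, Y] = 2 T Y\<close>, and the derivation sending \<open>f\<^sub>i\<close> to
  \<open>e\<^sub>i\<^sub>'\<close> sends \<open>Z\<close> to \<open>X\<close>, \<open>Y\<close> to \<open>2 Z\<close> and kills \<open>T\<close>.  Applying it to forms whose degree in the \<open>f\<^sub>i\<close> is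
  too large, which vanish, converts the product step by step into a multiple of \<open>T\<^bsup>N-2k\<^esup> X\<^sup>k Y\<^sup>k\<close>, a
  sum of products of Pfaffians.  Modulo the left ideal annihilating a highest weight vector this form
  reduces to the same forms for \<open>N - 2\<close>, which gives the recursion satisfied by the factorial elementary
  symmetric polynomials when the first variable is split off.

  The element is central because \<open>Z\<close> and \<open>T\<close> are invariant under the simultaneous action of the Lie
  algebra on the \<open>F\<^sub>i\<^sub>j\<close>, \<open>e\<^sub>i\<close> and \<open>f\<^sub>i\<close>, so its eigenvalue on the highest weight vector is its eigenvalue on
  the whole representation.
\<close>

section \<open>Odd generators over a ring containing the orthogonal relations\<close>

text \<open>The entries of F do not commute, so a weight can be used only where it stands at the
  right end of a product. Eigenvalues are therefore computed modulo a left ideal, and the Y are kept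
  on the right, where the raising elements of the outermost row pass through them. The shifts are
  dictated by [Z, X] = -2 T X: moving Z + u T past X changes u into u - 2. Products over consecutive
  symmetric shifts therefore reproduce themselves under the derivation, and each step trades two
  factors for one X and one Y. Only the shift k has no partner. Its part k T leaves T times the
  product over -k+1, ..., k-1, which has odd length and vanishes: exchanging e_i with f_i' preserves
  the relations and Z but reverses T. Annihilation operators dual to the generators are adjoined as
  well. They turn every derivation into a commutator, and they allow the top form to be cancelled at
  the end, since the computation yields only identities multiplied by it.\<close>

lemma flip_in: "i \<in> {1..N} \<Longrightarrow> flip N i \<in> {1..N}" by (auto simp: flip_def)
lemma flip_flip: "i \<in> {1..N} \<Longrightarrow> flip N (flip N i) = i" by (auto simp: flip_def)

lemma sum_flip: "(\<Sum>i=1..N. g (flip N i)) = (\<Sum>i=1..N. (g i :: 'b::comm_monoid_add))"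
  by (rule sum.reindex_bij_witness[of _ "flip N" "flip N"]) (auto simp: flip_def)

text \<open>Every derivation of the proof is the commutator with a ring element, so the Leibniz rule
  is automatic.\<close>

definition der :: "'r::ring \<Rightarrow> 'r \<Rightarrow> 'r" where "der d x = d * x - x * d"

lemma der_mult: "der d (x * y) = der d x * y + x * der d y"
  by (simp add: der_def algebra_simps)
lemma der_add: "der d (x + y) = der d x + der d y"
  by (simp add: der_def algebra_simps)
lemma der_diff: "der d (x - y) = der d x - der d y"
  by (simp add: der_def algebra_simps)
lemma der_zero [simp]: "der d 0 = 0" by (simp add: der_def)
lemma der_sum: "der d (\<Sum>i\<in>A. g i) = (\<Sum>i\<in>A. der d (g i))"
  by (simp add: der_def sum_distrib_left sum_distrib_right sum_subtractf)

text \<open>An abstract ring, because it is instantiated more than once: with the operators on a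
  Fock space, and with e and f exchanged. \<open>F_comm\<close> is the bracket of the spanning
  elements of the orthogonal algebra; two of its terms come from the general linear algebra and two
  from the skew symmetry. \<open>de\<close> and \<open>df\<close> are the annihilation operators
  dual to \<open>e\<close> and \<open>f\<close>, and \<open>sc\<close> supplies the complex scalars,
  which the type of the ring does not provide.\<close>

locale so_fock =
  fixes N :: nat and sc :: "complex \<Rightarrow> 'r::ring_1"
    and F :: "nat \<Rightarrow> nat \<Rightarrow> 'r" and e f de df :: "nat \<Rightarrow> 'r"
  assumes sc_add: "sc (a + b) = sc a + sc b"
    and sc_mult: "sc (a * b) = sc a * sc b"
    and sc_one [simp]: "sc 1 = 1"
    and sc_central: "x * sc a = sc a * x"
    and F_skew: "\<lbrakk>i \<in> {1..N}; j \<in> {1..N}\<rbrakk> \<Longrightarrow> F (flip N j) (flip N i) = - F i j"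
    and F_comm: "\<lbrakk>i \<in> {1..N}; j \<in> {1..N}; k \<in> {1..N}; l \<in> {1..N}\<rbrakk> \<Longrightarrow>
      F i j * F k l - F k l * F i j =
        (if k = j then F i l else 0) - (if i = l then F k j else 0)
        - (if k = flip N i then F (flip N j) l else 0)
        + (if l = flip N j then F k (flip N i) else 0)"
    and e_e: "e i * e j = - (e j * e i)" and e_sq: "e i * e i = 0"
    and f_f: "f i * f j = - (f j * f i)" and f_sq: "f i * f i = 0"
    and e_f: "e i * f j = - (f j * e i)"
    and F_e: "F k l * e i = e i * F k l" and F_f: "F k l * f i = f i * F k l"
    and de_e: "de i * e j = (if i = j then 1 else 0) - e j * de i"
    and de_f: "de i * f j = - (f j * de i)"
    and df_e: "df i * e j = - (e j * df i)"
    and df_f: "df i * f j = (if i = j then 1 else 0) - f j * df i"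
    and F_de: "F k l * de i = de i * F k l" and F_df: "F k l * df i = df i * F k l"
begin

lemma sc_zero [simp]: "sc 0 = 0"
  using sc_add[of 0 0] by simp

lemma sc_minus: "sc (- a) = - sc a"
  using sc_add[of a "- a"] by (simp add: eq_neg_iff_add_eq_0 add.commute)

lemma sc_diff: "sc (a - b) = sc a - sc b"
  using sc_add[of a "- b"] by (simp add: sc_minus)

lemma sc_of_nat: "sc (of_nat n) = of_nat n"
  by (induction n) (simp_all add: sc_add)

lemma sc_of_int: "sc (of_int n) = of_int n"
  by (cases n) (simp_all add: sc_of_nat sc_minus sc_diff)

lemma sc_cancel: "a \<noteq> 0 \<Longrightarrow> sc a * x = 0 \<Longrightarrow> x = 0"
proof -
  assume a: "a \<noteq> 0" "sc a * x = 0"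
  have "x = sc (inverse a * a) * x" using a(1) by simp
  also have "\<dots> = sc (inverse a) * (sc a * x)" by (simp only: sc_mult mult.assoc)
  finally show ?thesis by (simp add: a(2))
qed

lemma of_nat_cancel: "n \<noteq> 0 \<Longrightarrow> of_nat n * x = 0 \<Longrightarrow> x = (0::'r)"
  using sc_cancel[of "of_nat n" x] by (simp add: sc_of_nat)

lemma self_neg_zero: "x = - x \<Longrightarrow> x = (0::'r)"
proof -
  assume "x = - x"
  hence "of_nat 2 * x = 0" by (simp add: mult_2 eq_neg_iff_add_eq_0)
  thus ?thesis by (rule of_nat_cancel[rotated]) simp
qed

text \<open>Zero is included so that families truncated to an index range, or supported at a single
  index, are odd at every index.\<close>

definition odds :: "'r set" where "odds = {0} \<union> range e \<union> range f"

lemma odds_zero [simp]: "0 \<in> odds" and odds_e [simp]: "e i \<in> odds" and odds_f [simp]: "f i \<in> odds"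
  by (auto simp: odds_def)

lemma odds_anti: "x \<in> odds \<Longrightarrow> y \<in> odds \<Longrightarrow> x * y = - (y * x)"
  unfolding odds_def using e_e f_f e_f by (auto simp: minus_equation_iff[of "_ * _"])

lemma odds_F: "x \<in> odds \<Longrightarrow> x * F i j = F i j * x"
  unfolding odds_def using F_e F_f by auto

text \<open>All forms of the proof are instances of \<open>dot\<close> and \<open>FF\<close> for
  suitable families of odd elements. One commutator formula, \<open>FF_comm\<close>, then covers X,
  Y, Z and all the pieces into which they are split later.\<close>

definition dot :: "(nat \<Rightarrow> 'r) \<Rightarrow> (nat \<Rightarrow> 'r) \<Rightarrow> 'r"
  where "dot u v = (\<Sum>i=1..N. u i * v i)"
definition fl :: "(nat \<Rightarrow> 'r) \<Rightarrow> nat \<Rightarrow> 'r"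
  where "fl u i = u (flip N i)"
definition FF :: "(nat \<Rightarrow> 'r) \<Rightarrow> (nat \<Rightarrow> 'r) \<Rightarrow> 'r"
  where "FF u v = (\<Sum>i=1..N. \<Sum>j=1..N. F i j * (u i * v j))"

definition oddf :: "(nat \<Rightarrow> 'r) \<Rightarrow> bool" where "oddf u \<longleftrightarrow> (\<forall>i. u i \<in> odds)"

lemma oddf_fl [simp]: "oddf u \<Longrightarrow> oddf (fl u)" by (simp add: oddf_def fl_def)

text \<open>Each sign is that of the permutation of the four factors. The first four rearrangements
  match the four terms of \<open>F_comm\<close>; the last one interchanges two even pairs.\<close>

lemma odd4:
  assumes "a \<in> odds" "b \<in> odds" "c \<in> odds" "d \<in> odds"
  shows "a * b * (c * d) = a * d * (b * c)"
    and "a * b * (c * d) = - (c * b * (a * d))"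
    and "a * b * (c * d) = - (b * d * (a * c))"
    and "a * b * (c * d) = c * a * (b * d)"
    and "a * b * (c * d) = c * d * (a * b)"
proof -
  have ab: "a * b = - (b * a)" and ac: "a * c = - (c * a)" and ad: "a * d = - (d * a)" and
    bc: "b * c = - (c * b)" and bd: "b * d = - (d * b)" and cd: "c * d = - (d * c)"
    using assms odds_anti by blast+
  \<comment> \<open>The rules sort every product into the order d, c, b, a; \<open>L\<close>
    supplies them for factors inside a product nested to the right.\<close>
  have L: "x * y = - (y * x) \<Longrightarrow> x * (y * z) = - (y * (x * z))" for x y z :: 'r
    by (metis minus_mult_left mult.assoc)
  note n = mult.assoc ab[THEN L] ac[THEN L] ad[THEN L] bc[THEN L] bd[THEN L] cd[THEN L] ab ac ad bc bd cd
  show "a * b * (c * d) = a * d * (b * c)" by (simp add: n)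
  show "a * b * (c * d) = - (c * b * (a * d))" by (simp add: n)
  show "a * b * (c * d) = - (b * d * (a * c))" by (simp add: n)
  show "a * b * (c * d) = c * a * (b * d)" by (simp add: n)
  show "a * b * (c * d) = c * d * (a * b)" by (simp add: n)
qed

lemma odds_pair_F: "x \<in> odds \<Longrightarrow> y \<in> odds \<Longrightarrow> x * y * F i j = F i j * (x * y)"
  by (metis odds_F mult.assoc)

lemma odds_pair_move:
  "x \<in> odds \<Longrightarrow> y \<in> odds \<Longrightarrow> a * (x * y) * (F k l * b) = a * F k l * (x * y * b)"
  using odds_pair_F[of x y k l] by (metis mult.assoc)

lemma FF_mult_dot:
  "FF u v * dot s t = (\<Sum>i=1..N. \<Sum>j=1..N. \<Sum>k=1..N. F i j * (u i * v j * (s k * t k)))"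
  unfolding FF_def sum_distrib_right
  unfolding dot_def sum_distrib_left
  by (simp only: mult.assoc)

lemma FF_mult_FF:
  assumes "oddf u" "oddf v"
  shows "FF u v * FF s t = (\<Sum>i=1..N. \<Sum>j=1..N. \<Sum>k=1..N. \<Sum>l=1..N.
      F i j * F k l * (u i * v j * (s k * t l)))"
proof -
  have "FF u v * FF s t = (\<Sum>i=1..N. \<Sum>j=1..N. F i j * (u i * v j) * FF s t)"
    unfolding FF_def[of u v] sum_distrib_right ..
  also have "\<dots> = (\<Sum>i=1..N. \<Sum>j=1..N. \<Sum>k=1..N. \<Sum>l=1..N.
      F i j * (u i * v j) * (F k l * (s k * t l)))"
    unfolding FF_def sum_distrib_left ..
  also have "\<dots> = (\<Sum>i=1..N. \<Sum>j=1..N. \<Sum>k=1..N. \<Sum>l=1..N.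
      F i j * F k l * (u i * v j * (s k * t l)))"
    using assms by (intro sum.cong refl) (rule odds_pair_move, auto simp: oddf_def)
  finally show ?thesis .
qed

lemma sum_rot3: "(\<Sum>i\<in>A. \<Sum>j\<in>B. \<Sum>k\<in>C. g i j k) = (\<Sum>j\<in>B. \<Sum>k\<in>C. \<Sum>i\<in>A. (g i j k :: 'c::comm_monoid_add))"
  by (rule trans[OF sum.swap]) (rule sum.cong[OF refl sum.swap])

text \<open>Products of two odd elements commute with each other and with every F, so the odd
  factors can be given the same order in both products and only the commutators of the F
  remain.\<close>

lemma FF_comm_raw:
  assumes "oddf u" "oddf v" "oddf s" "oddf t"
  shows "FF u v * FF s t - FF s t * FF u v =
    (\<Sum>i=1..N. \<Sum>j=1..N. \<Sum>k=1..N. \<Sum>l=1..N.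
      (F i j * F k l - F k l * F i j) * (u i * v j * (s k * t l)))"
proof -
  have o: "u i \<in> odds" "v i \<in> odds" "s i \<in> odds" "t i \<in> odds" for i
    using assms by (auto simp: oddf_def)
  have 1: "FF u v * FF s t = (\<Sum>i=1..N. \<Sum>j=1..N. \<Sum>k=1..N. \<Sum>l=1..N.
      F i j * F k l * (u i * v j * (s k * t l)))"
    by (rule FF_mult_FF[OF assms(1,2)])
  have "FF s t * FF u v = (\<Sum>k=1..N. \<Sum>l=1..N. \<Sum>i=1..N. \<Sum>j=1..N.
      F k l * F i j * (s k * t l * (u i * v j)))"
    by (rule FF_mult_FF[OF assms(3,4)])
  also have "\<dots> = (\<Sum>k=1..N. \<Sum>l=1..N. \<Sum>i=1..N. \<Sum>j=1..N.
      F k l * F i j * (u i * v j * (s k * t l)))"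
    by (simp only: odd4(5)[OF o(3) o(4) o(1) o(2)])
  also have "\<dots> = (\<Sum>k=1..N. \<Sum>i=1..N. \<Sum>l=1..N. \<Sum>j=1..N.
      F k l * F i j * (u i * v j * (s k * t l)))"
    by (rule sum.cong[OF refl sum.swap])
  also have "\<dots> = (\<Sum>i=1..N. \<Sum>k=1..N. \<Sum>j=1..N. \<Sum>l=1..N.
      F k l * F i j * (u i * v j * (s k * t l)))"
    by (rule trans[OF sum.swap]) (rule sum.cong[OF refl sum.cong[OF refl sum.swap]])
  also have "\<dots> = (\<Sum>i=1..N. \<Sum>j=1..N. \<Sum>k=1..N. \<Sum>l=1..N.
      F k l * F i j * (u i * v j * (s k * t l)))"
    by (rule sum.cong[OF refl sum.swap])
  finally show ?thesis unfolding 1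
    by (simp add: sum_subtractf left_diff_distrib)
qed

text \<open>Each Kronecker delta of \<open>F_comm\<close> contracts one odd factor of the first form
  with one of the second. The last two contractions run through the flip of indices and stem from
  the skew symmetry of F.\<close>

lemma FF_comm:
  assumes "oddf u" "oddf v" "oddf s" "oddf t"
  shows "FF u v * FF s t - FF s t * FF u v =
    FF u t * dot v s + FF s v * dot u t + FF (fl v) t * dot u (fl s) + FF s (fl u) * dot v (fl t)"
proof -
  have o: "u i \<in> odds" "v i \<in> odds" "s i \<in> odds" "t i \<in> odds" for i
    using assms by (auto simp: oddf_def)
  let ?w = "\<lambda>i j k l. u i * v j * (s k * t l)"
  have "FF u v * FF s t - FF s t * FF u v =
    (\<Sum>i=1..N. \<Sum>j=1..N. \<Sum>k=1..N. \<Sum>l=1..N.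
       (if k = j then F i l * ?w i j k l else 0) - (if l = i then F k j * ?w i j k l else 0)
        - (if k = flip N i then F (flip N j) l * ?w i j k l else 0)
        + (if l = flip N j then F k (flip N i) * ?w i j k l else 0))"
    unfolding FF_comm_raw[OF assms]
    by (intro sum.cong refl) (simp add: F_comm left_diff_distrib distrib_right)
  also have "\<dots> =
      (\<Sum>i=1..N. \<Sum>j=1..N. \<Sum>l=1..N. F i l * ?w i j j l)
    - (\<Sum>i=1..N. \<Sum>j=1..N. \<Sum>k=1..N. F k j * ?w i j k i)
    - (\<Sum>i=1..N. \<Sum>j=1..N. \<Sum>l=1..N. F (flip N j) l * ?w i j (flip N i) l)
    + (\<Sum>i=1..N. \<Sum>j=1..N. \<Sum>k=1..N. F k (flip N i) * ?w i j k (flip N j))"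
  proof -
    have "(\<Sum>k=1..N. \<Sum>l=1..N. if k = c then g k l else 0) = (\<Sum>l=1..N. g c l)"
      if "c \<in> {1..N}" for c and g :: "nat \<Rightarrow> nat \<Rightarrow> 'r"
      using that by (subst sum.swap) (simp add: sum.delta)
    moreover have "(\<Sum>k=1..N. \<Sum>l=1..N. if l = c then g k l else 0) = (\<Sum>k=1..N. g k c)"
      if "c \<in> {1..N}" for c and g :: "nat \<Rightarrow> nat \<Rightarrow> 'r"
      using that by (simp add: sum.delta)
    ultimately show ?thesis
      using flip_in by (simp add: sum.distrib sum_subtractf del: atLeastAtMost_iff cong: sum.cong)
  qed
  also have "(\<Sum>i=1..N. \<Sum>j=1..N. \<Sum>l=1..N. F i l * ?w i j j l) = FF u t * dot v s"
  proof -
    have "(\<Sum>i=1..N. \<Sum>j=1..N. \<Sum>l=1..N. F i l * ?w i j j l)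
      = (\<Sum>i=1..N. \<Sum>l=1..N. \<Sum>j=1..N. F i l * (u i * t l * (v j * s j)))"
      by (rule sum.cong[OF refl], rule trans[OF sum.swap]) (simp only: odd4(1)[OF o(1) o(2) o(3) o(4)])
    thus ?thesis by (simp only: FF_mult_dot)
  qed
  also have "(\<Sum>i=1..N. \<Sum>j=1..N. \<Sum>k=1..N. F k j * ?w i j k i) = - (FF s v * dot u t)"
  proof -
    have "(\<Sum>i=1..N. \<Sum>j=1..N. \<Sum>k=1..N. F k j * ?w i j k i)
      = (\<Sum>j=1..N. \<Sum>k=1..N. \<Sum>i=1..N. F k j * ?w i j k i)"
      by (rule sum_rot3)
    also have "\<dots> = (\<Sum>k=1..N. \<Sum>j=1..N. \<Sum>i=1..N. F k j * (- (s k * v j * (u i * t i))))"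
      by (rule trans[OF sum.swap]) (simp only: odd4(2)[OF o(1) o(2) o(3) o(4)])
    finally show ?thesis
      by (simp only: FF_mult_dot mult_minus_right sum_negf)
  qed
  also have "(\<Sum>i=1..N. \<Sum>j=1..N. \<Sum>l=1..N. F (flip N j) l * ?w i j (flip N i) l)
      = - (FF (fl v) t * dot u (fl s))"
  proof -
    have "(\<Sum>i=1..N. \<Sum>j=1..N. \<Sum>l=1..N. F (flip N j) l * ?w i j (flip N i) l)
      = (\<Sum>j=1..N. \<Sum>l=1..N. \<Sum>i=1..N. F (flip N j) l * ?w i j (flip N i) l)"
      by (rule sum_rot3)
    also have "\<dots> = (\<Sum>j=1..N. \<Sum>l=1..N. \<Sum>i=1..N. F (flip N j) l * (- (v j * t l * (u i * fl s i))))"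
      by (simp only: odd4(3)[OF o(1) o(2) o(3) o(4)] fl_def)
    also have "\<dots> = (\<Sum>j=1..N. \<Sum>l=1..N. \<Sum>i=1..N. F j l * (- (fl v j * t l * (u i * fl s i))))"
      by (subst sum_flip[symmetric]) (rule sum.cong[OF refl], simp only: fl_def flip_flip)
    finally show ?thesis by (simp only: FF_mult_dot mult_minus_right sum_negf)
  qed
  also have "(\<Sum>i=1..N. \<Sum>j=1..N. \<Sum>k=1..N. F k (flip N i) * ?w i j k (flip N j))
      = FF s (fl u) * dot v (fl t)"
  proof -
    have "(\<Sum>i=1..N. \<Sum>j=1..N. \<Sum>k=1..N. F k (flip N i) * ?w i j k (flip N j))
      = (\<Sum>i=1..N. \<Sum>k=1..N. \<Sum>j=1..N. F k (flip N i) * (s k * u i * (v j * fl t j)))"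
      by (rule sum.cong[OF refl], rule trans[OF sum.swap]) (simp only: odd4(4)[OF o(1) o(2) o(3) o(4)] fl_def)
    also have "\<dots> = (\<Sum>i=1..N. \<Sum>k=1..N. \<Sum>j=1..N. F k i * (s k * fl u i * (v j * fl t j)))"
      by (subst sum_flip[symmetric]) (rule sum.cong[OF refl], simp only: fl_def flip_flip)
    also have "\<dots> = (\<Sum>k=1..N. \<Sum>i=1..N. \<Sum>j=1..N. F k i * (s k * fl u i * (v j * fl t j)))"
      by (rule sum.swap)
    finally show ?thesis by (simp only: FF_mult_dot)
  qed
  finally show ?thesis by (simp add: algebra_simps)
qed

end

section \<open>The forms X, Y, Z, T on the middle indices\<close>

context so_fock begin

lemma oddfD: "oddf u \<Longrightarrow> u i \<in> odds" by (simp add: oddf_def)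

text \<open>The range r < i <= N - r is stable under the flip, so the forms built from these
  families belong to the orthogonal algebra on the middle N - 2 r indices.\<close>

definition er :: "nat \<Rightarrow> nat \<Rightarrow> 'r" where "er r i = (if r < i \<and> i \<le> N - r then e i else 0)"
definition fr :: "nat \<Rightarrow> nat \<Rightarrow> 'r" where "fr r i = (if r < i \<and> i \<le> N - r then f i else 0)"
definition atf :: "nat \<Rightarrow> 'r \<Rightarrow> nat \<Rightarrow> 'r" where "atf a x i = (if i = a then x else 0)"

lemma oddf_er [simp]: "oddf (er r)" and oddf_fr [simp]: "oddf (fr r)"
  by (auto simp: oddf_def er_def fr_def)
lemma oddf_atf [simp]: "x \<in> odds \<Longrightarrow> oddf (atf a x)"
  by (auto simp: oddf_def atf_def)

lemma FF_add_left: "FF (\<lambda>i. u i + v i) w = FF u w + FF v w"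
  by (simp add: FF_def distrib_left distrib_right sum.distrib)
lemma FF_add_right: "FF w (\<lambda>i. u i + v i) = FF w u + FF w v"
  by (simp add: FF_def distrib_left distrib_right sum.distrib)

text \<open>The sign from the skew symmetry of F cancels the sign from exchanging two odd
  factors.\<close>

lemma FF_skew:
  assumes "oddf u" "oddf v" shows "FF u (fl v) = FF v (fl u)"
proof -
  have "FF u (fl v) = (\<Sum>i=1..N. \<Sum>j=1..N. F i (flip N j) * (u i * v j))"
    unfolding FF_def
    by (rule sum.cong[OF refl], subst sum_flip[symmetric], rule sum.cong[OF refl]) (simp only: fl_def flip_flip)
  also have "\<dots> = (\<Sum>i=1..N. \<Sum>j=1..N. F j (flip N i) * (v j * u i))"
  proof (intro sum.cong refl)
    fix i j assume ij: "i \<in> {1..N}" "j \<in> {1..N}"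
    have "F j (flip N i) = - F i (flip N j)"
      using F_skew[OF ij(1) flip_in[OF ij(2)]] by (simp add: flip_flip[OF ij(2)])
    moreover have "u i * v j = - (v j * u i)"
      using assms by (intro odds_anti) (auto simp: oddf_def)
    ultimately show "F i (flip N j) * (u i * v j) = F j (flip N i) * (v j * u i)" by simp
  qed
  also have "\<dots> = (\<Sum>j=1..N. \<Sum>i=1..N. F j (flip N i) * (v j * u i))" by (rule sum.swap)
  also have "\<dots> = FF v (fl u)"
    unfolding FF_def
    by (rule sum.cong[OF refl], rule sym, subst sum_flip[symmetric], rule sum.cong[OF refl]) (simp only: fl_def flip_flip)
  finally show ?thesis .
qed

lemma dot_skew: assumes "oddf u" "oddf v" shows "dot u v = - dot v u"
  unfolding dot_def sum_negf[symmetric] using assms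
  by (intro sum.cong refl odds_anti) (auto simp: oddf_def)

lemma dot_fl_fl: "dot (fl u) (fl v) = dot u v"
  unfolding dot_def fl_def using sum_flip[of "\<lambda>i. u i * v i" N] by simp

lemma fl_fl_on: "i \<in> {1..N} \<Longrightarrow> fl (fl u) i = u i" by (simp add: fl_def flip_flip)

lemma dot_cong: "(\<And>i. i \<in> {1..N} \<Longrightarrow> u i = u' i) \<Longrightarrow> (\<And>i. i \<in> {1..N} \<Longrightarrow> v i = v' i) \<Longrightarrow> dot u v = dot u' v'"
  unfolding dot_def by (intro sum.cong) auto
lemma FF_cong: "(\<And>i. i \<in> {1..N} \<Longrightarrow> u i = u' i) \<Longrightarrow> (\<And>i. i \<in> {1..N} \<Longrightarrow> v i = v' i) \<Longrightarrow> FF u v = FF u' v'"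
  unfolding FF_def by (intro sum.cong) auto

lemma dot_flfl_right [simp]: "dot u (fl (fl v)) = dot u v" by (rule dot_cong) (simp_all add: fl_fl_on)
lemma FF_flfl_left [simp]: "FF (fl (fl u)) v = FF u v" by (rule FF_cong) (simp_all add: fl_fl_on)
lemma FF_flfl_right [simp]: "FF u (fl (fl v)) = FF u v" by (rule FF_cong) (simp_all add: fl_fl_on)

lemma dot_fl_left: "dot (fl u) v = dot u (fl v)"
  using dot_fl_fl[of u "fl v"] by simp

text \<open>The contraction is skew under exchange of its arguments but symmetric under the flip.
  This removes two of the four contractions from each of the commutators of Z with X and with
  Y.\<close>

lemma dot_self_fl: assumes "oddf u" shows "dot u (fl u) = 0"
proof (rule self_neg_zero)
  show "dot u (fl u) = - dot u (fl u)"
    using dot_skew[of u "fl u"] assms dot_fl_left[of u u] by simp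
qed

lemma odds_pair_commute:
  assumes "a \<in> odds" "b \<in> odds" "x \<in> odds" shows "a * b * x = x * (a * b)"
proof -
  have "a * b * x = a * (b * x)" by (rule mult.assoc)
  also have "\<dots> = - (a * x) * b" using odds_anti[OF assms(2,3)] by (simp add: mult.assoc)
  also have "\<dots> = x * (a * b)" using odds_anti[OF assms(1,3)] by (simp add: mult.assoc)
  finally show ?thesis .
qed

lemma dot_odd_commute:
  assumes "oddf u" "oddf v" "x \<in> odds" shows "dot u v * x = x * dot u v"
  unfolding dot_def sum_distrib_left sum_distrib_right
  using assms by (intro sum.cong refl odds_pair_commute) (auto simp: oddf_def)

lemma dot_F_commute: "oddf u \<Longrightarrow> oddf v \<Longrightarrow> dot u v * F i j = F i j * dot u v"
  unfolding dot_def sum_distrib_left sum_distrib_right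
  by (intro sum.cong refl odds_pair_F) (auto simp: oddf_def)

lemma commute_mult: "x * a = a * x \<Longrightarrow> x * b = b * x \<Longrightarrow> x * (a * b) = (a * b) * (x::'r)"
  by (metis mult.assoc)

lemma commute_sum: "(\<And>i. i \<in> A \<Longrightarrow> x * g i = g i * x) \<Longrightarrow> x * (\<Sum>i\<in>A. g i) = (\<Sum>i\<in>A. g i) * (x::'r)"
  unfolding sum_distrib_left sum_distrib_right by (intro sum.cong) auto

lemma FF_commute:
  assumes "\<And>i j. i \<in> {1..N} \<Longrightarrow> j \<in> {1..N} \<Longrightarrow> x * F i j = F i j * x"
    and "\<And>i j. x * (u i * v j) = (u i * v j) * x"
  shows "x * FF u v = FF u v * x"
  unfolding FF_def
  by (rule commute_sum, rule commute_sum, rule commute_mult) (rule assms; assumption)+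

lemma dot_FF_commute:
  assumes "oddf u" "oddf v" "oddf s" "oddf t" shows "dot u v * FF s t = FF s t * dot u v"
  using assms
  by (intro FF_commute dot_F_commute) (auto intro!: commute_mult dot_odd_commute simp: oddf_def)

lemma dot_dot_commute:
  assumes "oddf u" "oddf v" "oddf s" "oddf t" shows "dot u v * dot s t = dot s t * dot u v"
  unfolding dot_def[of s t]
  using assms by (auto intro!: commute_sum commute_mult dot_odd_commute simp: oddf_def)

definition XX where "XX r = FF (er r) (fl (er r))"
definition YY where "YY r = FF (fl (fr r)) (fr r)"
definition ZZ where "ZZ r = FF (er r) (fr r)"
definition TT where "TT r = dot (er r) (fr r)"

lemma T_X: "TT r * XX s = XX s * TT r" and T_Y: "TT r * YY s = YY s * TT r"
  and T_Z: "TT r * ZZ s = ZZ s * TT r" and T_T: "TT r * TT s = TT s * TT r"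
  unfolding XX_def YY_def ZZ_def TT_def by (simp_all add: dot_FF_commute dot_dot_commute)

lemma Z_X: "ZZ r * XX r = XX r * (ZZ r - 2 * TT r)"
proof -
  have "ZZ r * XX r - XX r * ZZ r = - (XX r * TT r) - XX r * TT r"
    unfolding XX_def ZZ_def TT_def
    by (subst FF_comm) (simp_all add: dot_self_fl dot_skew[of "fr r" "er r"])
  thus ?thesis by (simp add: algebra_simps mult_2 mult_2_right)
qed

lemma Z_Y: "ZZ r * YY r = YY r * (ZZ r + 2 * TT r)"
proof -
  have "ZZ r * YY r - YY r * ZZ r = YY r * TT r + YY r * TT r"
    unfolding YY_def ZZ_def TT_def
    by (subst FF_comm) (simp_all add: dot_self_fl)
  thus ?thesis by (simp add: algebra_simps mult_2 mult_2_right)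
qed

text \<open>The derivation that replaces f_i by e_i'. A creation operator times an annihilation
  operator is even, so it acts through an ordinary commutator, without signs.\<close>

definition DD where "DD = (\<Sum>i=1..N. e (flip N i) * df i)"

lemma D_F: "der DD (F i j) = 0"
proof -
  have "F i j * DD = DD * F i j"
    unfolding DD_def by (intro commute_sum commute_mult) (simp_all add: F_e F_df)
  thus ?thesis by (simp add: der_def)
qed

lemma D_e: "der DD (e j) = 0"
proof -
  have "e (flip N i) * df i * e j = e j * (e (flip N i) * df i)" for i
  proof -
    have "e (flip N i) * df i * e j = - (e (flip N i) * e j) * df i"
      by (simp add: mult.assoc df_e)
    thus ?thesis by (simp add: e_e[of "flip N i" j] mult.assoc)
  qed
  thus ?thesis by (simp add: der_def DD_def sum_distrib_left sum_distrib_right)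
qed

lemma D_f: "j \<in> {1..N} \<Longrightarrow> der DD (f j) = e (flip N j)"
proof -
  assume j: "j \<in> {1..N}"
  have "e (flip N i) * df i * f j = (if i = j then e (flip N j) else 0) + f j * (e (flip N i) * df i)" for i
  proof -
    have "e (flip N i) * df i * f j = (if i = j then e (flip N j) else 0) - e (flip N i) * f j * df i"
      by (simp add: mult.assoc df_f right_diff_distrib)
    also have "e (flip N i) * f j * df i = - (f j * (e (flip N i) * df i))"
      using e_f[of "flip N i" j] by (simp add: mult.assoc)
    finally show ?thesis by simp
  qed
  hence "DD * f j = e (flip N j) + f j * DD"
    using j by (simp add: DD_def sum_distrib_left sum_distrib_right sum.distrib sum.delta)
  thus ?thesis by (simp add: der_def)
qed

lemma der_FF:
  assumes "\<And>i. i \<in> {1..N} \<Longrightarrow> der DD (u i) = u' i" "\<And>i. i \<in> {1..N} \<Longrightarrow> der DD (v i) = v' i"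
  shows "der DD (FF u v) = FF u' v + FF u v'"
  unfolding FF_def using assms
  by (simp add: der_sum der_mult D_F sum.distrib distrib_left cong: sum.cong del: atLeastAtMost_iff)

lemma der_er: "der DD (er r i) = 0" by (simp add: er_def D_e)
lemma der_fr: "i \<in> {1..N} \<Longrightarrow> der DD (fr r i) = fl (er r) i"
  by (auto simp: er_def fr_def D_f fl_def flip_def)
lemma der_fl_fr: "i \<in> {1..N} \<Longrightarrow> der DD (fl (fr r) i) = er r i"
  using der_fr[OF flip_in, of i r] by (simp add: fl_def flip_flip)

lemma D_X: "der DD (XX r) = 0"
  unfolding XX_def by (subst der_FF[of _ "\<lambda>_. 0" _ "\<lambda>_. 0"]) (simp_all add: der_er fl_def FF_def)
lemma D_Z: "der DD (ZZ r) = XX r"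
  unfolding ZZ_def XX_def by (subst der_FF[of _ "\<lambda>_. 0" _ "fl (er r)"]) (simp_all add: der_er der_fr FF_def)
lemma D_Y: "der DD (YY r) = 2 * ZZ r"
proof -
  have "FF (fl (fr r)) (fl (er r)) = ZZ r"
    using FF_skew[of "fl (fr r)" "er r"] by (simp add: ZZ_def)
  thus ?thesis
    unfolding YY_def by (subst der_FF[of _ "er r" _ "fl (er r)"]) (simp_all add: der_fl_fr der_fr ZZ_def mult_2)
qed
lemma D_T: "der DD (TT r) = 0"
proof -
  have "der DD (TT r) = dot (er r) (fl (er r))"
    unfolding TT_def dot_def
    by (simp add: der_sum der_mult der_er der_fr cong: sum.cong del: atLeastAtMost_iff)
  thus ?thesis by (simp add: dot_self_fl)
qed

lemma Y_pow_Z: "YY r ^ a * ZZ r = (ZZ r - of_nat (2 * a) * TT r) * YY r ^ a"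
proof (induction a)
  case (Suc a)
  have "YY r * ZZ r = (ZZ r - 2 * TT r) * YY r"
    using Z_Y[of r] T_Y[of r r] by (simp add: algebra_simps mult_2 mult_2_right)
  hence "YY r ^ Suc a * ZZ r = YY r ^ a * ((ZZ r - 2 * TT r) * YY r)"
    by (simp only: power_Suc2 mult.assoc)
  also have "\<dots> = (YY r ^ a * ZZ r) * YY r - 2 * (YY r ^ a * TT r) * YY r"
    by (simp add: algebra_simps mult_2 mult_2_right)
  also have "YY r ^ a * TT r = TT r * YY r ^ a"
    by (metis T_Y power_commuting_commutes)
  finally show ?case unfolding Suc
    by (simp add: algebra_simps mult_2 mult_2_right power_Suc2 del: power_Suc)
qed simp

text \<open>Each of the a + 1 factors Y yields 2 Z. Moving Z to the left past j factors Y turns it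
  into Z - 2 j T, and the mean of these over j = 0, ..., a is Z - a T.\<close>

lemma D_Y_pow: "der DD (YY r ^ Suc a) = of_nat (2 * (a + 1)) * ((ZZ r - of_nat a * TT r) * YY r ^ a)"
proof (induction a)
  case 0 thus ?case by (simp add: D_Y)
next
  case (Suc a)
  have c: "YY r ^ a * TT r = TT r * YY r ^ a" for a by (metis T_Y power_commuting_commutes)
  have "der DD (YY r ^ Suc (Suc a)) = der DD (YY r ^ Suc a) * YY r + YY r ^ Suc a * (2 * ZZ r)"
    unfolding power_Suc2[of _ "Suc a"] der_mult D_Y ..
  also have "YY r ^ Suc a * (2 * ZZ r) = 2 * ((ZZ r - of_nat (2 * Suc a) * TT r) * YY r ^ Suc a)"
    using Y_pow_Z[of r "Suc a"] by (simp add: mult_2 distrib_left)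
  finally show ?case unfolding Suc
    by (simp add: algebra_simps mult_2 mult_2_right power_Suc2 del: power_Suc)
qed

end

text \<open>\<open>Dg g S q\<close> is the left ideal generated by the products of q generators with
  indices in S. The ring has no grading, so a lower bound for the degree is expressed by membership
  in it; when the generators anticommute and square to zero, a bound larger than the number of
  indices forces an element to vanish.\<close>

primrec Dg :: "(nat \<Rightarrow> 'r::ring_1) \<Rightarrow> nat set \<Rightarrow> nat \<Rightarrow> 'r set" where
  "Dg g S 0 = UNIV"
| "Dg g S (Suc q) = {\<Sum>i\<in>S. c i * g i | c. \<forall>i. c i \<in> Dg g S q}"

lemma Dg_zero: "0 \<in> Dg g S q"
proof (induction q)
  case (Suc q)
  have "(0::'a) = (\<Sum>i\<in>S. 0 * g i)" by simp
  thus ?case using Suc unfolding Dg.simps by (blast intro: exI[of _ "\<lambda>_. 0"])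
qed simp

lemma Dg_add: "x \<in> Dg g S q \<Longrightarrow> y \<in> Dg g S q \<Longrightarrow> x + y \<in> Dg g S q"
proof (induction q arbitrary: x y)
  case (Suc q)
  then obtain c d where "x = (\<Sum>i\<in>S. c i * g i)" "\<forall>i. c i \<in> Dg g S q"
    "y = (\<Sum>i\<in>S. d i * g i)" "\<forall>i. d i \<in> Dg g S q" by auto
  hence "x + y = (\<Sum>i\<in>S. (c i + d i) * g i)" "\<forall>i. c i + d i \<in> Dg g S q"
    using Suc.IH by (simp_all add: distrib_right sum.distrib)
  thus ?case unfolding Dg.simps by (blast intro: exI[of _ "\<lambda>i. c i + d i"])
qed simp

lemma Dg_uminus: "x \<in> Dg g S q \<Longrightarrow> - x \<in> Dg g S q"
proof (induction q arbitrary: x)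
  case (Suc q)
  then obtain c where "x = (\<Sum>i\<in>S. c i * g i)" "\<forall>i. c i \<in> Dg g S q" by auto
  hence "- x = (\<Sum>i\<in>S. (- c i) * g i)" "\<forall>i. - c i \<in> Dg g S q"
    using Suc.IH by (simp_all add: sum_negf)
  thus ?case unfolding Dg.simps by (blast intro: exI[of _ "\<lambda>i. - c i"])
qed simp

lemma Dg_sum: "(\<And>i. i \<in> A \<Longrightarrow> h i \<in> Dg g S q) \<Longrightarrow> (\<Sum>i\<in>A. h i) \<in> Dg g S q"
  by (induction A rule: infinite_finite_induct) (auto simp: Dg_zero Dg_add)

lemma Dg_mono: "Dg g S (Suc q) \<subseteq> Dg g S q"
proof (induction q)
  case (Suc q)
  show ?case
  proof
    fix x assume "x \<in> Dg g S (Suc (Suc q))"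
    then obtain c where "x = (\<Sum>i\<in>S. c i * g i)" "\<forall>i. c i \<in> Dg g S (Suc q)"
      unfolding Dg.simps(2)[of g S "Suc q"] by blast
    thus "x \<in> Dg g S (Suc q)" using Suc unfolding Dg.simps(2)[of g S q] by blast
  qed
qed simp

text \<open>Such a y moves to the left through all generators at the cost of a uniform sign, so
  multiplying by it on the right does not lower the degree.\<close>

definition grading :: "(nat \<Rightarrow> 'r::ring_1) \<Rightarrow> 'r \<Rightarrow> bool" where
  "grading g y \<longleftrightarrow> (\<forall>i. g i * y = y * g i) \<or> (\<forall>i. g i * y = - (y * g i))"

lemma Dg_mult: "grading g y \<Longrightarrow> x \<in> Dg g S q \<Longrightarrow> x * y \<in> Dg g S q"
proof (induction q arbitrary: x)
  case (Suc q)
  then obtain c where c: "x = (\<Sum>i\<in>S. c i * g i)" "\<forall>i. c i \<in> Dg g S q" by auto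
  obtain y' where y': "\<forall>i. g i * y = y' * g i" "y' = y \<or> y' = - y"
    using Suc.prems(1) unfolding grading_def by (metis minus_mult_left)
  have "x * y = (\<Sum>i\<in>S. (c i * y') * g i)"
    unfolding c(1) sum_distrib_right by (simp add: mult.assoc y'(1))
  moreover have "\<forall>i. c i * y' \<in> Dg g S q"
  proof (cases "y' = y")
    case True thus ?thesis using Suc.IH[OF Suc.prems(1)] c(2) by simp
  next
    case False
    hence "y' = - y" using y'(2) by simp
    thus ?thesis using Suc.IH[OF Suc.prems(1)] c(2) Dg_uminus by fastforce
  qed
  ultimately show ?case unfolding Dg.simps by (blast intro: exI[of _ "\<lambda>i. c i * y'"])
qed simp

lemma Dg_gen:
  assumes "finite S" "j \<in> S" "x \<in> Dg g S q" shows "x * g j \<in> Dg g S (Suc q)"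
proof -
  have "x * g j = (\<Sum>i\<in>S. if i = j then x * g i else 0)"
    using assms by (simp add: sum.delta)
  also have "\<dots> = (\<Sum>i\<in>S. (if i = j then x else 0) * g i)"
    by (rule sum.cong) auto
  finally have 1: "x * g j = \<dots>" .
  have "\<forall>i. (if i = j then x else 0) \<in> Dg g S q" using assms Dg_zero by auto
  with 1 show ?thesis unfolding Dg.simps by (blast intro: exI[of _ "\<lambda>i. if i = j then x else 0"])
qed

text \<open>Pigeonhole. T lists the generators already split off to the right. The next one either
  repeats one of them, and the product is zero, or makes the list longer; after q steps the distinct
  indices would outnumber S.\<close>

lemma Dg_vanish_aux:
  assumes "finite S" and gg: "\<And>i j. g i * g j = - (g j * g i)" and g2: "\<And>i. g i * g i = 0"
  shows "x \<in> Dg g S q \<Longrightarrow> distinct T \<Longrightarrow> set T \<subseteq> S \<Longrightarrow> card S < q + length T \<Longrightarrow>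
    x * prod_list (map g T) = 0"
proof (induction q arbitrary: x T)
  case 0
  have "length T \<le> card S" using 0 assms(1) by (metis card_mono distinct_card)
  thus ?case using 0 by simp
next
  case (Suc q)
  have rep: "i \<in> set T \<Longrightarrow> g i * prod_list (map g T) = 0" for i T
  proof (induction T)
    case (Cons t T)
    show ?case
    proof (cases "i = t")
      case True thus ?thesis by (simp add: mult.assoc[symmetric] g2)
    next
      case False
      have "g i * (g t * prod_list (map g T)) = - (g t * (g i * prod_list (map g T)))"
        using gg[of i t] by (simp add: mult.assoc[symmetric])
      thus ?thesis using False Cons by simp
    qed
  qed simp
  obtain c where c: "x = (\<Sum>i\<in>S. c i * g i)" "\<forall>i. c i \<in> Dg g S q" using Suc.prems by auto
  have "c i * g i * prod_list (map g T) = 0" if i: "i \<in> S" for i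
  proof (cases "i \<in> set T")
    case True thus ?thesis using rep[OF True] by (simp add: mult.assoc)
  next
    case False
    have "c i * prod_list (map g (i # T)) = 0"
      using Suc.prems i False c(2) by (intro Suc.IH) auto
    thus ?thesis by (simp add: mult.assoc)
  qed
  thus ?case unfolding c(1) sum_distrib_right by (intro sum.neutral) auto
qed

text \<open>Right multiplication by y raises the level of the filtration by q. In contrast to
  membership in \<open>Dg\<close>, this is additive over products, so the degree of a product is
  read off from its factors.\<close>

definition dgr :: "(nat \<Rightarrow> 'r::ring_1) \<Rightarrow> nat set \<Rightarrow> nat \<Rightarrow> 'r \<Rightarrow> bool" where
  "dgr g S q y \<longleftrightarrow> (\<forall>p x. x \<in> Dg g S p \<longrightarrow> x * y \<in> Dg g S (p + q))"

lemma dgr_zero [simp]: "dgr g S q 0" by (simp add: dgr_def Dg_zero)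
lemma dgr_grading: "grading g y \<Longrightarrow> dgr g S 0 y" by (simp add: dgr_def Dg_mult)
lemma dgr_gen: "finite S \<Longrightarrow> j \<in> S \<Longrightarrow> dgr g S (Suc 0) (g j)" by (simp add: dgr_def Dg_gen del: Dg.simps)
lemma dgr_mult: "dgr g S a x \<Longrightarrow> dgr g S b y \<Longrightarrow> dgr g S (a + b) (x * y)"
  by (simp add: dgr_def mult.assoc[symmetric] add.assoc[symmetric])
lemma dgr_add: "dgr g S a x \<Longrightarrow> dgr g S a y \<Longrightarrow> dgr g S a (x + y)"
  by (simp add: dgr_def distrib_left Dg_add)
lemma dgr_sum: "(\<And>i. i \<in> A \<Longrightarrow> dgr g S a (h i)) \<Longrightarrow> dgr g S a (\<Sum>i\<in>A. h i)"
  by (simp add: dgr_def sum_distrib_left Dg_sum)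
lemma dgr_weaken1: "dgr g S (Suc a) x \<Longrightarrow> dgr g S a x"
  unfolding dgr_def using Dg_mono[of g S] by (metis add_Suc_right subsetD)
lemma dgr_weaken: "dgr g S a x \<Longrightarrow> b \<le> a \<Longrightarrow> dgr g S b x"
  by (induction a) (auto simp: le_Suc_eq dest: dgr_weaken1)
lemma dgr_one: "dgr g S 0 1" by (simp add: dgr_def)
lemma dgr_power: "dgr g S a x \<Longrightarrow> dgr g S (n * a) (x ^ n)"
  by (induction n) (auto simp: dgr_one intro: dgr_mult)
lemma dgr_of_int: "dgr g S 0 (of_int n)"
  by (rule dgr_grading) (simp add: grading_def mult_of_int_commute)

lemma dgr_vanish:
  assumes "finite S" "\<And>i j. g i * g j = - (g j * g i)" "\<And>i. g i * g i = 0"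
    and "dgr g S q y" "card S < q"
  shows "y = 0"
proof -
  have "1 * y \<in> Dg g S (0 + q)" using assms(4) unfolding dgr_def by (metis Dg.simps(1) UNIV_I)
  thus ?thesis using Dg_vanish_aux[OF assms(1-3), where x = y and q = q and T = "[]"] assms(5) by simp
qed

lemma der_of_int: "der d (of_int n) = 0"
  by (simp add: der_def mult_of_int_commute)
lemma der_one: "der d (1::'r::ring_1) = 0" by (simp add: der_def)
lemma der_power_zero: "der d (x::'r::ring_1) = 0 \<Longrightarrow> der d (x ^ n) = 0"
  by (induction n) (simp_all add: der_mult der_one)

text \<open>For commuting x and T this is the product of x + u T over u = -K, ..., K.\<close>

primrec pp :: "nat \<Rightarrow> 'r::ring_1 \<Rightarrow> 'r \<Rightarrow> 'r" where
  "pp 0 T x = x"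
| "pp (Suc K) T x = pp K T x * (x * x - of_int ((int K + 1)\<^sup>2) * (T * T))"

text \<open>For commuting x and T and K > 0 this is the product of x + u T over u = -K+1, ..., K-1,
  with the factor for u = 0 taken twice.\<close>

primrec qq :: "nat \<Rightarrow> 'r::ring_1 \<Rightarrow> 'r \<Rightarrow> 'r" where
  "qq 0 T x = 1"
| "qq (Suc K) T x = qq K T x * (x * x - of_int ((int K)\<^sup>2) * (T * T))"

lemma qq_pp: "qq (Suc K) T x = x * pp K T x"
  by (induction K) (simp_all add: mult.assoc add.commute)

lemma of_int_left: "y * (of_int n * z) = of_int n * (y * (z::'r::ring_1))"
  by (simp only: mult.assoc[symmetric] mult_of_int_commute[of n y])
lemma of_nat_left: "y * (of_nat n * z) = of_nat n * (y * (z::'r::ring_1))"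
  by (simp only: mult.assoc[symmetric] mult_of_nat_commute[of n y])
lemma comm_mult: "x * a = a * x \<Longrightarrow> x * b = b * x \<Longrightarrow> x * (a * b) = (a * b) * (x::'r::ring_1)"
  by (metis mult.assoc)

lemma lin_mult:
  assumes "x * T = T * (x::'r::ring_1)"
  shows "(x + of_int a * T) * (x + of_int b * T) = x * x + of_int (a + b) * (T * x) + of_int (a * b) * (T * T)"
proof -
  have "x * (of_int b * T) = of_int b * (T * x)"
    by (simp only: of_int_left assms)
  moreover have "of_int a * T * (of_int b * T) = of_int (a * b) * (T * T)"
    by (simp only: mult.assoc of_int_left[of T] of_int_mult)
  moreover have "of_int a * T * x = of_int a * (T * x)" by (rule mult.assoc)
  ultimately show ?thesis by (simp add: distrib_left distrib_right)
qed

text \<open>Comparison of coefficients, which reduces an identity of quadratic expressions in a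
  noncommutative ring to integer arithmetic.\<close>

lemma quad_comb:
  assumes "p + q = w" "p * a + q * a' = w * a''" "p * b + q * b' = w * (b''::int)"
  shows "of_int p * (S + of_int a * U + of_int b * V) + of_int q * (S + of_int a' * U + of_int b' * V)
     = of_int w * (S + of_int a'' * U + of_int b'' * (V::'r::ring_1))"
proof -
  have "of_int p * (S + of_int a * U + of_int b * V) + of_int q * (S + of_int a' * U + of_int b' * V)
    = of_int (p + q) * S + of_int (p * a + q * a') * U + of_int (p * b + q * b') * V"
    by (simp only: distrib_left of_int_add of_int_mult distrib_right mult.assoc) (simp only: add_ac)
  thus ?thesis unfolding assms by (simp only: distrib_left of_int_mult mult.assoc)
qed

text \<open>Written in s, the factors on the left have the shifts -K-1, ..., K-1 and 0 once more.
  \<open>qq K T s\<close> accounts for all of them except -K and -K-1.\<close>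

lemma pp_qq:
  assumes "s * T = T * (s::'r::ring_1)"
  shows "pp K T (s - T) * s = qq K T s * ((s + of_int (- int K) * T) * (s + of_int (- int K - 1) * T))"
proof (induction K)
  case 0
  have "(s - T) * s = s * (s - T)" using assms by (simp add: algebra_simps)
  thus ?case by simp
next
  case (Suc K)
  define L where "L a = s + of_int a * T" for a
  have LL: "L a * L b = L b * L a" for a b
    unfolding L_def lin_mult[OF assms] by (simp only: add.commute[of a b] mult.commute[of a b])
  have 1: "(s - T) * (s - T) - of_int ((int K + 1)\<^sup>2) * (T * T) = L (- int K - 2) * L (int K)"
  proof -
    have c: "(s - T) * T = T * (s - T)" using assms by (simp add: algebra_simps)
    have "(s - T) * (s - T) - of_int ((int K + 1)\<^sup>2) * (T * T)
      = (s - T + of_int (- int K - 1) * T) * (s - T + of_int (int K + 1) * T)"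
    proof -
      have "(- int K - 1) + (int K + 1) = 0" "(- int K - 1) * (int K + 1) = - ((int K + 1)\<^sup>2)"
        by (simp_all add: power2_eq_square algebra_simps)
      thus ?thesis unfolding lin_mult[OF c] by (simp only: of_int_minus of_int_0) simp
    qed
    moreover have "s - T + of_int (- int K - 1) * T = L (- int K - 2)" "s - T + of_int (int K + 1) * T = L (int K)"
      by (simp_all add: L_def algebra_simps mult_2)
    ultimately show ?thesis by simp
  qed
  have 2: "s * s - of_int ((int K)\<^sup>2) * (T * T) = L (- int K) * L (int K)"
    unfolding L_def lin_mult[OF assms] by (simp add: power2_eq_square)
  have L0: "s = L 0" by (simp add: L_def)
  have "pp (Suc K) T (s - T) * s = pp K T (s - T) * s * (L (- int K - 2) * L (int K))"
  proof -
    have "s * (L (- int K - 2) * L (int K)) = L (- int K - 2) * L (int K) * s"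
      using LL[of 0] by (intro comm_mult) (simp_all add: L0[symmetric])
    thus ?thesis unfolding pp.simps 1 by (simp only: mult.assoc)
  qed
  also have "\<dots> = qq K T s * (L (- int K) * L (- int K - 1)) * (L (- int K - 2) * L (int K))"
    unfolding Suc L_def ..
  also have "\<dots> = qq K T s * (L (- int K) * L (int K)) * (L (- int K - 1) * L (- int K - 2))"
  proof -
    have "L (int K) * (L (- int K - 1) * L (- int K - 2)) = L (- int K - 1) * L (- int K - 2) * L (int K)"
      by (intro comm_mult LL)
    thus ?thesis by (simp only: mult.assoc)
  qed
  moreover have "- int (Suc K) = - int K - 1" "- int (Suc K) - 1 = - int K - 2" by simp_all
  ultimately show ?case unfolding qq.simps 2 by (simp only: L_def)
qed

lemma pp_move:
  assumes "x * X = X * (x - 2 * T)" "T * X = X * (T::'r::ring_1)"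
  shows "pp K T x * X = X * pp K T (x - 2 * T)"
proof (induction K)
  case (Suc K)
  have "x * x * X = X * ((x - 2 * T) * (x - 2 * T))"
    by (metis assms(1) mult.assoc)
  moreover have "of_int n * (T * T) * X = X * (of_int n * (T * T))" for n
  proof -
    have "X * (T * T) = T * T * X" using assms(2) by (intro comm_mult) simp_all
    thus ?thesis by (simp only: of_int_left mult.assoc)
  qed
  ultimately have "(x * x - of_int ((int K + 1)\<^sup>2) * (T * T)) * X =
     X * ((x - 2 * T) * (x - 2 * T) - of_int ((int K + 1)\<^sup>2) * (T * T))"
    by (simp only: left_diff_distrib right_diff_distrib)
  thus ?case unfolding pp.simps by (metis Suc mult.assoc)
qed (simp add: assms)

text \<open>X is pulled to the left, which turns every x that it passes into x - 2 T. The sum of all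
  these contributions is again a product over consecutive shifts, centred at the mean x - T, with
  the degree 2 K + 1 as coefficient.\<close>

lemma der_pp:
  assumes xX: "x * X = X * (x - 2 * T)" and TX: "T * X = X * (T::'r::ring_1)" and xT: "x * T = T * x"
    and dx: "der d x = X" and dT: "der d T = 0"
  shows "der d (pp K T x) = of_int (2 * int K + 1) * (X * qq K T (x - T))"
proof (induction K)
  case 0 thus ?case by (simp add: dx)
next
  case (Suc K)
  define s where "s = x - T"
  have sT: "s * T = T * s" using xT by (simp add: s_def algebra_simps)
  define L where "L a = s + of_int a * T" for a
  define fac where "fac = x * x - of_int ((int K + 1)\<^sup>2) * (T * T)"
  have 1: "x * x - of_int ((int K + 1)\<^sup>2) * (T * T) = L (- int K) * L (int K + 2)"
  proof -
    have "x * x - of_int ((int K + 1)\<^sup>2) * (T * T)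
      = (x + of_int (- int K - 1) * T) * (x + of_int (int K + 1) * T)"
    proof -
      have "(- int K - 1) + (int K + 1) = 0" "(- int K - 1) * (int K + 1) = - ((int K + 1)\<^sup>2)"
        by (simp_all add: power2_eq_square algebra_simps)
      thus ?thesis unfolding lin_mult[OF xT] by (simp only: of_int_minus of_int_0) simp
    qed
    moreover have "x + of_int (- int K - 1) * T = L (- int K)" "x + of_int (int K + 1) * T = L (int K + 2)"
      by (simp_all add: L_def s_def algebra_simps mult_2)
    ultimately show ?thesis by simp
  qed
  have 2: "der d (x * x - of_int ((int K + 1)\<^sup>2) * (T * T)) = X * (2 * s)"
  proof -
    have "der d (of_int n * (T * T)) = 0" for n
      by (simp only: der_mult der_of_int dT mult_zero_left mult_zero_right add_0)
    hence "der d (x * x - of_int ((int K + 1)\<^sup>2) * (T * T)) = X * x + x * X"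
      by (simp only: der_diff der_mult[of d x x] dx diff_zero)
    thus ?thesis by (simp add: xX s_def algebra_simps mult_2)
  qed
  have "der d (pp (Suc K) T x) = of_int (2 * int K + 1) * (X * qq K T s) * (L (- int K) * L (int K + 2))
     + X * pp K T (s - T) * (2 * s)"
  proof -
    have "x - 2 * T = s - T" by (simp add: s_def mult_2)
    hence "pp K T x * (X * (2 * s)) = X * pp K T (s - T) * (2 * s)"
      using pp_move[OF xX TX, of K] by (simp only: mult.assoc[symmetric])
    moreover have "der d (pp (Suc K) T x) = der d (pp K T x) * fac + pp K T x * der d fac"
      unfolding pp.simps fac_def der_mult ..
    ultimately show ?thesis unfolding 2[folded fac_def] unfolding 1[folded fac_def] Suc s_def[symmetric] by simp
  qed
  also have "X * pp K T (s - T) * (2 * s) = 2 * (X * (pp K T (s - T) * s))"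
    by (simp add: mult_2 mult_2_right algebra_simps)
  also have "pp K T (s - T) * s = qq K T s * (L (- int K) * L (- int K - 1))"
    unfolding pp_qq[OF sT] L_def ..
  also have "of_int (2 * int K + 1) * (X * qq K T s) * (L (- int K) * L (int K + 2))
       + 2 * (X * (qq K T s * (L (- int K) * L (- int K - 1))))
     = X * qq K T s * (of_int (2 * int K + 1) * (L (- int K) * L (int K + 2))
        + of_int 2 * (L (- int K) * L (- int K - 1)))"
  proof -
    have "(2::'r) * y = of_int 2 * y" for y by simp
    thus ?thesis by (simp only: distrib_left of_int_left mult.assoc)
  qed
  \<comment> \<open>Apart from the common factor s - K T this is (2 K + 1) (s + (K + 2) T) + 2 (s -
    (K + 1) T) = (2 K + 3) (s + K T).\<close>
  also have "of_int (2 * int K + 1) * (L (- int K) * L (int K + 2)) + of_int 2 * (L (- int K) * L (- int K - 1))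
     = of_int (2 * int K + 3) * (L (- int K) * L (int K))"
    unfolding L_def lin_mult[OF sT]
    by (rule quad_comb) (simp_all add: algebra_simps)
  also have "L (- int K) * L (int K) = s * s - of_int ((int K)\<^sup>2) * (T * T)"
    unfolding L_def lin_mult[OF sT] by (simp add: power2_eq_square)
  also have "X * qq K T s * (of_int (2 * int K + 3) * (s * s - of_int ((int K)\<^sup>2) * (T * T)))
    = of_int (2 * int K + 3) * (X * qq (Suc K) T s)"
    unfolding qq.simps by (simp only: of_int_left mult.assoc)
  finally show ?case by (simp add: s_def add.commute)
qed

section \<open>Degrees of the forms and the ladder from Z to X and Y\<close>

context so_fock begin

definition Inn where "Inn r = {i. r < i \<and> i \<le> N - r}"

lemma finite_Inn [simp]: "finite (Inn r)"
  by (rule finite_subset[of _ "{..N}"]) (auto simp: Inn_def)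
lemma card_Inn: "card (Inn r) = N - 2 * r"
proof -
  have "Inn r = {r<..N - r}" by (auto simp: Inn_def)
  thus ?thesis by simp
qed

lemma dgr_e_vanish: "finite S \<Longrightarrow> dgr e S q y \<Longrightarrow> card S < q \<Longrightarrow> y = 0"
  using dgr_vanish[of S e q y] e_e e_sq by blast
lemma dgr_f_vanish: "finite S \<Longrightarrow> dgr f S q y \<Longrightarrow> card S < q \<Longrightarrow> y = 0"
  using dgr_vanish[of S f q y] f_f f_sq by blast

lemma dgr_F [simp]: "dgr e S 0 (F i j)" "dgr f S 0 (F i j)"
  by (auto intro!: dgr_grading simp: grading_def F_e F_f)
lemma dgr_sc [simp]: "dgr g S 0 (sc a)"
  by (rule dgr_grading) (simp add: grading_def sc_central)
lemma dgr_odds [simp]: "x \<in> odds \<Longrightarrow> dgr e S 0 x" "x \<in> odds \<Longrightarrow> dgr f S 0 x"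
  by (rule dgr_grading; unfold grading_def; intro disjI2 allI odds_anti; simp)+
lemma dgr_er: "dgr e (Inn r) (Suc 0) (er r i)"
  using dgr_gen[OF finite_Inn, of i r e] by (auto simp: er_def Inn_def)
lemma dgr_fr: "dgr f (Inn r) (Suc 0) (fr r i)"
  using dgr_gen[OF finite_Inn, of i r f] by (auto simp: fr_def Inn_def)

lemma dgr_FF:
  assumes "\<And>i j. dgr g S 0 (F i j)" "\<And>i. dgr g S a (u i)" "\<And>i. dgr g S b (v i)"
  shows "dgr g S (a + b) (FF u v)"
  unfolding FF_def
  by (intro dgr_sum) (rule dgr_mult[OF assms(1) dgr_mult[OF assms(2) assms(3)], unfolded add_0])
lemma dgr_dot:
  assumes "\<And>i. dgr g S a (u i)" "\<And>i. dgr g S b (v i)"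
  shows "dgr g S (a + b) (dot u v)"
  unfolding dot_def using assms by (intro dgr_sum dgr_mult)

lemma dgr_fl: "(\<And>i. dgr g S a (u i)) \<Longrightarrow> dgr g S a (fl u i)" by (simp add: fl_def)

lemma dgr_e_XYZT: "dgr e (Inn r) 2 (XX r)" "dgr e (Inn r) 0 (YY r)" "dgr e (Inn r) 1 (ZZ r)" "dgr e (Inn r) 1 (TT r)"
proof -
  have "dgr e (Inn r) (Suc 0 + Suc 0) (XX r)" "dgr e (Inn r) (0 + 0) (YY r)"
      "dgr e (Inn r) (Suc 0 + 0) (ZZ r)" "dgr e (Inn r) (Suc 0 + 0) (TT r)"
    unfolding XX_def YY_def ZZ_def TT_def
    by (intro dgr_FF dgr_dot dgr_fl dgr_er dgr_F dgr_odds oddfD oddf_fr)+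
  thus "dgr e (Inn r) 2 (XX r)" "dgr e (Inn r) 0 (YY r)" "dgr e (Inn r) 1 (ZZ r)" "dgr e (Inn r) 1 (TT r)"
    by (simp_all add: numeral_2_eq_2)
qed

lemma dgr_f_XYZT: "dgr f (Inn r) 0 (XX r)" "dgr f (Inn r) 2 (YY r)" "dgr f (Inn r) 1 (ZZ r)" "dgr f (Inn r) 1 (TT r)"
proof -
  have "dgr f (Inn r) (0 + 0) (XX r)" "dgr f (Inn r) (Suc 0 + Suc 0) (YY r)"
      "dgr f (Inn r) (0 + Suc 0) (ZZ r)" "dgr f (Inn r) (0 + Suc 0) (TT r)"
    unfolding XX_def YY_def ZZ_def TT_def
    by (intro dgr_FF dgr_dot dgr_fl dgr_fr dgr_F dgr_odds oddfD oddf_er)+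
  thus "dgr f (Inn r) 0 (XX r)" "dgr f (Inn r) 2 (YY r)" "dgr f (Inn r) 1 (ZZ r)" "dgr f (Inn r) 1 (TT r)"
    by (simp_all add: numeral_2_eq_2)
qed

lemma dgr_pp:
  assumes "dgr g S 1 x" "dgr g S 1 T" shows "dgr g S (2 * K + 1) (pp K T x)"
proof (induction K)
  case (Suc K)
  have "dgr g S 2 (x * x)" "dgr g S 2 (of_int n * (T * T))" for n
    using dgr_mult[OF assms(1) assms(1), unfolded one_add_one]
      dgr_mult[OF dgr_of_int[of g S n] dgr_mult[OF assms(2) assms(2)], unfolded one_add_one add_0] .
  hence "dgr g S 2 (x * x + of_int (- ((int K + 1)\<^sup>2)) * (T * T))" by (intro dgr_add)
  hence "dgr g S 2 (x * x - of_int ((int K + 1)\<^sup>2) * (T * T))"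
    by (simp only: of_int_minus mult_minus_left add_uminus_conv_diff)
  from dgr_mult[OF Suc this] show ?case by simp
qed (use assms in simp)

text \<open>The form T^M X^a \<open>pp K\<close> Y^(a+1) has degree M + 2 K + 2 a + 3 in the f, more
  than there are indices, so it is zero and so is its derivative under \<open>DD\<close>. The
  derivation either hits the middle factor and creates an X, or hits a Y and creates a factor Z; the
  two outcomes are the two sides.\<close>

lemma ladder_step:
  assumes "N - 2 * r < M + 2 * K + 2 * a + 3"
  shows "of_int (2 * int K + 1) * (TT r ^ M * XX r ^ Suc a * qq K (TT r) (ZZ r - of_nat (Suc a) * TT r) * YY r ^ Suc a)
    = - (of_nat (2 * (a + 1)) * (TT r ^ M * XX r ^ a * qq (Suc K) (TT r) (ZZ r - of_nat a * TT r) * YY r ^ a))"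
proof -
  let ?T = "TT r" and ?X = "XX r" and ?Y = "YY r" and ?Z = "ZZ r"
  define x where "x = ?Z - of_nat a * ?T"
  have xT: "x * ?T = ?T * x"
    unfolding x_def by (simp only: left_diff_distrib right_diff_distrib T_Z of_nat_left mult.assoc)
  have xX: "x * ?X = ?X * (x - 2 * ?T)"
  proof -
    have "of_nat a * ?T * ?X = ?X * (of_nat a * ?T)"
      by (simp only: of_nat_left mult.assoc T_X)
    thus ?thesis unfolding x_def using Z_X[of r] by (simp add: algebra_simps)
  qed
  have dx: "der DD x = ?X"
    unfolding x_def using der_of_int[of DD "int a"] by (simp add: der_diff der_mult D_Z D_T)
  have dgx: "dgr f (Inn r) 1 x"
  proof -
    have "dgr f (Inn r) (0 + 1) (of_int (- int a) * ?T)"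
      by (intro dgr_mult dgr_of_int dgr_f_XYZT)
    hence "dgr f (Inn r) 1 (?Z + of_int (- int a) * ?T)"
      by (intro dgr_add dgr_f_XYZT) (simp only: add_0)
    thus ?thesis by (simp add: x_def)
  qed
  have "dgr f (Inn r) (M * 1 + a * 0 + (2 * K + 1) + Suc a * 2) (?T ^ M * ?X ^ a * pp K ?T x * ?Y ^ Suc a)"
    by (intro dgr_mult dgr_power dgr_pp dgx dgr_f_XYZT)
  hence "?T ^ M * ?X ^ a * pp K ?T x * ?Y ^ Suc a = 0"
    by (rule dgr_f_vanish[OF finite_Inn]) (use assms in \<open>simp add: card_Inn\<close>)
  hence "0 = der DD (?T ^ M * ?X ^ a * pp K ?T x * ?Y ^ Suc a)" by simp
  also have "\<dots> = ?T ^ M * ?X ^ a * (of_int (2 * int K + 1) * (?X * qq K ?T (x - ?T))) * ?Y ^ Suc a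
     + ?T ^ M * ?X ^ a * pp K ?T x * (of_nat (2 * (a + 1)) * (x * ?Y ^ a))"
    by (simp only: der_mult der_power_zero[OF D_T] der_power_zero[OF D_X] der_pp[OF xX T_X xT dx D_T]
      D_Y_pow x_def[symmetric] mult_zero_left mult_zero_right add_0 add_0_right)
  also have "?T ^ M * ?X ^ a * (of_int (2 * int K + 1) * (?X * qq K ?T (x - ?T))) * ?Y ^ Suc a
     = of_int (2 * int K + 1) * (?T ^ M * ?X ^ Suc a * qq K ?T (x - ?T) * ?Y ^ Suc a)"
  proof -
    have c: "A * (of_int n * (?X * Q)) * W = of_int n * (A * ?X * Q * W)" for A Q W n
      by (simp only: of_int_left mult.assoc)
    show ?thesis unfolding c by (simp only: power_Suc2 mult.assoc)
  qed
  also have "?T ^ M * ?X ^ a * pp K ?T x * (of_nat (2 * (a + 1)) * (x * ?Y ^ a))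
     = of_nat (2 * (a + 1)) * (?T ^ M * ?X ^ a * qq (Suc K) ?T x * ?Y ^ a)"
  proof -
    \<comment> \<open>The factor x that comes from the derivative of the power of Y has to be moved
      in front of \<open>pp K\<close> to complete it to \<open>qq (Suc K)\<close>.\<close>
    have "pp K ?T x * x = x * pp K ?T x"
    proof (induction K)
      case (Suc K)
      have "x * x * x = x * (x * x)" "of_int n * (?T * ?T) * x = x * (of_int n * (?T * ?T))" for n
      proof -
        show "x * x * x = x * (x * x)" by (rule mult.assoc)
        have "x * (?T * ?T) = ?T * ?T * x" using xT by (intro comm_mult)
        thus "of_int n * (?T * ?T) * x = x * (of_int n * (?T * ?T))" by (simp only: of_int_left mult.assoc)
      qed
      hence "(x * x - of_int ((int K + 1)\<^sup>2) * (?T * ?T)) * x = x * (x * x - of_int ((int K + 1)\<^sup>2) * (?T * ?T))"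
        by (simp only: left_diff_distrib right_diff_distrib)
      thus ?case unfolding pp.simps by (metis Suc mult.assoc)
    qed simp
    moreover have c: "A * P * (of_nat n * (x * W)) = of_nat n * (A * (P * x) * W)" for A P W n
      by (simp only: of_nat_left mult.assoc)
    ultimately show ?thesis unfolding c qq_pp by simp
  qed
  finally show ?thesis
    by (simp add: x_def eq_neg_iff_add_eq_0 algebra_simps del: power_Suc)
qed

end

section \<open>The Casimir operator as a coefficient of a top form\<close>

lemma multi_indices_Suc:
  "(\<Sum>I\<in>multi_indices N (Suc m). h I) =
   (\<Sum>I\<in>multi_indices N m. \<Sum>i=1..N. (h (I(Suc m := i)) :: 'b::comm_monoid_add))"
proof -
  have S: "{1..Suc m} = insert (Suc m) {1..m}" by auto
  have "(\<Sum>I\<in>multi_indices N (Suc m). h I)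
      = (\<Sum>z\<in>{1..N} \<times> multi_indices N m. h ((\<lambda>(y, g). g(Suc m := y)) z))"
    unfolding multi_indices_def S PiE_insert_eq
    by (subst sum.reindex) (auto intro!: inj_combinator simp: o_def)
  also have "\<dots> = (\<Sum>i=1..N. \<Sum>I\<in>multi_indices N m. h (I(Suc m := i)))"
    by (subst sum.cartesian_product) (rule sum.cong, auto)
  finally show ?thesis by (subst sum.swap)
qed

lemma finite_multi_indices [simp]: "finite (multi_indices N m)"
  by (simp add: multi_indices_def finite_PiE)

lemma multi_indices_0: "multi_indices N 0 = {\<lambda>_. undefined}"
  by (simp add: multi_indices_def)

lemma multi_indices_in: "I \<in> multi_indices N m \<Longrightarrow> a \<in> {1..m} \<Longrightarrow> I a \<in> {1..N}"
  unfolding multi_indices_def by (rule PiE_mem)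

lemma prod_list_sum:
  "prod_list (map (\<lambda>a. \<Sum>i=1..N. h a i) [1..<m + 1]) =
    (\<Sum>I\<in>multi_indices N m. prod_list (map (\<lambda>a. (h a (I a) :: 'b::semiring_1)) [1..<m + 1]))"
proof (induction m)
  case 0 show ?case by (simp add: multi_indices_0)
next
  case (Suc m)
  have "[1..<Suc m + 1] = [1..<m + 1] @ [Suc m]" by simp
  note upt = this
  hence "prod_list (map (\<lambda>a. \<Sum>i=1..N. h a i) [1..<Suc m + 1])
     = prod_list (map (\<lambda>a. \<Sum>i=1..N. h a i) [1..<m + 1]) * (\<Sum>i=1..N. h (Suc m) i)"
    by simp
  also have "\<dots> = (\<Sum>I\<in>multi_indices N m. \<Sum>i=1..N. prod_list (map (\<lambda>a. h a (I a)) [1..<m + 1]) * h (Suc m) i)"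
    unfolding Suc by (rule sum_product)
  also have "\<dots> = (\<Sum>I\<in>multi_indices N m. \<Sum>i=1..N.
      prod_list (map (\<lambda>a. h a ((I(Suc m := i)) a)) [1..<Suc m + 1]))"
  proof (intro sum.cong refl)
    fix I i
    have "map (\<lambda>a. h a ((I(Suc m := i)) a)) [1..<m + 1] = map (\<lambda>a. h a (I a)) [1..<m + 1]"
      by (rule map_cong) auto
    thus "prod_list (map (\<lambda>a. h a (I a)) [1..<m + 1]) * h (Suc m) i =
       prod_list (map (\<lambda>a. h a ((I(Suc m := i)) a)) [1..<Suc m + 1])"
      unfolding upt map_append prod_list.append by (simp only:) simp
  qed
  finally show ?case by (simp only: multi_indices_Suc)
qed

lemma prod_list_comm:
  "(\<And>y. y \<in> set ys \<Longrightarrow> x * y = y * x) \<Longrightarrow> x * prod_list ys = prod_list ys * (x::'r::monoid_mult)"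
proof (induction ys)
  case (Cons y ys)
  have "x * y = y * x" "x * prod_list ys = prod_list ys * x" using Cons by simp_all
  thus ?case by (metis mult.assoc prod_list.Cons)
qed simp

lemma prod_list_perm:
  "(\<And>x y. x \<in> set xs \<Longrightarrow> y \<in> set xs \<Longrightarrow> x * y = y * x) \<Longrightarrow> mset xs = mset ys \<Longrightarrow>
    prod_list xs = prod_list (ys :: 'r::monoid_mult list)"
proof (induction xs arbitrary: ys)
  case (Cons x xs)
  have "x \<in> set ys" using Cons.prems(2) by (metis list.set_intros(1) set_mset_mset)
  then obtain ys1 ys2 where ys: "ys = ys1 @ x # ys2" by (meson split_list)
  have s: "set ys = set (x # xs)" using Cons.prems(2) by (metis set_mset_mset)
  have "prod_list xs = prod_list (ys1 @ ys2)"
    using Cons.prems ys by (intro Cons.IH) auto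
  moreover have "x * prod_list ys1 = prod_list ys1 * x"
    using s ys by (intro prod_list_comm Cons.prems(1)) auto
  ultimately show ?case by (simp add: ys mult.assoc[symmetric])
qed simp

lemma mset_remove1_Cons: "x \<in> set xs \<Longrightarrow> mset xs = mset (x # remove1 x xs)"
  by simp

lemma prod_list_split:
  "(\<And>a b. a \<in> set xs \<Longrightarrow> b \<in> set xs \<Longrightarrow> h a * g b = g b * h a) \<Longrightarrow>
    prod_list (map (\<lambda>a. g a * h a) xs) = prod_list (map g xs) * (prod_list (map h xs) :: 'r::monoid_mult)"
proof (induction xs)
  case (Cons x xs)
  have "h x * prod_list (map g xs) = prod_list (map g xs) * h x"
    using Cons.prems by (intro prod_list_comm) auto
  hence 1: "h x * (prod_list (map g xs) * y) = prod_list (map g xs) * (h x * y)" for y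
    by (simp only: mult.assoc[symmetric])
  have "prod_list (map (\<lambda>a. g a * h a) xs) = prod_list (map g xs) * prod_list (map h xs)"
    using Cons.prems by (intro Cons.IH) simp
  thus ?case by (simp only: list.map prod_list.Cons mult.assoc 1)
qed simp

text \<open>The outermost shifts K + 1 and -K-1 are combined in each step of the induction; this is
  possible because all factors are polynomials in commuting elements.\<close>

lemma prod_list_pp:
  assumes c: "x * T = T * (x::'r::ring_1)"
  shows "prod_list (map (\<lambda>u. x + of_int u * T) [- int K..int K]) = pp K T x"
proof (induction K)
  case (Suc K)
  define L where "L u = x + of_int u * T" for u
  have LL: "L a * L b = L b * L a" for a b
    unfolding L_def lin_mult[OF c] by (simp only: add.commute[of a b] mult.commute[of a b])
  have "[- int (Suc K)..int (Suc K)] = - int (Suc K) # [- int K..int (Suc K)]"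
    by (subst upto_rec1) auto
  also have "[- int K..int (Suc K)] = [- int K..int K] @ [int (Suc K)]"
    by (subst upto_rec2) auto
  finally have "prod_list (map L [- int (Suc K)..int (Suc K)])
    = L (- int (Suc K)) * (prod_list (map L [- int K..int K]) * L (int (Suc K)))"
    by simp
  also have "\<dots> = prod_list (map L [- int K..int K]) * (L (- int (Suc K)) * L (int (Suc K)))"
  proof -
    have "L (- int (Suc K)) * prod_list (map L [- int K..int K])
        = prod_list (map L [- int K..int K]) * L (- int (Suc K))"
      by (intro prod_list_comm) (auto intro: LL)
    thus ?thesis by (simp only: mult.assoc[symmetric])
  qed
  also have "L (- int (Suc K)) * L (int (Suc K)) = x * x - of_int ((int K + 1)\<^sup>2) * (T * T)"
  proof -
    have "- int (Suc K) + int (Suc K) = 0" "- int (Suc K) * int (Suc K) = - ((int K + 1)\<^sup>2)"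
      by (simp_all add: power2_eq_square algebra_simps)
    thus ?thesis unfolding L_def lin_mult[OF c] by (simp only: of_int_minus of_int_0) simp
  qed
  finally show ?case using Suc by (simp only: L_def pp.simps)
qed simp

lemma pp_uminus: "pp K (- T) x = pp K T x"
  by (induction K) simp_all

section \<open>Monomials in the odd generators and the top form\<close>

context so_fock begin

definition pr :: "nat \<Rightarrow> 'r" where "pr i = e i * f i"
text \<open>The factors are even and commute, so the order of the list is immaterial.\<close>

definition vol :: 'r where "vol = prod_list (map pr [1..<N + 1])"
definition pl where "pl m I J = prod_list (map (\<lambda>a. e (I a) * f (J a)) [1..<m + 1])"

lemma ef_comm: "e i * f j * (e k * f l) = e k * f l * (e i * f j)"
  by (rule odd4(5)) simp_all

text \<open>The pairs are even and commute, so any two of them can be brought to the front. The list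
  \<open>rest\<close> is chosen before I and J, so that one decomposition applies to a monomial and
  to its transposed version.\<close>

lemma pl_split2:
  assumes "x \<in> {1..m}" "y \<in> {1..m}" "x \<noteq> y"
  shows "\<exists>rest. set rest = {1..m} - {x, y} \<and>
    (\<forall>I J. pl m I J = (e (I x) * f (J x)) * (e (I y) * f (J y)) * prod_list (map (\<lambda>a. e (I a) * f (J a)) rest))"
proof (intro exI conjI allI)
  let ?rest = "remove1 y (remove1 x [1..<m + 1])"
  show "set ?rest = {1..m} - {x, y}" by auto
  show "pl m I J = (e (I x) * f (J x)) * (e (I y) * f (J y)) * prod_list (map (\<lambda>a. e (I a) * f (J a)) ?rest)" for I J
  proof -
    have "mset [1..<m + 1] = mset (x # remove1 x [1..<m + 1])"
      using assms by (intro mset_remove1_Cons) auto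
    moreover have "mset (remove1 x [1..<m + 1]) = mset (y # ?rest)"
      using assms by (intro mset_remove1_Cons) auto
    ultimately have "mset [1..<m + 1] = mset (x # y # ?rest)" by (simp only: mset.simps)
    hence "mset (map (\<lambda>a. e (I a) * f (J a)) [1..<m + 1]) = mset (map (\<lambda>a. e (I a) * f (J a)) (x # y # ?rest))"
      unfolding mset_map by (simp only:)
    hence "pl m I J = prod_list (map (\<lambda>a. e (I a) * f (J a)) (x # y # ?rest))"
      unfolding pl_def by (intro prod_list_perm) (auto intro: ef_comm)
    thus ?thesis by (simp add: mult.assoc)
  qed
qed

lemma pl_split1:
  assumes "x \<in> {1..m}"
  obtains Q where "pl m I J = (e (I x) * f (J x)) * Q"
proof
  let ?rest = "remove1 x [1..<m + 1]"
  have "mset [1..<m + 1] = mset (x # ?rest)"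
    using assms by (intro mset_remove1_Cons) auto
  hence "mset (map (\<lambda>a. e (I a) * f (J a)) [1..<m + 1]) = mset (map (\<lambda>a. e (I a) * f (J a)) (x # ?rest))"
    unfolding mset_map by (simp only:)
  hence "pl m I J = prod_list (map (\<lambda>a. e (I a) * f (J a)) (x # ?rest))"
    unfolding pl_def by (intro prod_list_perm) (auto intro: ef_comm)
  thus "pl m I J = (e (I x) * f (J x)) * prod_list (map (\<lambda>a. e (I a) * f (J a)) ?rest)" by simp
qed

lemma pl_transpose:
  assumes "x \<in> {1..m}" "y \<in> {1..m}" "x \<noteq> y"
  shows "pl m I (J \<circ> transpose x y) = - pl m I J"
proof -
  obtain rest where r: "set rest = {1..m} - {x, y}"
    and s: "\<forall>I J. pl m I J = (e (I x) * f (J x)) * (e (I y) * f (J y)) * prod_list (map (\<lambda>a. e (I a) * f (J a)) rest)"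
    using pl_split2[OF assms] by blast
  note s = s[rule_format]
  have 1: "map (\<lambda>a. e (I a) * f ((J \<circ> transpose x y) a)) rest = map (\<lambda>a. e (I a) * f (J a)) rest"
    using r by (intro map_cong) (auto simp: transpose_def)
  have "e (I x) * f (J y) * (e (I y) * f (J x)) = - (e (I x) * f (J x) * (e (I y) * f (J y)))"
  proof -
    have "e (I x) * f (J y) * (e (I y) * f (J x)) = e (I x) * f (J x) * (f (J y) * e (I y))"
      by (rule odd4(1)) simp_all
    also have "f (J y) * e (I y) = - (e (I y) * f (J y))" by (rule odds_anti) simp_all
    finally show ?thesis by simp
  qed
  moreover have "(J \<circ> transpose x y) x = J y" "(J \<circ> transpose x y) y = J x" by simp_all
  ultimately show ?thesis unfolding s 1 by (simp only: mult_minus_left)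
qed

lemma pl_permutes: "\<pi> permutes {1..m} \<Longrightarrow> pl m I (J \<circ> \<pi>) = of_int (sign \<pi>) * pl m I J"
proof -
  assume p: "\<pi> permutes {1..m}"
  have "\<pi> permutes {1..m} \<and> (\<forall>J. pl m I (J \<circ> \<pi>) = of_int (sign \<pi>) * pl m I J)"
  proof (rule permutes_induct[OF p finite_atLeastAtMost])
    fix a b p
    assume ab: "a \<in> {1..m}" "b \<in> {1..m}"
      and IH: "p permutes {1..m} \<and> (\<forall>J. pl m I (J \<circ> p) = of_int (sign p) * pl m I J)"
    show "transpose a b \<circ> p permutes {1..m} \<and>
      (\<forall>J. pl m I (J \<circ> (transpose a b \<circ> p)) = of_int (sign (transpose a b \<circ> p)) * pl m I J)"
    proof (cases "a = b")
      case True thus ?thesis using IH by simp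
    next
      case False
      have "permutation p" using IH by (auto simp: permutation_permutes)
      hence "sign (transpose a b \<circ> p) = - sign p"
        using False by (simp add: sign_compose permutation_swap_id sign_swap_id)
      moreover have "pl m I (J \<circ> (transpose a b \<circ> p)) = - (of_int (sign p) * pl m I J)" for J
      proof -
        have "pl m I (J \<circ> (transpose a b \<circ> p)) = pl m I ((J \<circ> transpose a b) \<circ> p)"
          by (simp only: o_assoc)
        also have "\<dots> = of_int (sign p) * pl m I (J \<circ> transpose a b)" using IH by blast
        finally show ?thesis using pl_transpose[OF ab False] by simp
      qed
      moreover have "transpose a b \<circ> p permutes {1..m}"
        using IH ab by (intro permutes_compose permutes_swap_id) auto
      ultimately show ?thesis by simp
    qed
  next
    show "id permutes {1..m} \<and> (\<forall>J. pl m I (J \<circ> id) = of_int (sign id) * pl m I J)"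
      by (intro conjI permutes_id allI) simp
  qed
  thus ?thesis by blast
qed

lemma pr_comm: "pr i * pr j = pr j * pr i" by (simp add: pr_def ef_comm)

lemma TT0: "TT 0 = (\<Sum>i=1..N. pr i)"
  unfolding TT_def dot_def pr_def by (rule sum.cong) (auto simp: er_def fr_def)

lemma pr_sq: "pr i * pr i = 0"
proof -
  have "pr i * pr i = - (e i * (e i * (f i * f i)))"
    using e_f[of i i] by (simp add: pr_def mult.assoc[symmetric]) (simp add: mult.assoc f_sq e_sq)
  thus ?thesis by (simp add: f_sq)
qed

text \<open>T is a sum of commuting elements of square zero. Only indices not yet present
  contribute, and the M missing ones can be supplied in M! orders.\<close>

lemma T_prs:
  "distinct L \<Longrightarrow> set L \<subseteq> {1..N} \<Longrightarrow> M + length L = N \<Longrightarrow>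
    TT 0 ^ M * prod_list (map pr L) = of_nat (fact M) * vol"
proof (induction M arbitrary: L)
  case 0
  have "set L = {1..N}" using 0 by (intro card_subset_eq) (auto simp: distinct_card)
  hence "mset L = mset [1..<N + 1]" using 0(1)
    by (metis atLeastLessThanSuc_atLeastAtMost Suc_eq_plus1 distinct_upt set_eq_iff_mset_eq_distinct set_upt)
  hence "mset (map pr L) = mset (map pr [1..<N + 1])" by simp
  hence "prod_list (map pr L) = vol"
    unfolding vol_def by (intro prod_list_perm) (auto intro: pr_comm)
  thus ?case by simp
next
  case (Suc M)
  have z: "pr j * prod_list (map pr L) = 0" if j: "j \<in> set L" for j
  proof -
    obtain L1 L2 where L: "L = L1 @ j # L2" using j by (meson split_list)
    have "pr j * prod_list (map pr L1) = prod_list (map pr L1) * pr j"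
      by (intro prod_list_comm) (auto intro: pr_comm)
    hence "pr j * prod_list (map pr L) = prod_list (map pr L1) * (pr j * pr j) * prod_list (map pr L2)"
      by (simp add: L mult.assoc) (simp add: mult.assoc[symmetric])
    thus ?thesis by (simp add: pr_sq)
  qed
  have "TT 0 ^ Suc M * prod_list (map pr L) = TT 0 ^ M * (TT 0 * prod_list (map pr L))"
    by (simp only: power_Suc2 mult.assoc)
  also have "TT 0 * prod_list (map pr L) = (\<Sum>j\<in>{1..N} - set L. pr j * prod_list (map pr L))"
    unfolding TT0 sum_distrib_right using z by (intro sum.mono_neutral_right) auto
  also have "TT 0 ^ M * \<dots> = (\<Sum>j\<in>{1..N} - set L. TT 0 ^ M * prod_list (map pr (j # L)))"
    by (simp add: sum_distrib_left)
  also have "\<dots> = (\<Sum>j\<in>{1..N} - set L. of_nat (fact M) * vol)"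
    using Suc.prems by (intro sum.cong refl Suc.IH) auto
  also have "\<dots> = of_nat (N - length L) * (of_nat (fact M) * vol)"
    using Suc.prems by (simp add: card_Diff_subset distinct_card)
  also have "N - length L = Suc M" using Suc.prems by simp
  finally show ?case by (simp only: fact_Suc of_nat_mult of_nat_id mult.assoc)
qed

text \<open>The determinant of the matrix with entry 1 where J a = I b and 0 elsewhere. It is m!
  times an entry of the antisymmetrizer, and it is also the coefficient, up to M!, with which T^M
  completes the monomial \<open>pl m I J\<close> to the top form. This coincidence turns the trace
  into a coefficient of a form.\<close>

definition kappa :: "nat \<Rightarrow> (nat \<Rightarrow> nat) \<Rightarrow> (nat \<Rightarrow> nat) \<Rightarrow> int" where
  "kappa m I J = (\<Sum>\<pi> | \<pi> permutes {1..m}. sign \<pi> * (if \<forall>b\<in>{1..m}. J (\<pi> b) = I b then 1 else 0))"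

lemma pl_cong: "(\<And>a. a \<in> {1..m} \<Longrightarrow> I a = I' a) \<Longrightarrow> (\<And>a. a \<in> {1..m} \<Longrightarrow> J a = J' a) \<Longrightarrow> pl m I J = pl m I' J'"
  unfolding pl_def by (rule arg_cong[of _ _ prod_list], rule map_cong) auto

lemma pl_not_inj:
  assumes "\<not> inj_on I {1..m} \<or> \<not> inj_on J {1..m}" shows "pl m I J = 0"
proof -
  obtain x y where xy: "x \<in> {1..m}" "y \<in> {1..m}" "x \<noteq> y" "I x = I y \<or> J x = J y"
    using assms by (auto simp: inj_on_def)
  obtain rest where "set rest = {1..m} - {x, y}" and s: "\<forall>I J. pl m I J = (e (I x) * f (J x)) * (e (I y) * f (J y)) * prod_list (map (\<lambda>a. e (I a) * f (J a)) rest)"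
    using pl_split2[OF xy(1-3)] by blast
  note s = s[rule_format]
  have "(e (I x) * f (J x)) * (e (I y) * f (J y)) = 0"
  proof (cases "I x = I y")
    case True
    have "(e (I x) * f (J x)) * (e (I y) * f (J y)) = e (I y) * e (I x) * (f (J x) * f (J y))"
      by (rule odd4(4)) simp_all
    thus ?thesis using True by (simp add: e_sq)
  next
    case False
    have "(e (I x) * f (J x)) * (e (I y) * f (J y)) = - (f (J x) * f (J y) * (e (I x) * e (I y)))"
      by (rule odd4(3)) simp_all
    thus ?thesis using False xy(4) by (simp add: f_sq)
  qed
  thus ?thesis unfolding s by simp
qed

text \<open>The summands of T whose index lies in J or equals I x kill the monomial. Only M - 1
  summands are left, and the M-th power of their sum is zero.\<close>

lemma T_pl_zero:
  assumes J: "inj_on J {1..m}" and x: "x \<in> {1..m}" and I: "I x \<in> {1..N}" "I x \<notin> J ` {1..m}"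
    and JN: "J ` {1..m} \<subseteq> {1..N}" and M: "M + m = N"
  shows "TT 0 ^ M * pl m I J = 0"
proof -
  define S where "S = {1..N} - J ` {1..m} - {I x}"
  define T' where "T' = (\<Sum>j\<in>S. pr j)"
  have fS: "finite S" by (simp add: S_def)
  have cJ: "card (J ` {1..m}) = m" using J by (simp add: card_image)
  have "card S = N - m - 1"
    unfolding S_def using JN I by (subst card_Diff_singleton) (auto simp: card_Diff_subset cJ simp del: One_nat_def)
  moreover have "N - m \<ge> 1"
  proof -
    have "card (insert (I x) (J ` {1..m})) \<le> card {1..N}" using JN I by (intro card_mono) auto
    thus ?thesis using I(2) cJ by simp
  qed
  ultimately have cS: "card S < M" using M by simp
  have eI: "e (I x) * pl m I J = 0"
  proof -
    obtain Q where "pl m I J = (e (I x) * f (J x)) * Q" by (rule pl_split1[OF x])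
    thus ?thesis by (simp add: mult.assoc[symmetric] e_sq)
  qed
  have fJ: "f (J y) * pl m I J = 0" if y: "y \<in> {1..m}" for y
  proof -
    obtain Q where "pl m I J = (e (I y) * f (J y)) * Q" by (rule pl_split1[OF y])
    moreover have "f (J y) * (e (I y) * f (J y)) = - (e (I y) * (f (J y) * f (J y)))"
      using odds_anti[of "f (J y)" "e (I y)"] by (simp add: mult.assoc[symmetric])
    ultimately show ?thesis by (simp add: mult.assoc[symmetric] f_sq)
  qed
  have "TT 0 * pl m I J = T' * pl m I J"
    unfolding TT0 T'_def sum_distrib_right
  proof (rule sum.mono_neutral_right)
    show "\<forall>i\<in>{1..N} - S. pr i * pl m I J = 0"
    proof
      fix i assume "i \<in> {1..N} - S"
      hence "i = I x \<or> (\<exists>y\<in>{1..m}. i = J y)" by (auto simp: S_def)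
      thus "pr i * pl m I J = 0"
      proof
        assume i: "i = I x"
        have "pr i = - (f i * e i)" unfolding pr_def by (rule odds_anti) simp_all
        thus ?thesis using eI i by (simp add: mult.assoc)
      next
        assume "\<exists>y\<in>{1..m}. i = J y"
        thus ?thesis using fJ by (auto simp: pr_def mult.assoc)
      qed
    qed
  qed (auto simp: S_def)
  moreover have TT': "T' * TT 0 = TT 0 * T'"
    unfolding TT0 T'_def by (intro commute_sum[symmetric] commute_sum pr_comm)
  ultimately have "TT 0 ^ n * pl m I J = T' ^ n * pl m I J" for n
  proof (induction n)
    case (Suc n)
    have "TT 0 ^ Suc n * pl m I J = TT 0 ^ n * (TT 0 * pl m I J)" by (simp only: power_Suc2 mult.assoc)
    also have "\<dots> = (TT 0 ^ n * T') * pl m I J" by (simp only: Suc.prems mult.assoc)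
    also have "TT 0 ^ n * T' = T' * TT 0 ^ n"
      using TT' by (metis power_commuting_commutes)
    also have "T' * TT 0 ^ n * pl m I J = T' ^ Suc n * pl m I J"
      using Suc by (simp add: mult.assoc)
    finally show ?case .
  qed simp
  moreover have "T' ^ M = 0"
  proof (rule dgr_e_vanish[OF fS])
    have "dgr e S (Suc 0 + 0) T'"
      unfolding T'_def pr_def using fS by (intro dgr_sum dgr_mult dgr_gen) simp_all
    thus "dgr e S M (T' ^ M)" using dgr_power[of e S "Suc 0" T' M] by simp
  qed (rule cS)
  ultimately show ?thesis by simp
qed

text \<open>Both sides vanish unless I and J are injective with the same values. In that case
  exactly one permutation contributes to \<open>kappa\<close>, and reordering the f produces its
  sign and a product of the even elements \<open>pr\<close>.\<close>

lemma T_pl: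
  assumes I: "I \<in> multi_indices N m" and J: "J \<in> multi_indices N m" and M: "M + m = N"
  shows "TT 0 ^ M * pl m I J = of_nat (fact M) * (of_int (kappa m I J) * vol)"
proof -
  have IN: "I ` {1..m} \<subseteq> {1..N}" and JN: "J ` {1..m} \<subseteq> {1..N}"
    using I J by (auto dest: multi_indices_in)
  consider "\<not> inj_on J {1..m}" | "inj_on J {1..m}" "I ` {1..m} \<noteq> J ` {1..m} \<or> \<not> inj_on I {1..m}"
    | "inj_on J {1..m}" "inj_on I {1..m}" "I ` {1..m} = J ` {1..m}" by blast
  thus ?thesis
  proof cases
    case 1
    then obtain x y where xy: "x \<in> {1..m}" "y \<in> {1..m}" "x \<noteq> y" "J x = J y"
      by (auto simp: inj_on_def)
    have t: "transpose x y permutes {1..m}" using xy by (intro permutes_swap_id)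
    \<comment> \<open>J takes equal values at x and y, so composing with their transposition pairs
      off terms of opposite sign.\<close>
    have "kappa m I J = (\<Sum>\<pi> | \<pi> permutes {1..m}. sign (transpose x y \<circ> \<pi>) *
        (if \<forall>b\<in>{1..m}. J ((transpose x y \<circ> \<pi>) b) = I b then 1 else 0))"
      unfolding kappa_def by (rule setum_permutations_compose_left[OF t])
    also have "\<dots> = - kappa m I J"
      unfolding kappa_def sum_negf[symmetric]
    proof (rule sum.cong[OF refl])
      fix \<pi> assume "\<pi> \<in> {\<pi>. \<pi> permutes {1..m}}"
      hence "permutation \<pi>" by (auto simp: permutation_permutes)
      hence "sign (transpose x y \<circ> \<pi>) = - sign \<pi>"
        using xy(3) by (simp add: sign_compose permutation_swap_id sign_swap_id)
      moreover have "J ((transpose x y \<circ> \<pi>) b) = J (\<pi> b)" for b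
        using xy(4) by (auto simp: transpose_def)
      ultimately show "sign (transpose x y \<circ> \<pi>) * (if \<forall>b\<in>{1..m}. J ((transpose x y \<circ> \<pi>) b) = I b then 1 else 0)
        = - (sign \<pi> * (if \<forall>b\<in>{1..m}. J (\<pi> b) = I b then 1 else 0))" by simp
    qed
    finally have "kappa m I J = 0" by simp
    thus ?thesis using pl_not_inj[of I m J] 1 by simp
  next
    case 2
    have "kappa m I J = 0"
      unfolding kappa_def
    proof (rule sum.neutral, rule ballI)
      fix \<pi> assume "\<pi> \<in> {\<pi>. \<pi> permutes {1..m}}"
      hence p: "\<pi> permutes {1..m}" by simp
      have "\<not> (\<forall>b\<in>{1..m}. J (\<pi> b) = I b)"
      proof
        assume a: "\<forall>b\<in>{1..m}. J (\<pi> b) = I b"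
        have "I ` {1..m} = J ` (\<pi> ` {1..m})" unfolding image_image using a by (intro image_cong) auto
        hence "I ` {1..m} = J ` {1..m}" by (simp only: permutes_image[OF p])
        moreover have "inj_on (J \<circ> \<pi>) {1..m}"
          using 2(1) by (intro comp_inj_on permutes_inj_on[OF p]) (simp only: permutes_image[OF p])
        hence "inj_on I {1..m}" using a by (subst inj_on_cong[of _ _ "J \<circ> \<pi>"]) auto
        ultimately show False using 2 by blast
      qed
      thus "sign \<pi> * (if \<forall>b\<in>{1..m}. J (\<pi> b) = I b then 1 else 0) = 0" by simp
    qed
    moreover have "TT 0 ^ M * pl m I J = 0"
    proof (cases "inj_on I {1..m}")
      case False thus ?thesis using pl_not_inj[of I m J] by simp
    next
      case True
      have "\<not> I ` {1..m} \<subseteq> J ` {1..m}"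
      proof
        assume "I ` {1..m} \<subseteq> J ` {1..m}"
        hence "I ` {1..m} = J ` {1..m}"
          using True 2(1) by (intro card_subset_eq) (auto simp: card_image)
        thus False using 2 True by blast
      qed
      then obtain x where "x \<in> {1..m}" "I x \<notin> J ` {1..m}" by blast
      thus ?thesis using T_pl_zero[OF 2(1) _ _ _ JN M] IN by blast
    qed
    ultimately show ?thesis by simp
  next
    case 3
    \<comment> \<open>The only permutation with J (pi b) = I b on the positions; it is the identity
      elsewhere, as \<open>permutes\<close> demands.\<close>
    define \<pi> where "\<pi> b = (if b \<in> {1..m} then inv_into {1..m} J (I b) else b)" for b
    have JP: "J (\<pi> b) = I b" "\<pi> b \<in> {1..m}" if "b \<in> {1..m}" for b
    proof -
      have "I b \<in> J ` {1..m}" using 3(3) that by blast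
      thus "J (\<pi> b) = I b" "\<pi> b \<in> {1..m}"
        using that by (auto simp: \<pi>_def f_inv_into_f simp del: atLeastAtMost_iff intro: inv_into_into)
    qed
    have "inj_on \<pi> {1..m}"
    proof (rule inj_onI)
      fix a b assume ab: "a \<in> {1..m}" "b \<in> {1..m}" "\<pi> a = \<pi> b"
      have "I a = I b" unfolding JP(1)[OF ab(1), symmetric] JP(1)[OF ab(2), symmetric] ab(3) ..
      thus "a = b" using ab(1,2) by (rule inj_onD[OF 3(2)])
    qed
    moreover have "\<pi> ` {1..m} = {1..m}"
      by (rule endo_inj_surj[OF finite_atLeastAtMost _ calculation]) (use JP(2) in blast)
    ultimately have "bij_betw \<pi> {1..m} {1..m}" by (simp only: bij_betw_def)
    hence p: "\<pi> permutes {1..m}" by (rule bij_imp_permutes) (simp only: \<pi>_def if_False)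
    have uniq: "\<sigma> = \<pi>" if "\<sigma> permutes {1..m}" "\<forall>b\<in>{1..m}. J (\<sigma> b) = I b" for \<sigma>
    proof
      fix b show "\<sigma> b = \<pi> b"
      proof (cases "b \<in> {1..m}")
        case True
        have 1: "\<sigma> b \<in> {1..m}" using that(1) True by (simp only: permutes_in_image)
        have "J (\<sigma> b) = J (\<pi> b)" unfolding JP(1)[OF True] using that(2) True by blast
        thus ?thesis using 1 JP(2)[OF True] by (rule inj_onD[OF 3(1)])
      next
        case False thus ?thesis using permutes_not_in[OF that(1)] permutes_not_in[OF p] by simp
      qed
    qed
    have k: "kappa m I J = sign \<pi>"
    proof -
      have "kappa m I J = (\<Sum>\<sigma> | \<sigma> permutes {1..m}. if \<sigma> = \<pi> then sign \<pi> else 0)"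
        unfolding kappa_def
      proof (rule sum.cong[OF refl])
        fix \<sigma> assume "\<sigma> \<in> {\<sigma>. \<sigma> permutes {1..m}}"
        hence s: "\<sigma> permutes {1..m}" by simp
        show "sign \<sigma> * (if \<forall>b\<in>{1..m}. J (\<sigma> b) = I b then 1 else 0) = (if \<sigma> = \<pi> then sign \<pi> else 0)"
        proof (cases "\<forall>b\<in>{1..m}. J (\<sigma> b) = I b")
          case True
          hence "\<sigma> = \<pi>" by (rule uniq[OF s])
          thus ?thesis unfolding if_P[OF True] by simp
        next
          case False
          hence "\<sigma> \<noteq> \<pi>" using JP(1) by blast
          thus ?thesis unfolding if_not_P[OF False] by simp
        qed
      qed
      also have "\<dots> = sign \<pi>"
        using p finite_permutations[OF finite_atLeastAtMost[of 1 m]] by (simp only: sum.delta mem_Collect_eq if_True)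
      finally show ?thesis .
    qed
    have "pl m I J = of_int (sign (inv_into UNIV \<pi>)) * pl m I I"
    proof -
      have "pl m I J = pl m I (I \<circ> inv_into UNIV \<pi>)"
      proof (rule pl_cong[OF refl])
        fix a assume a: "a \<in> {1..m}"
        hence "inv_into UNIV \<pi> a \<in> {1..m}" using permutes_inv[OF p] by (simp only: permutes_in_image)
        hence "I (inv_into UNIV \<pi> a) = J (\<pi> (inv_into UNIV \<pi> a))" by (simp only: JP(1))
        thus "J a = (I \<circ> inv_into UNIV \<pi>) a" by (simp add: permutes_inverses[OF p])
      qed
      thus ?thesis by (simp only: pl_permutes[OF permutes_inv[OF p]])
    qed
    moreover have "sign (inv_into UNIV \<pi>) = sign \<pi>" using p by (intro sign_inverse) (auto simp: permutation_permutes)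
    moreover have "TT 0 ^ M * pl m I I = of_nat (fact M) * vol"
    proof -
      have S: "set [1..<m + 1] = {1..m}" by auto
      have "pl m I I = prod_list (map pr (map I [1..<m + 1]))"
        by (simp only: pl_def pr_def map_map o_def)
      moreover have "distinct (map I [1..<m + 1])"
        by (simp only: distinct_map distinct_upt S 3(2) simp_thms)
      moreover have "set (map I [1..<m + 1]) \<subseteq> {1..N}"
        by (simp only: set_map S IN)
      moreover have "M + length (map I [1..<m + 1]) = N" using M by simp
      ultimately show ?thesis by (simp only: T_prs)
    qed
    ultimately have "TT 0 ^ M * pl m I J = of_int (sign \<pi>) * (of_nat (fact M) * vol)"
      by (simp only: of_int_left[of "TT 0 ^ M"])
    thus ?thesis unfolding k by (simp only: of_int_left[of "of_nat (fact M)"])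
  qed
qed

end

lemma upt_upto': "map (\<lambda>i. int i - int (K + 1)) [1..<2 * K + 1 + 1] = [- int K..int K]"
  by (rule nth_equalityI) (simp_all add: nth_upto del: upt_Suc)

lemma pp_comm:
  assumes "y * x = x * y" "y * T = T * (y::'r::ring_1)" shows "y * pp K T x = pp K T x * y"
proof (induction K)
  case (Suc K)
  have 1: "y * (x * x) = (x * x) * y" "y * (T * T) = (T * T) * y" using assms by (simp_all add: comm_mult)
  have "y * (of_int n * (T * T)) = of_int n * (T * T) * y" for n
    by (simp only: of_int_left 1 mult.assoc)
  hence "y * (x * x - of_int ((int K + 1)\<^sup>2) * (T * T)) = (x * x - of_int ((int K + 1)\<^sup>2) * (T * T)) * y"
    by (simp only: left_diff_distrib right_diff_distrib 1)
  thus ?case unfolding pp.simps by (intro comm_mult Suc)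
qed (simp add: assms)

text \<open>The product is the double factorial of 2 k - 1, collected from the coefficients 2 K + 1
  of the ladder steps.\<close>

lemma prod_double_fact:
  "(\<Prod>b<k. 2 * of_nat (k - b) - 1) * 2 ^ k * fact k = (fact (2 * k) :: complex)"
proof (induction k)
  case (Suc k)
  have "(\<Prod>b<Suc k. 2 * of_nat (Suc k - b) - 1) = (2 * of_nat (Suc k) - 1) * (\<Prod>b<k. 2 * of_nat (k - b) - (1::complex))"
    by (subst prod.lessThan_Suc_shift) simp
  hence "(\<Prod>b<Suc k. 2 * of_nat (Suc k - b) - 1) * 2 ^ Suc k * fact (Suc k)
    = (2 * of_nat (Suc k) - 1) * (2 * of_nat (Suc k)) * ((\<Prod>b<k. 2 * of_nat (k - b) - 1) * 2 ^ k * fact k :: complex)"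
    by (simp only: fact_Suc power_Suc mult_ac of_nat_mult)
  also have "\<dots> = (2 * of_nat (Suc k) - 1) * (2 * of_nat (Suc k)) * fact (2 * k)" unfolding Suc ..
  also have "\<dots> = fact (2 * Suc k)"
    by (simp add: fact_reduce[of "Suc (Suc (2 * k))"] algebra_simps)
  finally show ?case .
qed simp

section \<open>The Casimir element as a coefficient and its expression through X and Y\<close>

context so_fock begin

lemma sc_left: "y * (sc c * z) = sc c * (y * z)"
  by (simp only: mult.assoc[symmetric] sc_central[of y c])

text \<open>The trace written out in matrix entries. The shifts and the number of factors are
  arbitrary, because an odd number of factors is considered as well in order to prove that it gives
  zero.\<close>

definition cas :: "(nat \<Rightarrow> complex) \<Rightarrow> nat \<Rightarrow> 'r" where
  "cas u m = (\<Sum>I\<in>multi_indices N m. \<Sum>K\<in>multi_indices N m.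
     prod_list (map (\<lambda>a. F (I a) (K a) + sc (u a * (if I a = K a then 1 else 0))) [1..<m + 1])
       * sc (antisymmetrizer m K I))"

lemma antisym_kappa: "sc (fact m) * sc (antisymmetrizer m K I) = of_int (kappa m I K)"
proof -
  have "of_int (kappa m I K) = (\<Sum>\<pi> | \<pi> permutes {1..m}. of_int (sign \<pi>) * perm_op m \<pi> K I)"
    unfolding kappa_def of_int_sum perm_op_def by (rule sum.cong) simp_all
  hence "fact m * antisymmetrizer m K I = of_int (kappa m I K)"
    by (simp add: antisymmetrizer_def)
  thus ?thesis by (simp only: sc_mult[symmetric] sc_of_int[symmetric])
qed

lemma ZZ_TT_0: "ZZ 0 + sc c * TT 0 =
  (\<Sum>i=1..N. \<Sum>j=1..N. (F i j + sc (c * (if i = j then 1 else 0))) * (e i * f j))"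
proof -
  have 1: "ZZ 0 = (\<Sum>i=1..N. \<Sum>j=1..N. F i j * (e i * f j))"
    unfolding ZZ_def FF_def by (intro sum.cong refl) (simp add: er_def fr_def)
  have "sc c * TT 0 = (\<Sum>i=1..N. \<Sum>j=1..N. sc (c * (if i = j then 1 else 0)) * (e i * f j))"
    unfolding TT0 sum_distrib_left
  proof (rule sum.cong[OF refl])
    fix i assume i: "i \<in> {1..N}"
    have "(\<Sum>j=1..N. sc (c * (if i = j then 1 else 0)) * (e i * f j)) = (\<Sum>j=1..N. if i = j then sc c * (e i * f j) else 0)"
      by (rule sum.cong) auto
    also have "\<dots> = sc c * pr i" using i by (simp add: sum.delta' pr_def)
    finally show "sc c * pr i = (\<Sum>j=1..N. sc (c * (if i = j then 1 else 0)) * (e i * f j))" ..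
  qed
  thus ?thesis unfolding 1 by (simp only: distrib_right sum.distrib)
qed

lemma TT_F: "TT r * F i j = F i j * TT r"
  unfolding TT_def by (rule dot_F_commute) simp_all

text \<open>After expansion the entries of F separate from the odd pairs, since they commute. T^M
  turns each monomial into M! \<open>kappa\<close> times the top form, and \<open>kappa\<close> is
  m! times an entry of the antisymmetrizer.\<close>

theorem coeff:
  assumes M: "M + m = N"
  shows "TT 0 ^ M * prod_list (map (\<lambda>a. ZZ 0 + sc (u a) * TT 0) [1..<m + 1])
    = sc (fact M * fact m) * (cas u m * vol)"
proof -
  define G where "G a i j = F i j + sc (u a * (if i = j then 1 else 0))" for a i j
  define PG where "PG I K = prod_list (map (\<lambda>a. G a (I a) (K a)) [1..<m + 1])" for I K
  let ?S = "multi_indices N m"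
  have TG: "TT 0 * G a i j = G a i j * TT 0" for a i j
    unfolding G_def by (simp only: distrib_left distrib_right TT_F sc_central)
  have TPG: "TT 0 ^ M * PG I K = PG I K * TT 0 ^ M" for I K
  proof -
    have "TT 0 * PG I K = PG I K * TT 0"
      unfolding PG_def by (rule prod_list_comm) (auto simp: TG)
    thus ?thesis by (metis power_commuting_commutes)
  qed
  have eG: "(e i * f j) * G a k l = G a k l * (e i * f j)" for i j a k l
    unfolding G_def by (simp only: distrib_left distrib_right odds_pair_F odds_e odds_f sc_central)
  have "prod_list (map (\<lambda>a. ZZ 0 + sc (u a) * TT 0) [1..<m + 1])
     = prod_list (map (\<lambda>a. \<Sum>i=1..N. \<Sum>j=1..N. G a i j * (e i * f j)) [1..<m + 1])"
    by (simp only: ZZ_TT_0 G_def)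
  also have "\<dots> = (\<Sum>I\<in>?S. prod_list (map (\<lambda>a. \<Sum>j=1..N. G a (I a) j * (e (I a) * f j)) [1..<m + 1]))"
    by (rule prod_list_sum)
  also have "\<dots> = (\<Sum>I\<in>?S. \<Sum>K\<in>?S. prod_list (map (\<lambda>a. G a (I a) (K a) * (e (I a) * f (K a))) [1..<m + 1]))"
    by (intro sum.cong refl prod_list_sum)
  also have "\<dots> = (\<Sum>I\<in>?S. \<Sum>K\<in>?S. PG I K * pl m I K)"
    unfolding PG_def pl_def by (intro sum.cong refl prod_list_split eG)
  finally have "TT 0 ^ M * prod_list (map (\<lambda>a. ZZ 0 + sc (u a) * TT 0) [1..<m + 1])
    = (\<Sum>I\<in>?S. \<Sum>K\<in>?S. TT 0 ^ M * (PG I K * pl m I K))"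
    by (simp only: sum_distrib_left)
  also have "\<dots> = (\<Sum>I\<in>?S. \<Sum>K\<in>?S. sc (fact M * fact m) * (PG I K * sc (antisymmetrizer m K I) * vol))"
  proof (intro sum.cong refl)
    fix I K assume IK: "I \<in> ?S" "K \<in> ?S"
    have "TT 0 ^ M * (PG I K * pl m I K) = PG I K * (TT 0 ^ M * pl m I K)"
      by (simp only: mult.assoc[symmetric] TPG)
    also have "\<dots> = PG I K * (sc (fact M) * (sc (fact m) * sc (antisymmetrizer m K I) * vol))"
      unfolding T_pl[OF IK M] antisym_kappa sc_of_nat[symmetric] of_nat_fact ..
    also have "\<dots> = sc (fact M * fact m) * (PG I K * sc (antisymmetrizer m K I) * vol)"
      by (simp only: sc_left[of "PG I K"] sc_mult mult.assoc)
    finally show "TT 0 ^ M * (PG I K * pl m I K) = \<dots>" .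
  qed
  also have "\<dots> = sc (fact M * fact m) * (cas u m * vol)"
    unfolding cas_def PG_def G_def by (simp only: sum_distrib_left sum_distrib_right)
  finally show ?thesis .
qed

lemma prod_u_pp:
  assumes "x * T = T * x"
  shows "prod_list (map (\<lambda>a. x + sc (of_nat a - of_nat (K + 1)) * T) [1..<2 * K + 1 + 1]) = pp K T x"
proof -
  have "map (\<lambda>a. x + sc (of_nat a - of_nat (K + 1)) * T) [1..<2 * K + 1 + 1]
     = map ((\<lambda>u. x + of_int u * T) \<circ> (\<lambda>i. int i - int (K + 1))) [1..<2 * K + 1 + 1]"
    by (rule map_cong[OF refl]) (simp only: o_def of_int_diff of_int_of_nat_eq sc_diff sc_of_nat)
  also have "\<dots> = map (\<lambda>u. x + of_int u * T) [- int K..int K]"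
    unfolding upt_upto'[symmetric] map_map ..
  finally show ?thesis by (simp only: prod_list_pp[OF assms])
qed

text \<open>Truncated subtraction prevents \<open>flip\<close> from being an involution outside
  1..N, whereas the relations between the odd generators are required at all indices. Hence the
  extension by the identity.\<close>

definition swp :: "nat \<Rightarrow> nat" where "swp i = (if i \<in> {1..N} then flip N i else i)"

lemma swp_swp: "swp (swp i) = i"
proof (cases "i \<in> {1..N}")
  case True
  thus ?thesis unfolding swp_def if_P[OF True] if_P[OF flip_in[OF True]] by (rule flip_flip)
qed (simp only: swp_def if_False)
lemma swp_inj: "swp i = swp j \<longleftrightarrow> i = j" by (metis swp_swp)

text \<open>This symmetry is the reason why products of odd length vanish: it leaves F alone, and
  hence every \<open>cas\<close>, but reverses the sign of T.\<close>

lemma swapped: "so_fock N sc F (\<lambda>i. f (swp i)) (\<lambda>i. e (swp i)) (\<lambda>i. df (swp i)) (\<lambda>i. de (swp i))"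
proof
  fix a b x i j k l
  show "sc (a + b) = sc a + sc b" "sc (a * b) = sc a * sc b" "sc 1 = 1" "x * sc a = sc a * x"
    by (rule sc_add sc_mult sc_one sc_central)+
  show "F (flip N j) (flip N i) = - F i j" if "i \<in> {1..N}" "j \<in> {1..N}" using that by (rule F_skew)
  show "F i j * F k l - F k l * F i j =
        (if k = j then F i l else 0) - (if i = l then F k j else 0)
        - (if k = flip N i then F (flip N j) l else 0)
        + (if l = flip N j then F k (flip N i) else 0)"
    if "i \<in> {1..N}" "j \<in> {1..N}" "k \<in> {1..N}" "l \<in> {1..N}" using that by (rule F_comm)
  show "f (swp i) * f (swp j) = - (f (swp j) * f (swp i))" by (rule f_f)
  show "f (swp i) * f (swp i) = 0" by (rule f_sq)
  show "e (swp i) * e (swp j) = - (e (swp j) * e (swp i))" by (rule e_e)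
  show "e (swp i) * e (swp i) = 0" by (rule e_sq)
  show "f (swp i) * e (swp j) = - (e (swp j) * f (swp i))" by (simp only: e_f minus_minus)
  show "F k l * f (swp i) = f (swp i) * F k l" by (rule F_f)
  show "F k l * e (swp i) = e (swp i) * F k l" by (rule F_e)
  show "df (swp i) * f (swp j) = (if i = j then 1 else 0) - f (swp j) * df (swp i)"
    unfolding df_f swp_inj ..
  show "df (swp i) * e (swp j) = - (e (swp j) * df (swp i))" by (rule df_e)
  show "de (swp i) * f (swp j) = - (f (swp j) * de (swp i))" by (rule de_f)
  show "de (swp i) * e (swp j) = (if i = j then 1 else 0) - e (swp j) * de (swp i)"
    unfolding de_e swp_inj ..
  show "F k l * df (swp i) = df (swp i) * F k l" by (rule F_df)
  show "F k l * de (swp i) = de (swp i) * F k l" by (rule F_de)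
qed

text \<open>The same element \<open>cas\<close> is read off in the original and in the exchanged
  generators. The exchange fixes Z and \<open>pp\<close>, which is even in T, turns T into -T, and
  multiplies the top form by (-1)^N. As M + N is odd, the form equals its own negative.\<close>

lemma odd_null:
  assumes M: "M + (2 * K + 1) = N"
  shows "TT 0 ^ M * pp K (TT 0) (ZZ 0) = 0"
proof -
  interpret sw: so_fock N sc F "\<lambda>i. f (swp i)" "\<lambda>i. e (swp i)" "\<lambda>i. df (swp i)" "\<lambda>i. de (swp i)"
    by (rule swapped)
  have sT: "sw.TT 0 = - TT 0"
  proof -
    have "sw.TT 0 = (\<Sum>i=1..N. f (flip N i) * e (flip N i))"
      unfolding sw.TT0 sw.pr_def by (rule sum.cong) (simp_all add: swp_def)
    also have "\<dots> = (\<Sum>i=1..N. f i * e i)" by (rule sum_flip)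
    also have "\<dots> = - TT 0"
      unfolding TT0 pr_def sum_negf[symmetric]
      by (intro sum.cong refl odds_anti) simp_all
    finally show ?thesis .
  qed
  have sZ: "sw.ZZ 0 = ZZ 0"
  proof -
    have "sw.ZZ 0 = FF (fl (fr 0)) (fl (er 0))"
      unfolding sw.ZZ_def sw.FF_def FF_def fl_def sw.er_def sw.fr_def er_def fr_def
      by (intro sum.cong refl) (auto simp: swp_def flip_def)
    also have "\<dots> = FF (er 0) (fr 0)" using FF_skew[of "fl (fr 0)" "er 0"] by simp
    finally show ?thesis by (simp only: ZZ_def)
  qed
  have sv: "sw.vol = (- 1) ^ N * vol"
  proof -
    have prn: "sw.pr i = - pr (swp i)" for i
      unfolding sw.pr_def pr_def by (rule odds_anti) simp_all
    have a: "prod_list (map (\<lambda>i. - g i) xs) = (- 1) ^ length xs * prod_list (map g xs)"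
      for g :: "nat \<Rightarrow> 'r" and xs
      by (induction xs) (simp_all add: minus_one_power_iff)
    have "sw.vol = (- 1) ^ N * prod_list (map (pr \<circ> swp) [1..<N + 1])"
      unfolding sw.vol_def prn a by (simp add: o_def del: upt_Suc)
    also have "prod_list (map (pr \<circ> swp) [1..<N + 1]) = vol"
    proof -
      have "set (map swp [1..<N + 1]) = {1..N}"
      proof -
        have "swp ` {1..N} = {1..N}"
        proof (intro equalityI subsetI)
          fix i assume i: "i \<in> {1..N}"
          hence "swp i \<in> {1..N}" using flip_in[OF i] by (simp only: swp_def if_True)
          thus "i \<in> swp ` {1..N}" using swp_swp[of i] by (metis imageI)
        next
          fix i assume "i \<in> swp ` {1..N}"
          then obtain j where j: "j \<in> {1..N}" "i = swp j" by blast
          thus "i \<in> {1..N}" using flip_in[OF j(1)] by (simp only: swp_def if_True)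
        qed
        thus ?thesis by (simp add: atLeastLessThanSuc_atLeastAtMost del: upt_Suc)
      qed
      moreover have "distinct (map swp [1..<N + 1])"
        by (simp add: distinct_map inj_on_def swp_inj del: upt_Suc)
      moreover have "set [1..<N + 1] = {1..N}" by auto
      ultimately have "mset (map swp [1..<N + 1]) = mset [1..<N + 1]"
        by (subst set_eq_iff_mset_eq_distinct[symmetric]) (simp_all only: distinct_upt)
      hence "mset (map pr (map swp [1..<N + 1])) = mset (map pr [1..<N + 1])"
        by (simp only: mset_map)
      hence "prod_list (map pr (map swp [1..<N + 1])) = prod_list (map pr [1..<N + 1])"
        by (intro prod_list_perm) (auto intro: pr_comm)
      thus ?thesis by (simp only: vol_def map_map)
    qed
    finally show ?thesis .
  qed
  let ?u = "\<lambda>a. of_nat a - of_nat (K + 1) :: complex"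
  have c1: "ZZ 0 * TT 0 = TT 0 * ZZ 0" using T_Z[of 0 0] by simp
  have c2: "sw.ZZ 0 * sw.TT 0 = sw.TT 0 * sw.ZZ 0" using sw.T_Z[of 0 0] by simp
  have e1: "TT 0 ^ M * pp K (TT 0) (ZZ 0) = sc (fact M * fact (2 * K + 1)) * (cas ?u (2 * K + 1) * vol)"
    using coeff[OF M, of ?u] unfolding prod_u_pp[OF c1] .
  have "(- TT 0) ^ M * pp K (TT 0) (ZZ 0) = sc (fact M * fact (2 * K + 1)) * (cas ?u (2 * K + 1) * ((- 1) ^ N * vol))"
    using sw.coeff[OF M, of ?u] unfolding sw.prod_u_pp[OF c2] unfolding sT sZ sv pp_uminus .
  also have "\<dots> = (- 1) ^ N * (TT 0 ^ M * pp K (TT 0) (ZZ 0))"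
    unfolding e1 by (cases "even N") simp_all
  finally have "(- 1) ^ M * (TT 0 ^ M * pp K (TT 0) (ZZ 0)) = (- 1) ^ N * (TT 0 ^ M * pp K (TT 0) (ZZ 0))"
    by (cases "even M") simp_all
  moreover have "odd N \<longleftrightarrow> even M" unfolding M[symmetric] by simp
  ultimately show ?thesis
    by (intro self_neg_zero) (cases "even M", simp_all)
qed

text \<open>Over the k steps the odd coefficients multiply to the double factorial of 2 k - 1 and
  the factors -2 (a + 1) to (-2)^k k!. Multiplication of both by 2^k k! gives (2 k)! and (-4)^k
  (k!)^2.\<close>

lemma ladder_total:
  assumes M: "M + 2 * k = N"
  shows "sc (fact (2 * k)) * (TT 0 ^ M * XX 0 ^ k * YY 0 ^ k)
    = sc ((- 4) ^ k * (fact k)\<^sup>2) * (TT 0 ^ M * qq k (TT 0) (ZZ 0))"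
proof -
  \<comment> \<open>Interpolates between the product in Z alone at a = 0 and the form in X and Y at
    a = k.\<close>
  define w where "w a = TT 0 ^ M * XX 0 ^ a * qq (k - a) (TT 0) (ZZ 0 - of_nat a * TT 0) * YY 0 ^ a" for a
  have "a \<le> k \<Longrightarrow> sc (\<Prod>b<a. 2 * of_nat (k - b) - 1) * w a = sc ((- 2) ^ a * fact a) * w 0" for a
  proof (induction a)
    case (Suc a)
    define K where "K = k - Suc a"
    have K: "k - a = Suc K" using Suc.prems by (simp add: K_def)
    define P :: complex where "P = (\<Prod>b<a. 2 * of_nat (k - b) - 1)"
    have step: "of_int (2 * int K + 1) * w (Suc a) = - (of_nat (2 * (a + 1)) * w a)"
      unfolding w_def K K_def[symmetric] using M K by (intro ladder_step) simp
    have "(2 * of_nat (k - a) - 1 :: complex) = of_int (2 * int K + 1)" unfolding K by simp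
    hence "sc (\<Prod>b<Suc a. 2 * of_nat (k - b) - 1) * w (Suc a) = sc P * (of_int (2 * int K + 1) * w (Suc a))"
      by (simp only: prod.lessThan_Suc P_def[symmetric] sc_mult sc_of_int mult.assoc)
    also have "\<dots> = - (of_nat (2 * (a + 1)) * (sc P * w a))"
      unfolding step by (simp only: mult_minus_right of_nat_left[of "sc P"])
    also have "sc P * w a = sc ((- 2) ^ a * fact a) * w 0" using Suc by (simp add: P_def)
    also have "- (of_nat (2 * (a + 1)) * (sc ((- 2) ^ a * fact a) * w 0)) = sc ((- 2) ^ Suc a * fact (Suc a)) * w 0"
    proof -
      have "(- 2) ^ Suc a * fact (Suc a) = (- (of_nat (2 * (a + 1)) * ((- 2) ^ a * fact a)) :: complex)"
      proof -
        have "of_nat (2 * (a + 1)) = (2 * of_nat (Suc a) :: complex)" by simp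
        thus ?thesis by (simp only: fact_Suc power_Suc) simp
      qed
      thus ?thesis by (simp only: sc_minus sc_mult sc_of_nat mult.assoc mult_minus_left)
    qed
    finally show ?case .
  qed simp
  from this[of k] have 1: "sc (\<Prod>b<k. 2 * of_nat (k - b) - 1) * w k = sc ((- 2) ^ k * fact k) * w 0" by simp
  have "sc (2 ^ k * fact k * (\<Prod>b<k. 2 * of_nat (k - b) - 1)) * w k = sc (2 ^ k * fact k * ((- 2) ^ k * fact k)) * w 0"
    unfolding sc_mult[of "2 ^ k * fact k"] by (simp only: mult.assoc 1)
  moreover have "2 ^ k * fact k * (\<Prod>b<k. 2 * of_nat (k - b) - 1) = (fact (2 * k) :: complex)"
    using prod_double_fact[of k] by (simp only: mult_ac)
  moreover have "2 ^ k * fact k * ((- 2) ^ k * fact k) = ((- 4) ^ k * (fact k)\<^sup>2 :: complex)"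
    by (simp add: power2_eq_square power_mult_distrib[symmetric] mult_ac)
  ultimately show ?thesis by (simp add: w_def)
qed

lemma prod_u_even:
  assumes "x * T = T * x"
  shows "prod_list (map (\<lambda>a. x + sc (of_nat a - of_nat (Suc K)) * T) [1..<2 * Suc K + 1])
     = pp K T x * (x + of_nat (Suc K) * T)"
proof -
  have u: "[1..<2 * Suc K + 1] = [1..<2 * K + 1 + 1] @ [2 * Suc K]" by simp
  have "of_nat (2 * Suc K) - of_nat (Suc K) = (of_nat (Suc K) :: complex)" by simp
  hence "sc (of_nat (2 * Suc K) - of_nat (Suc K)) = of_nat (Suc K)" by (simp only: sc_of_nat)
  thus ?thesis
    unfolding u map_append prod_list.append using prod_u_pp[OF assms, of K] by simp
qed

text \<open>The factor with shift k is the sum of Z and k T. The part Z completes \<open>pp\<close>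
  to the start of the ladder, and the part k T supplies one more T and is killed by
  \<open>odd_null\<close>.\<close>

theorem cas_XY:
  assumes M: "M + 2 * k = N" and k: "k \<ge> 1"
  shows "sc ((- 4) ^ k * (fact k)\<^sup>2 * fact M) * (cas (\<lambda>a. of_nat a - of_nat k) (2 * k) * vol)
     = TT 0 ^ M * XX 0 ^ k * YY 0 ^ k"
proof -
  obtain K where K: "k = Suc K" using k by (cases k) auto
  let ?T = "TT 0" and ?Z = "ZZ 0"
  have c: "?Z * ?T = ?T * ?Z" using T_Z[of 0 0] by simp
  have null: "?T ^ Suc M * pp K ?T ?Z = 0" using M K by (intro odd_null) simp
  have "sc (fact M * fact (2 * k)) * (cas (\<lambda>a. of_nat a - of_nat k) (2 * k) * vol)
    = ?T ^ M * (pp K ?T ?Z * (?Z + of_nat k * ?T))"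
    using coeff[OF M, of "\<lambda>a. of_nat a - of_nat k"] unfolding K prod_u_even[OF c] by simp
  also have "pp K ?T ?Z * (?Z + of_nat k * ?T) = ?Z * pp K ?T ?Z + of_nat k * (?T * pp K ?T ?Z)"
    using pp_comm[of ?Z ?Z ?T K] pp_comm[of ?T ?Z ?T K] c
    by (simp only: distrib_left of_nat_left[of "pp K ?T ?Z"])
  also have "?T ^ M * \<dots> = ?T ^ M * qq k ?T ?Z + of_nat k * (?T ^ Suc M * pp K ?T ?Z)"
    unfolding K qq_pp by (simp only: distrib_left of_nat_left[of "?T ^ M"] power_Suc2 mult.assoc)
  finally have "sc (fact M * fact (2 * k)) * (cas (\<lambda>a. of_nat a - of_nat k) (2 * k) * vol) = ?T ^ M * qq k ?T ?Z"
    unfolding null by simp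
  note w0 = this
  have "sc (fact (2 * k)) * (sc ((- 4) ^ k * (fact k)\<^sup>2 * fact M) * (cas (\<lambda>a. of_nat a - of_nat k) (2 * k) * vol))
     = sc (fact (2 * k)) * (?T ^ M * XX 0 ^ k * YY 0 ^ k)"
  proof -
    have 1: "fact (2 * k) * ((- 4) ^ k * (fact k)\<^sup>2 * fact M) = (- 4) ^ k * (fact k)\<^sup>2 * (fact M * fact (2 * k) :: complex)"
      by (simp only: mult_ac)
    have "sc (fact (2 * k)) * (sc ((- 4) ^ k * (fact k)\<^sup>2 * fact M) * y) = sc ((- 4) ^ k * (fact k)\<^sup>2) * (sc (fact M * fact (2 * k)) * y)" for y
      unfolding mult.assoc[symmetric, of "sc _" "sc _" y] sc_mult[symmetric] 1 ..
    thus ?thesis unfolding ladder_total[OF M] using w0 by simp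
  qed
  hence "sc (fact (2 * k)) * (sc ((- 4) ^ k * (fact k)\<^sup>2 * fact M) * (cas (\<lambda>a. of_nat a - of_nat k) (2 * k) * vol)
     - ?T ^ M * XX 0 ^ k * YY 0 ^ k) = 0"
    by (simp only: right_diff_distrib right_minus_eq)
  thus ?thesis using sc_cancel[of "fact (2 * k)"] by fastforce
qed

end

section \<open>Pfaffians, the highest weight recursion and centrality\<close>

text \<open>Stated for the exponent k + 2 so that no truncated subtraction occurs in the induction;
  in \<open>binom_trunc\<close> the exponents 0 and 1 are separate, where the coefficients of the
  meaningless powers vanish.\<close>

lemma binom_trunc_aux:
  assumes c: "y * w = w * (y::'r::ring_1)" and n: "w * w * w = 0"
  shows "(y + w) ^ (k + 2) = y ^ (k + 2) + of_nat (k + 2) * (y ^ (k + 1) * w)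
    + of_nat ((k + 2) choose 2) * (y ^ k * (w * w))"
proof (induction k)
  case 0
  have "((0 + 2) choose 2 :: nat) = 1" by (simp add: numeral_2_eq_2)
  thus ?case using c by (simp add: power2_eq_square distrib_left distrib_right mult_2 add_ac)
next
  case (Suc k)
  have ch: "(Suc k + 2) choose 2 = (k + 2) + ((k + 2) choose 2)"
    by (simp add: numeral_2_eq_2)
  have a1: "y ^ (k + 1) * w * y = y ^ (k + 2) * w"
  proof -
    have "y ^ (k + 2) = y ^ (k + 1) * y" by (simp add: power_commutes mult.assoc)
    thus ?thesis by (simp only: mult.assoc c)
  qed
  have a2: "y ^ k * (w * w) * y = y ^ (k + 1) * (w * w)"
  proof -
    have "w * w * y = y * (w * w)" using c by (simp add: comm_mult)
    hence "y ^ k * (w * w) * y = y ^ k * (y * (w * w))" by (simp only: mult.assoc)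
    thus ?thesis by (simp only: power_Suc2 mult.assoc Suc_eq_plus1[symmetric])
  qed
  have "(y + w) ^ (Suc k + 2) = (y + w) ^ (k + 2) * (y + w)"
    by (simp only: add_Suc power_Suc2)
  also have "\<dots> = y ^ (k + 2) * y + of_nat (k + 2) * (y ^ (k + 1) * w * y)
      + of_nat ((k + 2) choose 2) * (y ^ k * (w * w) * y)
      + (y ^ (k + 2) * w + of_nat (k + 2) * (y ^ (k + 1) * (w * w))
      + of_nat ((k + 2) choose 2) * (y ^ k * (w * w * w)))"
    unfolding Suc by (simp only: distrib_left distrib_right mult.assoc)
  also have "\<dots> = y ^ (Suc k + 2) + of_nat (Suc k + 2) * (y ^ (Suc k + 1) * w)
    + of_nat ((Suc k + 2) choose 2) * (y ^ Suc k * (w * w))"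
  proof -
    have 1: "y ^ (k + 2) * y = y ^ (Suc k + 2)" by (simp only: add_Suc power_Suc2)
    have 2: "y ^ (Suc k + 1) = y ^ (k + 2)" "y ^ (k + 1) = y ^ Suc k" by simp_all
    have 3: "of_nat (Suc k + 2) = of_nat (k + 2) + (1::'r)" by simp
    show ?thesis unfolding a1 a2 n unfolding 1 2 3 ch of_nat_add[of "k + 2" "(k + 2) choose 2"]
      by (simp only: distrib_right mult_1 mult_zero_right add_0_right) (simp only: add_ac)
  qed
  finally show ?case .
qed

lemma binom_trunc:
  assumes c: "y * w = w * (y::'r::ring_1)" and n: "w * w * w = 0"
  shows "(y + w) ^ k = y ^ k + of_nat k * (y ^ (k - 1) * w) + of_nat (k choose 2) * (y ^ (k - 2) * (w * w))"
proof -
  consider "k = 0" | "k = 1" | j where "k = j + 2"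
    by (metis One_nat_def Suc_eq_plus1 add_2_eq_Suc' not0_implies_Suc)
  thus ?thesis
  proof cases
    case 3
    thus ?thesis using binom_trunc_aux[OF c n, of j] by simp
  qed (simp_all add: numeral_2_eq_2)
qed

text \<open>The doubled w is the shape in which the mixed parts of X and Y occur, each of them
  appearing twice by the skew symmetry.\<close>

lemma binom_trunc2:
  assumes c: "y * w = w * (y::'r::ring_1)" and n: "w * w * w = 0"
  shows "(y + (w + w)) ^ k = y ^ k + of_nat (2 * k) * (y ^ (k - 1) * w)
    + of_nat (2 * k * (k - 1)) * (y ^ (k - 2) * (w * w))"
proof -
  have 1: "y * (w + w) = (w + w) * y" using c by (simp add: distrib_left distrib_right)
  have 2: "(w + w) * (w + w) * (w + w) = 0" using n by (simp add: distrib_left distrib_right)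
  have "even (k * (k - 1))" by (cases k) simp_all
  hence 3: "2 * (k choose 2) = k * (k - 1)" unfolding choose_two by (rule dvd_mult_div_cancel)
  have "of_nat (k choose 2) * (y ^ (k - 2) * ((w + w) * (w + w)))
      = of_nat (2 * (2 * (k choose 2))) * (y ^ (k - 2) * (w * w))"
    by (simp only: mult_2 of_nat_add distrib_left distrib_right add_ac)
  moreover have "of_nat k * (y ^ (k - 1) * (w + w)) = of_nat (2 * k) * (y ^ (k - 1) * w)"
    by (simp only: mult_2 of_nat_add distrib_left distrib_right)
  ultimately show ?thesis unfolding binom_trunc[OF 1 2] 3 by (simp only: mult.assoc)
qed

context so_fock begin

lemma FF_atf_left: "p \<in> {1..N} \<Longrightarrow> FF (atf p x) v = (\<Sum>j=1..N. F p j * (x * v j))"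
proof -
  assume p: "p \<in> {1..N}"
  have "FF (atf p x) v = (\<Sum>i=1..N. if i = p then \<Sum>j=1..N. F i j * (x * v j) else 0)"
    unfolding FF_def by (rule sum.cong) (auto simp: atf_def)
  thus ?thesis using p by (simp add: sum.delta)
qed

lemma FF_atf: "p \<in> {1..N} \<Longrightarrow> q \<in> {1..N} \<Longrightarrow> FF (atf p x) (atf q y) = F p q * (x * y)"
proof -
  assume pq: "p \<in> {1..N}" "q \<in> {1..N}"
  have "FF (atf p x) (atf q y) = (\<Sum>j=1..N. if j = q then F p j * (x * y) else 0)"
    unfolding FF_atf_left[OF pq(1)] by (rule sum.cong) (auto simp: atf_def)
  thus ?thesis using pq by (simp add: sum.delta)
qed

lemma dot_atf: "p \<in> {1..N} \<Longrightarrow> dot (atf p x) (atf p y) = x * y"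
proof -
  assume p: "p \<in> {1..N}"
  have "dot (atf p x) (atf p y) = (\<Sum>i=1..N. if i = p then x * y else 0)"
    unfolding dot_def by (rule sum.cong) (auto simp: atf_def)
  thus ?thesis using p by (simp add: sum.delta)
qed

lemma dot_disj: "(\<And>i. i \<in> {1..N} \<Longrightarrow> u i = 0 \<or> v i = 0) \<Longrightarrow> dot u v = 0"
  unfolding dot_def by (rule sum.neutral) (metis mult_zero_left mult_zero_right)

lemma fl_add: "fl (\<lambda>i. u i + v i) = (\<lambda>i. fl u i + fl v i)" by (rule ext) (simp add: fl_def)

lemma FF_skew': "oddf u \<Longrightarrow> oddf v \<Longrightarrow> FF (fl u) v = FF (fl v) u"
  using FF_skew[of "fl u" "fl v"] by simp

lemma FF_commute_supp:
  assumes "\<And>i j. i \<in> {1..N} \<Longrightarrow> j \<in> {1..N} \<Longrightarrow> u i * v j = 0 \<or> x * F i j = F i j * x"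
    and "\<And>i j. x * (u i * v j) = (u i * v j) * x"
  shows "x * FF u v = FF u v * x"
  unfolding FF_def
proof (rule commute_sum, rule commute_sum)
  fix i j assume "i \<in> {1..N}" "j \<in> {1..N}"
  thus "x * (F i j * (u i * v j)) = F i j * (u i * v j) * x"
    using assms(1)[of i j] assms(2)[of i j] by (metis commute_mult mult_zero_left mult_zero_right)
qed

lemma pair_FF_comm: "x \<in> odds \<Longrightarrow> y \<in> odds \<Longrightarrow> oddf u \<Longrightarrow> oddf v \<Longrightarrow> x * y * FF u v = FF u v * (x * y)"
  by (rule FF_commute) (auto simp: odds_pair_F oddf_def intro: odd4(5))

lemma pair_dot_comm: "x \<in> odds \<Longrightarrow> y \<in> odds \<Longrightarrow> oddf u \<Longrightarrow> oddf v \<Longrightarrow> x * y * dot u v = dot u v * (x * y)"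
  unfolding dot_def by (rule commute_sum) (auto simp: oddf_def intro: odd4(5))

end

section \<open>Splitting off the outermost pair of indices a and b = a'\<close>

locale so_step = so_fock N sc F e f de df
  for N :: nat and sc :: "complex \<Rightarrow> 'r::ring_1" and F :: "nat \<Rightarrow> nat \<Rightarrow> 'r"
    and e f de df :: "nat \<Rightarrow> 'r" +
  fixes r :: nat assumes r: "2 * Suc r \<le> N"
begin

definition a where "a = Suc r"
definition b where "b = N - r"
definition ep where "ep = er (Suc r)"
definition fp where "fp = fr (Suc r)"
definition al where "al = atf a (e a)"
definition be where "be = atf b (e b)"
definition ga where "ga = atf a (f a)"
definition dl where "dl = atf b (f b)"
text \<open>The parts of Y, and with B those of X, that involve an outer index: one of them in
  \<open>A1\<close>, \<open>A2\<close>, \<open>B1\<close>, \<open>B2\<close>, both in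
  \<open>A3\<close>, \<open>B3\<close>. The F in \<open>A2\<close> and \<open>B1\<close> have row
  index a and are raising, those in \<open>A1\<close> and \<open>B2\<close> have row index b and are
  lowering, and those in \<open>A3\<close> and \<open>B3\<close> are diagonal.\<close>

definition A1 where "A1 = FF (fl ga) fp"
definition A2 where "A2 = FF (fl dl) fp"
definition A3 where "A3 = FF (fl ga) dl"
definition B1 where "B1 = FF al (fl ep)"
definition B2 where "B2 = FF be (fl ep)"
definition B3 where "B3 = FF al (fl be)"
abbreviation "X \<equiv> XX (Suc r)"
abbreviation "Y \<equiv> YY (Suc r)"
abbreviation "Z \<equiv> ZZ (Suc r)"
abbreviation "T \<equiv> TT (Suc r)"

lemma ab: "a \<in> {1..N}" "b \<in> {1..N}" "a \<noteq> b" "flip N a = b" "flip N b = a" "a < b"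
  using r by (auto simp: a_def b_def flip_def)

lemma odd_all [simp]: "oddf ep" "oddf fp" "oddf al" "oddf be" "oddf ga" "oddf dl"
  by (simp_all add: ep_def fp_def al_def be_def ga_def dl_def)

lemma fl_atf: "i \<in> {1..N} \<Longrightarrow> fl (atf a x) i = atf b x i" "i \<in> {1..N} \<Longrightarrow> fl (atf b x) i = atf a x i"
  using r by (auto simp: fl_def atf_def a_def b_def flip_def)

lemma er_split: "er r = (\<lambda>i. ep i + (al i + be i))" and fr_split: "fr r = (\<lambda>i. fp i + (ga i + dl i))"
  using r by (auto simp: fun_eq_iff er_def fr_def ep_def fp_def al_def be_def ga_def dl_def atf_def a_def b_def)

lemma supp:
  "i \<in> {1..N} \<Longrightarrow> i = a \<or> i = b \<Longrightarrow> ep i = 0" "i \<in> {1..N} \<Longrightarrow> i = a \<or> i = b \<Longrightarrow> fp i = 0"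
  "i \<in> {1..N} \<Longrightarrow> i = a \<or> i = b \<Longrightarrow> fl ep i = 0" "i \<in> {1..N} \<Longrightarrow> i = a \<or> i = b \<Longrightarrow> fl fp i = 0"
  "i \<noteq> a \<Longrightarrow> al i = 0" "i \<noteq> a \<Longrightarrow> ga i = 0" "i \<noteq> b \<Longrightarrow> be i = 0" "i \<noteq> b \<Longrightarrow> dl i = 0"
  "i \<in> {1..N} \<Longrightarrow> i \<noteq> b \<Longrightarrow> fl al i = 0" "i \<in> {1..N} \<Longrightarrow> i \<noteq> b \<Longrightarrow> fl ga i = 0"
  "i \<in> {1..N} \<Longrightarrow> i \<noteq> a \<Longrightarrow> fl be i = 0" "i \<in> {1..N} \<Longrightarrow> i \<noteq> a \<Longrightarrow> fl dl i = 0"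
  using r by (auto simp: er_def fr_def ep_def fp_def al_def be_def ga_def dl_def atf_def a_def b_def fl_def flip_def)

text \<open>Contractions of families with disjoint supports. As simplification rules they reduce
  \<open>FF_comm\<close> to its few nonzero terms.\<close>

lemma dots0 [simp]:
  "dot ep al = 0" "dot ep be = 0" "dot ep ga = 0" "dot ep dl = 0"
  "dot fp al = 0" "dot fp be = 0" "dot fp ga = 0" "dot fp dl = 0"
  "dot al ep = 0" "dot be ep = 0" "dot ga ep = 0" "dot dl ep = 0"
  "dot al fp = 0" "dot be fp = 0" "dot ga fp = 0" "dot dl fp = 0"
  "dot al (fl ep) = 0" "dot be (fl ep) = 0" "dot ga (fl ep) = 0" "dot dl (fl ep) = 0"
  "dot al (fl fp) = 0" "dot be (fl fp) = 0" "dot ga (fl fp) = 0" "dot dl (fl fp) = 0"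
  "dot ep (fl al) = 0" "dot ep (fl be) = 0" "dot ep (fl ga) = 0" "dot ep (fl dl) = 0"
  "dot fp (fl al) = 0" "dot fp (fl be) = 0" "dot fp (fl ga) = 0" "dot fp (fl dl) = 0"
  "dot al dl = 0" "dot be ga = 0" "dot al (fl ga) = 0" "dot be (fl dl) = 0"
  "dot ga dl = 0" "dot dl ga = 0" "dot ga be = 0" "dot dl al = 0"
  using supp ab by (intro dot_disj; metis)+

lemma dots0' [simp]: "dot ep (fl ep) = 0" "dot fp (fl fp) = 0"
  by (simp_all add: dot_self_fl)

lemmas dl_simps = dot_fl_fl dot_fl_left

lemma X_eq: "X = FF ep (fl ep)" and Y_eq: "Y = FF (fl fp) fp" and Z_eq: "Z = FF ep fp" and T_eq: "T = dot ep fp"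
  by (simp_all add: XX_def YY_def ZZ_def TT_def ep_def fp_def)

lemma B3_eq: "B3 = F a a * (e a * e b)"
proof -
  have "B3 = FF (atf a (e a)) (atf a (e b))"
    unfolding B3_def al_def be_def by (rule FF_cong) (simp_all add: fl_atf)
  thus ?thesis using ab by (simp add: FF_atf)
qed

lemma F_bb: "F b b = - F a a" using F_skew[OF ab(1) ab(1)] by (simp add: ab)

lemma A3_eq: "A3 = - (F a a * (f a * f b))"
proof -
  have "A3 = FF (atf b (f a)) (atf b (f b))"
    unfolding A3_def ga_def dl_def by (rule FF_cong) (simp_all add: fl_atf)
  thus ?thesis using ab by (simp add: FF_atf F_bb)
qed

text \<open>Each mixed part occurs twice by \<open>FF_skew\<close>, and terms that repeat e a or e b
  are zero.\<close>

lemma XX_split: "XX r = X + ((B1 + B2 + B3) + (B1 + B2 + B3))"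
proof -
  have 0: "FF al (fl al) = 0" "FF be (fl be) = 0"
  proof -
    have "FF al (fl al) = FF (atf a (e a)) (atf b (e a))" "FF be (fl be) = FF (atf b (e b)) (atf a (e b))"
      unfolding al_def be_def by (rule FF_cong; simp add: fl_atf)+
    thus "FF al (fl al) = 0" "FF be (fl be) = 0" using ab by (simp_all add: FF_atf e_sq)
  qed
  have "XX r = FF ep (fl ep) + (FF ep (fl al) + FF ep (fl be)) +
     ((FF al (fl ep) + (FF al (fl al) + FF al (fl be))) + (FF be (fl ep) + (FF be (fl al) + FF be (fl be))))"
    unfolding XX_def er_split fl_add FF_add_left FF_add_right ..
  also have "FF ep (fl al) = B1" unfolding B1_def by (rule FF_skew) simp_all
  also have "FF ep (fl be) = B2" unfolding B2_def by (rule FF_skew) simp_all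
  also have "FF be (fl al) = B3" unfolding B3_def by (rule FF_skew) simp_all
  finally show ?thesis unfolding 0 B1_def[symmetric] B2_def[symmetric] B3_def[symmetric] X_eq[symmetric]
    by (simp only: add_0_left add_0_right) (simp only: add_ac)
qed

lemma YY_split: "YY r = Y + ((A1 + A2 + A3) + (A1 + A2 + A3))"
proof -
  have 0: "FF (fl ga) ga = 0" "FF (fl dl) dl = 0"
  proof -
    have "FF (fl ga) ga = FF (atf b (f a)) (atf a (f a))" "FF (fl dl) dl = FF (atf a (f b)) (atf b (f b))"
      unfolding ga_def dl_def by (rule FF_cong; simp add: fl_atf)+
    thus "FF (fl ga) ga = 0" "FF (fl dl) dl = 0" using ab by (simp_all add: FF_atf f_sq)
  qed
  have "YY r = FF (fl fp) fp + (FF (fl fp) ga + FF (fl fp) dl) +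
     ((FF (fl ga) fp + (FF (fl ga) ga + FF (fl ga) dl)) + (FF (fl dl) fp + (FF (fl dl) ga + FF (fl dl) dl)))"
    unfolding YY_def fr_split fl_add FF_add_left FF_add_right ..
  also have "FF (fl fp) ga = A1" unfolding A1_def by (rule FF_skew') simp_all
  also have "FF (fl fp) dl = A2" unfolding A2_def by (rule FF_skew') simp_all
  also have "FF (fl dl) ga = A3" unfolding A3_def by (rule FF_skew') simp_all
  finally show ?thesis unfolding 0 A1_def[symmetric] A2_def[symmetric] A3_def[symmetric] Y_eq[symmetric]
    by (simp only: add_0_left add_0_right) (simp only: add_ac)
qed

lemma TT_split: "TT r = T + (pr a + pr b)"
proof -
  have "dot (\<lambda>i. u i + u' i) w = dot u w + dot u' w" "dot w (\<lambda>i. u i + u' i) = dot w u + dot w u'" for u u' w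
    by (simp_all add: dot_def distrib_left distrib_right sum.distrib)
  hence "TT r = dot ep fp + dot al ga + dot be dl"
    unfolding TT_def er_split fr_split by simp
  moreover have "dot al ga = pr a" "dot be dl = pr b"
    using ab by (simp_all add: al_def be_def ga_def dl_def dot_atf pr_def)
  ultimately show ?thesis by (simp add: T_eq)
qed

lemma A_Y: "A1 * Y = Y * A1" "A2 * Y = Y * A2" "A3 * Y = Y * A3"
proof -
  have "A1 * Y - Y * A1 = 0" "A2 * Y - Y * A2 = 0" "A3 * Y - Y * A3 = 0"
    unfolding A1_def A2_def A3_def Y_eq by (subst FF_comm; simp add: dl_simps)+
  thus "A1 * Y = Y * A1" "A2 * Y = Y * A2" "A3 * Y = Y * A3" by simp_all
qed

lemma B_X: "B1 * X = X * B1" "B2 * X = X * B2" "B3 * X = X * B3"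
proof -
  have "B1 * X - X * B1 = 0" "B2 * X - X * B2 = 0" "B3 * X - X * B3 = 0"
    unfolding B1_def B2_def B3_def X_eq by (subst FF_comm; simp add: dl_simps)+
  thus "B1 * X = X * B1" "B2 * X = X * B2" "B3 * X = X * B3" by simp_all
qed

lemma A12: "A1 * A2 - A2 * A1 = Y * (f a * f b)"
proof -
  have "dot (fl ga) dl = dot (atf b (f a)) (atf b (f b))"
    unfolding ga_def dl_def by (rule dot_cong) (simp_all add: fl_atf)
  hence "dot (fl ga) dl = f a * f b" using ab by (simp add: dot_atf)
  hence "dot ga (fl dl) = f a * f b" by (simp add: dl_simps)
  thus ?thesis unfolding A1_def A2_def Y_eq by (subst FF_comm; simp add: dl_simps)
qed

lemma B12: "B1 * B2 - B2 * B1 = X * (e a * e b)"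
proof -
  have "dot al (fl be) = dot (atf a (e a)) (atf a (e b))"
    unfolding al_def be_def by (rule dot_cong) (simp_all add: fl_atf)
  hence "dot al (fl be) = e a * e b" using ab by (simp add: dot_atf)
  thus ?thesis unfolding B1_def B2_def X_eq by (subst FF_comm; simp add: dl_simps)
qed

text \<open>The contraction at the index a gives \<open>pr a\<close> and leaves Z; the contraction
  over the middle indices gives T and leaves the Cartan element \<open>F a a\<close>. This is where
  the inner Z enters the computation.\<close>

lemma B1A1: "B1 * A1 - A1 * B1 = Z * pr a + F a a * pr a * T"
proof -
  have 1: "dot al ga = pr a" using ab by (simp add: al_def ga_def dot_atf pr_def)
  have "FF (fl ga) (fl al) = FF (atf b (f a)) (atf b (e a))"
    unfolding al_def ga_def by (rule FF_cong) (simp_all add: fl_atf)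
  also have "\<dots> = F a a * pr a"
    using ab e_f[of a a] by (simp add: FF_atf F_bb pr_def)
  finally show ?thesis unfolding B1_def A1_def Z_eq T_eq by (subst FF_comm; simp add: dl_simps 1)
qed

definition P where "P = pr a + pr b"
definition V where "V = B1 + B2 + B3"
definition W where "W = A1 + A2 + A3"
definition ff where "ff = f a * f b"
definition ee where "ee = e a * e b"

lemma dgr_al: "dgr e {a} (Suc 0) (al i)" "dgr f {a} (Suc 0) (ga i)" "dgr e {b} (Suc 0) (be i)" "dgr f {b} (Suc 0) (dl i)"
  "dgr e {a,b} (Suc 0) (al i)" "dgr f {a,b} (Suc 0) (ga i)" "dgr e {a,b} (Suc 0) (be i)" "dgr f {a,b} (Suc 0) (dl i)"
  by (auto simp: al_def be_def ga_def dl_def atf_def intro!: dgr_gen)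

lemma dgr_odd0: "oddf u \<Longrightarrow> dgr e S 0 (u i)" "oddf u \<Longrightarrow> dgr f S 0 (u i)"
  by (simp_all add: oddfD)

lemma dgr_FF0: "oddf u \<Longrightarrow> oddf v \<Longrightarrow> dgr e S 0 (FF u v)" "oddf u \<Longrightarrow> oddf v \<Longrightarrow> dgr f S 0 (FF u v)"
  using dgr_FF[of e S 0 u 0 v] dgr_FF[of f S 0 u 0 v] by (simp_all add: dgr_odd0)

lemma dgr_XYT0: "dgr e S 0 X" "dgr f S 0 X" "dgr e S 0 Y" "dgr f S 0 Y" "dgr e S 0 T" "dgr f S 0 T"
proof -
  show "dgr e S 0 X" "dgr f S 0 X" "dgr e S 0 Y" "dgr f S 0 Y" unfolding X_eq Y_eq by (simp_all add: dgr_FF0)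
  show "dgr e S 0 T" "dgr f S 0 T"
    unfolding T_eq using dgr_dot[of e S 0 ep 0 fp] dgr_dot[of f S 0 ep 0 fp] by (simp_all add: dgr_odd0)
qed

lemma dgr_B: "dgr e {a} 1 B1" "dgr e {b} 1 B2" "dgr e {a,b} 1 B1" "dgr e {a,b} 1 B2" "dgr e {a,b} 2 B3"
  "dgr f S 0 B1" "dgr f S 0 B2" "dgr f S 0 B3"
proof -
  have "dgr e {a} (Suc 0 + 0) B1" "dgr e {b} (Suc 0 + 0) B2" "dgr e {a,b} (Suc 0 + 0) B1" "dgr e {a,b} (Suc 0 + 0) B2"
    "dgr e {a,b} (Suc 0 + Suc 0) B3"
    unfolding B1_def B2_def B3_def
    by (intro dgr_FF dgr_F dgr_al dgr_odd0 dgr_fl odd_all oddf_fl)+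
  thus "dgr e {a} 1 B1" "dgr e {b} 1 B2" "dgr e {a,b} 1 B1" "dgr e {a,b} 1 B2" "dgr e {a,b} 2 B3"
    by (simp_all add: numeral_2_eq_2)
  show "dgr f S 0 B1" "dgr f S 0 B2" "dgr f S 0 B3"
    unfolding B1_def B2_def B3_def by (simp_all add: dgr_FF0)
qed

lemma dgr_A: "dgr f {a} 1 A1" "dgr f {b} 1 A2" "dgr f {a,b} 1 A1" "dgr f {a,b} 1 A2" "dgr f {a,b} 2 A3"
proof -
  have "dgr f {a} (Suc 0 + 0) A1" "dgr f {b} (Suc 0 + 0) A2" "dgr f {a,b} (Suc 0 + 0) A1" "dgr f {a,b} (Suc 0 + 0) A2"
    "dgr f {a,b} (Suc 0 + Suc 0) A3"
    unfolding A1_def A2_def A3_def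
    by (intro dgr_FF dgr_F dgr_al dgr_odd0 dgr_fl odd_all oddf_fl)+
  thus "dgr f {a} 1 A1" "dgr f {b} 1 A2" "dgr f {a,b} 1 A1" "dgr f {a,b} 1 A2" "dgr f {a,b} 2 A3"
    by (simp_all add: numeral_2_eq_2)
qed

lemma dgr_pr: "finite S \<Longrightarrow> i \<in> S \<Longrightarrow> dgr e S 1 (pr i)" "finite S \<Longrightarrow> i \<in> S \<Longrightarrow> dgr f S 1 (pr i)"
  "dgr e S 0 (pr i)" "dgr f S 0 (pr i)"
proof -
  show "dgr e S 1 (pr i)" "dgr f S 1 (pr i)" if "finite S" "i \<in> S"
    using dgr_mult[OF dgr_gen[OF that, of e] dgr_odds(1)[of "f i" S]]
      dgr_mult[OF dgr_odds(2)[of "e i" S] dgr_gen[OF that, of f]] by (simp_all add: pr_def)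
  show "dgr e S 0 (pr i)" "dgr f S 0 (pr i)"
    using dgr_mult[of e S 0 "e i" 0 "f i"] dgr_mult[of f S 0 "e i" 0 "f i"] by (simp_all add: pr_def)
qed

lemma dgr_P: "dgr e {a,b} 1 P" "dgr f {a,b} 1 P" "dgr e S 0 P" "dgr f S 0 P"
  unfolding P_def by (intro dgr_add dgr_pr; simp)+
lemma dgr_V: "dgr e {a,b} 1 V" "dgr f S 0 V"
proof -
  show "dgr e {a,b} 1 V"
    unfolding V_def by (intro dgr_add dgr_B(3,4) dgr_weaken[OF dgr_B(5)]) simp
  show "dgr f S 0 V" unfolding V_def by (intro dgr_add dgr_B(6-8))
qed
lemma dgr_W: "dgr f {a,b} 1 W"
  unfolding W_def by (intro dgr_add dgr_A(3,4) dgr_weaken[OF dgr_A(5)]) simp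
lemma dgr_ff: "dgr f {a,b} 2 ff"
  using dgr_mult[OF dgr_gen[of "{a,b}" a f] dgr_gen[of "{a,b}" b f]] by (simp add: ff_def numeral_2_eq_2)

lemma dgr_inner: "dgr e (Inn (Suc r)) 1 B1" "dgr e (Inn (Suc r)) 1 B2" "dgr f (Inn (Suc r)) 1 A1"
proof -
  have "dgr e (Inn (Suc r)) (0 + Suc 0) B1" "dgr e (Inn (Suc r)) (0 + Suc 0) B2" "dgr f (Inn (Suc r)) (0 + Suc 0) A1"
    unfolding B1_def B2_def A1_def ep_def fp_def
    by (intro dgr_FF dgr_F dgr_odd0 dgr_fl dgr_er dgr_fr odd_all oddf_fl)+
  thus "dgr e (Inn (Suc r)) 1 B1" "dgr e (Inn (Suc r)) 1 B2" "dgr f (Inn (Suc r)) 1 A1" by simp_all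
qed

lemma card_inner: "card (Inn (Suc r)) = N - 2 * r - 2" by (simp add: card_Inn)
lemma card_ab: "card {a,b} = 2" using ab by simp

text \<open>With its companions below this decides which terms of an expansion survive: an e or f
  occurs at most once per index, hence at most twice at the outer indices and at most N - 2 r - 2
  times at the inner ones.\<close>

lemma kill_eab: "dgr e {a,b} q y \<Longrightarrow> 2 < q \<Longrightarrow> y = 0"
  by (rule dgr_e_vanish[of "{a,b}"]) (simp_all add: card_ab)
lemma kill_fab: "dgr f {a,b} q y \<Longrightarrow> 2 < q \<Longrightarrow> y = 0"
  by (rule dgr_f_vanish[of "{a,b}"]) (simp_all add: card_ab)
lemma kill_e1: "dgr e {i} q y \<Longrightarrow> 1 < q \<Longrightarrow> y = 0"
  by (rule dgr_e_vanish[of "{i}"]) simp_all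
lemma kill_f1: "dgr f {i} q y \<Longrightarrow> 1 < q \<Longrightarrow> y = 0"
  by (rule dgr_f_vanish[of "{i}"]) simp_all
lemma kill_e: "dgr e (Inn (Suc r)) q y \<Longrightarrow> N - 2 * r - 2 < q \<Longrightarrow> y = 0"
  by (rule dgr_e_vanish[of "Inn (Suc r)"]) (simp_all add: card_inner)
lemma kill_f: "dgr f (Inn (Suc r)) q y \<Longrightarrow> N - 2 * r - 2 < q \<Longrightarrow> y = 0"
  by (rule dgr_f_vanish[of "Inn (Suc r)"]) (simp_all add: card_inner)

lemma VVV: "V * V * V = 0"
  by (rule kill_eab[OF dgr_mult[OF dgr_mult[OF dgr_V(1) dgr_V(1)] dgr_V(1)]]) simp
lemma WWW: "W * W * W = 0"
  by (rule kill_fab[OF dgr_mult[OF dgr_mult[OF dgr_W dgr_W] dgr_W]]) simp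
lemma PPP: "P * P * P = 0"
  by (rule kill_eab[OF dgr_mult[OF dgr_mult[OF dgr_P(1) dgr_P(1)] dgr_P(1)]]) simp

lemma X_V: "X * V = V * X" by (simp add: V_def distrib_left distrib_right B_X)
lemma Y_W: "Y * W = W * Y" by (simp add: W_def distrib_left distrib_right A_Y)
lemma pr_X: "pr i * X = X * pr i" and pr_Y: "pr i * Y = Y * pr i" and pr_T: "pr i * T = T * pr i"
  and pr_Z: "pr i * Z = Z * pr i"
  unfolding pr_def X_eq Y_eq Z_eq T_eq by (rule pair_FF_comm pair_dot_comm; simp)+
lemma T_P: "T * P = P * T" by (simp add: P_def distrib_left distrib_right pr_T)
lemma P_X: "P * X = X * P" by (simp add: P_def distrib_left distrib_right pr_X)

text \<open>Every other product repeats e a or e b.\<close>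

lemma VV: "V * V = B1 * B2 + B2 * B1"
proof -
  have "B1 * B1 = 0" by (rule kill_e1[OF dgr_mult[OF dgr_B(1) dgr_B(1)]]) simp
  moreover have "B2 * B2 = 0" by (rule kill_e1[OF dgr_mult[OF dgr_B(2) dgr_B(2)]]) simp
  moreover have "B1 * B3 = 0" by (rule kill_eab[OF dgr_mult[OF dgr_B(3) dgr_B(5)]]) simp
  moreover have "B2 * B3 = 0" by (rule kill_eab[OF dgr_mult[OF dgr_B(4) dgr_B(5)]]) simp
  moreover have "B3 * B1 = 0" by (rule kill_eab[OF dgr_mult[OF dgr_B(5) dgr_B(3)]]) simp
  moreover have "B3 * B2 = 0" by (rule kill_eab[OF dgr_mult[OF dgr_B(5) dgr_B(4)]]) simp
  moreover have "B3 * B3 = 0" by (rule kill_eab[OF dgr_mult[OF dgr_B(5) dgr_B(5)]]) simp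
  ultimately show ?thesis by (simp add: V_def distrib_left distrib_right)
qed

lemma WW: "W * W = A1 * A2 + A2 * A1"
proof -
  have "A1 * A1 = 0" by (rule kill_f1[OF dgr_mult[OF dgr_A(1) dgr_A(1)]]) simp
  moreover have "A2 * A2 = 0" by (rule kill_f1[OF dgr_mult[OF dgr_A(2) dgr_A(2)]]) simp
  moreover have "A1 * A3 = 0" by (rule kill_fab[OF dgr_mult[OF dgr_A(3) dgr_A(5)]]) simp
  moreover have "A2 * A3 = 0" by (rule kill_fab[OF dgr_mult[OF dgr_A(4) dgr_A(5)]]) simp
  moreover have "A3 * A1 = 0" by (rule kill_fab[OF dgr_mult[OF dgr_A(5) dgr_A(3)]]) simp
  moreover have "A3 * A2 = 0" by (rule kill_fab[OF dgr_mult[OF dgr_A(5) dgr_A(4)]]) simp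
  moreover have "A3 * A3 = 0" by (rule kill_fab[OF dgr_mult[OF dgr_A(5) dgr_A(5)]]) simp
  ultimately show ?thesis by (simp add: W_def distrib_left distrib_right)
qed

lemma PP: "P * P = 2 * (pr a * pr b)"
  by (simp add: P_def distrib_left distrib_right pr_sq pr_comm[of b a] mult_2)

end

section \<open>The surviving terms of the expanded form\<close>

context so_step begin

text \<open>A form of degree N - 2 r in the e must contain both outer generators. In the forms
  listed here at most one is available, so their inner degree exceeds N - 2 r - 2.\<close>

lemma kill9:
  assumes Nr: "M + 2 * k = N - 2 * r" and k: "k \<ge> 1"
  shows "T ^ M * X ^ k = 0" "T ^ M * (X ^ (k - 1) * B1) = 0" "T ^ M * (X ^ (k - 1) * B2) = 0"
    "M \<ge> 1 \<Longrightarrow> T ^ (M - 1) * P * X ^ k = 0"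
proof -
  note d = dgr_e_XYZT[of "Suc r"]
  have N2: "N - 2 * r \<ge> 2" using r by simp
  show "T ^ M * X ^ k = 0"
    by (rule kill_e[OF dgr_mult[OF dgr_power[OF d(4)] dgr_power[OF d(1)]]]) (use Nr N2 in simp)
  show "T ^ M * (X ^ (k - 1) * B1) = 0"
    by (rule kill_e[OF dgr_mult[OF dgr_power[OF d(4)] dgr_mult[OF dgr_power[OF d(1)] dgr_inner(1)]]]) (use Nr N2 k in simp)
  show "T ^ M * (X ^ (k - 1) * B2) = 0"
    by (rule kill_e[OF dgr_mult[OF dgr_power[OF d(4)] dgr_mult[OF dgr_power[OF d(1)] dgr_inner(2)]]]) (use Nr N2 k in simp)
  show "T ^ (M - 1) * P * X ^ k = 0" if "M \<ge> 1"
    by (rule kill_e[OF dgr_mult[OF dgr_mult[OF dgr_power[OF d(4)] dgr_P(3)] dgr_power[OF d(1)]]]) (use Nr N2 k that in simp)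
qed

text \<open>The terms of the expansion that contain both e a and e b: together in \<open>B3\<close>,
  one in each of two factors V, one in P and one in V, or both from factors P.\<close>

definition TX where "TX M k = of_nat (2 * k) * (T ^ M * (X ^ (k - 1) * B3))
   + of_nat (2 * k * (k - 1)) * (T ^ M * (X ^ (k - 2) * (V * V)))
   + of_nat (M * (2 * k)) * (T ^ (M - 1) * P * (X ^ (k - 1) * V))
   + of_nat (M choose 2) * (T ^ (M - 2) * (P * P) * X ^ k)"

lemma TX_eq:
  assumes Nr: "M + 2 * k = N - 2 * r" and k: "k \<ge> 1"
  shows "TT r ^ M * XX r ^ k = TX M k"
proof -
  note kk = kill9[OF Nr k]
  \<comment> \<open>For M = 0 the power with exponent M - 1 is not the intended one, but then its
    coefficient is zero.\<close>
  have z1: "of_nat M * (T ^ (M - 1) * P * X ^ k) = 0"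
    using kk(4) by (cases "M = 0") simp_all
  have z2: "T ^ (M - 1) * P * (X ^ (k - 2) * (V * V)) = 0"
    by (rule kill_eab[OF dgr_mult[OF dgr_mult[OF dgr_power[OF dgr_XYT0(5)] dgr_P(1)] dgr_mult[OF dgr_power[OF dgr_XYT0(1)] dgr_mult[OF dgr_V(1) dgr_V(1)]]]]) simp
  have z3: "T ^ (M - 2) * (P * P) * (X ^ (k - 1) * V) = 0"
    by (rule kill_eab[OF dgr_mult[OF dgr_mult[OF dgr_power[OF dgr_XYT0(5)] dgr_mult[OF dgr_P(1) dgr_P(1)]] dgr_mult[OF dgr_power[OF dgr_XYT0(1)] dgr_V(1)]]]) simp
  have z4: "T ^ (M - 2) * (P * P) * (X ^ (k - 2) * (V * V)) = 0"
    by (rule kill_eab[OF dgr_mult[OF dgr_mult[OF dgr_power[OF dgr_XYT0(5)] dgr_mult[OF dgr_P(1) dgr_P(1)]] dgr_mult[OF dgr_power[OF dgr_XYT0(1)] dgr_mult[OF dgr_V(1) dgr_V(1)]]]]) simp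
  have z5: "T ^ M * (X ^ (k - 1) * V) = T ^ M * (X ^ (k - 1) * B3)"
    by (simp only: V_def distrib_left kk add_0_left)
  have x: "XX r ^ k = X ^ k + of_nat (2 * k) * (X ^ (k - 1) * V) + of_nat (2 * k * (k - 1)) * (X ^ (k - 2) * (V * V))"
    unfolding XX_split V_def[symmetric] by (rule binom_trunc2[OF X_V VVV])
  have t: "TT r ^ M = T ^ M + of_nat M * (T ^ (M - 1) * P) + of_nat (M choose 2) * (T ^ (M - 2) * (P * P))"
    unfolding TT_split P_def[symmetric] by (rule binom_trunc[OF T_P PPP])
  have nn: "p * x' * (q * y') = p * q * (x' * y')" if "q = of_nat m" for p x' q y' :: 'r and m
    unfolding that by (simp only: mult.assoc of_nat_left[of x'])
  have "TT r ^ M * XX r ^ k =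
      T ^ M * X ^ k + of_nat (2 * k) * (T ^ M * (X ^ (k - 1) * V)) + of_nat (2 * k * (k - 1)) * (T ^ M * (X ^ (k - 2) * (V * V)))
    + (of_nat M * (T ^ (M - 1) * P * X ^ k) + of_nat M * of_nat (2 * k) * (T ^ (M - 1) * P * (X ^ (k - 1) * V))
       + of_nat M * of_nat (2 * k * (k - 1)) * (T ^ (M - 1) * P * (X ^ (k - 2) * (V * V))))
    + (of_nat (M choose 2) * (T ^ (M - 2) * (P * P) * X ^ k) + of_nat (M choose 2) * of_nat (2 * k) * (T ^ (M - 2) * (P * P) * (X ^ (k - 1) * V))
       + of_nat (M choose 2) * of_nat (2 * k * (k - 1)) * (T ^ (M - 2) * (P * P) * (X ^ (k - 2) * (V * V))))"
    unfolding x t distrib_left distrib_right nn[OF refl] of_nat_left[of "T ^ M"] mult.assoc[of "of_nat _" _ "X ^ k"]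
    by (simp only: add_ac)
  thus ?thesis unfolding TX_def z1 z2 z3 z4 z5 kk(1) by (simp only: of_nat_mult mult_zero_right add_0_left add_0_right mult.assoc)
qed

text \<open>Y^k contains only inner f, so both outer f must come from \<open>TX\<close>, and only
  its term with P P contains both.\<close>

lemma TX_Y:
  assumes Nr: "M + 2 * k = N - 2 * r" and k: "k \<ge> 1"
  shows "TX M k * Y ^ k = of_nat (M * (M - 1)) * (pr a * pr b * (T ^ (M - 2) * X ^ k * Y ^ k))"
proof -
  note d = dgr_f_XYZT[of "Suc r"]
  have N2: "N - 2 * r \<ge> 2" using r by simp
  have 1: "T ^ M * (X ^ (k - 1) * B3) * Y ^ k = 0"
    by (rule kill_f[OF dgr_mult[OF dgr_mult[OF dgr_power[OF d(4)] dgr_mult[OF dgr_power[OF d(1)] dgr_B(8)]] dgr_power[OF d(2)]]]) (use Nr N2 k in simp)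
  have 2: "T ^ M * (X ^ (k - 2) * (V * V)) * Y ^ k = 0"
    by (rule kill_f[OF dgr_mult[OF dgr_mult[OF dgr_power[OF d(4)] dgr_mult[OF dgr_power[OF d(1)] dgr_mult[OF dgr_V(2) dgr_V(2)]]] dgr_power[OF d(2)]]]) (use Nr N2 k in simp)
  have 3: "M \<ge> 1 \<Longrightarrow> T ^ (M - 1) * P * (X ^ (k - 1) * V) * Y ^ k = 0"
    by (rule kill_f[OF dgr_mult[OF dgr_mult[OF dgr_mult[OF dgr_power[OF d(4)] dgr_P(4)] dgr_mult[OF dgr_power[OF d(1)] dgr_V(2)]] dgr_power[OF d(2)]]]) (use Nr N2 k in simp)
  have t3: "of_nat (M * (2 * k)) * (T ^ (M - 1) * P * (X ^ (k - 1) * V) * Y ^ k) = 0"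
    using 3 by (cases "M = 0") simp_all
  have "TX M k * Y ^ k = of_nat (M choose 2) * (T ^ (M - 2) * (P * P) * X ^ k * Y ^ k)"
    unfolding TX_def distrib_right mult.assoc[of "of_nat _" _ "Y ^ k"] 1 2 t3 by simp
  also have "T ^ (M - 2) * (P * P) * X ^ k * Y ^ k = 2 * (pr a * pr b * (T ^ (M - 2) * X ^ k * Y ^ k))"
  proof -
    have "T * (pr a * pr b) = pr a * pr b * T" by (intro comm_mult pr_T[symmetric])
    hence "T ^ (M - 2) * (pr a * pr b) = pr a * pr b * T ^ (M - 2)" by (metis power_commuting_commutes)
    moreover have "T ^ (M - 2) * (2 * (pr a * pr b)) = 2 * (T ^ (M - 2) * (pr a * pr b))"
      by (simp only: mult_2 distrib_left)
    ultimately show ?thesis unfolding PP by (simp only: mult.assoc)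
  qed
  also have "of_nat (M choose 2) * (2 * y) = of_nat (M * (M - 1)) * y" for y :: 'r
  proof -
    have "even (M * (M - 1))" by (cases M) simp_all
    hence "2 * (M choose 2) = M * (M - 1)" unfolding choose_two by (rule dvd_mult_div_cancel)
    hence "of_nat (M * (M - 1)) * y = of_nat (2 * (M choose 2)) * y" by simp
    thus ?thesis by (simp add: mult_2 distrib_left distrib_right)
  qed
  finally show ?thesis .
qed

text \<open>\<open>A1\<close> supplies f a but not f b, so f b must come from P. Its companion e b
  then excludes every part of V except \<open>B1\<close>.\<close>

lemma TX_A1:
  assumes Nr: "M + 2 * k = N - 2 * r" and k: "k \<ge> 1"
  shows "TX M k * (Y ^ (k - 1) * A1) =
    of_nat (M * (2 * k)) * (T ^ (M - 1) * X ^ (k - 1) * (pr b * (B1 * A1 * Y ^ (k - 1))))"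
proof -
  note d = dgr_f_XYZT[of "Suc r"]
  let ?Q = "Y ^ (k - 1) * A1"
  have dQ: "dgr f (Inn (Suc r)) ((k - 1) * 2 + 1) ?Q" by (intro dgr_mult dgr_power d dgr_inner)
  have N2: "N - 2 * r \<ge> 2" using r by simp
  have YA: "?Q = A1 * Y ^ (k - 1)" using A_Y(1) by (metis power_commuting_commutes)
  have 1: "T ^ M * (X ^ (k - 1) * B3) * ?Q = 0"
    by (rule kill_f[OF dgr_mult[OF dgr_mult[OF dgr_power[OF d(4)] dgr_mult[OF dgr_power[OF d(1)] dgr_B(8)]] dQ]]) (use Nr N2 k in simp)
  have 2: "T ^ M * (X ^ (k - 2) * (V * V)) * ?Q = 0"
    by (rule kill_f[OF dgr_mult[OF dgr_mult[OF dgr_power[OF d(4)] dgr_mult[OF dgr_power[OF d(1)] dgr_mult[OF dgr_V(2) dgr_V(2)]]] dQ]]) (use Nr N2 k in simp)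
  have "P * P * X ^ k * A1 = 0"
    by (rule kill_fab[OF dgr_mult[OF dgr_mult[OF dgr_mult[OF dgr_P(2) dgr_P(2)] dgr_power[OF dgr_XYT0(2)]] dgr_A(3)]]) simp
  moreover have "T ^ (M - 2) * (P * P) * X ^ k * ?Q = T ^ (M - 2) * ((P * P * X ^ k * A1) * Y ^ (k - 1))"
    by (simp only: YA mult.assoc)
  ultimately have 3: "T ^ (M - 2) * (P * P) * X ^ k * ?Q = 0" by simp
  have "P * X ^ (k - 1) = X ^ (k - 1) * P" using P_X by (metis power_commuting_commutes)
  note PX = this
  have "T ^ (M - 1) * P * (X ^ (k - 1) * V) * ?Q = T ^ (M - 1) * (P * X ^ (k - 1)) * (V * (A1 * Y ^ (k - 1)))"
    unfolding YA by (simp only: mult.assoc)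
  also have "\<dots> = T ^ (M - 1) * X ^ (k - 1) * (P * V * A1 * Y ^ (k - 1))"
    unfolding PX by (simp only: mult.assoc)
  also have "P * V * A1 = pr b * (B1 * A1)"
  proof -
    have "pr a * B1 = 0" by (rule kill_e1[OF dgr_mult[OF dgr_pr(1)[of "{a}" a] dgr_B(1)]]) simp_all
    moreover have "pr b * B2 = 0" by (rule kill_e1[OF dgr_mult[OF dgr_pr(1)[of "{b}" b] dgr_B(2)]]) simp_all
    moreover have "P * B3 = 0" by (rule kill_eab[OF dgr_mult[OF dgr_P(1) dgr_B(5)]]) simp
    moreover have "pr a * B2 * A1 = 0"
      by (rule kill_f1[OF dgr_mult[OF dgr_mult[OF dgr_pr(2)[of "{a}" a] dgr_B(7)] dgr_A(1)]]) simp_all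
    ultimately show ?thesis
      by (simp add: V_def distrib_left distrib_right) (simp add: P_def distrib_left distrib_right mult.assoc)
  qed
  also have "pr b * (B1 * A1) * Y ^ (k - 1) = pr b * (B1 * A1 * Y ^ (k - 1))" by (simp only: mult.assoc)
  finally have 4: "T ^ (M - 1) * P * (X ^ (k - 1) * V) * ?Q
    = T ^ (M - 1) * X ^ (k - 1) * (pr b * (B1 * A1 * Y ^ (k - 1)))" .
  show ?thesis
    unfolding TX_def distrib_right mult.assoc[of "of_nat _" _ ?Q] 1 2 3 4 by simp
qed

text \<open>\<open>ff\<close> already contains both outer f, which excludes every term with a factor
  P.\<close>

lemma TX_ff:
  shows "TX M k * (Y ^ (k - 1) * ff) = of_nat (2 * k) * (T ^ M * (X ^ (k - 1) * (B3 * (Y ^ (k - 1) * ff))))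
   + of_nat (2 * k * (k - 1)) * (T ^ M * (X ^ (k - 2) * (V * V * (Y ^ (k - 1) * ff))))"
proof -
  have d: "dgr f {a,b} (1 + 2) (P * y * (Y ^ (k - 1) * ff))" if "dgr f {a,b} 0 y" for y
    using dgr_mult[OF dgr_mult[OF dgr_P(2) that] dgr_mult[OF dgr_power[OF dgr_XYT0(4)] dgr_ff], of "k - 1"] by simp
  have 0: "P * y * (Y ^ (k - 1) * ff) = 0" if "dgr f {a,b} 0 y" for y
    by (rule kill_fab[OF d[OF that]]) simp
  have 1: "T ^ (M - 1) * P * (X ^ (k - 1) * V) * (Y ^ (k - 1) * ff) = 0"
  proof -
    have "dgr f {a,b} 0 (X ^ (k - 1) * V)"
      using dgr_mult[OF dgr_power[OF dgr_XYT0(2), where n = "k - 1"] dgr_V(2)] by simp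
    from 0[OF this] show ?thesis by (simp only: mult.assoc mult_zero_right)
  qed
  have 2: "T ^ (M - 2) * (P * P) * X ^ k * (Y ^ (k - 1) * ff) = 0"
  proof -
    have "dgr f {a,b} 0 (P * X ^ k)"
      using dgr_mult[OF dgr_P(4) dgr_power[OF dgr_XYT0(2), where n = k]] by simp
    from 0[OF this] show ?thesis by (simp only: mult.assoc mult_zero_right)
  qed
  show ?thesis
    unfolding TX_def distrib_right mult.assoc[of "of_nat _" _ "Y ^ (k - 1) * ff"] 1 2
    by (simp only: mult_zero_right add_0_right mult.assoc)
qed

text \<open>T^(M-1) X^(k-1) Y^k has inner degree N - 2 r - 1 in the f and is zero. Applying the
  derivation \<open>DD\<close> to it shows that in this position Z may be replaced by (k - 1)
  T.\<close>

lemma Z_elim: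
  assumes Nr: "M + 2 * k = N - 2 * r" and k: "k \<ge> 1" and M: "M \<ge> 1"
  shows "T ^ (M - 1) * X ^ (k - 1) * (Z * Y ^ (k - 1)) = of_nat (k - 1) * (T ^ M * X ^ (k - 1) * Y ^ (k - 1))"
proof -
  note d = dgr_f_XYZT[of "Suc r"]
  have N2: "N - 2 * r \<ge> 2" using r by simp
  have "T ^ (M - 1) * X ^ (k - 1) * Y ^ k = 0"
    by (rule kill_f[OF dgr_mult[OF dgr_mult[OF dgr_power[OF d(4)] dgr_power[OF d(1)]] dgr_power[OF d(2)]]]) (use Nr N2 k M in simp)
  hence "0 = der DD (T ^ (M - 1) * X ^ (k - 1) * Y ^ Suc (k - 1))" using k by simp
  also have "\<dots> = T ^ (M - 1) * X ^ (k - 1) * (of_nat (2 * (k - 1 + 1)) * ((Z - of_nat (k - 1) * T) * Y ^ (k - 1)))"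
    by (simp only: der_mult der_power_zero[OF D_T] der_power_zero[OF D_X] D_Y_pow mult_zero_left mult_zero_right add_0)
  also have "\<dots> = of_nat (2 * (k - 1 + 1)) * (T ^ (M - 1) * X ^ (k - 1) * ((Z - of_nat (k - 1) * T) * Y ^ (k - 1)))"
    by (rule of_nat_left)
  finally have "T ^ (M - 1) * X ^ (k - 1) * ((Z - of_nat (k - 1) * T) * Y ^ (k - 1)) = 0"
    by (rule of_nat_cancel[of "2 * (k - 1 + 1)", rotated, OF sym]) simp
  hence "T ^ (M - 1) * X ^ (k - 1) * (Z * Y ^ (k - 1)) = T ^ (M - 1) * X ^ (k - 1) * (of_nat (k - 1) * T * Y ^ (k - 1))"
    by (simp only: left_diff_distrib right_diff_distrib right_minus_eq)
  also have "\<dots> = of_nat (k - 1) * (T ^ (M - 1) * (X ^ (k - 1) * T) * Y ^ (k - 1))"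
    by (simp only: mult.assoc of_nat_left[of "X ^ (k - 1)"] of_nat_left[of "T ^ (M - 1)"])
  also have "X ^ (k - 1) * T = T * X ^ (k - 1)" using T_X by (metis power_commuting_commutes)
  also have "T ^ (M - 1) * (T * X ^ (k - 1)) = T ^ M * X ^ (k - 1)"
    using M by (cases M) (simp_all add: power_commutes mult.assoc[symmetric])
  finally show ?thesis .
qed

end

section \<open>Congruence modulo a left ideal and the recursion\<close>

locale left_ideal =
  fixes L :: "'r::ring_1 set"
  assumes L_zero: "0 \<in> L" and L_add: "x \<in> L \<Longrightarrow> y \<in> L \<Longrightarrow> x + y \<in> L"
    and L_mult: "y \<in> L \<Longrightarrow> x * y \<in> L"
begin

text \<open>Compatible with left multiplication only, so an element known modulo L has to be moved
  to the right end before it can be replaced.\<close>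

definition eqv (infix "\<approx>" 50) where "x \<approx> y \<longleftrightarrow> x - y \<in> L"

lemma L_uminus: "x \<in> L \<Longrightarrow> - x \<in> L" using L_mult[of x "- 1"] by simp
lemma L_if: "x \<in> L \<Longrightarrow> (if P then x else 0) \<in> L" by (simp add: L_zero)
lemma L_diff: "x \<in> L \<Longrightarrow> y \<in> L \<Longrightarrow> x - y \<in> L"
  using L_add[of x "- y"] L_uminus[of y] by simp
lemma L_sum: "(\<And>i. i \<in> A \<Longrightarrow> g i \<in> L) \<Longrightarrow> (\<Sum>i\<in>A. g i) \<in> L"
  by (induction A rule: infinite_finite_induct) (auto simp: L_zero L_add)
lemma eqv_refl [simp]: "x \<approx> x" by (simp add: eqv_def L_zero)
lemma eqv_trans [trans]: "x \<approx> y \<Longrightarrow> y \<approx> z \<Longrightarrow> x \<approx> z"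
  unfolding eqv_def using L_add[of "x - y" "y - z"] by simp
lemma eqv_trans1 [trans]: "x = y \<Longrightarrow> y \<approx> z \<Longrightarrow> x \<approx> z" and eqv_trans2 [trans]: "x \<approx> y \<Longrightarrow> y = z \<Longrightarrow> x \<approx> z" by simp_all
lemma eqv_add: "x \<approx> y \<Longrightarrow> x' \<approx> y' \<Longrightarrow> x + x' \<approx> y + y'"
  unfolding eqv_def using L_add[of "x - y" "x' - y'"] by (simp add: algebra_simps)
lemma eqv_diff: "x \<approx> y \<Longrightarrow> x' \<approx> y' \<Longrightarrow> x - x' \<approx> y - y'"
  unfolding eqv_def using L_diff[of "x - y" "x' - y'"] by (simp add: algebra_simps)
lemma eqv_mult: "x \<approx> y \<Longrightarrow> z * x \<approx> z * y"
  unfolding eqv_def using L_mult[of "x - y" z] by (simp add: right_diff_distrib)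
lemma eqv_zero: "x \<in> L \<Longrightarrow> x \<approx> 0" by (simp add: eqv_def)
lemma eqv_uminus: "x \<approx> y \<Longrightarrow> - x \<approx> - y" using eqv_mult[of x y "- 1"] by simp

end

text \<open>L stands for the annihilator of a highest weight vector; the passage from r to r + 1
  draws on row r + 1 of F.\<close>

locale so_hw_step = so_step N sc F e f de df r + left_ideal L
  for N :: nat and sc :: "complex \<Rightarrow> 'r::ring_1" and F :: "nat \<Rightarrow> nat \<Rightarrow> 'r"
    and e f de df :: "nat \<Rightarrow> 'r" and r :: nat and L :: "'r set" +
  fixes lam :: complex
  assumes raise: "\<And>j. Suc r < j \<Longrightarrow> j \<le> N \<Longrightarrow> F (Suc r) j \<in> L"
    and weight: "F (Suc r) (Suc r) - sc lam \<in> L"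
begin

lemma pair_F_L: "x \<in> odds \<Longrightarrow> y \<in> odds \<Longrightarrow> F i j * z \<in> L \<Longrightarrow> F i j * (x * y) * z \<in> L"
  unfolding odds_pair_F[symmetric] by (simp add: mult.assoc L_mult)

text \<open>Commuting \<open>F a j\<close> through the entries of Y produces only elements
  \<open>F a q\<close> of the same row with q again in the middle, so the hypothesis on x passes to
  Y x.\<close>

lemma inner_raise:
  assumes x: "\<And>j. j \<in> Inn (Suc r) \<Longrightarrow> F a j * x \<in> L" and j: "j \<in> Inn (Suc r)"
  shows "F a j * (Y * x) \<in> L"
proof -
  have inN: "i \<in> Inn (Suc r) \<Longrightarrow> i \<in> {1..N} \<and> i \<noteq> a \<and> i \<noteq> b \<and> flip N i \<in> Inn (Suc r)" for i
    using r by (auto simp: Inn_def a_def b_def flip_def)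
  have o: "fl fp p \<in> odds" "fp q \<in> odds" for p q by (simp_all add: oddfD)
  have "F a j * (F p q * (fl fp p * fp q) * x) \<in> L" if pq: "p \<in> {1..N}" "q \<in> {1..N}" for p q
  proof (cases "p \<in> Inn (Suc r) \<and> q \<in> Inn (Suc r)")
    case False
    have "fl fp p = 0 \<or> fp q = 0"
      using False pq r by (auto simp: fp_def fr_def fl_def flip_def Inn_def)
    hence "fl fp p * fp q = 0" by auto
    thus ?thesis by (simp add: L_zero)
  next
    case True
    note p = inN[of p] and q = inN[of q] and jj = inN[OF j]
    \<comment> \<open>Column b agrees with row a up to sign, since b is the flip of a. This keeps
      the commutator inside row a.\<close>
    have fb: "F p b = - F a (flip N p)"
      using F_skew[of a "flip N p"] ab True p flip_flip[of p N] flip_in[of p N] by simp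
    have c: "F a j * F p q = F p q * F a j + (if p = j then F a q else 0) + (if q = flip N j then F p b else 0)"
    proof -
      have "q \<noteq> a" "p \<noteq> flip N a" using True p q ab by auto
      thus ?thesis using F_comm[of a j p q] ab(1) jj p q True by (simp add: ab(4) algebra_simps split: if_splits)
    qed
    have L1: "F a i * (fl fp p * fp q) * x \<in> L" if "i \<in> Inn (Suc r)" for i
      by (rule pair_F_L[OF o x[OF that]])
    have "F a j * (F p q * (fl fp p * fp q) * x) = F p q * (F a j * (fl fp p * fp q) * x)
       + (if p = j then F a q * (fl fp p * fp q) * x else 0)
       + (if q = flip N j then - (F a (flip N p) * (fl fp p * fp q) * x) else 0)"
      unfolding mult.assoc[symmetric] c fb by (simp add: distrib_right)
    also have "\<dots> \<in> L"
    proof -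
      have m1: "F p q * (F a j * (fl fp p * fp q) * x) \<in> L" by (rule L_mult[OF L1[OF j]])
      have "F a q * (fl fp p * fp q) * x \<in> L" using L1[of q] True by blast
      hence m2: "(if p = j then F a q * (fl fp p * fp q) * x else 0) \<in> L"
        by (rule L_if)
      have m3: "(if q = flip N j then - (F a (flip N p) * (fl fp p * fp q) * x) else 0) \<in> L"
        using p True by (intro L_if L_uminus L1) blast
      show ?thesis by (rule L_add[OF L_add[OF m1 m2] m3])
    qed
    finally show ?thesis .
  qed
  hence "(\<Sum>p=1..N. \<Sum>q=1..N. F a j * (F p q * (fl fp p * fp q) * x)) \<in> L"
    by (intro L_sum)
  thus ?thesis unfolding Y_eq FF_def sum_distrib_right sum_distrib_left .
qed

lemma raise_Y: "j \<in> Inn (Suc r) \<Longrightarrow> F a j * Y ^ m \<in> L"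
proof (induction m arbitrary: j)
  case 0
  thus ?case using raise[of j] by (auto simp: Inn_def a_def)
next
  case (Suc m)
  thus ?case using inner_raise[of "Y ^ m" j] by simp
qed

lemma FF_a_L:
  assumes "x \<in> odds" "oddf v" "\<And>j. j \<in> {1..N} \<Longrightarrow> j \<notin> Inn (Suc r) \<Longrightarrow> v j = 0"
  shows "FF (atf a x) v * Y ^ m \<in> L"
  unfolding FF_atf_left[OF ab(1)] sum_distrib_right
proof (rule L_sum)
  fix j assume j: "j \<in> {1..N}"
  show "F a j * (x * v j) * Y ^ m \<in> L"
  proof (cases "j \<in> Inn (Suc r)")
    case True
    show ?thesis by (rule pair_F_L[OF assms(1) oddfD[OF assms(2)] raise_Y[OF True]])
  qed (use assms(3)[OF j] L_zero in simp)
qed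

lemma B1_Y: "B1 * Y ^ m \<in> L"
proof -
  have "fl (er (Suc r)) j = 0" if "j \<in> {1..N}" "j \<notin> Inn (Suc r)" for j
    using that r by (auto simp: fl_def er_def Inn_def flip_def)
  thus ?thesis unfolding B1_def al_def ep_def by (intro FF_a_L) simp_all
qed

lemma A2_L: "A2 \<in> L"
proof -
  have "A2 = FF (atf a (f b)) fp"
    unfolding A2_def dl_def by (rule FF_cong) (simp_all add: fl_atf)
  moreover have "FF (atf a (f b)) fp * Y ^ 0 \<in> L"
  proof (rule FF_a_L)
    show "fp j = 0" if "j \<in> {1..N}" "j \<notin> Inn (Suc r)" for j
      using that by (auto simp: fp_def fr_def Inn_def)
  qed simp_all
  ultimately show ?thesis by simp
qed

text \<open>Y involves middle indices only and so has weight zero under \<open>F a a\<close>, which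
  can be moved to the right end.\<close>

lemma h_Y: "F a a * Y ^ m \<approx> sc lam * Y ^ m"
proof -
  have "F a a * Y = Y * F a a"
    unfolding Y_eq
  proof (rule FF_commute_supp)
    fix i j assume ij: "i \<in> {1..N}" "j \<in> {1..N}"
    show "fl fp i * fp j = 0 \<or> F a a * F i j = F i j * F a a"
    proof (cases "i = a \<or> i = b \<or> j = a \<or> j = b")
      case True thus ?thesis using supp ij by (metis mult_zero_left mult_zero_right)
    next
      case False
      thus ?thesis using F_comm[OF ab(1) ab(1) ij] by (simp add: ab)
    qed
  qed (simp add: odds_pair_F oddfD)
  hence "F a a * Y ^ m = Y ^ m * F a a" by (metis power_commuting_commutes)
  also have "\<dots> \<approx> Y ^ m * sc lam" using weight by (intro eqv_mult) (simp add: eqv_def a_def)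
  finally show ?thesis by (simp only: sc_central)
qed

lemma W_eqv: "W \<approx> A1 - sc lam * ff"
proof -
  have "F a a * ff = ff * F a a" by (simp add: ff_def odds_pair_F)
  hence "A3 = - (ff * F a a)" by (simp only: A3_eq ff_def[symmetric])
  also have "\<dots> \<approx> - (ff * sc lam)"
    using weight by (intro eqv_uminus eqv_mult) (simp add: eqv_def a_def)
  finally have "W \<approx> A1 + 0 + - (ff * sc lam)"
    unfolding W_def by (intro eqv_add eqv_refl eqv_zero A2_L)
  thus ?thesis by (simp add: sc_central)
qed

text \<open>The raising part \<open>A2\<close> is moved to the right, where it lies in L; only the
  commutator with \<open>A1\<close> remains.\<close>

lemma WW_eqv: "W * W \<approx> - (Y * ff)"
proof -
  have "W * W = 2 * (A1 * A2) - Y * ff"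
    unfolding WW ff_def A12[symmetric] by (simp add: mult_2)
  also have "\<dots> \<approx> 0 - Y * ff" by (intro eqv_diff eqv_refl eqv_zero L_mult A2_L)
  finally show ?thesis by simp
qed

text \<open>In the coefficient of Y^(k-1) \<open>ff\<close>, the linear term in W contributes the
  weight and the quadratic term contributes k - 1.\<close>

lemma Y_pow_eqv:
  assumes k: "k \<ge> 1"
  shows "YY r ^ k \<approx> Y ^ k + of_nat (2 * k) * (Y ^ (k - 1) * A1)
     - of_nat (2 * k) * (sc (lam + of_nat (k - 1)) * (Y ^ (k - 1) * ff))"
proof -
  have "YY r ^ k = Y ^ k + of_nat (2 * k) * (Y ^ (k - 1) * W) + of_nat (2 * k * (k - 1)) * (Y ^ (k - 2) * (W * W))"
    unfolding YY_split W_def[symmetric] by (rule binom_trunc2[OF Y_W WWW])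
  also have "\<dots> \<approx> Y ^ k + of_nat (2 * k) * (Y ^ (k - 1) * (A1 - sc lam * ff))
      + of_nat (2 * k * (k - 1)) * (Y ^ (k - 2) * - (Y * ff))"
    by (intro eqv_add eqv_refl eqv_mult W_eqv WW_eqv)
  also have "of_nat (2 * k * (k - 1)) * (Y ^ (k - 2) * - (Y * ff)) = - (of_nat (2 * k) * (of_nat (k - 1) * (Y ^ (k - 1) * ff)))"
  proof (cases "k = 1")
    case False
    hence "k - 1 = Suc (k - 2)" using k by simp
    hence "Y ^ (k - 2) * Y = Y ^ (k - 1)" by (simp only: power_Suc2)
    hence "Y ^ (k - 2) * - (Y * ff) = - (Y ^ (k - 1) * ff)"
      by (simp only: mult_minus_right mult.assoc[symmetric])
    thus ?thesis by (simp only: of_nat_mult mult.assoc mult_minus_right)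
  qed simp
  also have "of_nat (2 * k) * (Y ^ (k - 1) * (A1 - sc lam * ff)) =
      of_nat (2 * k) * (Y ^ (k - 1) * A1) - of_nat (2 * k) * (sc lam * (Y ^ (k - 1) * ff))"
    by (simp only: right_diff_distrib sc_left)
  finally show ?thesis
    by (simp only: sc_add sc_of_nat distrib_right distrib_left) (simp add: algebra_simps)
qed

lemma ee_ff: "ee * ff = - (pr a * pr b)"
  unfolding ee_def ff_def pr_def
proof -
  have "e a * e b * (f a * f b) = e a * (e b * f a) * f b" by (simp only: mult.assoc)
  also have "e b * f a = - (f a * e b)" by (rule e_f)
  finally show "e a * e b * (f a * f b) = - (e a * f a * (e b * f b))" by (simp add: mult.assoc)
qed

lemma ff_Y: "Y ^ m * ff = ff * Y ^ m"
proof -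
  have "ff * Y = Y * ff" unfolding ff_def Y_eq by (rule pair_FF_comm) simp_all
  thus ?thesis by (metis power_commuting_commutes)
qed

lemma B3_eqv: "B3 * (Y ^ m * ff) \<approx> sc lam * (- (pr a * pr b) * Y ^ m)"
proof -
  have "B3 * (Y ^ m * ff) = F a a * (ee * ff) * Y ^ m" unfolding ff_Y B3_eq ee_def by (simp only: mult.assoc)
  also have "F a a * (ee * ff) = ee * ff * F a a"
    unfolding ee_def ff_def by (rule comm_mult; simp add: odds_pair_F)
  also have "ee * ff * F a a * Y ^ m = ee * ff * (F a a * Y ^ m)" by (simp only: mult.assoc)
  also have "\<dots> \<approx> ee * ff * (sc lam * Y ^ m)" by (intro eqv_mult h_Y)
  finally show ?thesis by (simp only: sc_left ee_ff)
qed

text \<open>The raising part \<open>B1\<close> is moved to the right, past the even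
  \<open>ff\<close> and past the powers of Y, where it lies in L; the commutator of
  \<open>B1\<close> and \<open>B2\<close> remains.\<close>

lemma VV_eqv: "V * V * (Y ^ m * ff) \<approx> X * (- (pr a * pr b) * Y ^ m)"
proof -
  have "ff * B1 = B1 * ff" unfolding ff_def B1_def by (rule pair_FF_comm) simp_all
  hence "B1 * (ff * Y ^ m) = ff * (B1 * Y ^ m)" by (metis mult.assoc)
  hence BL: "B1 * (ff * Y ^ m) \<in> L" by (simp add: L_mult B1_Y)
  have "V * V = X * ee + 2 * (B2 * B1)" unfolding VV ee_def B12[symmetric] by (simp add: mult_2)
  hence "V * V * (Y ^ m * ff) = X * (ee * ff * Y ^ m) + 2 * B2 * (B1 * (ff * Y ^ m))"
    unfolding ff_Y by (simp add: distrib_right mult.assoc)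
  also have "\<dots> \<approx> X * (ee * ff * Y ^ m) + 0" by (intro eqv_add eqv_refl eqv_zero L_mult BL)
  finally show ?thesis by (simp only: ee_ff add_0_right)
qed

lemma TX_ff_eqv:
  assumes k: "k \<ge> 1"
  shows "TX M k * (Y ^ (k - 1) * ff) \<approx>
    - (of_nat (2 * k) * (sc (lam + of_nat (k - 1)) * (pr a * pr b * (T ^ M * X ^ (k - 1) * Y ^ (k - 1)))))"
proof -
  let ?G = "pr a * pr b * (T ^ M * X ^ (k - 1) * Y ^ (k - 1))"
  have "T * (pr a * pr b) = pr a * pr b * T" by (rule comm_mult[OF pr_T[symmetric] pr_T[symmetric]])
  hence cT: "T ^ M * (pr a * pr b) = pr a * pr b * T ^ M" by (metis power_commuting_commutes)
  have "X * (pr a * pr b) = pr a * pr b * X" by (rule comm_mult[OF pr_X[symmetric] pr_X[symmetric]])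
  hence cX: "X ^ m * (pr a * pr b) = pr a * pr b * X ^ m" for m by (metis power_commuting_commutes)
  have G: "T ^ M * (X ^ (k - 1) * (- (pr a * pr b) * Y ^ (k - 1))) = - ?G"
  proof -
    have "T ^ M * (X ^ (k - 1) * (pr a * pr b * Y ^ (k - 1))) = T ^ M * (X ^ (k - 1) * (pr a * pr b)) * Y ^ (k - 1)"
      by (simp only: mult.assoc)
    also have "\<dots> = T ^ M * (pr a * pr b) * X ^ (k - 1) * Y ^ (k - 1)" unfolding cX by (simp only: mult.assoc)
    also have "\<dots> = ?G" unfolding cT by (simp only: mult.assoc)
    finally show ?thesis by simp
  qed
  have "TX M k * (Y ^ (k - 1) * ff) \<approx>
      of_nat (2 * k) * (T ^ M * (X ^ (k - 1) * (sc lam * (- (pr a * pr b) * Y ^ (k - 1)))))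
    + of_nat (2 * k * (k - 1)) * (T ^ M * (X ^ (k - 2) * (X * (- (pr a * pr b) * Y ^ (k - 1)))))"
    unfolding TX_ff by (intro eqv_add eqv_mult B3_eqv VV_eqv)
  also have "T ^ M * (X ^ (k - 1) * (sc lam * (- (pr a * pr b) * Y ^ (k - 1)))) = - (sc lam * ?G)"
    unfolding sc_left[of "X ^ (k - 1)"] sc_left[of "T ^ M"] G by simp
  also have "of_nat (2 * k * (k - 1)) * (T ^ M * (X ^ (k - 2) * (X * (- (pr a * pr b) * Y ^ (k - 1)))))
     = - (of_nat (2 * k) * (of_nat (k - 1) * ?G))"
  proof (cases "k = 1")
    case False
    hence "k - 1 = Suc (k - 2)" using k by simp
    hence "X ^ (k - 2) * X = X ^ (k - 1)" by (simp only: power_Suc2)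
    hence "X ^ (k - 2) * (X * y) = X ^ (k - 1) * y" for y by (simp only: mult.assoc[symmetric])
    hence "T ^ M * (X ^ (k - 2) * (X * (- (pr a * pr b) * Y ^ (k - 1)))) = - ?G" by (simp only: G)
    thus ?thesis by (simp only: of_nat_mult mult.assoc mult_minus_right)
  qed simp
  finally show ?thesis
    by (simp only: sc_add sc_of_nat distrib_right distrib_left mult_minus_right minus_add_distrib)
qed

text \<open>Since \<open>B1\<close> moves through Y into L, the product of \<open>B1\<close> and
  \<open>A1\<close> may be replaced by their commutator. Its Cartan part contributes the weight and
  its Z contributes k - 1 by \<open>Z_elim\<close>, so the factor lam + k - 1 of
  \<open>Y_pow_eqv\<close> appears again.\<close>

lemma TX_A1_eqv:
  assumes Nr: "M + 2 * k = N - 2 * r" and k: "k \<ge> 1"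
  shows "TX M k * (Y ^ (k - 1) * A1) \<approx>
    of_nat (M * (2 * k)) * (sc (lam + of_nat (k - 1)) * (pr a * pr b * (T ^ M * X ^ (k - 1) * Y ^ (k - 1))))"
proof (cases "M = 0")
  case True
  thus ?thesis unfolding TX_A1[OF Nr k] by simp
next
  case False
  hence M: "M \<ge> 1" by simp
  have "X * (pr b * pr a) = pr b * pr a * X" by (rule comm_mult[OF pr_X[symmetric] pr_X[symmetric]])
  hence cX: "X ^ m * (pr b * pr a) = pr b * pr a * X ^ m" for m by (metis power_commuting_commutes)
  have "T * (pr b * pr a) = pr b * pr a * T" by (rule comm_mult[OF pr_T[symmetric] pr_T[symmetric]])
  hence cT: "T ^ m * (pr b * pr a) = pr b * pr a * T ^ m" for m by (metis power_commuting_commutes)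
  have hp: "F a a * pr a = pr a * F a a" by (simp add: pr_def odds_pair_F)
  have "B1 * A1 * Y ^ (k - 1) = pr a * (Z * Y ^ (k - 1)) + pr a * (T * (F a a * Y ^ (k - 1))) + A1 * (B1 * Y ^ (k - 1))"
  proof -
    have "B1 * A1 = pr a * Z + pr a * (T * F a a) + A1 * B1"
    proof -
      have 1: "F a a * pr a * T = pr a * (T * F a a)" by (simp only: hp mult.assoc TT_F)
      have "B1 * A1 = (B1 * A1 - A1 * B1) + A1 * B1" by simp
      thus ?thesis unfolding B1A1 1 pr_Z[symmetric] .
    qed
    thus ?thesis by (simp add: distrib_right mult.assoc)
  qed
  also have "\<dots> \<approx> pr a * (Z * Y ^ (k - 1)) + pr a * (T * (sc lam * Y ^ (k - 1))) + 0"
    by (intro eqv_add eqv_refl eqv_mult h_Y eqv_zero L_mult B1_Y)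
  finally have B: "B1 * A1 * Y ^ (k - 1) \<approx> pr a * (Z * Y ^ (k - 1) + sc lam * (T * Y ^ (k - 1)))"
    by (simp add: distrib_left sc_left)
  have "T ^ (M - 1) * X ^ (k - 1) * (pr b * (B1 * A1 * Y ^ (k - 1)))
     \<approx> T ^ (M - 1) * X ^ (k - 1) * (pr b * (pr a * (Z * Y ^ (k - 1) + sc lam * (T * Y ^ (k - 1)))))"
    by (intro eqv_mult B)
  also have "\<dots> = pr b * pr a * (T ^ (M - 1) * X ^ (k - 1) * (Z * Y ^ (k - 1) + sc lam * (T * Y ^ (k - 1))))"
  proof -
    have "T ^ (M - 1) * X ^ (k - 1) * (pr b * (pr a * Q)) = pr b * pr a * (T ^ (M - 1) * X ^ (k - 1) * Q)" for Q
    proof -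
      have "T ^ (M - 1) * X ^ (k - 1) * (pr b * (pr a * Q)) = T ^ (M - 1) * (X ^ (k - 1) * (pr b * pr a)) * Q"
        by (simp only: mult.assoc)
      also have "\<dots> = T ^ (M - 1) * (pr b * pr a) * (X ^ (k - 1) * Q)" unfolding cX by (simp only: mult.assoc)
      finally show ?thesis unfolding cT by (simp only: mult.assoc)
    qed
    thus ?thesis .
  qed
  also have "T ^ (M - 1) * X ^ (k - 1) * (Z * Y ^ (k - 1) + sc lam * (T * Y ^ (k - 1)))
     = of_nat (k - 1) * (T ^ M * X ^ (k - 1) * Y ^ (k - 1)) + sc lam * (T ^ M * X ^ (k - 1) * Y ^ (k - 1))"
  proof -
    have "X ^ (k - 1) * T = T * X ^ (k - 1)" using T_X by (metis power_commuting_commutes)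
    note XT = this
    have "T ^ (M - 1) * X ^ (k - 1) * (T * Y ^ (k - 1)) = T ^ (M - 1) * T * X ^ (k - 1) * Y ^ (k - 1)"
    proof -
      have "T ^ (M - 1) * X ^ (k - 1) * (T * Y ^ (k - 1)) = T ^ (M - 1) * (X ^ (k - 1) * T) * Y ^ (k - 1)"
        by (simp only: mult.assoc)
      thus ?thesis unfolding XT by (simp only: mult.assoc)
    qed
    also have "T ^ (M - 1) * T = T ^ M" using M by (cases M) (simp_all add: power_commutes)
    finally show ?thesis unfolding distrib_left Z_elim[OF Nr k M] sc_left by simp
  qed
  also have "\<dots> = sc (lam + of_nat (k - 1)) * (T ^ M * X ^ (k - 1) * Y ^ (k - 1))"
    by (simp only: sc_add sc_of_nat distrib_right add.commute)
  also have "pr b * pr a * \<dots> = sc (lam + of_nat (k - 1)) * (pr a * pr b * (T ^ M * X ^ (k - 1) * Y ^ (k - 1)))"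
    by (simp only: sc_left pr_comm[of b a])
  finally show ?thesis unfolding TX_A1[OF Nr k] by (rule eqv_mult)
qed

text \<open>With l = lam + k - 1, the part with \<open>A1\<close> contributes 4 k^2 M l and the part
  with \<open>ff\<close> contributes 4 k^2 l^2. In the part with Y^k both outer pairs come from the
  power of T.\<close>

theorem recursion:
  assumes Nr: "M + 2 * k = N - 2 * r" and k: "k \<ge> 1"
  shows "TT r ^ M * XX r ^ k * YY r ^ k \<approx>
    of_nat (M * (M - 1)) * (pr a * pr b * (T ^ (M - 2) * X ^ k * Y ^ k))
    + sc (4 * of_nat k ^ 2 * (lam + of_nat (k - 1)) * (lam + of_nat (k - 1) + of_nat M))
       * (pr a * pr b * (T ^ M * X ^ (k - 1) * Y ^ (k - 1)))"
proof -
  let ?G = "pr a * pr b * (T ^ M * X ^ (k - 1) * Y ^ (k - 1))"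
  let ?l = "lam + of_nat (k - 1)"
  have "TT r ^ M * XX r ^ k * YY r ^ k = TX M k * YY r ^ k" by (simp only: TX_eq[OF Nr k])
  also have "\<dots> \<approx> TX M k * (Y ^ k + of_nat (2 * k) * (Y ^ (k - 1) * A1)
     - of_nat (2 * k) * (sc ?l * (Y ^ (k - 1) * ff)))"
    by (rule eqv_mult[OF Y_pow_eqv[OF k]])
  also have "\<dots> = TX M k * Y ^ k + of_nat (2 * k) * (TX M k * (Y ^ (k - 1) * A1))
     - of_nat (2 * k) * (sc ?l * (TX M k * (Y ^ (k - 1) * ff)))"
    by (simp only: distrib_left right_diff_distrib of_nat_left[of "TX M k"] sc_left[of "TX M k"])
  also have "\<dots> \<approx> of_nat (M * (M - 1)) * (pr a * pr b * (T ^ (M - 2) * X ^ k * Y ^ k))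
     + of_nat (2 * k) * (of_nat (M * (2 * k)) * (sc ?l * ?G))
     - of_nat (2 * k) * (sc ?l * (- (of_nat (2 * k) * (sc ?l * ?G))))"
    unfolding TX_Y[OF Nr k] by (intro eqv_add eqv_diff eqv_refl eqv_mult TX_A1_eqv[OF Nr k] TX_ff_eqv[OF k])
  also have "\<dots> = of_nat (M * (M - 1)) * (pr a * pr b * (T ^ (M - 2) * X ^ k * Y ^ k))
     + sc (of_nat (2 * k) * (of_nat (M * (2 * k)) * ?l) + of_nat (2 * k) * (?l * (of_nat (2 * k) * ?l))) * ?G"
    by (simp only: sc_add sc_mult sc_of_nat mult.assoc distrib_right mult_minus_right diff_minus_eq_add add.assoc)
  also have "of_nat (2 * k) * (of_nat (M * (2 * k)) * ?l) + of_nat (2 * k) * (?l * (of_nat (2 * k) * ?l))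
     = 4 * of_nat k ^ 2 * ?l * (?l + of_nat M)"
    by (simp add: power2_eq_square algebra_simps)
  finally show ?thesis .
qed

text \<open>The counterpart of \<open>recursion\<close> for k = 0.\<close>

lemma T_pow:
  assumes "M = N - 2 * r"
  shows "TT r ^ M = of_nat (M * (M - 1)) * (pr a * pr b * T ^ (M - 2))"
proof -
  note d = dgr_e_XYZT[of "Suc r"]
  have N2: "N - 2 * r \<ge> 2" using r by simp
  have 1: "T ^ M = 0" by (rule kill_e[OF dgr_power[OF d(4)]]) (use assms N2 in simp)
  have 2: "T ^ (M - 1) = 0" by (rule kill_e[OF dgr_power[OF d(4)]]) (use assms N2 in simp)
  have "T * (pr a * pr b) = pr a * pr b * T" by (intro comm_mult pr_T[symmetric])
  hence c: "T ^ (M - 2) * (pr a * pr b) = pr a * pr b * T ^ (M - 2)" by (metis power_commuting_commutes)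
  have "even (M * (M - 1))" by (cases M) simp_all
  hence "2 * (M choose 2) = M * (M - 1)" unfolding choose_two by (rule dvd_mult_div_cancel)
  hence ch: "of_nat (M * (M - 1)) * y = of_nat (M choose 2) * (y + y)" for y :: 'r
    by (metis distrib_left distrib_right mult_2 of_nat_add)
  have "TT r ^ M = of_nat (M choose 2) * (T ^ (M - 2) * (P * P))"
    unfolding TT_split P_def[symmetric] binom_trunc[OF T_P PPP] 1 2 by simp
  also have "T ^ (M - 2) * (P * P) = pr a * pr b * T ^ (M - 2) + pr a * pr b * T ^ (M - 2)"
    unfolding PP mult_2 distrib_left c ..
  finally show ?thesis unfolding ch .
qed

end

text \<open>
  With \<open>n = N div 2\<close>, the value \<open>EE N lam d k\<close> belongs to the orthogonal Lie algebra on the middle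
  \<open>N - 2 (n - d)\<close> indices, whose weight is \<open>lam (n - d + 1), \<dots>, lam n\<close>.
\<close>

primrec EE :: "nat \<Rightarrow> (nat \<Rightarrow> complex) \<Rightarrow> nat \<Rightarrow> nat \<Rightarrow> complex" where
  "EE N lam 0 k = (if k = 0 then 1 else 0)"
| "EE N lam (Suc d) k = EE N lam d k + (if k = 0 then 0 else
     (lam (N div 2 - d) + of_nat (k - 1))
     * (lam (N div 2 - d) + of_nat (k - 1) + of_nat (N - 2 * (N div 2 - Suc d) - 2 * k)) * EE N lam d (k - 1))"

lemma EE_zero: "d < k \<Longrightarrow> EE N lam d k = 0"
  by (induction d arbitrary: k) auto

section \<open>The eigenvalue on the highest weight vector\<close>

locale so_hw = so_fock N sc F e f de df + left_ideal L
  for N :: nat and sc :: "complex \<Rightarrow> 'r::ring_1" and F :: "nat \<Rightarrow> nat \<Rightarrow> 'r"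
    and e f de df :: "nat \<Rightarrow> 'r" and L :: "'r set" +
  fixes lam :: "nat \<Rightarrow> complex"
  assumes raise: "\<And>i j. 1 \<le> i \<Longrightarrow> i < j \<Longrightarrow> j \<le> N \<Longrightarrow> F i j \<in> L"
    and weight: "\<And>i. 1 \<le> i \<Longrightarrow> i \<le> N div 2 \<Longrightarrow> F i i - sc (lam i) \<in> L"
begin

definition volr where "volr r = prod_list (map pr [Suc r..<N - r + 1])"

lemma volr_Suc: "2 * Suc r \<le> N \<Longrightarrow> volr r = pr (Suc r) * pr (N - r) * volr (Suc r)"
proof -
  assume r: "2 * Suc r \<le> N"
  have "[Suc r..<N - r + 1] = Suc r # [Suc (Suc r)..<N - Suc r + 1] @ [N - r]"
  proof -
    have "[Suc r..<N - r + 1] = Suc r # [Suc (Suc r)..<N - r + 1]" using r by (intro upt_conv_Cons) simp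
    also have "[Suc (Suc r)..<N - r + 1] = [Suc (Suc r)..<N - r] @ [N - r]"
      using r upt_Suc_append[of "Suc (Suc r)" "N - r"] by simp
    moreover have "N - Suc r + 1 = N - r" using r by simp
    ultimately show ?thesis by (simp only:)
  qed
  hence "volr r = pr (Suc r) * (volr (Suc r) * pr (N - r))"
    by (simp add: volr_def mult.assoc del: upt_Suc)
  also have "volr (Suc r) * pr (N - r) = pr (N - r) * volr (Suc r)"
    unfolding volr_def by (rule prod_list_comm[symmetric]) (auto intro: pr_comm)
  finally show ?thesis by (simp only: mult.assoc)
qed

text \<open>Induction on the rank d of the middle algebra, N div 2 - d outer pairs being split off.
  The factor M! 4^k (k!)^2 absorbs the coefficients M (M - 1) and 4 k^2 of \<open>recursion\<close>,
  so that exactly the recursion of \<open>EE\<close> is left.\<close>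

theorem eigen_forms:
  "d \<le> N div 2 \<Longrightarrow> M + 2 * k = N - 2 * (N div 2 - d) \<Longrightarrow>
   TT (N div 2 - d) ^ M * XX (N div 2 - d) ^ k * YY (N div 2 - d) ^ k
     \<approx> sc (fact M * 4 ^ k * (fact k)\<^sup>2 * EE N lam d k) * volr (N div 2 - d)"
proof (induction d arbitrary: M k)
  case 0
  have "N - 2 * (N div 2) \<le> 1" by presburger
  hence k: "k = 0" and M: "M = 0 \<or> M = 1" using 0 by auto
  let ?n = "N div 2"
  show ?case
  \<comment> \<open>At rank 0 no index is left for even N, and the single middle index for odd
    N.\<close>
  proof (cases "M = 0")
    case True
    hence "N - ?n = ?n" using 0 by presburger
    thus ?thesis using k True by (simp add: volr_def)
  next
    case False
    hence M1: "M = 1" using M by simp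
    hence Nn: "N = 2 * ?n + 1" using 0 by presburger
    have sp: "N - ?n = ?n + 1" using Nn by presburger
    have "TT ?n = (\<Sum>i=1..N. if i = Suc ?n then pr i else 0)"
      unfolding TT_def dot_def
      by (rule sum.cong[OF refl]) (auto simp: er_def fr_def pr_def sp)
    hence "TT ?n = pr (Suc ?n)" using Nn by (simp add: sum.delta)
    moreover have "volr ?n = pr (Suc ?n)" by (simp add: volr_def sp)
    ultimately show ?thesis using k M1 by simp
  qed
next
  case (Suc d)
  define r where "r = N div 2 - Suc d"
  have r: "2 * Suc r \<le> N" and Sr: "Suc r = N div 2 - d" using Suc.prems by (auto simp: r_def)
  interpret st: so_hw_step N sc F e f de df r L "lam (Suc r)"
    by unfold_locales (use r Suc.prems in \<open>auto intro!: raise weight simp: r_def\<close>)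
  have Nr: "M + 2 * k = N - 2 * r" using Suc.prems by (simp add: r_def)
  have Nr': "N - 2 * (N div 2 - d) = N - 2 * r - 2" using Sr by simp
  have N2: "N - 2 * r \<ge> 2" using r by simp
  have IH: "M' + 2 * k' = N - 2 * r - 2 \<Longrightarrow> TT (Suc r) ^ M' * XX (Suc r) ^ k' * YY (Suc r) ^ k'
     \<approx> sc (fact M' * 4 ^ k' * (fact k')\<^sup>2 * EE N lam d k') * volr (Suc r)" for M' k'
    using Suc.IH[of M' k'] Suc.prems unfolding Nr' Sr by simp
  have vr: "pr st.a * pr st.b * volr (Suc r) = volr r"
    by (simp add: volr_Suc[OF r] st.a_def st.b_def)
  have P: "pr st.a * pr st.b * (TT (Suc r) ^ M' * XX (Suc r) ^ k' * YY (Suc r) ^ k')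
     \<approx> sc (fact M' * 4 ^ k' * (fact k')\<^sup>2 * EE N lam d k') * volr r" if "M' + 2 * k' = N - 2 * r - 2" for M' k'
    using eqv_mult[OF IH[OF that], of "pr st.a * pr st.b"] unfolding sc_left vr .
  have 1: "of_nat (M * (M - 1)) * (pr st.a * pr st.b * (TT (Suc r) ^ (M - 2) * XX (Suc r) ^ k * YY (Suc r) ^ k))
     \<approx> sc (fact M * 4 ^ k * (fact k)\<^sup>2 * EE N lam d k) * volr r"
  \<comment> \<open>For M < 2 the coefficient M (M - 1) vanishes; the right-hand side vanishes too,
    because then k exceeds the rank d.\<close>
  proof (cases "M < 2")
    case True
    have eq: "r + Suc d = N div 2" using Suc.prems(1) by (simp add: r_def)
    have "2 * (r + Suc d) \<le> N" unfolding eq by simp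
    hence "2 * Suc d \<le> N - 2 * r" by simp
    hence "d < k" using True Nr by simp
    moreover have MM: "M * (M - 1) = 0" using True by (cases M) auto
    ultimately show ?thesis unfolding MM by (simp add: EE_zero)
  next
    case False
    define m where "m = M - 2"
    have m: "M = m + 2" using False by (simp add: m_def)
    have "of_nat (M * (M - 1)) * (pr st.a * pr st.b * (TT (Suc r) ^ (M - 2) * XX (Suc r) ^ k * YY (Suc r) ^ k))
      \<approx> sc (of_nat (M * (M - 1))) * (sc (fact (M - 2) * 4 ^ k * (fact k)\<^sup>2 * EE N lam d k) * volr r)"
      unfolding sc_of_nat using False Nr by (intro eqv_mult P) simp
    also have "\<dots> = sc (of_nat (M * (M - 1)) * (fact (M - 2) * 4 ^ k * (fact k)\<^sup>2 * EE N lam d k)) * volr r"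
      by (simp only: sc_mult mult.assoc)
    also have "of_nat (M * (M - 1)) * (fact (M - 2) * 4 ^ k * (fact k)\<^sup>2 * EE N lam d k)
       = fact M * 4 ^ k * (fact k)\<^sup>2 * EE N lam d k"
      unfolding m by (simp add: algebra_simps)
    finally show ?thesis .
  qed
  show ?case
  proof (cases "k = 0")
    case True
    have "TT r ^ M = of_nat (M * (M - 1)) * (pr st.a * pr st.b * TT (Suc r) ^ (M - 2))"
      using Nr True by (intro st.T_pow) simp
    thus ?thesis using 1 True by (simp add: r_def)
  next
    case False
    hence k: "k \<ge> 1" by simp
    let ?l = "lam (Suc r) + of_nat (k - 1)"
    have NM: "N - 2 * r - 2 * k = M" using Nr by simp
    have "TT r ^ M * XX r ^ k * YY r ^ k \<approx>
      of_nat (M * (M - 1)) * (pr st.a * pr st.b * (TT (Suc r) ^ (M - 2) * XX (Suc r) ^ k * YY (Suc r) ^ k))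
      + sc (4 * of_nat k ^ 2 * ?l * (?l + of_nat M))
       * (pr st.a * pr st.b * (TT (Suc r) ^ M * XX (Suc r) ^ (k - 1) * YY (Suc r) ^ (k - 1)))"
      by (rule st.recursion[OF Nr k])
    also have "\<dots> \<approx> sc (fact M * 4 ^ k * (fact k)\<^sup>2 * EE N lam d k) * volr r
      + sc (4 * of_nat k ^ 2 * ?l * (?l + of_nat M))
       * (sc (fact M * 4 ^ (k - 1) * (fact (k - 1))\<^sup>2 * EE N lam d (k - 1)) * volr r)"
      using Nr k by (intro eqv_add 1 eqv_mult P) simp
    also have "\<dots> = sc (fact M * 4 ^ k * (fact k)\<^sup>2 * EE N lam d k
       + 4 * of_nat k ^ 2 * ?l * (?l + of_nat M) * (fact M * 4 ^ (k - 1) * (fact (k - 1))\<^sup>2 * EE N lam d (k - 1))) * volr r"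
      by (simp only: sc_add sc_mult mult.assoc distrib_right)
    also have "fact M * 4 ^ k * (fact k)\<^sup>2 * EE N lam d k
       + 4 * of_nat k ^ 2 * ?l * (?l + of_nat M) * (fact M * 4 ^ (k - 1) * (fact (k - 1))\<^sup>2 * EE N lam d (k - 1))
      = fact M * 4 ^ k * (fact k)\<^sup>2 * (EE N lam d k + ?l * (?l + of_nat M) * EE N lam d (k - 1))"
    proof -
      obtain j where "k = Suc j" using k by (cases k) auto
      thus ?thesis by (simp add: power2_eq_square) (simp add: algebra_simps)
    qed
    also have "EE N lam d k + ?l * (?l + of_nat M) * EE N lam d (k - 1) = EE N lam (Suc d) k"
      using False NM unfolding Sr by (simp add: r_def)
    finally show ?thesis by (simp only: r_def)
  qed
qed

text \<open>The constants of \<open>cas_XY\<close> and \<open>eigen_forms\<close> differ only by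
  (-4)^k against 4^k, which is the origin of the sign (-1)^k.\<close>

theorem eigen_cas:
  assumes k: "1 \<le> k" "k \<le> N div 2"
  shows "(cas (\<lambda>a. of_nat a - of_nat k) (2 * k) - sc ((- 1) ^ k * EE N lam (N div 2) k)) * vol \<in> L"
proof -
  define M where "M = N - 2 * k"
  have M: "M + 2 * k = N" using k by (simp add: M_def)
  define c where "c = ((- 4) ^ k * (fact k)\<^sup>2 * fact M :: complex)"
  have c0: "c \<noteq> 0" by (simp add: c_def)
  have v: "volr 0 = vol" by (simp add: volr_def vol_def)
  have "sc c * (cas (\<lambda>a. of_nat a - of_nat k) (2 * k) * vol) = TT 0 ^ M * XX 0 ^ k * YY 0 ^ k"
    unfolding c_def by (rule cas_XY[OF M k(1)])
  also have "\<dots> \<approx> sc (fact M * 4 ^ k * (fact k)\<^sup>2 * EE N lam (N div 2) k) * vol"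
    using eigen_forms[of "N div 2" M k] M by (simp add: v)
  also have "fact M * 4 ^ k * (fact k)\<^sup>2 * EE N lam (N div 2) k = c * ((- 1) ^ k * EE N lam (N div 2) k)"
  proof -
    have "(- 4) ^ k * (- 1) ^ k = (4 ^ k :: complex)" by (simp add: power_mult_distrib[symmetric])
    thus ?thesis by (simp add: c_def algebra_simps)
  qed
  finally have "sc (inverse c) * (sc c * (cas (\<lambda>a. of_nat a - of_nat k) (2 * k) * vol))
    \<approx> sc (inverse c) * (sc (c * ((- 1) ^ k * EE N lam (N div 2) k)) * vol)" by (rule eqv_mult)
  moreover have "sc (inverse c) * (sc (c * x) * y) = sc x * y" for x y
  proof -
    have "sc (inverse c) * (sc (c * x) * y) = sc (inverse c * c * x) * y" by (simp only: sc_mult mult.assoc)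
    thus ?thesis using c0 by simp
  qed
  moreover from this[of 1] have "sc (inverse c) * (sc c * y) = y" for y by simp
  ultimately show ?thesis by (simp add: eqv_def left_diff_distrib)
qed

end

section \<open>Cancelling the top form on a vacuum\<close>

locale so_vac = so_fock N sc F e f de df + left_ideal L
  for N :: nat and sc :: "complex \<Rightarrow> 'r::ring_1" and F :: "nat \<Rightarrow> nat \<Rightarrow> 'r"
    and e f de df :: "nat \<Rightarrow> 'r" and L :: "'r set" +
  assumes de_L: "de i \<in> L" and df_L: "df i \<in> L"
begin

text \<open>Applying \<open>de i\<close> and then \<open>df i\<close> undoes the multiplication by e
  i f i, up to terms in which an annihilation operator meets y, and these lie in L.\<close>

lemma strip_pr:
  assumes "pr i * y \<in> L" "de i * y \<in> L" "df i * y \<in> L" shows "y \<in> L"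
proof -
  have "de i * (pr i * y) = (de i * e i) * (f i * y)" by (simp only: pr_def mult.assoc)
  also have "\<dots> = f i * y - e i * ((de i * f i) * y)"
    by (simp add: de_e left_diff_distrib mult.assoc)
  also have "\<dots> = f i * y + e i * f i * (de i * y)" by (simp add: de_f mult.assoc)
  finally have "f i * y = de i * (pr i * y) - e i * f i * (de i * y)" by simp
  hence fy: "f i * y \<in> L" using assms by (simp add: L_diff L_mult)
  have "df i * (f i * y) = y - f i * (df i * y)"
    by (simp add: mult.assoc[symmetric] df_f left_diff_distrib)
  hence "y = df i * (f i * y) + f i * (df i * y)" by simp
  thus ?thesis using fy assms(3) by (metis L_add L_mult)
qed

lemma d_pr: "i \<noteq> j \<Longrightarrow> de i * pr j = pr j * de i" "i \<noteq> j \<Longrightarrow> df i * pr j = pr j * df i"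
proof -
  assume ij: "i \<noteq> j"
  have "de i * e j = - (e j * de i)" "df i * f j = - (f j * df i)" using ij by (simp_all add: de_e df_f)
  thus "de i * pr j = pr j * de i" "df i * pr j = pr j * df i"
    unfolding pr_def
    by (simp_all add: mult.assoc[symmetric] df_e) (simp_all add: mult.assoc de_f)
qed

lemma strip_prs:
  assumes "\<And>i. de i * y \<in> L" "\<And>i. df i * y \<in> L"
  shows "distinct xs \<Longrightarrow> prod_list (map pr xs) * y \<in> L \<Longrightarrow> y \<in> L"
proof (induction xs)
  case (Cons i xs)
  let ?P = "prod_list (map pr xs)"
  have "de i * ?P = ?P * de i" "df i * ?P = ?P * df i"
    using Cons.prems(1) by (auto intro!: prod_list_comm d_pr)
  hence "de i * (?P * y) = ?P * (de i * y)" "df i * (?P * y) = ?P * (df i * y)"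
    by (simp_all only: mult.assoc[symmetric])
  hence "?P * y \<in> L"
    using Cons.prems(2) assms by (intro strip_pr[of i "?P * y"]) (simp_all add: L_mult mult.assoc)
  thus ?case using Cons by simp
qed simp

text \<open>x commutes with the annihilation operators, which lie in L, so L contains all
  \<open>de i * x\<close> and \<open>df i * x\<close>. The pairs in \<open>vol\<close> can then be
  removed one after another.\<close>

lemma strip_vol:
  assumes "\<And>i. x * e i = e i * x" "\<And>i. x * f i = f i * x" "\<And>i. x * de i = de i * x" "\<And>i. x * df i = df i * x"
    and "x * vol \<in> L"
  shows "x \<in> L"
proof -
  have "x * vol = vol * x"
    unfolding vol_def pr_def using assms(1,2) by (intro prod_list_comm) (auto intro: comm_mult)
  hence "vol * x \<in> L" using assms(5) by simp
  moreover have "de i * x \<in> L" "df i * x \<in> L" for i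
    unfolding assms(3,4)[symmetric] by (rule L_mult, rule de_L df_L)+
  ultimately show ?thesis unfolding vol_def by (intro strip_prs[of x]) (auto simp del: upt_Suc)
qed

end

section \<open>Centrality of the Casimir element\<close>

context so_fock begin

lemma cas_comm:
  assumes "\<And>i j. x * F i j = F i j * x" shows "x * cas u m = cas u m * x"
  unfolding cas_def
proof (intro commute_sum comm_mult prod_list_comm)
  fix I K y assume "y \<in> set (map (\<lambda>a. F (I a) (K a) + sc (u a * (if I a = K a then 1 else 0))) [1..<m + 1])"
  then obtain a where "y = F (I a) (K a) + sc (u a * (if I a = K a then 1 else 0))" by auto
  thus "x * y = y * x" by (simp only: distrib_left distrib_right assms sc_central)
qed (rule sc_central)

text \<open>The action of the Lie algebra element F k l on the odd generators, realised as a
  commutator with a quadratic expression. The e and f transform dually, so that commutation with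
  \<open>F k l + LL k l\<close> acts on the F, e and f simultaneously.\<close>

definition LL where "LL k l = - (e l * de k) + e (flip N k) * de (flip N l) + f k * df l - f (flip N l) * df (flip N k)"

lemma der_e_pair: "e l * de k * e i - e i * (e l * de k) = (if k = i then e l else 0)"
proof -
  have "e l * de k * e i = (if k = i then e l else 0) - e l * e i * de k"
    by (simp add: mult.assoc de_e right_diff_distrib)
  also have "e l * e i * de k = - (e i * (e l * de k))"
    using e_e[of l i] by (simp add: mult.assoc)
  finally show ?thesis by simp
qed

lemma der_f_pair: "f l * df k * f i - f i * (f l * df k) = (if k = i then f l else 0)"
proof -
  have "f l * df k * f i = (if k = i then f l else 0) - f l * f i * df k"
    by (simp add: mult.assoc df_f right_diff_distrib)
  also have "f l * f i * df k = - (f i * (f l * df k))"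
    using f_f[of l i] by (simp add: mult.assoc)
  finally show ?thesis by simp
qed

lemma ef_pair: "e l * de k * f i = f i * (e l * de k)" "f l * df k * e i = e i * (f l * df k)"
proof -
  have "e l * de k * f i = - (e l * f i * de k)" by (simp add: mult.assoc de_f)
  thus "e l * de k * f i = f i * (e l * de k)" by (simp add: e_f mult.assoc)
  have "f l * df k * e i = - (f l * e i * df k)" by (simp add: mult.assoc df_e)
  moreover have "f l * e i = - (e i * f l)" by (simp add: e_f)
  ultimately show "f l * df k * e i = e i * (f l * df k)" by (simp add: mult.assoc)
qed

lemma der_LL_e: "der (LL k l) (e i) = - (if k = i then e l else 0) + (if flip N l = i then e (flip N k) else 0)"
proof -
  have "der (LL k l) (e i) = - (e l * de k * e i - e i * (e l * de k))
     + (e (flip N k) * de (flip N l) * e i - e i * (e (flip N k) * de (flip N l)))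
     + (f k * df l * e i - e i * (f k * df l)) - (f (flip N l) * df (flip N k) * e i - e i * (f (flip N l) * df (flip N k)))"
    unfolding der_def LL_def by (simp add: distrib_left distrib_right left_diff_distrib right_diff_distrib)
  thus ?thesis unfolding der_e_pair ef_pair by simp
qed

lemma der_LL_f: "der (LL k l) (f i) = (if l = i then f k else 0) - (if flip N k = i then f (flip N l) else 0)"
proof -
  have "der (LL k l) (f i) = - (e l * de k * f i - f i * (e l * de k))
     + (e (flip N k) * de (flip N l) * f i - f i * (e (flip N k) * de (flip N l)))
     + (f k * df l * f i - f i * (f k * df l)) - (f (flip N l) * df (flip N k) * f i - f i * (f (flip N l) * df (flip N k)))"
    unfolding der_def LL_def by (simp add: distrib_left distrib_right left_diff_distrib right_diff_distrib)
  thus ?thesis unfolding der_f_pair ef_pair by simp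
qed

lemma der_LL_F: "der (LL k l) (F i j) = 0"
proof -
  have "F i j * LL k l = LL k l * F i j"
    unfolding LL_def distrib_left distrib_right left_diff_distrib right_diff_distrib
      mult_minus_left mult_minus_right
    by (simp only: comm_mult[OF F_e F_de] comm_mult[OF F_f F_df])
  thus ?thesis by (simp add: der_def)
qed

lemma der_add_left: "der (x + y) z = der x z + der y z" by (simp add: der_def algebra_simps)

text \<open>In T the changes of e and f cancel because they are dual. In Z the four terms of
  \<open>F_comm\<close> cancel against the four terms from the odd generators.\<close>

lemma der_H:
  assumes k: "k \<in> {1..N}" and l: "l \<in> {1..N}"
  shows "der (F k l + LL k l) (TT 0) = 0" "der (F k l + LL k l) (ZZ 0) = 0"
proof -
  let ?H = "F k l + LL k l"
  have He: "der ?H (e i) = - (if i = k then e l else 0) + (if i = flip N l then e (flip N k) else 0)" for i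
    unfolding der_add_left der_LL_e by (simp add: der_def F_e eq_commute[of i])
  have Hf: "der ?H (f i) = (if i = l then f k else 0) - (if i = flip N k then f (flip N l) else 0)" for i
    unfolding der_add_left der_LL_f by (simp add: der_def F_f eq_commute[of i])
  have k': "flip N k \<in> {1..N}" and l': "flip N l \<in> {1..N}" using k l flip_in by blast+
  have d: "(\<Sum>i=1..N. if i = c then g i else 0) = g c" if "c \<in> {1..N}" for c and g :: "nat \<Rightarrow> 'r"
    using that by (simp add: sum.delta)
  have "der ?H (TT 0) = (\<Sum>i=1..N. - (if i = k then e l * f i else 0) + (if i = flip N l then e (flip N k) * f i else 0)
      + ((if i = l then e i * f k else 0) - (if i = flip N k then e i * f (flip N l) else 0)))"
    unfolding TT0 der_sum pr_def der_mult He Hf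
    by (rule sum.cong[OF refl]) (simp add: distrib_right left_diff_distrib right_diff_distrib)
  thus "der ?H (TT 0) = 0"
    unfolding sum.distrib sum_subtractf sum_negf d[OF k] d[OF l] d[OF k'] d[OF l'] by simp
  have HF: "der ?H (F i j) = (if i = l then F k j else 0) - (if j = k then F i l else 0)
        - (if i = flip N k then F (flip N l) j else 0) + (if j = flip N l then F i (flip N k) else 0)"
    if "i \<in> {1..N}" "j \<in> {1..N}" for i j
    unfolding der_add_left der_LL_F using F_comm[OF k l that] by (simp add: der_def eq_commute[of k j])
  have ZZ0: "ZZ 0 = (\<Sum>i=1..N. \<Sum>j=1..N. F i j * (e i * f j))"
    unfolding ZZ_def FF_def by (intro sum.cong refl) (simp add: er_def fr_def)
  have "der ?H (ZZ 0) = (\<Sum>i=1..N. \<Sum>j=1..N.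
      (if i = l then F k j * (e i * f j) else 0) - (if j = k then F i l * (e i * f j) else 0)
      - (if i = flip N k then F (flip N l) j * (e i * f j) else 0)
      + (if j = flip N l then F i (flip N k) * (e i * f j) else 0)
      + (- (if i = k then F i j * (e l * f j) else 0) + (if i = flip N l then F i j * (e (flip N k) * f j) else 0)
      + ((if j = l then F i j * (e i * f k) else 0) - (if j = flip N k then F i j * (e i * f (flip N l)) else 0))))"
    unfolding ZZ0 der_sum der_mult He Hf
    by (intro sum.cong refl)
      (simp only: HF distrib_left distrib_right left_diff_distrib right_diff_distrib
        if_distrib[where f = "\<lambda>x. x * _"] if_distrib[where f = "\<lambda>x. _ * x"] mult_zero_left mult_zero_right
        mult_minus_left mult_minus_right)
  also have "\<dots> =
      (\<Sum>j=1..N. F k j * (e l * f j)) - (\<Sum>i=1..N. F i l * (e i * f k))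
    - (\<Sum>j=1..N. F (flip N l) j * (e (flip N k) * f j)) + (\<Sum>i=1..N. F i (flip N k) * (e i * f (flip N l)))
    + (- (\<Sum>j=1..N. F k j * (e l * f j)) + (\<Sum>j=1..N. F (flip N l) j * (e (flip N k) * f j))
    + ((\<Sum>i=1..N. F i l * (e i * f k)) - (\<Sum>i=1..N. F i (flip N k) * (e i * f (flip N l)))))"
  proof -
    have d1: "(\<Sum>i=1..N. \<Sum>j=1..N. if i = c then g i j else 0) = (\<Sum>j=1..N. g c j)"
      if "c \<in> {1..N}" for c and g :: "nat \<Rightarrow> nat \<Rightarrow> 'r"
      using that by (subst sum.swap) (simp add: sum.delta)
    have d2: "(\<Sum>i=1..N. \<Sum>j=1..N. if j = c then g i j else 0) = (\<Sum>i=1..N. g i c)"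
      if "c \<in> {1..N}" for c and g :: "nat \<Rightarrow> nat \<Rightarrow> 'r"
      using that by (simp add: sum.delta)
    show ?thesis
      unfolding sum.distrib sum_subtractf sum_negf d1[OF k] d1[OF l] d1[OF k'] d1[OF l'] d2[OF k] d2[OF l] d2[OF k'] d2[OF l'] ..
  qed
  also have "\<dots> = 0" by simp
  finally show "der ?H (ZZ 0) = 0" .
qed

lemma der_sc: "der d (sc c) = 0" by (simp add: der_def sc_central)

lemma der_prod_list_zero: "(\<And>y. y \<in> set ys \<Longrightarrow> der d y = 0) \<Longrightarrow> der d (prod_list ys) = (0::'r)"
  by (induction ys) (simp_all add: der_one der_mult)

text \<open>The derivation kills T^(N-m) times the product and also T^N, which are nonzero multiples
  of \<open>cas u m * vol\<close> and of \<open>vol\<close>. It therefore kills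
  \<open>cas u m\<close> up to the factor \<open>vol\<close>, and since \<open>LL\<close> commutes
  with \<open>cas u m\<close>, only the commutator with F is left.\<close>

theorem cas_central:
  assumes k: "k \<in> {1..N}" and l: "l \<in> {1..N}" and m: "m \<le> N"
  shows "(F k l * cas u m - cas u m * F k l) * vol = 0"
proof -
  let ?H = "F k l + LL k l"
  note dT = der_H(1)[OF k l] and dZ = der_H(2)[OF k l]
  have "der ?H (TT 0 ^ (N - m) * prod_list (map (\<lambda>a. ZZ 0 + sc (u a) * TT 0) [1..<m + 1])) = 0"
  proof -
    have "der ?H (prod_list (map (\<lambda>a. ZZ 0 + sc (u a) * TT 0) [1..<m + 1])) = 0"
      by (rule der_prod_list_zero) (auto simp: der_add der_mult dT dZ der_sc)
    thus ?thesis by (simp add: der_mult der_power_zero[OF dT])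
  qed
  moreover have mm: "N - m + m = N" using m by simp
  ultimately have "sc (fact (N - m) * fact m) * der ?H (cas u m * vol) = 0"
    unfolding coeff[OF mm] by (simp add: der_mult der_sc)
  hence 1: "der ?H (cas u m * vol) = 0" by (rule sc_cancel[rotated]) simp
  have TN: "TT 0 ^ N = of_nat (fact N) * vol" using T_prs[of "[]" N] by simp
  have "of_nat (fact N) * der ?H vol = 0"
  proof -
    have "der ?H (of_nat (fact N)) = 0"
      unfolding der_def mult_of_nat_commute[of "fact N" ?H] by simp
    thus ?thesis using der_power_zero[OF dT, of N] unfolding TN der_mult by simp
  qed
  hence 2: "der ?H vol = 0" by (rule of_nat_cancel[rotated]) simp
  have "LL k l * F i j = F i j * LL k l" for i j
    using der_LL_F[of k l i j] by (simp add: der_def)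
  hence "LL k l * cas u m = cas u m * LL k l" by (rule cas_comm)
  hence "der ?H (cas u m) = F k l * cas u m - cas u m * F k l"
    by (simp add: der_def distrib_left distrib_right)
  thus ?thesis using 1 2 by (simp add: der_mult)
qed

end

section \<open>Factorial elementary symmetric polynomials\<close>

definition increasing :: "nat \<Rightarrow> nat \<Rightarrow> (nat \<Rightarrow> nat) set" where
  "increasing n k = {p \<in> {1..k} \<rightarrow>\<^sub>E {1..n}. strict_mono_on {1..k} p}"

lemma factorial_elem_sym_alt:
  "factorial_elem_sym n k z a = (\<Sum>p\<in>increasing n k. \<Prod>j=1..k. z (p j) - a (p j - j + 1))"
  unfolding factorial_elem_sym_def increasing_def ..

lemma finite_increasing: "finite (increasing n k)"
  unfolding increasing_def by (rule finite_subset[of _ "{1..k} \<rightarrow>\<^sub>E {1..n}"]) (auto intro: finite_PiE)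

lemma factorial_elem_sym_0: "factorial_elem_sym n 0 z a = 1"
proof -
  have "increasing n 0 = {\<lambda>_. undefined}" unfolding increasing_def by (auto simp: strict_mono_on_def)
  thus ?thesis unfolding factorial_elem_sym_alt by simp
qed

lemma factorial_elem_sym_0_Suc: "factorial_elem_sym 0 (Suc k) z a = 0"
proof -
  have "increasing 0 (Suc k) = {}" unfolding increasing_def by auto
  thus ?thesis unfolding factorial_elem_sym_alt by simp
qed

lemma increasing_iff:
  "p \<in> increasing n k \<longleftrightarrow> (\<forall>j. 1 \<le> j \<and> j \<le> k \<longrightarrow> 1 \<le> p j \<and> p j \<le> n) \<and>
    (\<forall>j. \<not> (1 \<le> j \<and> j \<le> k) \<longrightarrow> p j = undefined) \<and> (\<forall>i j. 1 \<le> i \<and> i < j \<and> j \<le> k \<longrightarrow> p i < p j)"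
  (is "_ \<longleftrightarrow> ?R")
proof
  assume "p \<in> increasing n k"
  hence a: "p \<in> {1..k} \<rightarrow>\<^sub>E {1..n}" and b: "strict_mono_on {1..k} p" unfolding increasing_def by auto
  show ?R
  proof (intro conjI allI impI)
    fix j assume j: "1 \<le> j \<and> j \<le> k"
    show "1 \<le> p j" "p j \<le> n" using PiE_mem[OF a, of j] j by auto
  next
    fix j assume "\<not> (1 \<le> j \<and> j \<le> k)"
    thus "p j = undefined" using PiE_arb[OF a, of j] by simp
  next
    fix i j assume "1 \<le> i \<and> i < j \<and> j \<le> k"
    thus "p i < p j" using strict_mono_onD[OF b, of i j] by simp
  qed
next
  assume R: ?R
  have "p \<in> {1..k} \<rightarrow>\<^sub>E {1..n}" by (rule PiE_I) (use R in auto)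
  moreover have "strict_mono_on {1..k} p" by (rule strict_mono_onI) (use R in auto)
  ultimately show "p \<in> increasing n k" unfolding increasing_def by blast
qed

lemma increasing_top:
  "{p \<in> increasing (Suc n) (Suc k). p (Suc k) \<noteq> Suc n} = increasing n (Suc k)"
proof (intro subset_antisym subsetI)
  fix p assume "p \<in> {p \<in> increasing (Suc n) (Suc k). p (Suc k) \<noteq> Suc n}"
  hence p: "p \<in> increasing (Suc n) (Suc k)" "p (Suc k) \<noteq> Suc n" by auto
  have "p (Suc k) \<le> Suc n" using p(1) unfolding increasing_iff by simp
  hence t: "p (Suc k) \<le> n" using p(2) by simp
  have "p j \<le> n" if "1 \<le> j" "j \<le> Suc k" for j
  proof (cases "j = Suc k")
    case False
    hence "p j < p (Suc k)" using that p(1) unfolding increasing_iff by simp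
    thus ?thesis using t by simp
  qed (simp add: t)
  thus "p \<in> increasing n (Suc k)" using p(1) unfolding increasing_iff by blast
next
  fix p assume p: "p \<in> increasing n (Suc k)"
  have "p j \<le> n" if "1 \<le> j" "j \<le> Suc k" for j using p that unfolding increasing_iff by blast
  hence "p j \<le> Suc n \<and> p (Suc k) \<noteq> Suc n" if "1 \<le> j" "j \<le> Suc k" for j using that by fastforce
  thus "p \<in> {p \<in> increasing (Suc n) (Suc k). p (Suc k) \<noteq> Suc n}"
    using p unfolding increasing_iff mem_Collect_eq by (metis le_add1 le_refl plus_1_eq_Suc)
qed

text \<open>Split by whether the last chosen index is n + 1. If it is, its parameter has the fixed
  index (n + 1) - (k + 1) + 1 = n - k + 1.\<close>

lemma factorial_elem_sym_last:
  "factorial_elem_sym (Suc n) (Suc k) z a =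
    factorial_elem_sym n (Suc k) z a + (z (Suc n) - a (n - k + 1)) * factorial_elem_sym n k z a"
proof -
  let ?t = "\<lambda>k p. \<Prod>j=1..k. z (p j) - a (p j - j + 1)"
  let ?P = "increasing (Suc n) (Suc k)"
  let ?B = "{p \<in> ?P. p (Suc k) = Suc n}"
  have u: "?P = {p \<in> ?P. p (Suc k) \<noteq> Suc n} \<union> ?B" by blast
  have "factorial_elem_sym (Suc n) (Suc k) z a = (\<Sum>p\<in>{p \<in> ?P. p (Suc k) \<noteq> Suc n} \<union> ?B. ?t (Suc k) p)"
    unfolding factorial_elem_sym_alt u[symmetric] ..
  also have "\<dots> = (\<Sum>p\<in>{p \<in> ?P. p (Suc k) \<noteq> Suc n}. ?t (Suc k) p) + (\<Sum>p\<in>?B. ?t (Suc k) p)"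
    by (rule sum.union_disjoint) (use finite_increasing[of "Suc n" "Suc k"] in auto)
  also have "(\<Sum>p\<in>{p \<in> ?P. p (Suc k) \<noteq> Suc n}. ?t (Suc k) p) = factorial_elem_sym n (Suc k) z a"
    unfolding increasing_top factorial_elem_sym_alt ..
  also have "(\<Sum>p\<in>?B. ?t (Suc k) p) = (\<Sum>q\<in>increasing n k. (z (Suc n) - a (n - k + 1)) * ?t k q)"
  proof (rule sum.reindex_bij_witness[of _ "\<lambda>q. q(Suc k := Suc n)" "\<lambda>p. restrict p {1..k}"])
    fix p assume "p \<in> ?B"
    hence p: "p \<in> ?P" "p (Suc k) = Suc n" by auto
    have ext: "p j = undefined" if "\<not> (1 \<le> j \<and> j \<le> Suc k)" for j using p(1) that unfolding increasing_iff by blast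
    show "(restrict p {1..k})(Suc k := Suc n) = p"
    proof
      fix j
      show "((restrict p {1..k})(Suc k := Suc n)) j = p j"
        using p(2) ext[of j] by (cases "j = Suc k"; cases "j \<in> {1..k}") auto
    qed
    have "p j \<le> n" if "1 \<le> j" "j \<le> k" for j
    proof -
      have "p j < p (Suc k)" using p(1) that unfolding increasing_iff by simp
      thus ?thesis using p(2) by simp
    qed
    thus "restrict p {1..k} \<in> increasing n k" using p(1) unfolding increasing_iff by simp
    show "(z (Suc n) - a (n - k + 1)) * ?t k (restrict p {1..k}) = ?t (Suc k) p"
      using p(2) by (simp add: mult.commute)
  next
    fix q assume q: "q \<in> increasing n k"
    show "restrict (q(Suc k := Suc n)) {1..k} = q"
    proof
      fix j
      have "q j = undefined" if "\<not> (1 \<le> j \<and> j \<le> k)" using q that unfolding increasing_iff by blast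
      thus "restrict (q(Suc k := Suc n)) {1..k} j = q j" by auto
    qed
    have b: "1 \<le> q j \<and> q j \<le> n" if "1 \<le> j" "j \<le> k" for j using q that unfolding increasing_iff by blast
    have m: "q i < q j" if "1 \<le> i" "i < j" "j \<le> k" for i j using q that unfolding increasing_iff by blast
    have x: "q j = undefined" if "\<not> (1 \<le> j \<and> j \<le> k)" for j using q that unfolding increasing_iff by blast
    have "q(Suc k := Suc n) \<in> ?P"
      unfolding increasing_iff
    proof (intro conjI allI impI)
      fix j assume "1 \<le> j \<and> j \<le> Suc k"
      thus "1 \<le> (q(Suc k := Suc n)) j" "(q(Suc k := Suc n)) j \<le> Suc n"
        using b[of j] by (cases "j = Suc k"; simp)+
    next
      fix j assume "\<not> (1 \<le> j \<and> j \<le> Suc k)"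
      thus "(q(Suc k := Suc n)) j = undefined" using x[of j] by auto
    next
      fix i j assume ij: "1 \<le> i \<and> i < j \<and> j \<le> Suc k"
      show "(q(Suc k := Suc n)) i < (q(Suc k := Suc n)) j"
      proof (cases "j = Suc k")
        case True
        thus ?thesis using ij b[of i] by simp
      next
        case False
        thus ?thesis using ij m[of i j] by simp
      qed
    qed
    thus "q(Suc k := Suc n) \<in> ?B" by simp
  qed
  finally show ?thesis unfolding factorial_elem_sym_alt[of n k] sum_distrib_left .
qed

text \<open>Splitting the sum by whether p 1 = 1 would leave the terms without the first variable
  with shifted parameters. The formula instead expresses that the first variable can take the role
  of the last, a trace of the symmetry in the variables; it follows by induction from splitting off
  the last variable.\<close>

lemma factorial_elem_sym_first:
  "factorial_elem_sym (Suc n) (Suc k) z a =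
    factorial_elem_sym n (Suc k) (\<lambda>i. z (Suc i)) a + (z 1 - a (n - k + 1)) * factorial_elem_sym n k (\<lambda>i. z (Suc i)) a"
proof (induction n arbitrary: k)
  case 0
  show ?case
    unfolding factorial_elem_sym_last by (cases k) (simp_all add: factorial_elem_sym_0 factorial_elem_sym_0_Suc)
next
  case (Suc n)
  note IH = Suc.IH
  show ?case
  proof (cases k)
    case 0
    show ?thesis
      unfolding 0 factorial_elem_sym_last[of "Suc n"] IH factorial_elem_sym_last[of n _ "\<lambda>i. z (Suc i)"] factorial_elem_sym_0
      by simp
  next
    case (Suc m)
    have i: "Suc n - Suc m + 1 = n - m + 1" by simp
    show ?thesis
      unfolding Suc factorial_elem_sym_last[of "Suc n"] IH factorial_elem_sym_last[of n _ "\<lambda>i. z (Suc i)"] i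
      by (simp add: algebra_simps)
  qed
qed

lemma factorial_elem_sym_gt: "n < k \<Longrightarrow> factorial_elem_sym n k z a = 0"
proof (induction n arbitrary: k)
  case 0 thus ?case by (cases k) (simp_all add: factorial_elem_sym_0_Suc)
next
  case (Suc n)
  obtain m where m: "k = Suc m" using Suc.prems by (cases k) auto
  have "n < Suc m" "n < m" using Suc.prems m by auto
  thus ?case unfolding m factorial_elem_sym_last by (simp add: Suc.IH)
qed

text \<open>Put eps = \<open>rho_shift N\<close>, l = lam + d + eps and t = d - m + eps. The two
  factors in the recursion of \<open>EE\<close> are l - t and l + t, and t^2 is the parameter with
  index d - m + 1.\<close>

lemma EE_factorial:
  "d \<le> N div 2 \<Longrightarrow> EE N lam d k =
    factorial_elem_sym d k (\<lambda>i. (shifted_weight N lam (N div 2 - d + i))\<^sup>2) (shift_sequence N)"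
proof (induction d arbitrary: k)
  case 0
  show ?case by (cases k) (simp_all add: factorial_elem_sym_0 factorial_elem_sym_0_Suc)
next
  case (Suc d)
  note Suc_d = Suc.prems
  let ?n = "N div 2"
  let ?z = "\<lambda>d i. (shifted_weight N lam (?n - d + i))\<^sup>2"
  have IH: "EE N lam d k = factorial_elem_sym d k (?z d) (shift_sequence N)" for k
    using Suc.prems by (intro Suc.IH) simp
  show ?case
  proof (cases k)
    case 0
    show ?thesis unfolding 0 EE.simps IH factorial_elem_sym_0 by simp
  next
    case (Suc m)
    have z: "(\<lambda>i. ?z (Suc d) (Suc i)) = ?z d" "?z (Suc d) 1 = (shifted_weight N lam (?n - d))\<^sup>2"
    proof -
      have e: "?n - Suc d + Suc i = ?n - d + i" "?n - Suc d + 1 = ?n - d" for i using Suc_d by simp_all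
      show "(\<lambda>i. ?z (Suc d) (Suc i)) = ?z d" by (simp only: e)
      show "?z (Suc d) 1 = (shifted_weight N lam (?n - d))\<^sup>2" by (simp only: e)
    qed
    have "(lam (?n - d) + of_nat m) * (lam (?n - d) + of_nat m + of_nat (N - 2 * (?n - Suc d) - 2 * Suc m))
        * factorial_elem_sym d m (?z d) (shift_sequence N)
      = ((shifted_weight N lam (?n - d))\<^sup>2 - shift_sequence N (d - m + 1)) * factorial_elem_sym d m (?z d) (shift_sequence N)"
    proof (cases "m \<le> d")
      case True
      \<comment> \<open>Twice \<open>rho_shift N\<close>, as a natural number, so that the dimension
        count stays in the naturals.\<close>
      define e where "e = (if even N then 0 else 1 :: nat)"
      have N: "N = 2 * ?n + e" unfolding e_def by auto
      have r: "rho_shift N = of_nat e / 2" unfolding rho_shift_def e_def by simp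
      have s: "N - 2 * (?n - Suc d) - 2 * Suc m = 2 * (d - m) + e"
      proof -
        have "M - 2 * (p - Suc d) - 2 * Suc m = 2 * (d - m) + e" if M: "M = 2 * p + e" "Suc d \<le> p" for M p
        proof -
          obtain x where "p = Suc d + x" using le_Suc_ex[OF M(2)] by blast
          moreover obtain y where "d = m + y" using le_Suc_ex[OF True] by blast
          ultimately show ?thesis using M(1) by simp
        qed
        from this[OF N Suc_d] show ?thesis .
      qed
      have w: "shifted_weight N lam (?n - d) = lam (?n - d) + of_nat d + of_nat e / 2"
        using Suc_d unfolding shifted_weight_def r by (simp add: of_nat_diff)
      have q: "shift_sequence N (d - m + 1) = (of_nat e / 2 + of_nat d - of_nat m)\<^sup>2"
        using True unfolding shift_sequence_def r by (simp add: of_nat_diff algebra_simps)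
      have dm: "of_nat (d - m) = (of_nat d - of_nat m :: complex)" using True by (rule of_nat_diff)
      have "(lam (?n - d) + of_nat m) * (lam (?n - d) + of_nat m + of_nat (N - 2 * (?n - Suc d) - 2 * Suc m))
        = (shifted_weight N lam (?n - d))\<^sup>2 - shift_sequence N (d - m + 1)"
        unfolding s w q of_nat_add of_nat_mult dm by (simp add: power2_eq_square field_simps)
      thus ?thesis by simp
    next
      case False
      \<comment> \<open>Truncated subtraction spoils the identity of the factors for m > d, but both
        sides are multiples of a polynomial that is zero there.\<close>
      thus ?thesis by (simp add: factorial_elem_sym_gt)
    qed
    thus ?thesis
      unfolding Suc factorial_elem_sym_first z EE.simps IH by simp
  qed
qed

lemma EE_harish_chandra:
  "EE N lam (N div 2) k = factorial_elem_sym (N div 2) k (\<lambda>i. (shifted_weight N lam i)\<^sup>2) (shift_sequence N)"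
  using EE_factorial[OF order.refl] by simp

section \<open>The enveloping algebra and matrices over it\<close>

text \<open>The carrier of \<open>free_algebra X\<close> as a plain set, so that computations use
  the operations of the type of polynomial mappings.\<close>

definition words_in :: "'g set \<Rightarrow> 'g free_poly set" where
  "words_in X = {p. \<forall>w\<in>Poly_Mapping.keys p. set (letters w) \<subseteq> X}"

lemma words_in_zero [simp]: "0 \<in> words_in X" by (simp add: words_in_def)
lemma words_in_single: "set (letters w) \<subseteq> X \<Longrightarrow> Poly_Mapping.single w c \<in> words_in X"
  by (auto simp: words_in_def)
lemma words_in_one [simp]: "1 \<in> words_in X"
proof -
  have "set (letters (0 :: 'a fmon)) \<subseteq> X" by (simp add: zero_fmon_def)
  from words_in_single[OF this, of 1] show ?thesis by simp
qed
lemma words_in_add: "p \<in> words_in X \<Longrightarrow> q \<in> words_in X \<Longrightarrow> p + q \<in> words_in X"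
  using Poly_Mapping.keys_add[of p q] by (auto simp: words_in_def)
lemma words_in_uminus: "p \<in> words_in X \<Longrightarrow> - p \<in> words_in X"
  by (simp add: words_in_def)
lemma words_in_diff: "p \<in> words_in X \<Longrightarrow> q \<in> words_in X \<Longrightarrow> p - q \<in> words_in X"
  using words_in_add[of p X "- q"] words_in_uminus[of q X] by simp
lemma words_in_mult:
  assumes "p \<in> words_in X" "q \<in> words_in X" shows "p * q \<in> words_in X"
  unfolding words_in_def
proof (intro CollectI ballI)
  fix w assume "w \<in> Poly_Mapping.keys (p * q)"
  then obtain u v where "w = u + v" "u \<in> Poly_Mapping.keys p" "v \<in> Poly_Mapping.keys q"
    using keys_mult[of p q] by auto
  thus "set (letters w) \<subseteq> X" using assms by (auto simp: words_in_def plus_fmon_def)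
qed
lemma words_in_sum: "(\<And>i. i \<in> A \<Longrightarrow> h i \<in> words_in X) \<Longrightarrow> (\<Sum>i\<in>A. h i) \<in> words_in X"
  by (induction A rule: infinite_finite_induct) (auto simp: words_in_add)
lemma words_in_prod_list: "(\<And>p. p \<in> set ps \<Longrightarrow> p \<in> words_in X) \<Longrightarrow> prod_list ps \<in> words_in X"
  by (induction ps) (auto simp: words_in_mult)
lemma words_in_const [simp]: "const c \<in> words_in X"
  by (simp add: const_def words_in_single zero_fmon_def)
lemma words_in_letter: "x \<in> X \<Longrightarrow> letter x \<in> words_in X"
  by (simp add: letter_def words_in_single)

lemma const_add: "const (a + b) = const a + const b" by (simp add: const_def single_add)
lemma const_mult: "const (a * b) = const a * const b" by (simp add: const_def mult_single)
lemma const_one [simp]: "const 1 = 1" by (simp add: const_def)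
lemma const_zero [simp]: "const 0 = 0" by (simp add: const_def)
lemma const_sum: "const (\<Sum>i\<in>A. h i) = (\<Sum>i\<in>A. const (h i))"
  by (induction A rule: infinite_finite_induct) (simp_all add: const_add)

lemma poly_mapping_sum_singles:
  "(\<Sum>w\<in>Poly_Mapping.keys p. Poly_Mapping.single w (Poly_Mapping.lookup p w)) = p"
proof (rule poly_mapping_eqI)
  fix v
  have "Poly_Mapping.lookup (\<Sum>w\<in>Poly_Mapping.keys p. Poly_Mapping.single w (Poly_Mapping.lookup p w)) v
    = (\<Sum>w\<in>Poly_Mapping.keys p. if w = v then Poly_Mapping.lookup p w else 0)"
    unfolding lookup_sum by (rule sum.cong) (auto simp: lookup_single when_def)
  also have "\<dots> = Poly_Mapping.lookup p v"
    by (simp add: sum.delta in_keys_iff)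
  finally show "Poly_Mapping.lookup (\<Sum>w\<in>Poly_Mapping.keys p. Poly_Mapping.single w (Poly_Mapping.lookup p w)) v
    = Poly_Mapping.lookup p v" .
qed

text \<open>The algebra homomorphism out of the free algebra that extends theta. Both the maps
  induced on the free algebra by \<open>free_map\<close> and the action on Fock space are
  instances.\<close>

definition feval :: "(complex \<Rightarrow> 'r::ring_1) \<Rightarrow> ('g \<Rightarrow> 'r) \<Rightarrow> 'g free_poly \<Rightarrow> 'r" where
  "feval s \<theta> p = (\<Sum>w\<in>Poly_Mapping.keys p. s (Poly_Mapping.lookup p w) * prod_list (map \<theta> (letters w)))"

locale scalars =
  fixes s :: "complex \<Rightarrow> 'r::ring_1"
  assumes s_add: "s (a + b) = s a + s b" and s_mult: "s (a * b) = s a * s b" and s_one: "s 1 = 1"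
    and s_central: "x * s a = s a * x"
begin

lemma s_zero: "s 0 = 0" using s_add[of 0 0] by simp

lemma feval_superset:
  "finite A \<Longrightarrow> Poly_Mapping.keys p \<subseteq> A \<Longrightarrow>
    feval s \<theta> p = (\<Sum>w\<in>A. s (Poly_Mapping.lookup p w) * prod_list (map \<theta> (letters w)))"
  unfolding feval_def by (rule sum.mono_neutral_left) (auto simp: s_zero in_keys_iff)

lemma feval_add: "feval s \<theta> (p + q) = feval s \<theta> p + feval s \<theta> q"
proof -
  let ?A = "Poly_Mapping.keys p \<union> Poly_Mapping.keys q"
  have f: "finite ?A" by simp
  have "Poly_Mapping.keys (p + q) \<subseteq> ?A" by (rule Poly_Mapping.keys_add)
  hence "feval s \<theta> (p + q) = (\<Sum>w\<in>?A. s (Poly_Mapping.lookup (p + q) w) * prod_list (map \<theta> (letters w)))"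
    by (rule feval_superset[OF f])
  also have "\<dots> = feval s \<theta> p + feval s \<theta> q"
    unfolding feval_superset[OF f Un_upper1] feval_superset[OF f Un_upper2]
    by (simp add: lookup_add s_add distrib_right sum.distrib)
  finally show ?thesis .
qed

lemma feval_zero [simp]: "feval s \<theta> 0 = 0" by (simp add: feval_def)

lemma feval_uminus: "feval s \<theta> (- p) = - feval s \<theta> p"
  using feval_add[of \<theta> p "- p"] by (simp add: eq_neg_iff_add_eq_0 add.commute)

lemma feval_diff: "feval s \<theta> (p - q) = feval s \<theta> p - feval s \<theta> q"
  using feval_add[of \<theta> p "- q"] by (simp add: feval_uminus)

lemma feval_sum: "feval s \<theta> (\<Sum>i\<in>A. h i) = (\<Sum>i\<in>A. feval s \<theta> (h i))"
  by (induction A rule: infinite_finite_induct) (simp_all add: feval_add)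

lemma feval_single: "feval s \<theta> (Poly_Mapping.single w c) = s c * prod_list (map \<theta> (letters w))"
  by (cases "c = 0") (simp_all add: feval_def s_zero)

lemma feval_mult: "feval s \<theta> (p * q) = feval s \<theta> p * feval s \<theta> q"
proof -
  have rep: "p = (\<Sum>w\<in>Poly_Mapping.keys p. Poly_Mapping.single w (Poly_Mapping.lookup p w))" for p :: "'g free_poly"
    by (rule poly_mapping_sum_singles[symmetric])
  have 1: "feval s \<theta> (Poly_Mapping.single u a * Poly_Mapping.single v b)
     = feval s \<theta> (Poly_Mapping.single u a) * feval s \<theta> (Poly_Mapping.single v b)" for u v a b
  proof -
    have "s a * s b * (prod_list (map \<theta> (letters u)) * prod_list (map \<theta> (letters v)))
      = s a * prod_list (map \<theta> (letters u)) * (s b * prod_list (map \<theta> (letters v)))"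
      using s_central[of "prod_list (map \<theta> (letters u))" b] by (metis mult.assoc)
    thus ?thesis by (simp add: mult_single feval_single plus_fmon_def s_mult)
  qed
  have "feval s \<theta> (p * q) = feval s \<theta> ((\<Sum>w\<in>Poly_Mapping.keys p. Poly_Mapping.single w (Poly_Mapping.lookup p w)) *
      (\<Sum>v\<in>Poly_Mapping.keys q. Poly_Mapping.single v (Poly_Mapping.lookup q v)))"
    using rep[of p] rep[of q] by simp
  also have "\<dots> = (\<Sum>w\<in>Poly_Mapping.keys p. feval s \<theta> (Poly_Mapping.single w (Poly_Mapping.lookup p w))) *
      (\<Sum>v\<in>Poly_Mapping.keys q. feval s \<theta> (Poly_Mapping.single v (Poly_Mapping.lookup q v)))"
    unfolding sum_product feval_sum 1 ..
  also have "\<dots> = feval s \<theta> p * feval s \<theta> q"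
    unfolding feval_sum[symmetric] rep[symmetric] ..
  finally show ?thesis .
qed

lemma feval_const: "feval s \<theta> (const c) = s c"
  by (simp add: const_def feval_single zero_fmon_def)
lemma feval_letter: "feval s \<theta> (letter x) = \<theta> x"
  by (simp add: letter_def feval_single s_one)
lemma feval_one: "feval s \<theta> 1 = 1"
  using feval_const[of \<theta> 1] by (simp add: s_one)
lemma feval_prod_list: "feval s \<theta> (prod_list ps) = prod_list (map (feval s \<theta>) ps)"
  by (induction ps) (simp_all add: feval_mult feval_one)

end

lemma const_central: "p * const c = const c * (p :: 'g free_poly)"
proof -
  have "p = (\<Sum>w\<in>Poly_Mapping.keys p. Poly_Mapping.single w (Poly_Mapping.lookup p w))"
    by (rule poly_mapping_sum_singles[symmetric])
  moreover have "(\<Sum>w\<in>A. Poly_Mapping.single w (g w)) * const c = const c * (\<Sum>w\<in>A. Poly_Mapping.single w (g w))"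
    for A and g :: "'g fmon \<Rightarrow> complex"
    by (simp add: sum_distrib_left sum_distrib_right const_def mult_single mult.commute)
  ultimately show ?thesis by metis
qed

interpretation const: scalars "const :: complex \<Rightarrow> 'g free_poly"
  by unfold_locales (rule const_add const_mult const_one const_central)+

lemma const_prod_letters: "const c * prod_list (map (\<lambda>x. letter (\<phi> x)) xs) = Poly_Mapping.single (FMon (map \<phi> xs)) c"
proof -
  have "prod_list (map (\<lambda>x. letter (\<phi> x)) xs) = Poly_Mapping.single (FMon (map \<phi> xs)) 1"
  proof (induction xs)
    case Nil
    show ?case by (simp flip: zero_fmon_def)
  qed (simp add: letter_def mult_single plus_fmon_def)
  thus ?thesis by (simp add: const_def mult_single plus_fmon_def zero_fmon_def)
qed

lemma free_map_feval: "free_map \<phi> p = feval const (\<lambda>x. letter (\<phi> x)) p"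
  unfolding free_map_def feval_def const_prod_letters ..

lemma free_map_comp:
  assumes "\<And>x. x \<in> X \<Longrightarrow> \<psi> (\<phi> x) = x" "p \<in> words_in X"
  shows "free_map \<psi> (free_map \<phi> p) = p"
proof -
  have "free_map \<psi> (free_map \<phi> p) =
     (\<Sum>w\<in>Poly_Mapping.keys p. Poly_Mapping.single (FMon (map \<psi> (map \<phi> (letters w)))) (Poly_Mapping.lookup p w))"
    unfolding free_map_def[of \<phi>] unfolding free_map_feval const.feval_sum const.feval_single const_prod_letters by simp
  also have "\<dots> = (\<Sum>w\<in>Poly_Mapping.keys p. Poly_Mapping.single w (Poly_Mapping.lookup p w))"
  proof (rule sum.cong[OF refl])
    fix w assume "w \<in> Poly_Mapping.keys p"
    hence "set (letters w) \<subseteq> X" using assms(2) by (auto simp: words_in_def)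
    hence "map \<psi> (map \<phi> (letters w)) = letters w"
      unfolding map_map by (intro map_idI) (auto simp: assms(1))
    thus "Poly_Mapping.single (FMon (map \<psi> (map \<phi> (letters w)))) (Poly_Mapping.lookup p w)
      = Poly_Mapping.single w (Poly_Mapping.lookup p w)" by simp
  qed
  also have "\<dots> = p" by (rule poly_mapping_sum_singles)
  finally show ?thesis .
qed

lemma free_map_words:
  assumes "\<And>x. x \<in> X \<Longrightarrow> \<phi> x \<in> Y" "p \<in> words_in X" shows "free_map \<phi> p \<in> words_in Y"
  unfolding free_map_def
proof (intro words_in_sum words_in_single)
  fix w assume "w \<in> Poly_Mapping.keys p"
  hence "set (letters w) \<subseteq> X" using assms(2) by (auto simp: words_in_def)
  thus "set (letters (FMon (map \<phi> (letters w)))) \<subseteq> Y" using assms(1) by auto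
qed

lemma free_algebra_simps [simp]:
  "carrier (free_algebra X) = words_in X" "monoid.mult (free_algebra X) = (*)"
  "one (free_algebra X) = 1" "zero (free_algebra X) = 0" "add (free_algebra X) = (+)"
  by (simp_all add: free_algebra_def words_in_def)

lemma free_algebra_ring: "ring (free_algebra X)"
proof (rule ringI)
  show "abelian_group (free_algebra X)"
  proof (rule abelian_groupI)
    fix p assume p: "p \<in> carrier (free_algebra X)"
    show "\<exists>q\<in>carrier (free_algebra X). q \<oplus>\<^bsub>free_algebra X\<^esub> p = \<zero>\<^bsub>free_algebra X\<^esub>"
      using p by (intro bexI[of _ "- p"]) (auto simp: words_in_uminus)
  qed (auto simp: words_in_add add_ac)
  show "Group.monoid (free_algebra X)"
    by (rule Group.monoidI) (auto simp: words_in_mult mult.assoc)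
qed (auto simp: distrib_left distrib_right)

section \<open>The quotient by the defining relations\<close>

locale env_loc =
  fixes g :: "complex mat set"
  assumes relations: "env_relations g \<subseteq> words_in g"
begin

abbreviation "I \<equiv> env_ideal g"
abbreviation "C \<equiv> words_in g"

lemma ideal_I: "ideal I (free_algebra g)"
  unfolding env_ideal_def using relations by (intro ring.genideal_ideal[OF free_algebra_ring]) simp

lemma I_C: "p \<in> I \<Longrightarrow> p \<in> C"
  using additive_subgroup.a_subset[OF ideal.axioms(1)[OF ideal_I]] by auto
lemma I_zero: "0 \<in> I"
  using additive_subgroup.zero_closed[OF ideal.axioms(1)[OF ideal_I]] by simp
lemma I_add: "p \<in> I \<Longrightarrow> q \<in> I \<Longrightarrow> p + q \<in> I"
  using additive_subgroup.a_closed[OF ideal.axioms(1)[OF ideal_I]] by simp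
lemma I_left: "p \<in> I \<Longrightarrow> q \<in> C \<Longrightarrow> q * p \<in> I"
  using ideal.I_l_closed[OF ideal_I] by simp
lemma I_right: "p \<in> I \<Longrightarrow> q \<in> C \<Longrightarrow> p * q \<in> I"
  using ideal.I_r_closed[OF ideal_I] by simp
lemma I_uminus: "p \<in> I \<Longrightarrow> - p \<in> I"
  using I_left[OF _ words_in_uminus[OF words_in_one], of p] by simp
lemma I_relations: "p \<in> env_relations g \<Longrightarrow> p \<in> I"
  unfolding env_ideal_def using ring.genideal_self[OF free_algebra_ring] relations by auto

lemma I_minimal: "ideal J (free_algebra g) \<Longrightarrow> env_relations g \<subseteq> J \<Longrightarrow> I \<subseteq> J"
  unfolding env_ideal_def by (rule ring.genideal_minimal[OF free_algebra_ring])

text \<open>Identities in the enveloping algebra are proved on representatives, where the simplifier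
  has the ring operations of a type class at its disposal.\<close>

definition cong_env (infix "\<doteq>" 50) where "p \<doteq> q \<longleftrightarrow> p \<in> C \<and> q \<in> C \<and> p - q \<in> I"

lemma cong_refl: "p \<in> C \<Longrightarrow> p \<doteq> p" by (simp add: cong_env_def I_zero)
lemma cong_trans: "p \<doteq> q \<Longrightarrow> q \<doteq> r \<Longrightarrow> p \<doteq> r"
  unfolding cong_env_def using I_add[of "p - q" "q - r"] by auto
lemma cong_add: "p \<doteq> q \<Longrightarrow> p' \<doteq> q' \<Longrightarrow> p + p' \<doteq> q + q'"
  unfolding cong_env_def using I_add[of "p - q" "p' - q'"] by (auto simp: words_in_add algebra_simps)
lemma cong_mult:
  assumes "p \<doteq> q" "p' \<doteq> q'" shows "p * p' \<doteq> q * q'"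
proof -
  have "p * p' - q * q' = (p - q) * p' + q * (p' - q')" by (simp add: algebra_simps)
  thus ?thesis using assms I_add I_left I_right unfolding cong_env_def by (auto simp: words_in_mult)
qed
lemma cong_sum: "(\<And>i. i \<in> A \<Longrightarrow> h i \<doteq> k i) \<Longrightarrow> (\<Sum>i\<in>A. h i) \<doteq> (\<Sum>i\<in>A. k i)"
proof (induction A rule: infinite_finite_induct)
  case (insert a A)
  thus ?case using cong_add[of "h a" "k a"] by simp
qed (simp_all add: cong_refl)
lemma cong_prod_list: "(\<And>a. a \<in> set xs \<Longrightarrow> h a \<doteq> k a) \<Longrightarrow> prod_list (map h xs) \<doteq> prod_list (map k xs)"
proof (induction xs)
  case (Cons a xs)
  thus ?case using cong_mult[of "h a" "k a"] by simp
qed (simp add: cong_refl)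

lemma env_class_eq: "env_class g p = (\<lambda>h. h + p) ` I"
  by (auto simp: env_class_def a_r_coset_def r_coset_def)

lemma env_class_cong:
  assumes "p \<doteq> q" shows "env_class g p = env_class g q"
proof -
  have sub: "(\<lambda>h. h + p) ` I \<subseteq> (\<lambda>h. h + q) ` I" if "p - q \<in> I" for p q
  proof
    fix x assume "x \<in> (\<lambda>h. h + p) ` I"
    then obtain h where h: "h \<in> I" "x = h + p" by blast
    have "h + (p - q) \<in> I" using h that I_add by blast
    moreover have "x = (h + (p - q)) + q" using h by simp
    ultimately show "x \<in> (\<lambda>h. h + q) ` I" by blast
  qed
  have "q - p \<in> I" using assms I_uminus[of "p - q"] by (simp add: cong_env_def)
  thus ?thesis using assms sub[of p q] sub[of q p] unfolding env_class_eq cong_env_def by blast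
qed

lemma env_ring: "ring (env g)"
  unfolding env_def by (rule ideal.quotient_is_ring[OF ideal_I])

lemma env_hom: "env_class g \<in> Ring.ring_hom (free_algebra g) (env g)"
proof -
  have "(\<lambda>x. env_ideal g +>\<^bsub>free_algebra g\<^esub> x) \<in> Ring.ring_hom (free_algebra g) (env g)"
    unfolding env_def using ideal.rcos_ring_hom[OF ideal_I] by simp
  thus ?thesis by (simp add: env_class_def[abs_def])
qed

lemma env_closed: "p \<in> C \<Longrightarrow> env_class g p \<in> carrier (env g)"
  using ring_hom_closed[OF env_hom] by simp
lemma env_mult: "p \<in> C \<Longrightarrow> q \<in> C \<Longrightarrow> env_class g p \<otimes>\<^bsub>env g\<^esub> env_class g q = env_class g (p * q)"
  using ring_hom_mult[OF env_hom, of p q] by simp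
lemma env_add: "p \<in> C \<Longrightarrow> q \<in> C \<Longrightarrow> env_class g p \<oplus>\<^bsub>env g\<^esub> env_class g q = env_class g (p + q)"
  using ring_hom_add[OF env_hom, of p q] by simp
lemma env_one: "\<one>\<^bsub>env g\<^esub> = env_class g 1"
  using ring_hom_one[OF env_hom] by simp
lemma env_zero: "\<zero>\<^bsub>env g\<^esub> = env_class g 0"
  using ring_hom_zero[OF env_hom free_algebra_ring env_ring] by simp

lemma env_finsum:
  assumes "finite A" "\<And>i. i \<in> A \<Longrightarrow> h i \<in> C"
  shows "(\<Oplus>\<^bsub>env g\<^esub>i\<in>A. env_class g (h i)) = env_class g (\<Sum>i\<in>A. h i)"
proof -
  interpret E: ring "env g" by (rule env_ring)
  show ?thesis using assms
  proof (induction A rule: finite_induct)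
    case empty thus ?case by (simp add: env_zero)
  next
    case (insert x A)
    thus ?case by (simp add: E.finsum_insert Pi_def env_closed env_add words_in_sum)
  qed
qed

end

section \<open>Matrices over the enveloping algebra\<close>

lemma matrix_ring_simps [simp]:
  "carrier (matrix_ring R X) = X \<times> X \<rightarrow>\<^sub>E carrier R"
  "monoid.mult (matrix_ring R X) = (\<lambda>A B. \<lambda>(I, J)\<in>X \<times> X. \<Oplus>\<^bsub>R\<^esub>K\<in>X. A (I, K) \<otimes>\<^bsub>R\<^esub> B (K, J))"
  "one (matrix_ring R X) = (\<lambda>(I, J)\<in>X \<times> X. if I = J then \<one>\<^bsub>R\<^esub> else \<zero>\<^bsub>R\<^esub>)"
  "zero (matrix_ring R X) = (\<lambda>(I, J)\<in>X \<times> X. \<zero>\<^bsub>R\<^esub>)"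
  "add (matrix_ring R X) = (\<lambda>A B. \<lambda>(I, J)\<in>X \<times> X. A (I, J) \<oplus>\<^bsub>R\<^esub> B (I, J))"
  by (simp_all add: matrix_ring_def)

lemma matrix_ring_abelian: "ring R \<Longrightarrow> abelian_monoid (matrix_ring R X)"
proof -
  assume "ring R"
  then interpret R: ring R .
  have c: "x \<in> X \<times> X \<rightarrow>\<^sub>E carrier R \<Longrightarrow> I \<in> X \<Longrightarrow> J \<in> X \<Longrightarrow> x (I, J) \<in> carrier R" for x I J
    by (auto dest: PiE_mem)
  show ?thesis
  proof (rule abelian_monoidI)
    fix x y assume "x \<in> carrier (matrix_ring R X)" "y \<in> carrier (matrix_ring R X)"
    thus "x \<oplus>\<^bsub>matrix_ring R X\<^esub> y \<in> carrier (matrix_ring R X)" using c by (auto intro!: restrict_PiE_iff[THEN iffD2])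
    show "x \<oplus>\<^bsub>matrix_ring R X\<^esub> y = y \<oplus>\<^bsub>matrix_ring R X\<^esub> x"
      using \<open>x \<in> carrier _\<close> \<open>y \<in> carrier _\<close> c by (auto simp: restrict_def fun_eq_iff R.a_comm)
  next
    show "\<zero>\<^bsub>matrix_ring R X\<^esub> \<in> carrier (matrix_ring R X)" by (auto intro!: restrict_PiE_iff[THEN iffD2])
  next
    fix x y z assume a: "x \<in> carrier (matrix_ring R X)" "y \<in> carrier (matrix_ring R X)" "z \<in> carrier (matrix_ring R X)"
    show "x \<oplus>\<^bsub>matrix_ring R X\<^esub> y \<oplus>\<^bsub>matrix_ring R X\<^esub> z = x \<oplus>\<^bsub>matrix_ring R X\<^esub> (y \<oplus>\<^bsub>matrix_ring R X\<^esub> z)"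
      using a c by (auto simp: restrict_def fun_eq_iff R.a_assoc)
  next
    fix x assume a: "x \<in> carrier (matrix_ring R X)"
    show "\<zero>\<^bsub>matrix_ring R X\<^esub> \<oplus>\<^bsub>matrix_ring R X\<^esub> x = x"
    proof
      fix z show "(\<zero>\<^bsub>matrix_ring R X\<^esub> \<oplus>\<^bsub>matrix_ring R X\<^esub> x) z = x z"
        using a c PiE_arb[of x "X \<times> X" "\<lambda>_. carrier R" z] by (cases "z \<in> X \<times> X") (auto simp: restrict_def)
    qed
  qed
qed

context env_loc begin

text \<open>A matrix over the quotient, given by a matrix of words. It is restricted to the index
  set because the carrier of \<open>matrix_ring\<close> consists of extensional functions.\<close>

definition cl :: "'x set \<Rightarrow> ('x \<Rightarrow> 'x \<Rightarrow> complex mat free_poly) \<Rightarrow> 'x \<times> 'x \<Rightarrow> env_elt" where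
  "cl X f = (\<lambda>(I, J)\<in>X \<times> X. env_class g (f I J))"

definition matC where "matC X f \<longleftrightarrow> (\<forall>I\<in>X. \<forall>J\<in>X. f I J \<in> C)"

lemma cl_closed: "matC X f \<Longrightarrow> cl X f \<in> carrier (matrix_ring (env g) X)"
  by (auto simp: cl_def matC_def env_closed intro!: restrict_PiE_iff[THEN iffD2])

lemma cl_cong: "(\<And>I J. I \<in> X \<Longrightarrow> J \<in> X \<Longrightarrow> f I J = h I J) \<Longrightarrow> cl X f = cl X h"
  unfolding cl_def by (rule restrict_ext) auto

lemma cl_add: "matC X f \<Longrightarrow> matC X h \<Longrightarrow> cl X f \<oplus>\<^bsub>matrix_ring (env g) X\<^esub> cl X h = cl X (\<lambda>I J. f I J + h I J)"
  by (auto simp: cl_def matC_def env_add restrict_def fun_eq_iff)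

lemma cl_mult:
  assumes "finite X" "matC X f" "matC X h"
  shows "cl X f \<otimes>\<^bsub>matrix_ring (env g) X\<^esub> cl X h = cl X (\<lambda>I J. \<Sum>K\<in>X. f I K * h K J)"
proof -
  interpret E: ring "env g" by (rule env_ring)
  have "(\<Oplus>\<^bsub>env g\<^esub>K\<in>X. cl X f (I, K) \<otimes>\<^bsub>env g\<^esub> cl X h (K, J)) = env_class g (\<Sum>K\<in>X. f I K * h K J)"
    if "I \<in> X" "J \<in> X" for I J
  proof -
    have "(\<Oplus>\<^bsub>env g\<^esub>K\<in>X. cl X f (I, K) \<otimes>\<^bsub>env g\<^esub> cl X h (K, J)) = (\<Oplus>\<^bsub>env g\<^esub>K\<in>X. env_class g (f I K * h K J))"
      using assms that
      by (intro E.finsum_cong') (auto simp: cl_def matC_def env_mult env_closed words_in_mult)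
    also have "\<dots> = env_class g (\<Sum>K\<in>X. f I K * h K J)"
      using assms that by (intro env_finsum) (auto simp: matC_def words_in_mult)
    finally show ?thesis .
  qed
  thus ?thesis by (auto simp: restrict_def fun_eq_iff cl_def[of X "\<lambda>I J. \<Sum>K\<in>X. f I K * h K J"])
qed

lemma matC_mult: "matC X f \<Longrightarrow> matC X h \<Longrightarrow> matC X (\<lambda>I J. \<Sum>K\<in>X. f I K * h K J)"
  by (auto simp: matC_def intro!: words_in_sum words_in_mult)

lemma cl_one: "\<one>\<^bsub>matrix_ring (env g) X\<^esub> = cl X (\<lambda>I J. if I = J then 1 else 0)"
  by (auto simp: cl_def restrict_def fun_eq_iff env_one env_zero)

lemma cl_finsum:
  assumes "finite A" "\<And>i. i \<in> A \<Longrightarrow> matC X (f i)"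
  shows "(\<Oplus>\<^bsub>matrix_ring (env g) X\<^esub>i\<in>A. cl X (f i)) = cl X (\<lambda>I J. \<Sum>i\<in>A. f i I J)"
proof -
  interpret M: abelian_monoid "matrix_ring (env g) X" by (rule matrix_ring_abelian[OF env_ring])
  show ?thesis using assms
  proof (induction A rule: finite_induct)
    case empty
    have "\<zero>\<^bsub>matrix_ring (env g) X\<^esub> = cl X (\<lambda>I J. 0)"
      by (auto simp: cl_def restrict_def fun_eq_iff env_zero)
    thus ?case by (simp del: matrix_ring_simps)
  next
    case (insert x A)
    have "matC X (\<lambda>I J. \<Sum>i\<in>A. f i I J)"
      using insert.prems unfolding matC_def by (auto intro!: words_in_sum)
    moreover have "(\<Oplus>\<^bsub>matrix_ring (env g) X\<^esub>i\<in>insert x A. cl X (f i))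
       = cl X (f x) \<oplus>\<^bsub>matrix_ring (env g) X\<^esub> (\<Oplus>\<^bsub>matrix_ring (env g) X\<^esub>i\<in>A. cl X (f i))"
      using insert cl_closed by (intro M.finsum_insert) (auto simp del: matrix_ring_simps)
    ultimately show ?case
      using insert by (simp add: cl_add del: matrix_ring_simps)
  qed
qed

primrec mprod where
  "mprod X [] = (\<lambda>I J. if I = J then 1 else 0)"
| "mprod X (f # fs) = (\<lambda>I J. \<Sum>K\<in>X. f I K * mprod X fs K J)"

lemma matC_mprod: "(\<And>f. f \<in> set fs \<Longrightarrow> matC X f) \<Longrightarrow> matC X (mprod X fs)"
proof (induction fs)
  case Nil thus ?case by (simp add: matC_def)
next
  case (Cons f fs) thus ?case by (simp add: matC_mult)
qed

lemma cl_ordered_prod: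
  "finite X \<Longrightarrow> (\<And>f. f \<in> set fs \<Longrightarrow> matC X f) \<Longrightarrow>
    ordered_prod (matrix_ring (env g) X) (map (cl X) fs) = cl X (mprod X fs)"
proof (induction fs)
  case Nil thus ?case by (simp add: ordered_prod_def cl_one del: matrix_ring_simps)
next
  case (Cons f fs)
  hence "ordered_prod (matrix_ring (env g) X) (map (cl X) fs) = cl X (mprod X fs)" by simp
  thus ?case using Cons.prems by (simp add: ordered_prod_def cl_mult matC_mprod del: matrix_ring_simps)
qed

end

text \<open>Matrix entries with indices starting at 1, to agree with the indices of
  \<open>so_gen\<close> and \<open>flip\<close>.\<close>

definition ent :: "complex mat \<Rightarrow> nat \<Rightarrow> nat \<Rightarrow> complex" where "ent x i j = x $$ (i - 1, j - 1)"

lemma ent_ext: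
  assumes "x \<in> carrier_mat N N" "y \<in> carrier_mat N N"
    and "\<And>i j. i \<in> {1..N} \<Longrightarrow> j \<in> {1..N} \<Longrightarrow> ent x i j = ent y i j"
  shows "x = y"
proof (rule eq_matI)
  fix i j assume "i < dim_row y" "j < dim_col y"
  thus "x $$ (i, j) = y $$ (i, j)" using assms(2) assms(3)[of "Suc i" "Suc j"] by (simp add: ent_def)
qed (use assms in auto)

lemma ent_mat: "i \<in> {1..N} \<Longrightarrow> j \<in> {1..N} \<Longrightarrow> ent (mat N N f) i j = f (i - 1, j - 1)"
  unfolding ent_def by (rule index_mat(1)) auto

lemma ent_add:
  assumes "x \<in> carrier_mat N N" "y \<in> carrier_mat N N" "i \<in> {1..N}" "j \<in> {1..N}"
  shows "ent (x + y) i j = ent x i j + ent y i j"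
  unfolding ent_def by (rule index_add_mat(1)) (use assms in auto)

lemma ent_diff:
  assumes "x \<in> carrier_mat N N" "y \<in> carrier_mat N N" "i \<in> {1..N}" "j \<in> {1..N}"
  shows "ent (x - y) i j = ent x i j - ent y i j"
  unfolding ent_def by (rule index_minus_mat(1)) (use assms in auto)

lemma ent_smult:
  assumes "x \<in> carrier_mat N N" "i \<in> {1..N}" "j \<in> {1..N}"
  shows "ent (c \<cdot>\<^sub>m x) i j = c * ent x i j"
  unfolding ent_def by (rule index_smult_mat(1)) (use assms in auto)

lemma ent_mult:
  assumes x: "x \<in> carrier_mat N N" and y: "y \<in> carrier_mat N N" and ij: "i \<in> {1..N}" "j \<in> {1..N}"
  shows "ent (x * y) i j = (\<Sum>k=1..N. ent x i k * ent y k j)"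
proof -
  have b: "i - 1 < dim_row x" "j - 1 < dim_col y" "dim_row y = N" "dim_col x = N" using assms by auto
  have "ent (x * y) i j = row x (i - 1) \<bullet> col y (j - 1)"
    unfolding ent_def by (rule index_mult_mat(1)[OF b(1,2)])
  also have "\<dots> = (\<Sum>k\<in>{0..<N}. x $$ (i - 1, k) * y $$ (k, j - 1))"
    unfolding scalar_prod_def dim_col b(3)
    by (rule sum.cong[OF refl]) (simp add: b index_row index_col del: One_nat_def)
  also have "\<dots> = (\<Sum>k=1..N. ent x i k * ent y k j)"
    unfolding ent_def by (rule sum.reindex_bij_witness[of _ "\<lambda>k. k - 1" Suc]) auto
  finally show ?thesis .
qed

lemma so_gen_carrier: "so_gen N i j \<in> carrier_mat N N"
  by (auto simp: so_gen_def gl_basis_def)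

lemma ent_so_gen:
  assumes pq: "p \<in> {1..N}" "q \<in> {1..N}"
  shows "ent (so_gen N i j) p q = (if p = i \<and> q = j then 1 else 0) - (if p = flip N j \<and> q = flip N i then 1 else 0)"
proof -
  have e: "p - 1 + 1 = p" "q - 1 + 1 = q" using pq by auto
  have c: "mat N N h \<in> carrier_mat N N" for h :: "nat \<times> nat \<Rightarrow> complex" by simp
  show ?thesis
    unfolding so_gen_def gl_basis_def ent_diff[OF c c pq] ent_mat[OF pq] prod.case e ..
qed

text \<open>The elements with indices i, j and j', i' are negatives of each other, so coefficients
  enter only through their skew part.\<close>

lemma sum_ent_so_gen:
  assumes "p \<in> {1..N}" "q \<in> {1..N}"
  shows "(\<Sum>i=1..N. \<Sum>j=1..N. c i j * ent (so_gen N i j) p q) = c p q - c (flip N q) (flip N p)"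
proof -
  have fl: "(p = flip N j) = (j = flip N p)" if "p \<in> {1..N}" "j \<in> {1..N}" for p j
    using that unfolding flip_def by auto
  have d2: "(\<Sum>i=1..N. \<Sum>j=1..N. if i = a \<and> j = b then c i j else 0) = c a b"
    if "a \<in> {1..N}" "b \<in> {1..N}" for a b
  proof -
    have "(\<Sum>i=1..N. \<Sum>j=1..N. if i = a \<and> j = b then c i j else 0) = (\<Sum>i=1..N. if i = a then \<Sum>j=1..N. if j = b then c i j else 0 else 0)"
      by (rule sum.cong) auto
    thus ?thesis using that by (simp add: sum.delta)
  qed
  have w: "c * ((if P then 1 else 0) - (if Q then 1 else 0)) = (if P then c else 0) - (if Q then c else (0 :: complex))"
    for P Q c by simp
  have "(\<Sum>i=1..N. \<Sum>j=1..N. c i j * ent (so_gen N i j) p q) =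
    (\<Sum>i=1..N. \<Sum>j=1..N. (if i = p \<and> j = q then c i j else 0) - (if i = flip N q \<and> j = flip N p then c i j else 0))"
  proof (intro sum.cong refl)
    fix i j assume ij: "i \<in> {1..N}" "j \<in> {1..N}"
    show "c i j * ent (so_gen N i j) p q = (if i = p \<and> j = q then c i j else 0) - (if i = flip N q \<and> j = flip N p then c i j else 0)"
      unfolding ent_so_gen[OF assms] fl[OF assms(1) ij(2)] fl[OF assms(2) ij(1)] w
        eq_commute[of p i] eq_commute[of q j] conj_commute[of "j = flip N p"] ..
  qed
  also have "\<dots> = c p q - c (flip N q) (flip N p)"
    unfolding sum_subtractf d2[OF assms] d2[OF flip_in[OF assms(2)] flip_in[OF assms(1)]] ..
  finally show ?thesis .
qed

text \<open>Skew symmetry about the antidiagonal. A skew x has the entries of x / 2 as coefficients,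
  since each entry is reached from two spanning elements.\<close>

lemma so_algebra_iff:
  "x \<in> so_algebra N \<longleftrightarrow> x \<in> carrier_mat N N \<and>
    (\<forall>i\<in>{1..N}. \<forall>j\<in>{1..N}. ent x (flip N j) (flip N i) = - ent x i j)"
proof
  assume "x \<in> so_algebra N"
  then obtain c where x: "x = mat N N (\<lambda>(r, s). \<Sum>i=1..N. \<Sum>j=1..N. c i j * so_gen N i j $$ (r, s))"
    by (auto simp: so_algebra_def)
  have e: "ent x i j = c i j - c (flip N j) (flip N i)" if "i \<in> {1..N}" "j \<in> {1..N}" for i j
    using sum_ent_so_gen[OF that, of c] that unfolding x ent_mat[OF that] by (simp add: ent_def)
  show "x \<in> carrier_mat N N \<and> (\<forall>i\<in>{1..N}. \<forall>j\<in>{1..N}. ent x (flip N j) (flip N i) = - ent x i j)"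
  proof (intro conjI ballI)
    fix i j assume ij: "i \<in> {1..N}" "j \<in> {1..N}"
    show "ent x (flip N j) (flip N i) = - ent x i j"
      unfolding e[OF ij] e[OF flip_in[OF ij(2)] flip_in[OF ij(1)]] flip_flip[OF ij(1)] flip_flip[OF ij(2)] by simp
  qed (simp add: x)
next
  assume a: "x \<in> carrier_mat N N \<and> (\<forall>i\<in>{1..N}. \<forall>j\<in>{1..N}. ent x (flip N j) (flip N i) = - ent x i j)"
  have e: "x = mat N N (\<lambda>(r, s). \<Sum>i=1..N. \<Sum>j=1..N. (ent x i j / 2) * so_gen N i j $$ (r, s))" (is "_ = ?y")
  proof (rule ent_ext[of _ N])
    fix i j assume ij: "i \<in> {1..N}" "j \<in> {1..N}"
    have "ent ?y i j = ent x i j / 2 - ent x (flip N j) (flip N i) / 2"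
      using sum_ent_so_gen[OF ij, of "\<lambda>i j. ent x i j / 2"] unfolding ent_mat[OF ij] by (simp add: ent_def)
    thus "ent x i j = ent ?y i j" using a ij by simp
  qed (use a in auto)
  show "x \<in> so_algebra N" unfolding so_algebra_def
    by (rule CollectI, rule exI[of _ "\<lambda>i j. ent x i j / 2"], rule conjI[OF e TrueI])
qed

lemma so_gen_in:
  assumes ij: "i \<in> {1..N}" "j \<in> {1..N}" shows "so_gen N i j \<in> so_algebra N"
  unfolding so_algebra_iff
proof (intro conjI ballI so_gen_carrier)
  fix p q assume pq: "p \<in> {1..N}" "q \<in> {1..N}"
  have e: "(flip N q = i) = (q = flip N i)" "(flip N p = j) = (p = flip N j)"
    "(flip N q = flip N j) = (q = j)" "(flip N p = flip N i) = (p = i)" using ij pq unfolding flip_def by auto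
  show "ent (so_gen N i j) (flip N q) (flip N p) = - ent (so_gen N i j) p q"
    unfolding ent_so_gen[OF pq] ent_so_gen[OF flip_in[OF pq(2)] flip_in[OF pq(1)]] e
      conj_commute[of "q = flip N i"] conj_commute[of "q = j"] minus_diff_eq ..
qed

lemma so_algebra_carrier: "x \<in> so_algebra N \<Longrightarrow> x \<in> carrier_mat N N" by (simp add: so_algebra_iff)

lemma so_add:
  assumes "x \<in> so_algebra N" "y \<in> so_algebra N" shows "x + y \<in> so_algebra N"
proof -
  have c: "x \<in> carrier_mat N N" "y \<in> carrier_mat N N" using assms so_algebra_carrier by blast+
  show ?thesis
    unfolding so_algebra_iff
  proof (intro conjI ballI)
    fix i j assume ij: "i \<in> {1..N}" "j \<in> {1..N}"
    have "ent x (flip N j) (flip N i) = - ent x i j" "ent y (flip N j) (flip N i) = - ent y i j"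
      using assms ij unfolding so_algebra_iff by blast+
    thus "ent (x + y) (flip N j) (flip N i) = - ent (x + y) i j"
      unfolding ent_add[OF c ij] ent_add[OF c flip_in[OF ij(2)] flip_in[OF ij(1)]] by simp
  qed (use c in auto)
qed

lemma so_smult:
  assumes "x \<in> so_algebra N" shows "c \<cdot>\<^sub>m x \<in> so_algebra N"
proof -
  have c: "x \<in> carrier_mat N N" using assms so_algebra_carrier by blast
  show ?thesis
    unfolding so_algebra_iff
  proof (intro conjI ballI)
    fix i j assume ij: "i \<in> {1..N}" "j \<in> {1..N}"
    have "ent x (flip N j) (flip N i) = - ent x i j"
      using assms ij unfolding so_algebra_iff by blast
    thus "ent (c \<cdot>\<^sub>m x) (flip N j) (flip N i) = - ent (c \<cdot>\<^sub>m x) i j"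
      unfolding ent_smult[OF c ij] ent_smult[OF c flip_in[OF ij(2)] flip_in[OF ij(1)]] by simp
  qed (use c in auto)
qed

text \<open>Reflection about the antidiagonal reverses products and negates x and y, so it exchanges
  x y with y x.\<close>

lemma so_bracket:
  assumes x: "x \<in> so_algebra N" and y: "y \<in> so_algebra N"
  shows "x * y - y * x \<in> so_algebra N"
proof -
  have c: "x \<in> carrier_mat N N" "y \<in> carrier_mat N N" using x y so_algebra_carrier by blast+
  have sw: "ent (u * v) (flip N j) (flip N i) = ent (v * u) i j"
    if uv: "u \<in> so_algebra N" "v \<in> so_algebra N" and ij: "i \<in> {1..N}" "j \<in> {1..N}" for u v i j
  proof -
    have cu: "u \<in> carrier_mat N N" "v \<in> carrier_mat N N" using uv so_algebra_carrier by blast+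
    have "ent (u * v) (flip N j) (flip N i) = (\<Sum>k=1..N. ent u (flip N j) (flip N k) * ent v (flip N k) (flip N i))"
      unfolding ent_mult[OF cu flip_in[OF ij(2)] flip_in[OF ij(1)]]
      using sum_flip[of "\<lambda>k. ent u (flip N j) k * ent v k (flip N i)" N] by simp
    also have "\<dots> = (\<Sum>k=1..N. ent v i k * ent u k j)"
    proof (rule sum.cong[OF refl])
      fix k assume k: "k \<in> {1..N}"
      have "ent u (flip N j) (flip N k) = - ent u k j" "ent v (flip N k) (flip N i) = - ent v i k"
        using uv ij k unfolding so_algebra_iff by blast+
      thus "ent u (flip N j) (flip N k) * ent v (flip N k) (flip N i) = ent v i k * ent u k j" by simp
    qed
    finally show ?thesis by (simp only: ent_mult[OF cu(2) cu(1) ij])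
  qed
  show ?thesis
    unfolding so_algebra_iff
  proof (intro conjI ballI)
    show "x * y - y * x \<in> carrier_mat N N" using c by auto
    fix i j assume ij: "i \<in> {1..N}" "j \<in> {1..N}"
    have cc: "x * y \<in> carrier_mat N N" "y * x \<in> carrier_mat N N" using c by auto
    show "ent (x * y - y * x) (flip N j) (flip N i) = - ent (x * y - y * x) i j"
      unfolding ent_diff[OF cc ij] ent_diff[OF cc flip_in[OF ij(2)] flip_in[OF ij(1)]] sw[OF x y ij] sw[OF y x ij] by simp
  qed
qed

lemma so_gen_comm:
  assumes ij: "i \<in> {1..N}" "j \<in> {1..N}" "k \<in> {1..N}" "l \<in> {1..N}"
  shows "so_gen N i j * so_gen N k l - so_gen N k l * so_gen N i j =
    (if k = j then 1 else 0) \<cdot>\<^sub>m so_gen N i l + (if i = l then - 1 else 0) \<cdot>\<^sub>m so_gen N k j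
    + ((if k = flip N i then - 1 else 0) \<cdot>\<^sub>m so_gen N (flip N j) l
    + (if l = flip N j then 1 else 0) \<cdot>\<^sub>m so_gen N k (flip N i))" (is "?l = ?r")
proof (rule ent_ext[of _ N])
  have c: "so_gen N i j \<in> carrier_mat N N" for i j by (rule so_gen_carrier)
  show "?l \<in> carrier_mat N N" by (rule minus_carrier_mat[OF mult_carrier_mat[OF c c]])
  show "?r \<in> carrier_mat N N" by (rule add_carrier_mat[OF add_carrier_mat[OF smult_carrier_mat[OF c]]])
  fix p q assume pq: "p \<in> {1..N}" "q \<in> {1..N}"
  \<comment> \<open>Kronecker deltas as numbers turn the claim into a polynomial identity, once all
    equations between indices have a common orientation.\<close>
  define d :: "bool \<Rightarrow> complex" where "d P = (if P then 1 else 0)" for P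
  have n: "(if P then 1 else 0) = d P" "(if P then - 1 else 0) = - d P" "d (P \<and> Q) = d P * d Q" for P Q
    by (auto simp: d_def)
  have g: "ent (so_gen N i j) r s = d (r = i) * d (s = j) - d (r = flip N j) * d (s = flip N i)"
    if "r \<in> {1..N}" "s \<in> {1..N}" for i j r s
    unfolding ent_so_gen[OF that] n ..
  have pr: "ent (so_gen N i j * so_gen N k l) p q =
     d (p = i) * ent (so_gen N k l) j q - d (p = flip N j) * ent (so_gen N k l) (flip N i) q"
    if "i \<in> {1..N}" "j \<in> {1..N}" for i j k l
  proof -
    have s: "(\<Sum>r=1..N. d (r = a) * h r) = h a" if "a \<in> {1..N}" for a h
    proof -
      have "(\<Sum>r=1..N. d (r = a) * h r) = (\<Sum>r=1..N. if r = a then h r else 0)"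
        by (rule sum.cong) (auto simp: d_def)
      thus ?thesis using that by simp
    qed
    have "ent (so_gen N i j * so_gen N k l) p q =
      d (p = i) * (\<Sum>r=1..N. d (r = j) * ent (so_gen N k l) r q)
      - d (p = flip N j) * (\<Sum>r=1..N. d (r = flip N i) * ent (so_gen N k l) r q)"
      unfolding ent_mult[OF c c pq] sum_distrib_left sum_subtractf[symmetric]
      by (rule sum.cong[OF refl]) (simp only: g[OF pq(1)] left_diff_distrib mult.assoc)
    thus ?thesis unfolding s[OF that(2)] s[OF flip_in[OF that(1)]] .
  qed
  have cm: "so_gen N i j * so_gen N k l \<in> carrier_mat N N" for i j k l by (rule mult_carrier_mat[OF c c])
  have s: "u \<cdot>\<^sub>m so_gen N a b \<in> carrier_mat N N" for u a b by (rule smult_carrier_mat[OF c])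
  have L: "ent ?l p q = ent (so_gen N i j * so_gen N k l) p q - ent (so_gen N k l * so_gen N i j) p q"
    by (rule ent_diff[OF cm cm pq])
  have R: "ent ?r p q = (if k = j then 1 else 0) * ent (so_gen N i l) p q + (if i = l then - 1 else 0) * ent (so_gen N k j) p q
     + ((if k = flip N i then - 1 else 0) * ent (so_gen N (flip N j) l) p q + (if l = flip N j then 1 else 0) * ent (so_gen N k (flip N i)) p q)"
    unfolding ent_add[OF add_carrier_mat[OF s] add_carrier_mat[OF s] pq] ent_add[OF s s pq] ent_smult[OF c pq] ..
  have f: "(flip N i = flip N l) = (i = l)" "(flip N k = flip N j) = (k = j)" "(flip N i = k) = (k = flip N i)"
    "(j = flip N l) = (l = flip N j)" "(flip N k = i) = (k = flip N i)" "(j = k) = (k = j)" "(l = i) = (i = l)"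
    "flip N (flip N i) = i" "flip N (flip N j) = j"
    using ij unfolding flip_def atLeastAtMost_iff by (presburger, presburger, presburger, presburger, presburger, blast, blast, presburger, presburger)
  show "ent ?l p q = ent ?r p q"
    unfolding L R unfolding pr[OF ij(1,2)] pr[OF ij(3,4)] n g[OF pq] g[OF ij(2) pq(2)] g[OF flip_in[OF ij(1)] pq(2)]
      g[OF ij(4) pq(2)] g[OF flip_in[OF ij(3)] pq(2)] f
    by (simp add: algebra_simps)
qed

lemma env_relations_add: "x \<in> g \<Longrightarrow> y \<in> g \<Longrightarrow> letter (x + y) - letter x - letter y \<in> env_relations g"
  unfolding env_relations_def by blast
lemma env_relations_smult: "x \<in> g \<Longrightarrow> letter (c \<cdot>\<^sub>m x) - const c * letter x \<in> env_relations g"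
  unfolding env_relations_def by blast
lemma env_relations_bracket: "x \<in> g \<Longrightarrow> y \<in> g \<Longrightarrow>
    letter x * letter y - letter y * letter x - letter (x * y - y * x) \<in> env_relations g"
  unfolding env_relations_def by blast

lemma so_relations: "env_relations (so_algebra N) \<subseteq> words_in (so_algebra N)"
  unfolding env_relations_def
  by (auto intro!: words_in_diff words_in_mult words_in_letter words_in_const so_add so_smult so_bracket)

interpretation so: env_loc "so_algebra N" for N
  by unfold_locales (rule so_relations)

text \<open>A letter is additive in its matrix only modulo the ideal, so the sum is built up one
  relation at a time. Membership of the partial sums is part of the induction, because the relations
  exist for members only.\<close>

lemma letter_sum:
  assumes "finite A" "A \<subseteq> {1..N} \<times> {1..N}"
  shows "so.cong_env N (letter (mat N N (\<lambda>(r, s). \<Sum>(i, j)\<in>A. c i j * so_gen N i j $$ (r, s))))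
      (\<Sum>(i, j)\<in>A. const (c i j) * letter (so_gen N i j))
    \<and> mat N N (\<lambda>(r, s). \<Sum>(i, j)\<in>A. c i j * so_gen N i j $$ (r, s)) \<in> so_algebra N"
  using assms
proof (induction A rule: finite_induct)
  case empty
  let ?z = "mat N N (\<lambda>(r, s). \<Sum>(i, j)\<in>{}. c i j * so_gen N i j $$ (r, s)) :: complex mat"
  have z: "?z \<in> so_algebra N"
    unfolding so_algebra_iff
  proof (intro conjI ballI)
    fix i j assume ij: "i \<in> {1..N}" "j \<in> {1..N}"
    show "ent ?z (flip N j) (flip N i) = - ent ?z i j"
      unfolding ent_mat[OF ij] ent_mat[OF flip_in[OF ij(2)] flip_in[OF ij(1)]] by simp
  qed simp
  \<comment> \<open>The letter of the zero matrix is not zero in the free algebra; the relation for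
    the scalar 0 makes it congruent to zero.\<close>
  have "0 \<cdot>\<^sub>m ?z = ?z" by (rule eq_matI) simp_all
  hence r: "letter ?z - const 0 * letter ?z \<in> env_relations (so_algebra N)"
    using env_relations_smult[OF z, of 0] by (simp only:)
  show ?case
  proof (intro conjI)
    show "so.cong_env N (letter ?z) (\<Sum>(i, j)\<in>{}. const (c i j) * letter (so_gen N i j))"
      using so.I_relations[OF r] words_in_letter[OF z] by (simp add: so.cong_env_def)
  qed (rule z)
next
  case (insert a A)
  obtain i j where a: "a = (i, j)" by fastforce
  have ij: "i \<in> {1..N}" "j \<in> {1..N}" using insert a by auto
  let ?m = "\<lambda>A. mat N N (\<lambda>(r, s). \<Sum>(i, j)\<in>A. c i j * so_gen N i j $$ (r, s)) :: complex mat"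
  have sub: "A \<subseteq> {1..N} \<times> {1..N}" using insert.prems by simp
  note IH = insert.IH[OF sub, THEN conjunct1] and mA = insert.IH[OF sub, THEN conjunct2]
  have g: "so_gen N i j \<in> so_algebra N" by (rule so_gen_in[OF ij])
  have cg: "c i j \<cdot>\<^sub>m so_gen N i j \<in> so_algebra N" by (rule so_smult[OF g])
  have eq: "?m (insert a A) = c i j \<cdot>\<^sub>m so_gen N i j + ?m A"
  proof (rule eq_matI)
    fix r s assume "r < dim_row (c i j \<cdot>\<^sub>m so_gen N i j + ?m A)" "s < dim_col (c i j \<cdot>\<^sub>m so_gen N i j + ?m A)"
    hence rs: "r < N" "s < N" by simp_all
    have "r < dim_row (so_gen N i j)" "s < dim_col (so_gen N i j)" using rs so_gen_carrier[of N i j] by simp_all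
    thus "?m (insert a A) $$ (r, s) = (c i j \<cdot>\<^sub>m so_gen N i j + ?m A) $$ (r, s)"
      using rs insert.hyps by (simp add: a)
  qed simp_all
  have 1: "so.cong_env N (letter (c i j \<cdot>\<^sub>m so_gen N i j)) (const (c i j) * letter (so_gen N i j))"
    unfolding so.cong_env_def
  proof (intro conjI words_in_letter words_in_mult words_in_const cg g so.I_relations)
    show "letter (c i j \<cdot>\<^sub>m so_gen N i j) - const (c i j) * letter (so_gen N i j) \<in> env_relations (so_algebra N)"
      by (rule env_relations_smult[OF g])
  qed
  have 2: "so.cong_env N (letter (c i j \<cdot>\<^sub>m so_gen N i j + ?m A)) (letter (c i j \<cdot>\<^sub>m so_gen N i j) + letter (?m A))"
    unfolding so.cong_env_def
  proof (intro conjI words_in_letter words_in_add cg mA so_add)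
    show "letter (c i j \<cdot>\<^sub>m so_gen N i j + ?m A) - (letter (c i j \<cdot>\<^sub>m so_gen N i j) + letter (?m A)) \<in> env_ideal (so_algebra N)"
      using so.I_relations[OF env_relations_add[OF cg mA]] unfolding diff_diff_add .
  qed
  have "so.cong_env N (letter (?m (insert a A))) (const (c i j) * letter (so_gen N i j) + (\<Sum>(i, j)\<in>A. const (c i j) * letter (so_gen N i j)))"
    unfolding eq by (rule so.cong_trans[OF 2 so.cong_add[OF 1 IH]])
  moreover have "?m (insert a A) \<in> so_algebra N" unfolding eq by (rule so_add[OF cg mA])
  moreover have "(\<Sum>(i, j)\<in>insert a A. const (c i j) * letter (so_gen N i j)) =
    const (c i j) * letter (so_gen N i j) + (\<Sum>(i, j)\<in>A. const (c i j) * letter (so_gen N i j))"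
    by (subst sum.insert[OF insert.hyps]) (simp add: a)
  ultimately show ?case by (simp only: simp_thms)
qed

lemma letter_expand:
  assumes "x \<in> so_algebra N" "\<And>r s. r \<in> {1..N} \<Longrightarrow> s \<in> {1..N} \<Longrightarrow> ent x r s = (\<Sum>i=1..N. \<Sum>j=1..N. c i j * ent (so_gen N i j) r s)"
  shows "so.cong_env N (letter x) (\<Sum>i=1..N. \<Sum>j=1..N. const (c i j) * letter (so_gen N i j))"
proof -
  have x: "x = mat N N (\<lambda>(r, s). \<Sum>(i, j)\<in>{1..N} \<times> {1..N}. c i j * so_gen N i j $$ (r, s))" (is "x = ?y")
  proof (rule ent_ext[of _ N])
    fix r s assume rs: "r \<in> {1..N}" "s \<in> {1..N}"
    show "ent x r s = ent ?y r s"
      unfolding assms(2)[OF rs] ent_mat[OF rs] prod.case sum.cartesian_product unfolding ent_def by simp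
  qed (use so_algebra_carrier[OF assms(1)] in auto)
  have "finite ({1..N} \<times> {1..N})" by simp
  note l = letter_sum[OF this subset_refl, of c, THEN conjunct1]
  show ?thesis using l unfolding x[symmetric] sum.cartesian_product .
qed

section \<open>The Casimir element and its invariance\<close>

lemma prod_indicator:
  "finite A \<Longrightarrow> (\<Prod>b\<in>A. if P b then 1 else (0 :: complex)) = (if \<forall>b\<in>A. P b then 1 else 0)"
  by (induction A rule: finite_induct) auto

text \<open>The matrix of an operator on the a-th tensor factor, acting as the identity on all the
  others.\<close>

definition slot :: "nat \<Rightarrow> (nat \<Rightarrow> nat \<Rightarrow> nat \<Rightarrow> 'r::zero) \<Rightarrow> nat \<Rightarrow> (nat \<Rightarrow> nat) \<Rightarrow> (nat \<Rightarrow> nat) \<Rightarrow> 'r" where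
  "slot m g a I J = (if \<forall>b\<in>{1..m} - {a}. I b = J b then g a (I a) (J a) else 0)"

lemma multi_indices_ext: "I \<in> multi_indices N m \<Longrightarrow> J \<in> multi_indices N m \<Longrightarrow> (\<And>b. b \<in> {1..m} \<Longrightarrow> I b = J b) \<Longrightarrow> I = J"
  unfolding multi_indices_def by (rule PiE_ext)

lemma multi_indices_upd: "I \<in> multi_indices N m \<Longrightarrow> a \<in> {1..m} \<Longrightarrow> i \<in> {1..N} \<Longrightarrow> I(a := i) \<in> multi_indices N m"
  unfolding multi_indices_def by (auto simp: PiE_iff extensional_def)

text \<open>The factors act on different slots, so the only intermediate index is I with its entry
  at s replaced by that of J. The product starts at an arbitrary slot s for the induction; on the
  slots before s it is the identity.\<close>

lemma mprod_slot:
  assumes "1 \<le> s" "s \<le> m + 1" "I \<in> multi_indices N m" "J \<in> multi_indices N m"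
  shows "env_loc.mprod (multi_indices N m) (map (slot m g) [s..<m + 1]) I J =
    (if \<forall>b\<in>{1..<s}. I b = J b then prod_list (map (\<lambda>a. (g a (I a) (J a) :: 'r::ring_1)) [s..<m + 1]) else 0)"
  using assms
proof (induction "m + 1 - s" arbitrary: s I)
  case 0
  hence s: "s = m + 1" by simp
  have "(\<forall>b\<in>{1..<m + 1}. I b = J b) = (I = J)"
    using multi_indices_ext[OF 0(4,5)] by auto
  thus ?case unfolding s by (simp only: upt_rec[of "m + 1"] order.irrefl if_False list.map so.mprod.simps prod_list.Nil)
next
  case (Suc d)
  have sm: "s \<le> m" "s \<in> {1..m}" using Suc.hyps(2) Suc.prems by auto
  let ?X = "multi_indices N m"
  let ?K = "I(s := J s)"
  have K: "?K \<in> ?X" by (rule multi_indices_upd[OF Suc.prems(3) sm(2) multi_indices_in[OF Suc.prems(4) sm(2)]])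
  have l: "[s..<m + 1] = s # [Suc s..<m + 1]" using sm by (simp add: upt_conv_Cons)
  let ?R = "\<lambda>K. prod_list (map (\<lambda>a. g a (K a) (J a)) [Suc s..<m + 1])"
  have R: "?R ?K = ?R I" by (rule arg_cong[where f = prod_list], rule map_cong[OF refl]) auto
  have IH: "env_loc.mprod ?X (map (slot m g) [Suc s..<m + 1]) K J = (if \<forall>b\<in>{1..<Suc s}. K b = J b then ?R K else 0)"
    if "K \<in> ?X" for K
    using Suc.hyps(2) sm Suc.prems that by (intro Suc.hyps(1)) auto
  have t: "slot m g s I K * env_loc.mprod ?X (map (slot m g) [Suc s..<m + 1]) K J =
     (if K = ?K then if \<forall>b\<in>{1..<s}. I b = J b then g s (I s) (J s) * ?R I else 0 else 0)" if "K \<in> ?X" for K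
  proof (cases "K = ?K")
    case True
    have c: "(\<forall>b\<in>{1..<Suc s}. ?K b = J b) = (\<forall>b\<in>{1..<s}. I b = J b)" by auto
    have "slot m g s I ?K = g s (I s) (J s)" unfolding slot_def by auto
    thus ?thesis unfolding True IH[OF K] c R by simp
  next
    case False
    have "\<not> ((\<forall>b\<in>{1..m} - {s}. I b = K b) \<and> (\<forall>b\<in>{1..<Suc s}. K b = J b))"
    proof
      assume a: "(\<forall>b\<in>{1..m} - {s}. I b = K b) \<and> (\<forall>b\<in>{1..<Suc s}. K b = J b)"
      have "K = ?K"
      proof (rule multi_indices_ext[OF that K])
        fix b assume b: "b \<in> {1..m}"
        show "K b = ?K b"
        proof (cases "b = s")
          case True
          have "s \<in> {1..<Suc s}" using Suc.prems by simp
          thus ?thesis using a True by simp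
        next
          case False
          thus ?thesis using a b by simp
        qed
      qed
      with False show False by simp
    qed
    thus ?thesis unfolding IH[OF that] slot_def using False by (auto simp del: fun_upd_apply)
  qed
  have "env_loc.mprod ?X (map (slot m g) [s..<m + 1]) I J =
    (\<Sum>K\<in>?X. slot m g s I K * env_loc.mprod ?X (map (slot m g) [Suc s..<m + 1]) K J)"
    unfolding l list.map so.mprod.simps ..
  also have "\<dots> = (\<Sum>K\<in>?X. if K = ?K then if \<forall>b\<in>{1..<s}. I b = J b then g s (I s) (J s) * ?R I else 0 else 0)"
    by (rule sum.cong[OF refl t])
  also have "\<dots> = (if \<forall>b\<in>{1..<s}. I b = J b then g s (I s) (J s) * ?R I else 0)"
    using K finite_multi_indices[of N m] by (simp add: sum.delta del: fun_upd_apply)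
  finally show ?case unfolding l by simp
qed

section \<open>The Casimir element as the class of a word\<close>

lemma pure_tensor_class:
  assumes "p \<in> words_in (so_algebra N)"
  shows "pure_tensor N m (env_class (so_algebra N) p) A = so.cl N (multi_indices N m) (\<lambda>I J. const (A I J) * p)"
  unfolding pure_tensor_def env_scalar_def so.cl_def
  by (rule restrict_ext) (auto simp: so.env_mult assms)

definition shifted_gen :: "nat \<Rightarrow> nat \<Rightarrow> nat \<Rightarrow> nat \<Rightarrow> nat \<Rightarrow> complex mat free_poly" where
  "shifted_gen N k a i j = letter (so_gen N i j) + const ((of_nat a - of_nat k) * (if i = j then 1 else 0))"

lemma words_in_shifted_gen:
  "i \<in> {1..N} \<Longrightarrow> j \<in> {1..N} \<Longrightarrow> shifted_gen N k a i j \<in> words_in (so_algebra N)"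
  unfolding shifted_gen_def by (rule words_in_add[OF words_in_letter[OF so_gen_in] words_in_const])

lemma F_op_class:
  assumes a: "a \<in> {1..m}"
  shows "F_op N m a = so.cl N (multi_indices N m) (slot m (\<lambda>a i j. letter (so_gen N i j)) a)"
proof -
  let ?X = "multi_indices N m" and ?M = "matrix_ring (env (so_algebra N)) (multi_indices N m)"
  let ?A = "\<lambda>i j. tensor_ops m (\<lambda>b. if b = a then unit_op i j else id_op)"
  interpret M: abelian_monoid ?M by (rule matrix_ring_abelian[OF so.env_ring])
  have w: "letter (so_gen N i j) \<in> words_in (so_algebra N)" if "i \<in> {1..N}" "j \<in> {1..N}" for i j
    by (rule words_in_letter[OF so_gen_in[OF that]])
  have m1: "so.matC N ?X (\<lambda>I J. const (?A i j I J) * letter (so_gen N i j))" if "i \<in> {1..N}" "j \<in> {1..N}" for i j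
    unfolding so.matC_def using w[OF that] by (simp add: words_in_mult)
  have m2: "so.matC N ?X (\<lambda>I J. \<Sum>j=1..N. const (?A i j I J) * letter (so_gen N i j))" if "i \<in> {1..N}" for i
    unfolding so.matC_def using w[OF that] by (auto intro!: words_in_mult words_in_sum)
  have p: "pure_tensor N m (env_of (so_algebra N) (so_gen N i j)) (?A i j) =
      so.cl N ?X (\<lambda>I J. const (?A i j I J) * letter (so_gen N i j))" if "i \<in> {1..N}" "j \<in> {1..N}" for i j
    unfolding env_of_def by (rule pure_tensor_class[OF w[OF that]])
  have 1: "(\<Oplus>\<^bsub>?M\<^esub>j\<in>{1..N}. pure_tensor N m (env_of (so_algebra N) (so_gen N i j)) (?A i j)) =
      so.cl N ?X (\<lambda>I J. \<Sum>j=1..N. const (?A i j I J) * letter (so_gen N i j))" if i: "i \<in> {1..N}" for i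
  proof -
    have "(\<Oplus>\<^bsub>?M\<^esub>j\<in>{1..N}. pure_tensor N m (env_of (so_algebra N) (so_gen N i j)) (?A i j)) =
      (\<Oplus>\<^bsub>?M\<^esub>j\<in>{1..N}. so.cl N ?X (\<lambda>I J. const (?A i j I J) * letter (so_gen N i j)))"
      by (rule M.finsum_cong'[OF refl Pi_I p[OF i]]) (rule so.cl_closed[OF m1[OF i]])
    thus ?thesis using so.cl_finsum[OF finite_atLeastAtMost m1[OF i]] by simp
  qed
  have "F_op N m a = (\<Oplus>\<^bsub>?M\<^esub>i\<in>{1..N}. \<Oplus>\<^bsub>?M\<^esub>j\<in>{1..N}. pure_tensor N m (env_of (so_algebra N) (so_gen N i j)) (?A i j))"
    unfolding F_op_def env_tensor_def ..
  also have "\<dots> = (\<Oplus>\<^bsub>?M\<^esub>i\<in>{1..N}. so.cl N ?X (\<lambda>I J. \<Sum>j=1..N. const (?A i j I J) * letter (so_gen N i j)))"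
    by (rule M.finsum_cong'[OF refl Pi_I 1]) (rule so.cl_closed[OF m2])
  also have "\<dots> = so.cl N ?X (\<lambda>I J. \<Sum>i=1..N. \<Sum>j=1..N. const (?A i j I J) * letter (so_gen N i j))"
    by (rule so.cl_finsum[OF finite_atLeastAtMost m2])
  also have "\<dots> = so.cl N ?X (slot m (\<lambda>a i j. letter (so_gen N i j)) a)"
  proof (rule so.cl_cong)
    fix I J assume IJ: "I \<in> ?X" "J \<in> ?X"
    have v: "?A i j I J = (if j = J a then if i = I a then if \<forall>b\<in>{1..m} - {a}. I b = J b then 1 else 0 else 0 else 0)" for i j
    proof -
      have "(\<Prod>b\<in>{1..m} - {a}. (if b = a then unit_op i j else id_op) (I b) (J b)) = (\<Prod>b\<in>{1..m} - {a}. if I b = J b then 1 else 0)"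
        by (rule prod.cong) (auto simp: id_op_def)
      also have "\<dots> = (if \<forall>b\<in>{1..m} - {a}. I b = J b then 1 else 0)" by (rule prod_indicator) simp
      finally have "?A i j I J = unit_op i j (I a) (J a) * (if \<forall>b\<in>{1..m} - {a}. I b = J b then 1 else 0)"
        unfolding tensor_ops_def prod.remove[OF finite_atLeastAtMost a] by simp
      thus ?thesis unfolding unit_op_def by auto
    qed
    have "(\<Sum>i=1..N. \<Sum>j=1..N. const (?A i j I J) * letter (so_gen N i j)) =
      (\<Sum>i=1..N. \<Sum>j=1..N. if j = J a then if i = I a then if \<forall>b\<in>{1..m} - {a}. I b = J b then letter (so_gen N i j) else 0 else 0 else 0)"
      by (intro sum.cong refl) (simp only: v if_distrib[of const] if_distribR if_distrib[of "\<lambda>x. x * letter _"] const_zero const_one mult_zero_left mult_1_left cong: if_cong)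
    also have "\<dots> = slot m (\<lambda>a i j. letter (so_gen N i j)) a I J"
      using multi_indices_in[OF IJ(1) a] multi_indices_in[OF IJ(2) a] by (simp add: sum.delta slot_def)
    finally show "(\<Sum>i=1..N. \<Sum>j=1..N. const (?A i j I J) * letter (so_gen N i j)) = slot m (\<lambda>a i j. letter (so_gen N i j)) a I J" .
  qed
  finally show ?thesis .
qed

lemma scalar_op_class:
  "scalar_op N m u = so.cl N (multi_indices N m) (\<lambda>I J. const (tensor_ops m (\<lambda>b. id_op) I J) * const u)"
  unfolding scalar_op_def env_scalar_def by (rule pure_tensor_class[OF words_in_const])

lemma factor_class:
  assumes a: "a \<in> {1..m}"
  shows "F_op N m a \<oplus>\<^bsub>env_tensor N m\<^esub> scalar_op N m (of_nat a - of_nat k)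
    = so.cl N (multi_indices N m) (slot m (shifted_gen N k) a)"
proof -
  let ?X = "multi_indices N m"
  have m1: "so.matC N ?X (slot m (\<lambda>a i j. letter (so_gen N i j)) a)"
    unfolding so.matC_def slot_def using multi_indices_in[OF _ a] by (auto intro!: words_in_letter so_gen_in)
  have m2: "so.matC N ?X (\<lambda>I J. const (tensor_ops m (\<lambda>b. id_op) I J) * const u)" for u
    unfolding so.matC_def by (simp add: words_in_mult)
  have "F_op N m a \<oplus>\<^bsub>env_tensor N m\<^esub> scalar_op N m (of_nat a - of_nat k) =
    so.cl N ?X (\<lambda>I J. slot m (\<lambda>a i j. letter (so_gen N i j)) a I J + const (tensor_ops m (\<lambda>b. id_op) I J) * const (of_nat a - of_nat k))"
    unfolding F_op_class[OF a] scalar_op_class env_tensor_def by (rule so.cl_add[OF m1 m2])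
  also have "\<dots> = so.cl N ?X (slot m (shifted_gen N k) a)"
  proof (rule so.cl_cong)
    fix I J
    have "tensor_ops m (\<lambda>b. id_op) I J = (if \<forall>b\<in>{1..m}. I b = J b then 1 else 0)"
      unfolding tensor_ops_def id_op_def by (rule prod_indicator) simp
    moreover have "(\<forall>b\<in>{1..m}. I b = J b) = ((\<forall>b\<in>{1..m} - {a}. I b = J b) \<and> I a = J a)" using a by auto
    ultimately show "slot m (\<lambda>a i j. letter (so_gen N i j)) a I J + const (tensor_ops m (\<lambda>b. id_op) I J) * const (of_nat a - of_nat k)
      = slot m (shifted_gen N k) a I J" unfolding slot_def shifted_gen_def by simp
  qed
  finally show ?thesis .
qed

definition casimir_word :: "nat \<Rightarrow> nat \<Rightarrow> complex mat free_poly" where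
  "casimir_word N k = (\<Sum>I\<in>multi_indices N (2 * k). \<Sum>K\<in>multi_indices N (2 * k).
     prod_list (map (\<lambda>a. shifted_gen N k a (I a) (K a)) [1..<2 * k + 1]) * const (antisymmetrizer (2 * k) K I))"

lemma words_in_shifted_prod:
  assumes "I \<in> multi_indices N m" "K \<in> multi_indices N m"
  shows "prod_list (map (\<lambda>a. shifted_gen N k a (I a) (K a)) [1..<m + 1]) \<in> words_in (so_algebra N)"
proof (rule words_in_prod_list)
  fix p assume "p \<in> set (map (\<lambda>a. shifted_gen N k a (I a) (K a)) [1..<m + 1])"
  then obtain a where a': "a \<in> {1..<m + 1}" "p = shifted_gen N k a (I a) (K a)"
    unfolding set_map set_upt by blast
  hence a: "a \<in> {1..m}" "p = shifted_gen N k a (I a) (K a)" by auto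
  show "p \<in> words_in (so_algebra N)"
    unfolding a(2) by (rule words_in_shifted_gen[OF multi_indices_in[OF assms(1) a(1)] multi_indices_in[OF assms(2) a(1)]])
qed

lemma words_in_casimir: "casimir_word N k \<in> words_in (so_algebra N)"
  unfolding casimir_word_def
  by (intro words_in_sum words_in_mult words_in_const) (rule words_in_shifted_prod)

lemma casimir_class: "casimir N k = env_class (so_algebra N) (casimir_word N k)"
proof -
  define m where "m = 2 * k"
  let ?X = "multi_indices N m" and ?R = "env (so_algebra N)"
  let ?M = "matrix_ring ?R ?X" and ?S = "slot m (shifted_gen N k)"
  interpret E: ring ?R by (rule so.env_ring)
  have mS: "so.matC N ?X (?S a)" if "a \<in> {1..m}" for a
    unfolding so.matC_def slot_def using multi_indices_in[OF _ that] by (auto intro!: words_in_shifted_gen)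
  have mf: "so.matC N ?X f" if fs: "f \<in> set (map ?S [1..<m + 1])" for f
  proof -
    obtain a where a: "a \<in> {1..<m + 1}" "f = ?S a" using fs unfolding set_map set_upt by blast
    show ?thesis unfolding a(2) by (rule mS) (use a in auto)
  qed
  have mP: "so.matC N ?X (env_loc.mprod ?X (map ?S [1..<m + 1]))" by (rule so.matC_mprod[OF mf])
  have op: "ordered_prod ?M (map (so.cl N ?X) (map ?S [1..<m + 1])) = so.cl N ?X (env_loc.mprod ?X (map ?S [1..<m + 1]))"
    by (rule so.cl_ordered_prod[OF finite_multi_indices mf])
  have mA: "so.matC N ?X (\<lambda>I J. const (antisymmetrizer m I J) * 1)"
    unfolding so.matC_def by simp
  have f: "map (\<lambda>i. F_op N m i \<oplus>\<^bsub>env_tensor N m\<^esub> scalar_op N m (of_nat i - of_nat k)) [1..<m + 1] =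
      map (so.cl N ?X) (map ?S [1..<m + 1])"
    unfolding map_map by (rule map_cong[OF refl]) (simp add: factor_class del: upt_Suc)
  have o: "ordered_prod (env_tensor N m) (map (\<lambda>i. F_op N m i \<oplus>\<^bsub>env_tensor N m\<^esub> scalar_op N m (of_nat i - of_nat k)) [1..<m + 1])
     = so.cl N ?X (env_loc.mprod ?X (map ?S [1..<m + 1]))"
    unfolding f unfolding env_tensor_def by (rule op)
  have t: "pure_tensor N m \<one>\<^bsub>?R\<^esub> (antisymmetrizer m) = so.cl N ?X (\<lambda>I J. const (antisymmetrizer m I J) * 1)"
    unfolding so.env_one by (rule pure_tensor_class[OF words_in_one])
  have c: "casimir N k = env_trace N m (so.cl N ?X (\<lambda>I J. \<Sum>K\<in>?X. env_loc.mprod ?X (map ?S [1..<m + 1]) I K * (const (antisymmetrizer m K J) * 1)))"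
    unfolding casimir_def m_def[symmetric] o t unfolding env_tensor_def so.cl_mult[OF finite_multi_indices mP mA] ..
  have w: "(\<Sum>K\<in>?X. env_loc.mprod ?X (map ?S [1..<m + 1]) I K * (const (antisymmetrizer m K I) * 1)) \<in> words_in (so_algebra N)" if "I \<in> ?X" for I
  proof (intro words_in_sum words_in_mult words_in_const words_in_one)
    fix K assume "K \<in> ?X"
    thus "env_loc.mprod ?X (map ?S [1..<m + 1]) I K \<in> words_in (so_algebra N)" using mP that unfolding so.matC_def by blast
  qed
  have e: "env_loc.mprod ?X (map ?S [1..<m + 1]) I K = prod_list (map (\<lambda>a. shifted_gen N k a (I a) (K a)) [1..<m + 1])"
    if "I \<in> ?X" "K \<in> ?X" for I K
    unfolding mprod_slot[of 1 m I N K "shifted_gen N k", OF order.refl le_add2 that] by (simp del: upt_Suc)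
  have "casimir N k = (\<Oplus>\<^bsub>?R\<^esub>I\<in>?X. env_class (so_algebra N) (\<Sum>K\<in>?X. env_loc.mprod ?X (map ?S [1..<m + 1]) I K * (const (antisymmetrizer m K I) * 1)))"
    unfolding c env_trace_def
  proof (rule E.finsum_cong'[OF refl Pi_I])
    fix I assume I: "I \<in> ?X"
    show "env_class (so_algebra N) (\<Sum>K\<in>?X. env_loc.mprod ?X (map ?S [1..<m + 1]) I K * (const (antisymmetrizer m K I) * 1)) \<in> carrier ?R"
      by (rule so.env_closed[OF w[OF I]])
    show "so.cl N ?X (\<lambda>I J. \<Sum>K\<in>?X. env_loc.mprod ?X (map ?S [1..<m + 1]) I K * (const (antisymmetrizer m K J) * 1)) (I, I) =
       env_class (so_algebra N) (\<Sum>K\<in>?X. env_loc.mprod ?X (map ?S [1..<m + 1]) I K * (const (antisymmetrizer m K I) * 1))"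
      using I unfolding so.cl_def by (simp only: restrict_apply mem_Sigma_iff simp_thms if_True prod.case)
  qed
  also have "\<dots> = env_class (so_algebra N) (\<Sum>I\<in>?X. \<Sum>K\<in>?X. env_loc.mprod ?X (map ?S [1..<m + 1]) I K * (const (antisymmetrizer m K I) * 1))"
    by (rule so.env_finsum[OF finite_multi_indices w])
  also have "(\<Sum>I\<in>?X. \<Sum>K\<in>?X. env_loc.mprod ?X (map ?S [1..<m + 1]) I K * (const (antisymmetrizer m K I) * 1)) = casimir_word N k"
    unfolding casimir_word_def m_def[symmetric] by (intro sum.cong refl) (simp only: e mult_1_right)
  finally show ?thesis .
qed

text \<open>Serves to extend a property from the relations to the ideal that they generate: the
  words with that property form an ideal.\<close>

lemma ideal_free_algebra:
  assumes sub: "J \<subseteq> words_in X" and zero: "0 \<in> J" and add: "\<And>p q. p \<in> J \<Longrightarrow> q \<in> J \<Longrightarrow> p + q \<in> J"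
    and um: "\<And>p. p \<in> J \<Longrightarrow> - p \<in> J" and l: "\<And>p q. p \<in> J \<Longrightarrow> q \<in> words_in X \<Longrightarrow> q * p \<in> J"
    and r: "\<And>p q. p \<in> J \<Longrightarrow> q \<in> words_in X \<Longrightarrow> p * q \<in> J"
  shows "ideal J (free_algebra X)"
proof (rule idealI[OF free_algebra_ring])
  interpret R: ring "free_algebra X" by (rule free_algebra_ring)
  show "subgroup J (add_monoid (free_algebra X))"
  proof
    fix p assume p: "p \<in> J"
    have "\<ominus>\<^bsub>free_algebra X\<^esub> p = - p"
      using p sub um by (intro R.minus_equality) auto
    thus "inv\<^bsub>add_monoid (free_algebra X)\<^esub> p \<in> J" using um[OF p] by (simp add: a_inv_def)
  qed (use sub zero add in auto)
qed (use l r in auto)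

section \<open>Automorphisms and the action of the orthogonal group\<close>

locale lie_automorphism =
  fixes g :: "complex mat set" and \<phi> \<psi> :: "complex mat \<Rightarrow> complex mat"
  assumes rel: "env_relations g \<subseteq> words_in g"
    and phi_in: "x \<in> g \<Longrightarrow> \<phi> x \<in> g" and psi_in: "x \<in> g \<Longrightarrow> \<psi> x \<in> g"
    and phi_add: "x \<in> g \<Longrightarrow> y \<in> g \<Longrightarrow> \<phi> (x + y) = \<phi> x + \<phi> y"
    and phi_smult: "x \<in> g \<Longrightarrow> \<phi> (c \<cdot>\<^sub>m x) = c \<cdot>\<^sub>m \<phi> x"
    and phi_bracket: "x \<in> g \<Longrightarrow> y \<in> g \<Longrightarrow> \<phi> (x * y - y * x) = \<phi> x * \<phi> y - \<phi> y * \<phi> x"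
begin

sublocale env_loc g by unfold_locales (rule rel)

lemma free_map_ideal: "p \<in> env_ideal g \<Longrightarrow> free_map \<phi> p \<in> env_ideal g"
proof -
  let ?J = "{p \<in> words_in g. free_map \<phi> p \<in> env_ideal g}"
  have w: "free_map \<phi> p \<in> words_in g" if "p \<in> words_in g" for p by (rule free_map_words[OF phi_in that])
  have "ideal ?J (free_algebra g)"
  proof (rule ideal_free_algebra)
    fix p q assume p: "p \<in> ?J" and q: "q \<in> words_in g"
    have "free_map \<phi> (q * p) \<in> I" "free_map \<phi> (p * q) \<in> I"
      unfolding free_map_feval const.feval_mult unfolding free_map_feval[symmetric]
      using p I_left[OF _ w[OF q]] I_right[OF _ w[OF q]] by blast+
    thus "q * p \<in> ?J" "p * q \<in> ?J" using p q by (simp_all add: words_in_mult)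
  qed (auto simp: free_map_feval const.feval_add const.feval_uminus words_in_add words_in_uminus I_zero I_add I_uminus)
  moreover have "env_relations g \<subseteq> ?J"
  proof
    fix p assume p: "p \<in> env_relations g"
    have "free_map \<phi> p \<in> env_relations g"
      using p[unfolded env_relations_def]
    proof (elim UnE CollectE exE conjE)
      fix x y assume xy: "p = letter (x + y) - letter x - letter y" "x \<in> g" "y \<in> g"
      show ?thesis
        unfolding free_map_feval xy(1) const.feval_diff const.feval_letter phi_add[OF xy(2,3)]
        by (rule env_relations_add[OF phi_in[OF xy(2)] phi_in[OF xy(3)]])
    next
      fix c x assume xy: "p = letter (c \<cdot>\<^sub>m x) - const c * letter x" "x \<in> g"
      show ?thesis
        unfolding free_map_feval xy(1) const.feval_diff const.feval_mult const.feval_const const.feval_letter phi_smult[OF xy(2)]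
        by (rule env_relations_smult[OF phi_in[OF xy(2)]])
    next
      fix x y assume xy: "p = letter x * letter y - letter y * letter x - letter (x * y - y * x)" "x \<in> g" "y \<in> g"
      show ?thesis
        unfolding free_map_feval xy(1) const.feval_diff const.feval_mult const.feval_letter phi_bracket[OF xy(2,3)]
        by (rule env_relations_bracket[OF phi_in[OF xy(2)] phi_in[OF xy(3)]])
    qed
    thus "p \<in> ?J" using p rel I_relations by blast
  qed
  ultimately have "env_ideal g \<subseteq> ?J" by (rule I_minimal)
  thus "p \<in> env_ideal g \<Longrightarrow> free_map \<phi> p \<in> env_ideal g" by blast
qed

end

text \<open>\<open>env_map\<close> takes the image of a coset, which is again a full coset only if
  phi maps the ideal onto itself. The inverse psi provides the surjectivity.\<close>

lemma env_map_class:
  assumes "lie_automorphism g \<phi> \<psi>" "lie_automorphism g \<psi> \<phi>"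
    and inv: "\<And>x. x \<in> g \<Longrightarrow> \<phi> (\<psi> x) = x" and p: "p \<in> words_in g"
  shows "env_map \<phi> (env_class g p) = env_class g (free_map \<phi> p)"
proof -
  interpret A: lie_automorphism g \<phi> \<psi> by fact
  interpret B: lie_automorphism g \<psi> \<phi> by fact
  have "free_map \<phi> ` env_ideal g = env_ideal g"
  proof
    show "free_map \<phi> ` env_ideal g \<subseteq> env_ideal g" using A.free_map_ideal by blast
    show "env_ideal g \<subseteq> free_map \<phi> ` env_ideal g"
    proof
      fix q assume q: "q \<in> env_ideal g"
      have "free_map \<phi> (free_map \<psi> q) = q" by (rule free_map_comp[where X = g and \<phi> = \<psi> and \<psi> = \<phi>, OF inv A.I_C[OF q]])
      thus "q \<in> free_map \<phi> ` env_ideal g" using B.free_map_ideal[OF q] by (metis image_eqI)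
    qed
  qed
  moreover have "free_map \<phi> ` (\<lambda>h. h + p) ` env_ideal g = (\<lambda>h. h + free_map \<phi> p) ` free_map \<phi> ` env_ideal g"
    unfolding image_image by (rule image_cong[OF refl]) (simp only: free_map_feval const.feval_add)
  ultimately show ?thesis unfolding env_map_def A.env_class_eq by (simp only:)
qed

text \<open>Gauss-Jordan elimination yields P A with P invertible. This is the identity or has a
  zero last row, and the latter contradicts the right inverse B Q of P A. With P A = 1 it follows
  that B = P.\<close>

lemma mat_right_inverse_imp_left_inverse:
  fixes A B :: "complex mat"
  assumes A: "A \<in> carrier_mat n n" and B: "B \<in> carrier_mat n n" and AB: "A * B = 1\<^sub>m n"
  shows "B * A = 1\<^sub>m n"
proof -
  note m = mult_carrier_mat
  obtain A' A'' where res: "gauss_jordan A A = (A', A'')" by force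
  obtain P where P: "P \<in> Units (ring_mat TYPE(complex) n ())" and A': "A' = P * A"
    using gauss_jordan_transform[OF A A res, of "()"] by blast
  obtain Q where PQ: "P \<in> carrier_mat n n" "Q \<in> carrier_mat n n" "P * Q = 1\<^sub>m n"
    using P unfolding Units_def ring_mat_def by auto
  have A'c: "A' \<in> carrier_mat n n" unfolding A' by (rule m[OF PQ(1) A])
  have P1: "P * A * B = P"
    unfolding assoc_mult_mat[OF PQ(1) A B] AB by (rule right_mult_one_mat[OF PQ(1)])
  have inv: "A' * (B * Q) = 1\<^sub>m n"
    unfolding assoc_mult_mat[OF A'c B PQ(2), symmetric] unfolding A' P1 by (rule PQ(3))
  have "A' = 1\<^sub>m n \<or> 0 < n \<and> row A' (n - 1) = 0\<^sub>v n"
    by (rule row_echelon_form_imp_1_or_0_row[OF A'c gauss_jordan_row_echelon[OF A res]])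
  hence "A' = 1\<^sub>m n"
  proof
    let ?n = "n - 1"
    assume z: "0 < n \<and> row A' ?n = 0\<^sub>v n"
    have n: "?n < n" using z by simp
    have "1 = 1\<^sub>m n $$ (?n, ?n)" using n by simp
    also have "\<dots> = scalar_prod (row A' ?n) (col (B * Q) ?n)"
      unfolding inv[symmetric] by (rule index_mult_mat(1)) (use n A'c PQ in auto)
    also have "\<dots> = scalar_prod (0\<^sub>v n) (col (B * Q) ?n)" using z by (simp only:)
    also have "\<dots> = 0" by (rule scalar_prod_left_zero) (use B PQ n in auto)
    finally have False by simp
    thus ?thesis ..
  qed
  hence PA: "P * A = 1\<^sub>m n" unfolding A' .
  have "B = P" using P1 unfolding PA left_mult_one_mat[OF B] .
  thus ?thesis using PA by simp
qed

lemma one_mat_ent: "i \<in> {1..N} \<Longrightarrow> j \<in> {1..N} \<Longrightarrow> ent (1\<^sub>m N) i j = (if i = j then 1 else 0)"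
  unfolding ent_def by (subst index_one_mat(1)) auto

text \<open>The adjoint with respect to the bilinear form, that is, the reflection of the matrix
  about its antidiagonal.\<close>

definition adjoint :: "nat \<Rightarrow> complex mat \<Rightarrow> complex mat" where
  "adjoint N h = mat N N (\<lambda>(r, s). ent h (flip N (s + 1)) (flip N (r + 1)))"

lemma ent_adjoint: "i \<in> {1..N} \<Longrightarrow> j \<in> {1..N} \<Longrightarrow> ent (adjoint N h) i j = ent h (flip N j) (flip N i)"
  unfolding adjoint_def ent_mat by simp

lemma adjoint_carrier: "adjoint N h \<in> carrier_mat N N" unfolding adjoint_def by simp

text \<open>The orthogonality relation, with its rows flipped, is the equation for a left inverse;
  the right inverse follows by finite dimension. The last claim evaluates the inverse that
  \<open>Ad\<close> refers to.\<close>

lemma adjoint_inverse: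
  assumes h: "h \<in> orthogonal_group N"
  shows "adjoint N h * h = 1\<^sub>m N" "h * adjoint N h = 1\<^sub>m N" "mat_inverse h = Some (adjoint N h)"
proof -
  let ?F = "form_matrix N" and ?B = "adjoint N h"
  have c: "h \<in> carrier_mat N N" and e: "transpose_mat h * ?F * h = ?F"
    using h unfolding orthogonal_group_def by auto
  have F: "?F \<in> carrier_mat N N" and T: "transpose_mat h \<in> carrier_mat N N"
    using c unfolding form_matrix_def by auto
  have eF: "ent ?F i j = (if i = flip N j then 1 else 0)" if "i \<in> {1..N}" "j \<in> {1..N}" for i j
  proof -
    have "i - 1 + 1 = i" "j - 1 + 1 = j" using that by auto
    thus ?thesis unfolding form_matrix_def ent_mat[OF that] by simp
  qed
  have eT: "ent (transpose_mat h) i j = ent h j i" if "i \<in> {1..N}" "j \<in> {1..N}" for i j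
    unfolding ent_def by (rule index_transpose_mat(1)) (use that c in auto)
  show 1: "?B * h = 1\<^sub>m N"
  proof (rule ent_ext[of _ N])
    show "?B * h \<in> carrier_mat N N" by (rule mult_carrier_mat[OF adjoint_carrier c])
    show "1\<^sub>m N \<in> carrier_mat N N" by simp
    fix q j assume qj: "q \<in> {1..N}" "j \<in> {1..N}"
    have fq: "flip N q \<in> {1..N}" by (rule flip_in[OF qj(1)])
    have i: "ent (transpose_mat h * ?F) (flip N q) p = ent h (flip N p) (flip N q)" if p: "p \<in> {1..N}" for p
    proof -
      have "ent (transpose_mat h * ?F) (flip N q) p = (\<Sum>k=1..N. ent h k (flip N q) * (if k = flip N p then 1 else 0))"
        unfolding ent_mult[OF T F fq p] by (rule sum.cong[OF refl]) (simp only: eT[OF fq] eF[OF _ p])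
      also have "\<dots> = ent h (flip N p) (flip N q)"
      proof -
        have "(\<Sum>k=1..N. ent h k (flip N q) * (if k = flip N p then 1 else 0)) =
          (\<Sum>k=1..N. if k = flip N p then ent h k (flip N q) else 0)" by (rule sum.cong[OF refl]) simp
        also have "\<dots> = ent h (flip N p) (flip N q)"
          using flip_in[OF p] unfolding sum.delta[OF finite_atLeastAtMost] by (simp only: if_True)
        finally show ?thesis .
      qed
      finally show ?thesis .
    qed
    have "ent (?B * h) q j = (\<Sum>p=1..N. ent h (flip N p) (flip N q) * ent h p j)"
      unfolding ent_mult[OF adjoint_carrier c qj] by (rule sum.cong[OF refl]) (simp only: ent_adjoint[OF qj(1)])
    also have "\<dots> = ent (transpose_mat h * ?F * h) (flip N q) j"
      unfolding ent_mult[OF mult_carrier_mat[OF T F] c fq qj(2)] by (rule sum.cong[OF refl]) (simp only: i)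
    also have "\<dots> = ent (1\<^sub>m N) q j"
    proof -
      have "(flip N q = flip N j) = (q = j)" using qj unfolding flip_def atLeastAtMost_iff by presburger
      thus ?thesis unfolding e eF[OF fq qj(2)] one_mat_ent[OF qj] by simp
    qed
    finally show "ent (?B * h) q j = ent (1\<^sub>m N) q j" .
  qed
  show 2: "h * ?B = 1\<^sub>m N" by (rule mat_right_inverse_imp_left_inverse[OF adjoint_carrier c 1])
  show "mat_inverse h = Some ?B"
  proof (cases "mat_inverse h")
    case None
    have "h \<in> Units (ring_mat TYPE(complex) N ())"
      unfolding Units_def ring_mat_def using c adjoint_carrier[of N h] 1 2 by (auto intro!: bexI[of _ ?B])
    thus ?thesis using mat_inverse(1)[OF c None, of "()"] by blast
  next
    case (Some D)
    have D: "h * D = 1\<^sub>m N" "D * h = 1\<^sub>m N" "D \<in> carrier_mat N N" using mat_inverse(2)[OF c Some] by auto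
    have "D = D * (h * ?B)" unfolding 2 using D(3) by simp
    also have "\<dots> = D * h * ?B" by (rule assoc_mult_mat[OF D(3) c adjoint_carrier, symmetric])
    also have "\<dots> = ?B" unfolding D(2) by (rule left_mult_one_mat[OF adjoint_carrier])
    finally show ?thesis using Some by simp
  qed
qed

lemma conj_mat_add:
  assumes "A \<in> carrier_mat N N" "B \<in> carrier_mat N N" "x \<in> carrier_mat N N" "y \<in> carrier_mat N N"
  shows "A * (x + y) * B = A * x * B + A * y * (B :: complex mat)"
  unfolding mult_add_distrib_mat[OF assms(1,3,4)]
  by (rule add_mult_distrib_mat[OF mult_carrier_mat[OF assms(1,3)] mult_carrier_mat[OF assms(1,4)] assms(2)])

lemma conj_mat_smult:
  assumes "A \<in> carrier_mat N N" "B \<in> carrier_mat N N" "x \<in> carrier_mat N N"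
  shows "A * (c \<cdot>\<^sub>m x) * B = c \<cdot>\<^sub>m (A * x * (B :: complex mat))"
  unfolding mult_smult_distrib[OF assms(1,3)]
  by (rule mult_smult_assoc_mat[OF mult_carrier_mat[OF assms(1,3)] assms(2)])

lemma conj_mat_mult:
  assumes A: "A \<in> carrier_mat N N" and B: "B \<in> carrier_mat N N" and x: "x \<in> carrier_mat N N" and y: "y \<in> carrier_mat N N"
    and BA: "B * A = 1\<^sub>m N"
  shows "(A * x * B) * (A * y * B) = A * (x * y) * (B :: complex mat)"
proof -
  note m = mult_carrier_mat
  have "(A * x * B) * (A * y * B) = A * x * (B * (A * y * B))" by (rule assoc_mult_mat[OF m[OF A x] B m[OF m[OF A y] B]])
  also have "B * (A * y * B) = B * A * (y * B)"
    unfolding assoc_mult_mat[OF A y B] by (rule assoc_mult_mat[OF B A m[OF y B], symmetric])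
  also have "\<dots> = y * B" unfolding BA by (rule left_mult_one_mat[OF m[OF y B]])
  also have "A * x * (y * B) = A * x * y * B" by (rule assoc_mult_mat[OF m[OF A x] y B, symmetric])
  also have "A * x * y = A * (x * y)" by (rule assoc_mult_mat[OF A x y])
  finally show ?thesis .
qed

lemma conj_mat_bracket:
  assumes A: "A \<in> carrier_mat N N" and B: "B \<in> carrier_mat N N" and x: "x \<in> carrier_mat N N" and y: "y \<in> carrier_mat N N"
    and BA: "B * A = 1\<^sub>m N"
  shows "A * (x * y - y * x) * B = (A * x * B) * (A * y * B) - (A * y * B) * (A * x * (B :: complex mat))"
  unfolding conj_mat_mult[OF A B x y BA] conj_mat_mult[OF A B y x BA]
    mult_minus_distrib_mat[OF A mult_carrier_mat[OF x y] mult_carrier_mat[OF y x]]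
  by (rule minus_mult_distrib_mat[OF mult_carrier_mat[OF A mult_carrier_mat[OF x y]] mult_carrier_mat[OF A mult_carrier_mat[OF y x]] B])

lemma ent_conj:
  assumes "A \<in> carrier_mat N N" "B \<in> carrier_mat N N" "x \<in> carrier_mat N N" "i \<in> {1..N}" "j \<in> {1..N}"
  shows "ent (A * x * B) i j = (\<Sum>q=1..N. (\<Sum>p=1..N. ent A i p * ent x p q) * ent B q j)"
  unfolding ent_mult[OF mult_carrier_mat[OF assms(1,3)] assms(2,4,5)]
  by (rule sum.cong[OF refl]) (simp only: ent_mult[OF assms(1,3,4)])

text \<open>Reflection about the antidiagonal reverses products, exchanges A with its adjoint B and
  negates x.\<close>

lemma so_conj:
  assumes c: "A \<in> carrier_mat N N" "B \<in> carrier_mat N N"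
    and adj: "\<And>i j. i \<in> {1..N} \<Longrightarrow> j \<in> {1..N} \<Longrightarrow> ent B i j = ent A (flip N j) (flip N i)"
    and x: "x \<in> so_algebra N"
  shows "A * x * B \<in> so_algebra N"
  unfolding so_algebra_iff
proof (intro conjI ballI)
  have xc: "x \<in> carrier_mat N N" by (rule so_algebra_carrier[OF x])
  show "A * x * B \<in> carrier_mat N N" by (rule mult_carrier_mat[OF mult_carrier_mat[OF c(1) xc] c(2)])
  fix i j assume ij: "i \<in> {1..N}" "j \<in> {1..N}"
  note fi = flip_in[OF ij(1)] flip_in[OF ij(2)]
  define a where "a p q = ent A (flip N j) p * ent x p q * ent B q (flip N i)" for p q
  have "ent (A * x * B) (flip N j) (flip N i) = (\<Sum>q=1..N. \<Sum>p=1..N. a p q)"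
    unfolding ent_conj[OF c xc fi(2,1)] sum_distrib_right a_def ..
  also have "\<dots> = (\<Sum>q=1..N. \<Sum>p=1..N. a (flip N p) q)"
    by (rule sum.cong[OF refl]) (rule sum_flip[symmetric])
  also have "\<dots> = (\<Sum>q=1..N. \<Sum>p=1..N. a (flip N p) (flip N q))"
    by (rule sum_flip[symmetric])
  also have "\<dots> = (\<Sum>q=1..N. \<Sum>p=1..N. - (ent A i q * ent x q p * ent B p j))"
  proof (intro sum.cong refl)
    fix p q assume pq: "p \<in> {1..N}" "q \<in> {1..N}"
    have "ent x (flip N p) (flip N q) = - ent x q p" using x pq unfolding so_algebra_iff by blast
    moreover have "ent B (flip N q) (flip N i) = ent A i q"
      unfolding adj[OF flip_in[OF pq(2)] fi(1)] flip_flip[OF ij(1)] flip_flip[OF pq(2)] ..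
    ultimately show "a (flip N p) (flip N q) = - (ent A i q * ent x q p * ent B p j)"
      unfolding a_def by (simp add: adj[OF pq(1) ij(2)])
  qed
  also have "\<dots> = - (\<Sum>p=1..N. \<Sum>q=1..N. ent A i q * ent x q p * ent B p j)"
    unfolding sum_negf by (rule arg_cong[where f = uminus]) (rule sum.swap)
  also have "\<dots> = - ent (A * x * B) i j" unfolding ent_conj[OF c xc ij] sum_distrib_right ..
  finally show "ent (A * x * B) (flip N j) (flip N i) = - ent (A * x * B) i j" .
qed

lemma conj_automorphism:
  assumes c: "A \<in> carrier_mat N N" "B \<in> carrier_mat N N"
    and adj: "\<And>i j. i \<in> {1..N} \<Longrightarrow> j \<in> {1..N} \<Longrightarrow> ent B i j = ent A (flip N j) (flip N i)"
    and BA: "B * A = 1\<^sub>m N"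
  shows "lie_automorphism (so_algebra N) (\<lambda>x. A * x * B) (\<lambda>x. B * x * A)"
proof
  have adj': "ent A i j = ent B (flip N j) (flip N i)" if ij: "i \<in> {1..N}" "j \<in> {1..N}" for i j
    unfolding adj[OF flip_in[OF ij(2)] flip_in[OF ij(1)]] flip_flip[OF ij(1)] flip_flip[OF ij(2)] ..
  fix x y :: "complex mat" and u
  assume x: "x \<in> so_algebra N"
  have xc: "x \<in> carrier_mat N N" by (rule so_algebra_carrier[OF x])
  show "A * x * B \<in> so_algebra N" by (rule so_conj[OF c adj x])
  show "B * x * A \<in> so_algebra N" by (rule so_conj[OF c(2,1) adj' x])
  show "A * (u \<cdot>\<^sub>m x) * B = u \<cdot>\<^sub>m (A * x * B)" by (rule conj_mat_smult[OF c xc])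
  assume y: "y \<in> so_algebra N"
  have yc: "y \<in> carrier_mat N N" by (rule so_algebra_carrier[OF y])
  show "A * (x + y) * B = A * x * B + A * y * B" by (rule conj_mat_add[OF c xc yc])
  show "A * (x * y - y * x) * B = (A * x * B) * (A * y * B) - (A * y * B) * (A * x * B)"
    by (rule conj_mat_bracket[OF c xc yc BA])
qed (rule so_relations)

text \<open>The tensor power of h commutes with the permutations of the tensor factors; here this is
  written in transposed form, B being inverse to h.\<close>

lemma perm_op_sum:
  assumes \<pi>: "\<pi> permutes {1..m}" and P: "P \<in> multi_indices N m" and Q: "Q \<in> multi_indices N m"
    and inv: "\<And>i j. i \<in> {1..N} \<Longrightarrow> j \<in> {1..N} \<Longrightarrow> (\<Sum>c=1..N. h i c * (B c j :: complex)) = (if i = j then 1 else 0)"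
  shows "(\<Sum>I\<in>multi_indices N m. \<Sum>K\<in>multi_indices N m.
      (\<Prod>a=1..m. h (P a) (I a) * B (K a) (Q a)) * perm_op m \<pi> K I) = perm_op m \<pi> Q P"
proof -
  let ?X = "multi_indices N m"
  have pi: "\<pi> a \<in> {1..m}" if "a \<in> {1..m}" for a using permutes_in_image[OF \<pi>] that by blast
  have ps: "(\<Sum>I\<in>?X. \<Prod>a=1..m. t a (I a)) = (\<Prod>a=1..m. \<Sum>i=1..N. t a i)" for t :: "nat \<Rightarrow> nat \<Rightarrow> complex"
    unfolding multi_indices_def by (rule prod_sum_PiE[symmetric]) auto
  have "(\<Sum>I\<in>?X. \<Sum>K\<in>?X. (\<Prod>a=1..m. h (P a) (I a) * B (K a) (Q a)) * perm_op m \<pi> K I) =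
    (\<Sum>K\<in>?X. \<Sum>I\<in>?X. (\<Prod>a=1..m. h (P a) (I a) * B (K a) (Q a)) * perm_op m \<pi> K I)" by (rule sum.swap)
  also have "\<dots> = (\<Sum>K\<in>?X. \<Prod>a=1..m. h (P a) (K (\<pi> a)) * B (K (\<pi> a)) (Q (\<pi> a)))"
  proof (rule sum.cong[OF refl])
    fix K assume K: "K \<in> ?X"
    have "(\<Sum>I\<in>?X. (\<Prod>a=1..m. h (P a) (I a) * B (K a) (Q a)) * perm_op m \<pi> K I) =
       (\<Sum>I\<in>?X. \<Prod>a=1..m. h (P a) (I a) * B (K a) (Q a) * (if K (\<pi> a) = I a then 1 else 0))"
      unfolding perm_op_def prod_indicator[OF finite_atLeastAtMost, symmetric] prod.distrib ..
    also have "\<dots> = (\<Prod>a=1..m. \<Sum>i=1..N. h (P a) i * B (K a) (Q a) * (if K (\<pi> a) = i then 1 else 0))" by (rule ps)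
    also have "\<dots> = (\<Prod>a=1..m. h (P a) (K (\<pi> a)) * B (K a) (Q a))"
    proof (rule prod.cong[OF refl])
      fix a assume a: "a \<in> {1..m}"
      have "(\<Sum>i=1..N. h (P a) i * B (K a) (Q a) * (if K (\<pi> a) = i then 1 else 0)) =
        (\<Sum>i=1..N. if i = K (\<pi> a) then h (P a) i * B (K a) (Q a) else 0)" by (rule sum.cong) auto
      thus "(\<Sum>i=1..N. h (P a) i * B (K a) (Q a) * (if K (\<pi> a) = i then 1 else 0)) = h (P a) (K (\<pi> a)) * B (K a) (Q a)"
        using multi_indices_in[OF K pi[OF a]] by simp
    qed
    also have "\<dots> = (\<Prod>a=1..m. h (P a) (K (\<pi> a))) * (\<Prod>a=1..m. B (K (\<pi> a)) (Q (\<pi> a)))"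
      unfolding prod.distrib prod.permute[OF \<pi>, of "\<lambda>a. B (K a) (Q a)"] comp_def ..
    finally show "(\<Sum>I\<in>?X. (\<Prod>a=1..m. h (P a) (I a) * B (K a) (Q a)) * perm_op m \<pi> K I) =
       (\<Prod>a=1..m. h (P a) (K (\<pi> a)) * B (K (\<pi> a)) (Q (\<pi> a)))" by (simp only: prod.distrib)
  qed
  \<comment> \<open>Renaming the position pi a to b decouples the positions, so that the sum over K
    becomes a product of sums over single indices.\<close>
  also have "\<dots> = (\<Sum>K\<in>?X. \<Prod>b=1..m. h (P (inv_into UNIV \<pi> b)) (K b) * B (K b) (Q b))"
  proof (rule sum.cong[OF refl])
    fix K
    show "(\<Prod>a=1..m. h (P a) (K (\<pi> a)) * B (K (\<pi> a)) (Q (\<pi> a))) = (\<Prod>b=1..m. h (P (inv_into UNIV \<pi> b)) (K b) * B (K b) (Q b))"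
      unfolding prod.permute[OF \<pi>, of "\<lambda>b. h (P (inv_into UNIV \<pi> b)) (K b) * B (K b) (Q b)"]
      by (simp only: comp_def permutes_inverses(2)[OF \<pi>])
  qed
  also have "\<dots> = (\<Prod>b=1..m. \<Sum>c=1..N. h (P (inv_into UNIV \<pi> b)) c * B c (Q b))" by (rule ps)
  also have "\<dots> = (\<Prod>a=1..m. \<Sum>c=1..N. h (P a) c * B c (Q (\<pi> a)))"
    unfolding prod.permute[OF \<pi>, of "\<lambda>b. \<Sum>c=1..N. h (P (inv_into UNIV \<pi> b)) c * B c (Q b)"]
    by (simp only: comp_def permutes_inverses(2)[OF \<pi>])
  also have "\<dots> = (\<Prod>a=1..m. if Q (\<pi> a) = P a then 1 else 0)"
  proof (rule prod.cong[OF refl])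
    fix a assume a: "a \<in> {1..m}"
    show "(\<Sum>c=1..N. h (P a) c * B c (Q (\<pi> a))) = (if Q (\<pi> a) = P a then 1 else 0)"
      unfolding inv[OF multi_indices_in[OF P a] multi_indices_in[OF Q pi[OF a]]] eq_commute[of "P a"] ..
  qed
  also have "\<dots> = perm_op m \<pi> Q P" unfolding perm_op_def by (rule prod_indicator) simp
  finally show ?thesis .
qed

lemma sum_swap3:
  "(\<Sum>a\<in>A. \<Sum>b\<in>B. \<Sum>c\<in>C. f a b c) = (\<Sum>c\<in>C. \<Sum>a\<in>A. \<Sum>b\<in>B. (f a b c :: 'c::comm_monoid_add))"
proof -
  have "(\<Sum>a\<in>A. \<Sum>b\<in>B. \<Sum>c\<in>C. f a b c) = (\<Sum>a\<in>A. \<Sum>c\<in>C. \<Sum>b\<in>B. f a b c)"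
    by (rule sum.cong[OF refl]) (rule sum.swap)
  also have "\<dots> = (\<Sum>c\<in>C. \<Sum>a\<in>A. \<Sum>b\<in>B. f a b c)" by (rule sum.swap)
  finally show ?thesis .
qed

lemma antisymmetrizer_sum:
  assumes P: "P \<in> multi_indices N m" and Q: "Q \<in> multi_indices N m"
    and inv: "\<And>i j. i \<in> {1..N} \<Longrightarrow> j \<in> {1..N} \<Longrightarrow> (\<Sum>c=1..N. h i c * (B c j :: complex)) = (if i = j then 1 else 0)"
  shows "(\<Sum>I\<in>multi_indices N m. \<Sum>K\<in>multi_indices N m.
      (\<Prod>a=1..m. h (P a) (I a) * B (K a) (Q a)) * antisymmetrizer m K I) = antisymmetrizer m Q P"
proof -
  let ?X = "multi_indices N m" and ?S = "{\<pi>. \<pi> permutes {1..m}}"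
  let ?t = "\<lambda>I K. \<Prod>a=1..m. h (P a) (I a) * B (K a) (Q a)"
  have "(\<Sum>I\<in>?X. \<Sum>K\<in>?X. ?t I K * antisymmetrizer m K I) =
    (\<Sum>I\<in>?X. \<Sum>K\<in>?X. \<Sum>\<pi>\<in>?S. 1 / fact m * of_int (sign \<pi>) * (?t I K * perm_op m \<pi> K I))"
    unfolding antisymmetrizer_def sum_distrib_left by (simp only: mult_ac)
  also have "\<dots> = (\<Sum>\<pi>\<in>?S. \<Sum>I\<in>?X. \<Sum>K\<in>?X. 1 / fact m * of_int (sign \<pi>) * (?t I K * perm_op m \<pi> K I))"
    by (rule sum_swap3)
  also have "\<dots> = (\<Sum>\<pi>\<in>?S. 1 / fact m * of_int (sign \<pi>) * perm_op m \<pi> Q P)"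
  proof (rule sum.cong[OF refl])
    fix \<pi> assume "\<pi> \<in> ?S"
    hence "(\<Sum>I\<in>?X. \<Sum>K\<in>?X. ?t I K * perm_op m \<pi> K I) = perm_op m \<pi> Q P"
      unfolding mem_Collect_eq by (rule perm_op_sum[OF _ P Q inv])
    thus "(\<Sum>I\<in>?X. \<Sum>K\<in>?X. 1 / fact m * of_int (sign \<pi>) * (?t I K * perm_op m \<pi> K I)) =
      1 / fact m * of_int (sign \<pi>) * perm_op m \<pi> Q P"
      unfolding sum_distrib_left[symmetric] by (simp only:)
  qed
  also have "\<dots> = antisymmetrizer m Q P"
    unfolding antisymmetrizer_def sum_distrib_left by (simp only: mult_ac)
  finally show ?thesis .
qed

text \<open>The matrix of generators is conjugated by h, and the shift, being a multiple of the
  identity matrix, is fixed by conjugation.\<close>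

lemma shifted_gen_conj:
  assumes h: "h \<in> orthogonal_group N" and ij: "i \<in> {1..N}" "j \<in> {1..N}"
  shows "so.cong_env N (free_map (Ad h) (shifted_gen N k a i j))
    (\<Sum>p=1..N. \<Sum>q=1..N. const (ent h p i * ent (adjoint N h) j q) * shifted_gen N k a p q)"
proof -
  let ?B = "adjoint N h" and ?c = "\<lambda>p q. ent h p i * ent (adjoint N h) j q"
  have c: "h \<in> carrier_mat N N" using h unfolding orthogonal_group_def by blast
  have Ad: "Ad h x = h * x * ?B" for x unfolding Ad_def adjoint_inverse(3)[OF h] by simp
  have x: "Ad h (so_gen N i j) \<in> so_algebra N"
    unfolding Ad by (rule so_conj[OF c adjoint_carrier ent_adjoint so_gen_in[OF ij]])
  have e: "ent (Ad h (so_gen N i j)) r s = (\<Sum>p=1..N. \<Sum>q=1..N. ?c p q * ent (so_gen N p q) r s)"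
    if rs: "r \<in> {1..N}" "s \<in> {1..N}" for r s
  proof -
    have "ent (Ad h (so_gen N i j)) r s =
      (\<Sum>q=1..N. \<Sum>p=1..N. ent h r p * ent ?B q s * ent (so_gen N i j) p q)"
      unfolding Ad ent_conj[OF c adjoint_carrier so_gen_carrier rs] sum_distrib_right by (simp only: mult_ac)
    also have "\<dots> = (\<Sum>p=1..N. \<Sum>q=1..N. ent h r p * ent ?B q s * ent (so_gen N i j) p q)" by (rule sum.swap)
    also have "\<dots> = (\<Sum>p=1..N. \<Sum>q=1..N. ent h r p * ent ?B q s *
        ((if p = i then if q = j then 1 else 0 else 0) - (if p = flip N j then if q = flip N i then 1 else 0 else 0)))"
    proof (intro sum.cong refl)
      fix p q assume pq: "p \<in> {1..N}" "q \<in> {1..N}"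
      have t: "(if A \<and> A' then 1 else 0) = (if A then if A' then 1 else 0 else (0::complex))" for A A' by simp
      show "ent h r p * ent ?B q s * ent (so_gen N i j) p q = ent h r p * ent ?B q s *
        ((if p = i then if q = j then 1 else 0 else 0) - (if p = flip N j then if q = flip N i then 1 else 0 else 0))"
        unfolding ent_so_gen[OF pq] t ..
    qed
    also have "\<dots> = ent h r i * ent ?B j s - ent h r (flip N j) * ent ?B (flip N i) s"
    proof -
      have d: "(\<Sum>p=1..N. \<Sum>q=1..N. y p q * (if p = a then if q = b then 1 else 0 else 0)) = y a b"
        if "a \<in> {1..N}" "b \<in> {1..N}" for y :: "nat \<Rightarrow> nat \<Rightarrow> complex" and a b
      proof -
        have "(\<Sum>p=1..N. \<Sum>q=1..N. y p q * (if p = a then if q = b then 1 else 0 else 0)) =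
          (\<Sum>p=1..N. if p = a then \<Sum>q=1..N. if q = b then y p q else 0 else 0)"
        proof (rule sum.cong[OF refl])
          fix p
          show "(\<Sum>q=1..N. y p q * (if p = a then if q = b then 1 else 0 else 0)) = (if p = a then \<Sum>q=1..N. if q = b then y p q else 0 else 0)"
          proof (cases "p = a")
            case True
            show ?thesis unfolding if_P[OF True] by (rule sum.cong[OF refl]) simp
          next
            case False
            show ?thesis unfolding if_not_P[OF False] by simp
          qed
        qed
        thus ?thesis using that by simp
      qed
      show ?thesis unfolding right_diff_distrib sum_subtractf d[OF ij] d[OF flip_in[OF ij(2)] flip_in[OF ij(1)]] ..
    qed
    also have "\<dots> = ?c r s - ?c (flip N s) (flip N r)"
      unfolding ent_adjoint[OF flip_in[OF ij(1)] rs(2)] ent_adjoint[OF ij(2) flip_in[OF rs(1)]] flip_flip[OF ij(1)] flip_flip[OF rs(1)]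
      by simp
    finally show ?thesis unfolding sum_ent_so_gen[OF rs] .
  qed
  have 1: "so.cong_env N (letter (Ad h (so_gen N i j))) (\<Sum>p=1..N. \<Sum>q=1..N. const (?c p q) * letter (so_gen N p q))"
    by (rule letter_expand[OF x e])
  have hB: "(\<Sum>p=1..N. \<Sum>q=1..N. ?c p q * (u * (if p = q then 1 else 0))) = u * (if i = j then 1 else 0)" for u
  proof -
    have "(\<Sum>p=1..N. \<Sum>q=1..N. ?c p q * (u * (if p = q then 1 else 0))) = (\<Sum>p=1..N. u * (ent ?B j p * ent h p i))"
    proof (rule sum.cong[OF refl])
      fix p assume p: "p \<in> {1..N}"
      have "(\<Sum>q=1..N. ?c p q * (u * (if p = q then 1 else 0))) = (\<Sum>q=1..N. if q = p then u * (ent ?B j q * ent h p i) else 0)"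
        by (rule sum.cong) auto
      thus "(\<Sum>q=1..N. ?c p q * (u * (if p = q then 1 else 0))) = u * (ent ?B j p * ent h p i)" using p by simp
    qed
    also have "\<dots> = u * ent (?B * h) j i"
      unfolding ent_mult[OF adjoint_carrier c ij(2,1)] sum_distrib_left ..
    finally show ?thesis unfolding adjoint_inverse(1)[OF h] one_mat_ent[OF ij(2,1)] eq_commute[of j i] .
  qed
  let ?u = "of_nat a - of_nat k :: complex"
  have "free_map (Ad h) (shifted_gen N k a i j) = letter (Ad h (so_gen N i j)) + const (?u * (if i = j then 1 else 0))"
    unfolding shifted_gen_def free_map_feval const.feval_add const.feval_letter const.feval_const ..
  moreover have sg: "(\<Sum>p=1..N. \<Sum>q=1..N. const (?c p q) * shifted_gen N k a p q) =
     (\<Sum>p=1..N. \<Sum>q=1..N. const (?c p q) * letter (so_gen N p q)) + const (?u * (if i = j then 1 else 0))"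
    unfolding shifted_gen_def distrib_left sum.distrib hB[symmetric] const_sum const_mult ..
  ultimately show ?thesis using so.cong_add[OF 1 so.cong_refl[OF words_in_const[of "?u * (if i = j then 1 else 0)"]]] by (simp only:)
qed

text \<open>The entries of h are scalars. Collected from all factors, they conjugate the
  antisymmetrizer, which commutes with the tensor power of h.\<close>

lemma casimir_word_invariant:
  assumes h: "h \<in> orthogonal_group N"
  shows "so.cong_env N (free_map (Ad h) (casimir_word N k)) (casimir_word N k)"
proof -
  define m where "m = 2 * k"
  let ?X = "multi_indices N m" and ?B = "adjoint N h"
  have c: "h \<in> carrier_mat N N" using h unfolding orthogonal_group_def by blast
  let ?G = "\<lambda>P Q. prod_list (map (\<lambda>a. shifted_gen N k a (P a) (Q a)) [1..<m + 1])"
  let ?t = "\<lambda>P Q I K. \<Prod>a=1..m. ent h (P a) (I a) * ent ?B (K a) (Q a)"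
  have ex: "prod_list (map (\<lambda>a. \<Sum>p=1..N. \<Sum>q=1..N. const (ent h p (I a) * ent ?B (K a) q) * shifted_gen N k a p q) [1..<m + 1])
     = (\<Sum>P\<in>?X. \<Sum>Q\<in>?X. const (?t P Q I K) * ?G P Q)" for I K
  proof -
    have cp: "prod_list (map (\<lambda>a. const (z a) :: complex mat free_poly) [1..<m + 1]) = const (\<Prod>a=1..m. z a)" for z
    proof -
      have "prod_list (map (\<lambda>a. const (z a) :: complex mat free_poly) xs) = const (prod_list (map z xs))" for xs
        by (induction xs) (simp_all add: const_mult)
      moreover have "prod_list (map z [1..<m + 1]) = (\<Prod>a=1..m. z a)"
        by (subst prod.distinct_set_conv_list[symmetric]) (simp_all add: atLeastLessThanSuc_atLeastAtMost del: upt_Suc)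
      ultimately show ?thesis by (simp only:)
    qed
    have "prod_list (map (\<lambda>a. const (ent h (P a) (I a) * ent ?B (K a) (Q a)) * shifted_gen N k a (P a) (Q a)) [1..<m + 1])
      = const (?t P Q I K) * ?G P Q" for P Q
    proof -
      have "prod_list (map (\<lambda>a. const (ent h (P a) (I a) * ent ?B (K a) (Q a)) * shifted_gen N k a (P a) (Q a)) [1..<m + 1])
        = prod_list (map (\<lambda>a. const (ent h (P a) (I a) * ent ?B (K a) (Q a))) [1..<m + 1]) * ?G P Q"
        by (rule prod_list_split) (rule const_central)
      thus ?thesis unfolding cp .
    qed
    thus ?thesis unfolding prod_list_sum by (simp only:)
  qed
  have step: "so.cong_env N (prod_list (map (\<lambda>a. free_map (Ad h) (shifted_gen N k a (I a) (K a))) [1..<m + 1]))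
     (\<Sum>P\<in>?X. \<Sum>Q\<in>?X. const (?t P Q I K) * ?G P Q)" if "I \<in> ?X" "K \<in> ?X" for I K
    unfolding ex[symmetric]
  proof (rule so.cong_prod_list)
    fix a assume "a \<in> set [1..<m + 1]"
    hence a: "a \<in> {1..m}" by auto
    show "so.cong_env N (free_map (Ad h) (shifted_gen N k a (I a) (K a)))
      (\<Sum>p=1..N. \<Sum>q=1..N. const (ent h p (I a) * ent ?B (K a) q) * shifted_gen N k a p q)"
      by (rule shifted_gen_conj[OF h multi_indices_in[OF that(1) a] multi_indices_in[OF that(2) a]])
  qed
  have fm: "free_map (Ad h) (casimir_word N k) = (\<Sum>I\<in>?X. \<Sum>K\<in>?X.
     prod_list (map (\<lambda>a. free_map (Ad h) (shifted_gen N k a (I a) (K a))) [1..<m + 1]) * const (antisymmetrizer m K I))"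
    unfolding casimir_word_def m_def[symmetric] free_map_feval const.feval_sum const.feval_mult const.feval_const const.feval_prod_list map_map comp_def ..
  have 1: "so.cong_env N (free_map (Ad h) (casimir_word N k))
    (\<Sum>I\<in>?X. \<Sum>K\<in>?X. (\<Sum>P\<in>?X. \<Sum>Q\<in>?X. const (?t P Q I K) * ?G P Q) * const (antisymmetrizer m K I))"
    unfolding fm by (intro so.cong_sum so.cong_mult step so.cong_refl words_in_const)
  have hB: "(\<Sum>c=1..N. ent h i c * ent ?B c j) = (if i = j then 1 else 0)" if "i \<in> {1..N}" "j \<in> {1..N}" for i j
    using ent_mult[OF c adjoint_carrier that, of h] unfolding adjoint_inverse(2)[OF h] one_mat_ent[OF that] by simp
  have "(\<Sum>I\<in>?X. \<Sum>K\<in>?X. (\<Sum>P\<in>?X. \<Sum>Q\<in>?X. const (?t P Q I K) * ?G P Q) * const (antisymmetrizer m K I)) =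
     (\<Sum>I\<in>?X. \<Sum>K\<in>?X. \<Sum>P\<in>?X. \<Sum>Q\<in>?X. ?G P Q * const (?t P Q I K * antisymmetrizer m K I))"
  proof -
    have t: "const a * g * const b = g * const (a * b)" for a b and g :: "complex mat free_poly"
    proof -
      have "const a * g = g * const a" by (rule const_central[symmetric])
      thus ?thesis by (simp only: mult.assoc const_mult)
    qed
    show ?thesis unfolding sum_distrib_right t ..
  qed
  also have "\<dots> = (\<Sum>P\<in>?X. \<Sum>I\<in>?X. \<Sum>K\<in>?X. \<Sum>Q\<in>?X. ?G P Q * const (?t P Q I K * antisymmetrizer m K I))"
    by (rule sum_swap3)
  also have "\<dots> = (\<Sum>P\<in>?X. \<Sum>Q\<in>?X. \<Sum>I\<in>?X. \<Sum>K\<in>?X. ?G P Q * const (?t P Q I K * antisymmetrizer m K I))"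
    by (rule sum.cong[OF refl]) (rule sum_swap3)
  also have "\<dots> = (\<Sum>P\<in>?X. \<Sum>Q\<in>?X. ?G P Q * const (antisymmetrizer m Q P))"
  proof (intro sum.cong refl)
    fix P Q assume PQ: "P \<in> ?X" "Q \<in> ?X"
    have "(\<Sum>I\<in>?X. \<Sum>K\<in>?X. ?t P Q I K * antisymmetrizer m K I) = antisymmetrizer m Q P"
      by (rule antisymmetrizer_sum[OF PQ hB])
    thus "(\<Sum>I\<in>?X. \<Sum>K\<in>?X. ?G P Q * const (?t P Q I K * antisymmetrizer m K I)) = ?G P Q * const (antisymmetrizer m Q P)"
      unfolding sum_distrib_left[symmetric] const_sum[symmetric] by (simp only:)
  qed
  also have "\<dots> = casimir_word N k" unfolding casimir_word_def m_def ..
  finally show ?thesis using 1 by (simp only:)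
qed

theorem casimir_invariant: "casimir N k \<in> orthogonal_invariants N"
proof -
  have "env_map (Ad h) (casimir N k) = casimir N k" if h: "h \<in> orthogonal_group N" for h
  proof -
    let ?B = "adjoint N h"
    have c: "h \<in> carrier_mat N N" using h unfolding orthogonal_group_def by blast
    have Ad: "Ad h = (\<lambda>x. h * x * ?B)" unfolding Ad_def adjoint_inverse(3)[OF h] by simp
    have adj': "ent h i j = ent ?B (flip N j) (flip N i)" if ij: "i \<in> {1..N}" "j \<in> {1..N}" for i j
      unfolding ent_adjoint[OF flip_in[OF ij(2)] flip_in[OF ij(1)]] flip_flip[OF ij(1)] flip_flip[OF ij(2)] ..
    have a: "lie_automorphism (so_algebra N) (Ad h) (\<lambda>x. ?B * x * h)"
      unfolding Ad by (rule conj_automorphism[OF c adjoint_carrier ent_adjoint adjoint_inverse(1)[OF h]])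
    have b: "lie_automorphism (so_algebra N) (\<lambda>x. ?B * x * h) (Ad h)"
      unfolding Ad by (rule conj_automorphism[OF adjoint_carrier c adj' adjoint_inverse(2)[OF h]])
    have i: "Ad h (?B * x * h) = x" if "x \<in> so_algebra N" for x
    proof -
      have x: "x \<in> carrier_mat N N" by (rule so_algebra_carrier[OF that])
      note m = mult_carrier_mat and B = adjoint_carrier[of N h]
      have "h * (?B * x * h) * ?B = h * ?B * x * h * ?B"
        unfolding assoc_mult_mat[OF B x c] assoc_mult_mat[OF c B m[OF x c], symmetric]
          assoc_mult_mat[OF m[OF c B] x c, symmetric] ..
      also have "\<dots> = h * ?B * x * (h * ?B)" by (rule assoc_mult_mat[OF m[OF m[OF c B] x] c B])
      also have "\<dots> = x" unfolding adjoint_inverse(2)[OF h] using x by simp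
      finally show ?thesis unfolding Ad .
    qed
    have "env_map (Ad h) (env_class (so_algebra N) (casimir_word N k)) = env_class (so_algebra N) (free_map (Ad h) (casimir_word N k))"
      by (rule env_map_class[OF a b i words_in_casimir])
    also have "\<dots> = env_class (so_algebra N) (casimir_word N k)"
      by (rule so.env_class_cong[OF casimir_word_invariant[OF h]])
    finally show ?thesis unfolding casimir_class .
  qed
  moreover have "casimir N k \<in> carrier (env (so_algebra N))"
    unfolding casimir_class by (rule so.env_closed[OF words_in_casimir])
  ultimately show ?thesis unfolding orthogonal_invariants_def by blast
qed

section \<open>A Fock space model\<close>

definition smul :: "complex \<Rightarrow> ('v \<Rightarrow>\<^sub>0 complex) \<Rightarrow> 'v \<Rightarrow>\<^sub>0 complex" where "smul c x = Poly_Mapping.map ((*) c) x"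

lemma lookup_smul: "Poly_Mapping.lookup (smul c x) v = c * Poly_Mapping.lookup x v"
  unfolding smul_def by (simp add: Poly_Mapping.map.rep_eq when_def)

lemma smul_simps: "smul c (x + y) = smul c x + smul c y" "smul c (- x) = - smul c x" "smul c 0 = 0"
  "smul (a + b) x = smul a x + smul b x" "smul a (smul b x) = smul (a * b) x" "smul 1 x = x" "smul 0 x = 0"
  "smul (- a) x = - smul a x"
  by (rule poly_mapping_eqI, simp add: lookup_smul lookup_add algebra_simps)+

text \<open>
  A state assigns to a set \<open>S\<close> of indices its coefficient at the ordered product of the odd generators
  in \<open>S\<close>; the generators \<open>e\<^sub>i\<close> and \<open>f\<^sub>i\<close> will have the indices \<open>2 i\<close> and \<open>2 i + 1\<close>.  Coefficients lie in a
  free vector space, since the representation space of the theorem is only a subset of its type and has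
  no scalar multiplication attached to the type.
\<close>

type_synonym 'v fock = "nat set \<Rightarrow> 'v \<Rightarrow>\<^sub>0 complex"

definition lin :: "('v fock \<Rightarrow> 'v fock) \<Rightarrow> bool" where
  "lin A \<longleftrightarrow> (\<forall>x y. A (\<lambda>S. x S + y S) = (\<lambda>S. A x S + A y S)) \<and> (\<forall>c x. A (\<lambda>S. smul c (x S)) = (\<lambda>S. smul c (A x S)))"

lemma linI: "(\<And>x y S. A (\<lambda>S. x S + y S) S = A x S + A y S) \<Longrightarrow> (\<And>c x S. A (\<lambda>S. smul c (x S)) S = smul c (A x S)) \<Longrightarrow> lin A"
  unfolding lin_def by (intro conjI allI ext)

lemma lin_addD: "lin A \<Longrightarrow> A (\<lambda>S. x S + y S) = (\<lambda>S. A x S + A y S)" unfolding lin_def by blast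
lemma lin_smulD: "lin A \<Longrightarrow> A (\<lambda>S. smul c (x S)) = (\<lambda>S. smul c (A x S))" unfolding lin_def by blast
text \<open>The locale \<open>so_fock\<close> works in a type of class \<open>ring_1\<close>, so the
  linear operators on states are made into a type.\<close>

typedef 'v fock_op = "{A :: 'v fock \<Rightarrow> 'v fock. lin A}"
  by (rule exI[of _ "\<lambda>x. x"]) (simp add: lin_def)

lemma Rep_lin: "lin (Rep_fock_op A)" using Rep_fock_op[of A] by simp

lemma Rep_Abs: "lin A \<Longrightarrow> Rep_fock_op (Abs_fock_op A) = A" by (rule Abs_fock_op_inverse) simp

lemma fock_op_eqI: "(\<And>x S. Rep_fock_op A x S = Rep_fock_op B x S) \<Longrightarrow> A = B"
  by (rule Rep_fock_op_inject[THEN iffD1]) (intro ext)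

instantiation fock_op :: (type) ring_1
begin

definition "0 = Abs_fock_op (\<lambda>x S. 0)"
definition "1 = Abs_fock_op (\<lambda>x. x)"
definition "A + B = Abs_fock_op (\<lambda>x S. Rep_fock_op A x S + Rep_fock_op B x S)"
definition "- A = Abs_fock_op (\<lambda>x S. - Rep_fock_op A x S)"
definition "A - B = Abs_fock_op (\<lambda>x S. Rep_fock_op A x S - Rep_fock_op B x S)"
definition "A * B = Abs_fock_op (\<lambda>x. Rep_fock_op A (Rep_fock_op B x))"

lemma Rep_fock_op_zero: "Rep_fock_op 0 x S = 0"
proof -
  have "lin (\<lambda>x S. 0 :: 'a \<Rightarrow>\<^sub>0 complex)" by (rule linI) (simp_all add: smul_simps)
  thus ?thesis by (simp add: zero_fock_op_def Rep_Abs)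
qed
lemma Rep_fock_op_one: "Rep_fock_op 1 x = x"
proof -
  have "lin (\<lambda>x :: 'a fock. x)" by (rule linI) simp_all
  thus ?thesis by (simp add: one_fock_op_def Rep_Abs)
qed
lemma Rep_fock_op_add: "Rep_fock_op (A + B) x S = Rep_fock_op A x S + Rep_fock_op B x S"
proof -
  have "lin (\<lambda>x S. Rep_fock_op A x S + Rep_fock_op B x S)"
    by (rule linI) (simp_all add: smul_simps lin_addD[OF Rep_lin] lin_smulD[OF Rep_lin])
  thus ?thesis by (simp add: plus_fock_op_def Rep_Abs)
qed
lemma Rep_fock_op_uminus: "Rep_fock_op (- A) x S = - Rep_fock_op A x S"
proof -
  have "lin (\<lambda>x S. - Rep_fock_op A x S)"
    by (rule linI) (simp_all add: smul_simps lin_addD[OF Rep_lin] lin_smulD[OF Rep_lin])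
  thus ?thesis by (simp add: uminus_fock_op_def Rep_Abs)
qed
lemma Rep_fock_op_diff: "Rep_fock_op (A - B) x S = Rep_fock_op A x S - Rep_fock_op B x S"
proof -
  have "smul c (x - y) = smul c x - smul c y" for c and x y :: "'a \<Rightarrow>\<^sub>0 complex"
    using smul_simps(1)[of c x "- y"] by (simp add: smul_simps(2))
  hence "lin (\<lambda>x S. Rep_fock_op A x S - Rep_fock_op B x S)"
    by (intro linI) (simp_all add: lin_addD[OF Rep_lin] lin_smulD[OF Rep_lin])
  thus ?thesis by (simp add: minus_fock_op_def Rep_Abs)
qed
lemma Rep_fock_op_mult: "Rep_fock_op (A * B) x = Rep_fock_op A (Rep_fock_op B x)"
proof -
  have "lin (\<lambda>x. Rep_fock_op A (Rep_fock_op B x))"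
    by (rule linI) (simp_all add: lin_addD[OF Rep_lin] lin_smulD[OF Rep_lin])
  thus ?thesis by (simp add: times_fock_op_def Rep_Abs)
qed

lemmas Rep_fock_op_simps = Rep_fock_op_zero Rep_fock_op_one Rep_fock_op_add Rep_fock_op_uminus Rep_fock_op_diff Rep_fock_op_mult

instance
proof
  fix A B C :: "'a fock_op"
  show "(0 :: 'a fock_op) \<noteq> 1"
  proof
    assume "(0 :: 'a fock_op) = 1"
    \<comment> \<open>\<open>undefined\<close> serves as a basis vector of the free vector space, so
      the two operators differ on a state with this nonzero constant value.\<close>
    hence "Rep_fock_op 0 (\<lambda>S. Poly_Mapping.single undefined 1) {} = Rep_fock_op (1 :: 'a fock_op) (\<lambda>S. Poly_Mapping.single undefined 1) {}"
      by simp
    hence "(0 :: 'a \<Rightarrow>\<^sub>0 complex) = Poly_Mapping.single undefined 1" by (simp add: Rep_fock_op_simps)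
    thus False by (metis lookup_single_eq lookup_zero zero_neq_one)
  qed
  show "A * (B + C) = A * B + A * C"
  proof (rule fock_op_eqI)
    fix x S
    have "Rep_fock_op (B + C) x = (\<lambda>S. Rep_fock_op B x S + Rep_fock_op C x S)" by (rule ext) (rule Rep_fock_op_add)
    thus "Rep_fock_op (A * (B + C)) x S = Rep_fock_op (A * B + A * C) x S"
      by (simp add: Rep_fock_op_mult Rep_fock_op_add lin_addD[OF Rep_lin])
  qed
qed (rule fock_op_eqI, simp add: Rep_fock_op_simps add_ac)+

end

lemma Rep_fock_op_sum: "Rep_fock_op (\<Sum>i\<in>A. h i) x S = (\<Sum>i\<in>A. Rep_fock_op (h i) x S)"
  by (induction A rule: infinite_finite_induct) (simp_all add: Rep_fock_op_simps)

definition scal :: "complex \<Rightarrow> 'v fock_op" where "scal c = Abs_fock_op (\<lambda>x S. smul c (x S))"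

lemma Rep_scal: "Rep_fock_op (scal c) x S = smul c (x S)"
proof -
  have "lin (\<lambda>x :: 'a fock. \<lambda>S. smul c (x S))" by (rule linI) (simp_all add: smul_simps mult.commute)
  thus ?thesis by (simp add: scal_def Rep_Abs)
qed

lemma scalars_scal: "scalars scal"
proof
  fix a b :: complex and x :: "'a fock_op"
  show "scal (a + b) = (scal a + scal b :: 'a fock_op)" by (rule fock_op_eqI) (simp add: Rep_scal Rep_fock_op_simps smul_simps)
  show "scal (a * b) = (scal a * scal b :: 'a fock_op)" by (rule fock_op_eqI) (simp add: Rep_scal Rep_fock_op_simps smul_simps)
  show "scal 1 = (1 :: 'a fock_op)" by (rule fock_op_eqI) (simp add: Rep_scal Rep_fock_op_simps smul_simps)
  show "x * scal a = scal a * x"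
  proof (rule fock_op_eqI)
    fix w :: "'a fock" and S
    have "Rep_fock_op (scal a) w = (\<lambda>S. smul a (w S))" by (rule ext) (rule Rep_scal)
    thus "Rep_fock_op (x * scal a) w S = Rep_fock_op (scal a * x) w S"
      by (simp add: Rep_fock_op_mult Rep_scal lin_smulD[OF Rep_lin])
  qed
qed

text \<open>The sign of moving generator i past the smaller ones in S. Only finitely many indices
  are smaller, so it behaves well for infinite S too.\<close>

definition sg :: "nat set \<Rightarrow> nat \<Rightarrow> complex" where "sg S i = (- 1) ^ card {j \<in> S. j < i}"

lemma sg_sq [simp]: "sg S i * sg S i = 1"
  unfolding sg_def by (simp flip: power_mult_distrib)

lemma sg_insert:
  assumes "i \<notin> S" shows "sg (insert i S) j = (if i < j then - sg S j else sg S j)"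
proof (cases "i < j")
  case True
  have f: "finite {k \<in> S. k < j}" by (rule finite_subset[of _ "{..<j}"]) auto
  have "{k \<in> insert i S. k < j} = insert i {k \<in> S. k < j}" using True by auto
  thus ?thesis using f assms True unfolding sg_def by simp
next
  case False
  hence "{k \<in> insert i S. k < j} = {k \<in> S. k < j}" by auto
  thus ?thesis using False unfolding sg_def by simp
qed

lemma sg_remove: "i \<in> S \<Longrightarrow> sg (S - {i}) j = (if i < j then - sg S j else sg S j)"
  using sg_insert[of i "S - {i}" j] by (simp add: insert_absorb split: if_splits)

text \<open>Multiplication by generator i from the left, seen on coefficients: the new coefficient
  at S is the old one at S without i.\<close>

definition crea :: "nat \<Rightarrow> 'v fock_op" where
  "crea i = Abs_fock_op (\<lambda>x S. if i \<in> S then smul (sg S i) (x (S - {i})) else 0)"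

definition anni :: "nat \<Rightarrow> 'v fock_op" where
  "anni i = Abs_fock_op (\<lambda>x S. if i \<notin> S then smul (sg S i) (x (insert i S)) else 0)"

lemma Rep_crea: "Rep_fock_op (crea i) x S = (if i \<in> S then smul (sg S i) (x (S - {i})) else 0)"
proof -
  have "lin (\<lambda>x :: 'a fock. \<lambda>S. if i \<in> S then smul (sg S i) (x (S - {i})) else 0)"
    by (rule linI) (simp_all add: smul_simps mult.commute)
  thus ?thesis by (simp add: crea_def Rep_Abs)
qed

lemma Rep_anni: "Rep_fock_op (anni i) x S = (if i \<notin> S then smul (sg S i) (x (insert i S)) else 0)"
proof -
  have "lin (\<lambda>x :: 'a fock. \<lambda>S. if i \<notin> S then smul (sg S i) (x (insert i S)) else 0)"
    by (rule linI) (simp_all add: smul_simps mult.commute)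
  thus ?thesis by (simp add: anni_def Rep_Abs)
qed

lemma crea_sq: "crea i * crea i = 0"
  by (rule fock_op_eqI) (simp add: Rep_fock_op_simps Rep_crea smul_simps)

lemma crea_anticomm: "crea i * crea j = - (crea j * crea i :: 'v fock_op)"
proof (cases "i = j")
  case True thus ?thesis by (simp add: crea_sq)
next
  case False
  show ?thesis
  proof (rule fock_op_eqI)
    fix x :: "'v fock" and S
    show "Rep_fock_op (crea i * crea j) x S = Rep_fock_op (- (crea j * crea i)) x S"
    proof (cases "i \<in> S \<and> j \<in> S")
      case True
      have s: "sg S i * sg (S - {i}) j = - (sg S j * sg (S - {j}) i)"
        using True False by (simp add: sg_remove)
      have "S - {i} - {j} = S - {j} - {i}" by auto
      thus ?thesis using True False s by (simp add: Rep_fock_op_simps Rep_crea smul_simps)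
    qed (use False in \<open>auto simp: Rep_fock_op_simps Rep_crea smul_simps\<close>)
  qed
qed

lemma anni_crea: "anni i * crea j = (if i = j then 1 else 0) - crea j * (anni i :: 'v fock_op)"
proof (rule fock_op_eqI)
  fix x :: "'v fock" and S
  show "Rep_fock_op (anni i * crea j) x S = Rep_fock_op ((if i = j then 1 else 0) - crea j * anni i) x S"
  proof (cases "i = j")
    case True
    have a: "insert j (S - {j}) = S" if "j \<in> S" using that by auto
    have b: "insert j S - {j} = S" if "j \<notin> S" using that by auto
    show ?thesis
      by (cases "j \<in> S")
        (simp_all add: True Rep_fock_op_simps Rep_crea Rep_anni smul_simps sg_insert sg_remove a b insert_absorb)
  next
    case False
    have s: "sg S i * sg (insert i S) j = - (sg S j * sg (S - {j}) i)" if "i \<notin> S" "j \<in> S"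
      using that False by (simp add: sg_remove sg_insert)
    have "insert i S - {j} = insert i (S - {j})" using False by auto
    thus ?thesis using False s
      by (cases "i \<in> S"; cases "j \<in> S") (simp_all add: Rep_fock_op_simps Rep_crea Rep_anni smul_simps)
  qed
qed

definition lin_map :: "(('v \<Rightarrow>\<^sub>0 complex) \<Rightarrow> 'v \<Rightarrow>\<^sub>0 complex) \<Rightarrow> bool" where
  "lin_map t \<longleftrightarrow> (\<forall>x y. t (x + y) = t x + t y) \<and> (\<forall>c x. t (smul c x) = smul c (t x))"

text \<open>The value 0 for maps that are not linear lets the commutation with \<open>crea\<close>
  and \<open>anni\<close> hold for every t.\<close>

definition lift_op :: "(('v \<Rightarrow>\<^sub>0 complex) \<Rightarrow> 'v \<Rightarrow>\<^sub>0 complex) \<Rightarrow> 'v fock_op" where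
  "lift_op t = (if lin_map t then Abs_fock_op (\<lambda>x S. t (x S)) else 0)"

lemma Rep_lift_op: "lin_map t \<Longrightarrow> Rep_fock_op (lift_op t) x S = t (x S)"
proof -
  assume t: "lin_map t"
  have "lin (\<lambda>x S. t (x S))" using t unfolding lin_map_def by (intro linI) blast+
  thus ?thesis using t by (simp add: lift_op_def Rep_Abs)
qed

lemma lin_map_zero: "lin_map t \<Longrightarrow> t 0 = 0"
  unfolding lin_map_def by (metis smul_simps(7))

lemma lift_op_crea: "lift_op t * crea i = crea i * lift_op t"
proof (cases "lin_map t")
  case True
  hence "t (smul c x) = smul c (t x)" for c x unfolding lin_map_def by blast
  thus ?thesis
    by (intro fock_op_eqI) (simp add: Rep_fock_op_simps Rep_crea Rep_lift_op[OF True] lin_map_zero[OF True])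
qed (simp add: lift_op_def)

lemma lift_op_anni: "lift_op t * anni i = anni i * lift_op t"
proof (cases "lin_map t")
  case True
  hence "t (smul c x) = smul c (t x)" for c x unfolding lin_map_def by blast
  thus ?thesis
    by (intro fock_op_eqI) (simp add: Rep_fock_op_simps Rep_anni Rep_lift_op[OF True] lin_map_zero[OF True])
qed (simp add: lift_op_def)

definition vac :: "('v \<Rightarrow>\<^sub>0 complex) \<Rightarrow> 'v fock" where "vac u S = (if S = {} then u else 0)"

lemma anni_vac: "Rep_fock_op (anni i) (vac u) S = 0"
  by (simp add: Rep_anni vac_def smul_simps)

lemma lift_op_vac: "lin_map t \<Longrightarrow> Rep_fock_op (lift_op t) (vac u) = vac (t u)"
  by (rule ext) (simp add: Rep_lift_op vac_def lin_map_zero)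

lemma scal_vac: "Rep_fock_op (scal c) (vac u) = vac (smul c u)"
  by (rule ext) (simp add: Rep_scal vac_def smul_simps)

text \<open>Provides the ideal L of the abstract computation; w will be a vector of the
  representation placed in the vacuum.\<close>

lemma left_ideal_annihilator: "left_ideal {A. \<forall>S. Rep_fock_op A w S = 0}"
proof
  fix A B :: "'a fock_op" assume a: "A \<in> {A. \<forall>S. Rep_fock_op A w S = 0}"
  have z: "Rep_fock_op B (\<lambda>S. 0) S = 0" for S
    using lin_smulD[OF Rep_lin[of B], of 0 "\<lambda>S. 0"] by (simp add: smul_simps fun_eq_iff)
  have "Rep_fock_op A w = (\<lambda>S. 0)" using a by auto
  thus "B * A \<in> {A. \<forall>S. Rep_fock_op A w S = 0}" by (simp add: Rep_fock_op_mult z)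
qed (simp_all add: Rep_fock_op_simps)

section \<open>Highest weight representations\<close>

interpretation scal: scalars "scal :: complex \<Rightarrow> 'v fock_op" by (rule scalars_scal)

text \<open>The basis B of V serves to carry vectors over to coordinates in the free vector space on
  which Fock space is built.\<close>

locale so_rep = vector_space scale for scale :: "complex \<Rightarrow> 'v::ab_group_add \<Rightarrow> 'v" +
  fixes N :: nat and V B :: "'v set" and \<rho> :: "complex mat \<Rightarrow> 'v \<Rightarrow> 'v"
  assumes rep: "lie_representation (so_algebra N) scale V \<rho>"
    and basis: "B \<subseteq> V" "independent B" "V \<subseteq> span B"
begin

lemma V_sub: "subspace V" using rep unfolding lie_representation_def by blast
lemma rho_in: "x \<in> so_algebra N \<Longrightarrow> v \<in> V \<Longrightarrow> \<rho> x v \<in> V" using rep unfolding lie_representation_def by blast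
lemma rho_add: "x \<in> so_algebra N \<Longrightarrow> v \<in> V \<Longrightarrow> w \<in> V \<Longrightarrow> \<rho> x (v + w) = \<rho> x v + \<rho> x w"
  using rep unfolding lie_representation_def by blast
lemma rho_scale: "x \<in> so_algebra N \<Longrightarrow> v \<in> V \<Longrightarrow> \<rho> x (scale c v) = scale c (\<rho> x v)"
  using rep unfolding lie_representation_def by blast
lemma rho_plus: "x \<in> so_algebra N \<Longrightarrow> y \<in> so_algebra N \<Longrightarrow> v \<in> V \<Longrightarrow> \<rho> (x + y) v = \<rho> x v + \<rho> y v"
  using rep unfolding lie_representation_def by blast
lemma rho_smult: "x \<in> so_algebra N \<Longrightarrow> v \<in> V \<Longrightarrow> \<rho> (c \<cdot>\<^sub>m x) v = scale c (\<rho> x v)"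
  using rep unfolding lie_representation_def by blast
lemma rho_bracket: "x \<in> so_algebra N \<Longrightarrow> y \<in> so_algebra N \<Longrightarrow> v \<in> V \<Longrightarrow> \<rho> (x * y - y * x) v = \<rho> x (\<rho> y v) - \<rho> y (\<rho> x v)"
  using rep unfolding lie_representation_def by blast

definition coords :: "'v \<Rightarrow> 'v \<Rightarrow>\<^sub>0 complex" where "coords v = Abs_poly_mapping (representation B v)"

text \<open>Dropping the coordinates outside B makes this a linear map on the whole free vector
  space with values in V.\<close>

definition vect :: "('v \<Rightarrow>\<^sub>0 complex) \<Rightarrow> 'v" where
  "vect u = (\<Sum>b\<in>Poly_Mapping.keys u \<inter> B. scale (Poly_Mapping.lookup u b) b)"

lemma lookup_coords: "Poly_Mapping.lookup (coords v) = representation B v"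
  unfolding coords_def by (rule Abs_poly_mapping_inverse) (simp add: finite_representation)

lemma in_span: "v \<in> V \<Longrightarrow> v \<in> span B" using basis by blast

lemma coords_add: "v \<in> V \<Longrightarrow> w \<in> V \<Longrightarrow> coords (v + w) = coords v + coords w"
  by (rule poly_mapping_eqI) (simp add: lookup_coords lookup_add representation_add[OF basis(2) in_span in_span])

lemma coords_scale: "v \<in> V \<Longrightarrow> coords (scale c v) = smul c (coords v)"
  by (rule poly_mapping_eqI) (simp add: lookup_coords lookup_smul representation_scale[OF basis(2) in_span])

lemma coords_zero: "coords 0 = 0"
  by (rule poly_mapping_eqI) (simp add: lookup_coords representation_zero)

lemma coords_sum: "(\<And>i. i \<in> A \<Longrightarrow> h i \<in> V) \<Longrightarrow> coords (\<Sum>i\<in>A. h i) = (\<Sum>i\<in>A. coords (h i))"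
proof (induction A rule: infinite_finite_induct)
  case (insert a A)
  have "(\<Sum>i\<in>A. h i) \<in> V" by (rule subspace_sum[OF V_sub]) (use insert in auto)
  thus ?case using insert by (simp add: coords_add)
qed (simp_all add: coords_zero)

lemma vect_superset:
  "finite A \<Longrightarrow> Poly_Mapping.keys u \<subseteq> A \<Longrightarrow> vect u = (\<Sum>b\<in>A \<inter> B. scale (Poly_Mapping.lookup u b) b)"
  unfolding vect_def by (rule sum.mono_neutral_left) (auto simp: in_keys_iff)

lemma vect_add: "vect (u + w) = vect u + vect w"
proof -
  let ?A = "Poly_Mapping.keys u \<union> Poly_Mapping.keys w"
  have f: "finite ?A" by simp
  show ?thesis
    unfolding vect_superset[OF f Un_upper1] vect_superset[OF f Un_upper2] vect_superset[OF f Poly_Mapping.keys_add]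
    by (simp add: lookup_add scale_left_distrib sum.distrib)
qed

lemma vect_smul: "vect (smul c u) = scale c (vect u)"
proof -
  have k: "Poly_Mapping.keys (smul c u) \<subseteq> Poly_Mapping.keys u" by (auto simp: in_keys_iff lookup_smul)
  show ?thesis
    unfolding vect_superset[OF finite_keys k] unfolding vect_def scale_sum_right by (simp add: lookup_smul)
qed

lemma vect_in: "vect u \<in> V"
  unfolding vect_def by (rule subspace_sum[OF V_sub], rule subspace_scale[OF V_sub]) (use basis in auto)

lemma vect_coords: "v \<in> V \<Longrightarrow> vect (coords v) = v"
proof -
  assume v: "v \<in> V"
  have "Poly_Mapping.keys (coords v) \<inter> B = {b. representation B v b \<noteq> 0}"
    using representation_ne_zero by (auto simp: in_keys_iff lookup_coords)
  thus ?thesis unfolding vect_def by (simp add: lookup_coords sum_nonzero_representation_eq[OF basis(2) in_span[OF v]])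
qed

definition theta :: "complex mat \<Rightarrow> ('v \<Rightarrow>\<^sub>0 complex) \<Rightarrow> 'v \<Rightarrow>\<^sub>0 complex" where
  "theta x u = coords (\<rho> x (vect u))"

lemma lin_theta: "x \<in> so_algebra N \<Longrightarrow> lin_map (theta x)"
  unfolding lin_map_def theta_def
  by (simp add: vect_add vect_smul rho_add rho_scale vect_in coords_add coords_scale rho_in)

definition rep_op :: "complex mat \<Rightarrow> 'v fock_op" where "rep_op x = lift_op (theta x)"

lemma Rep_rep_op: "x \<in> so_algebra N \<Longrightarrow> Rep_fock_op (rep_op x) w S = theta x (w S)"
  unfolding rep_op_def by (rule Rep_lift_op[OF lin_theta])

lemma rep_op_vac: "x \<in> so_algebra N \<Longrightarrow> v \<in> V \<Longrightarrow> Rep_fock_op (rep_op x) (vac (coords v)) = vac (coords (\<rho> x v))"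
  unfolding rep_op_def by (simp add: lift_op_vac lin_theta theta_def vect_coords)

lemma rep_op_add: "x \<in> so_algebra N \<Longrightarrow> y \<in> so_algebra N \<Longrightarrow> rep_op (x + y) = rep_op x + rep_op y"
  by (rule fock_op_eqI)
    (simp add: Rep_fock_op_simps Rep_rep_op so_add theta_def rho_plus vect_in coords_add rho_in)

lemma rep_op_smult: "x \<in> so_algebra N \<Longrightarrow> rep_op (c \<cdot>\<^sub>m x) = scal c * rep_op x"
  by (rule fock_op_eqI)
    (simp add: Rep_fock_op_simps Rep_rep_op Rep_scal so_smult theta_def rho_smult vect_in coords_scale rho_in)

lemma coords_diff: "v \<in> V \<Longrightarrow> w \<in> V \<Longrightarrow> coords (v - w) = coords v - coords w"
  using coords_add[of v "scale (- 1) w"] coords_scale[of w "- 1"] subspace_scale[OF V_sub, of w "- 1"]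
  by (simp add: smul_simps)

lemma rep_op_bracket:
  assumes "x \<in> so_algebra N" "y \<in> so_algebra N"
  shows "rep_op (x * y - y * x) = rep_op x * rep_op y - rep_op y * rep_op x"
  using assms by (intro fock_op_eqI)
    (simp add: Rep_fock_op_simps Rep_rep_op so_bracket theta_def rho_bracket vect_in coords_diff rho_in vect_coords)

abbreviation "ev \<equiv> feval scal rep_op"

text \<open>The kernel of \<open>ev\<close> is an ideal, and it contains the relations because
  \<open>rep_op\<close> respects sums, scalar multiples and brackets.\<close>

lemma ev_ideal: "p \<in> env_ideal (so_algebra N) \<Longrightarrow> ev p = 0"
proof -
  let ?J = "{p \<in> words_in (so_algebra N). ev p = 0}"
  have "ideal ?J (free_algebra (so_algebra N))"
  proof (rule ideal_free_algebra)
    fix p q assume p: "p \<in> ?J" and q: "q \<in> words_in (so_algebra N)"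
    have "ev (q * p) = 0" "ev (p * q) = 0" using p by (simp_all add: scal.feval_mult)
    thus "q * p \<in> ?J" "p * q \<in> ?J" using p q by (simp_all add: words_in_mult)
  qed (auto simp: scal.feval_add scal.feval_uminus words_in_add words_in_uminus)
  moreover have "env_relations (so_algebra N) \<subseteq> ?J"
  proof
    fix p assume p: "p \<in> env_relations (so_algebra N)"
    have "ev p = 0"
      using p[unfolded env_relations_def]
    proof (elim UnE CollectE exE conjE)
      fix x y assume xy: "p = letter (x + y) - letter x - letter y" "x \<in> so_algebra N" "y \<in> so_algebra N"
      show ?thesis unfolding xy(1) scal.feval_diff scal.feval_letter rep_op_add[OF xy(2,3)] by simp
    next
      fix c x assume xy: "p = letter (c \<cdot>\<^sub>m x) - const c * letter x" "x \<in> so_algebra N"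
      show ?thesis
        unfolding xy(1) scal.feval_diff scal.feval_mult scal.feval_const scal.feval_letter rep_op_smult[OF xy(2)] by simp
    next
      fix x y assume xy: "p = letter x * letter y - letter y * letter x - letter (x * y - y * x)" "x \<in> so_algebra N" "y \<in> so_algebra N"
      show ?thesis
        unfolding xy(1) scal.feval_diff scal.feval_mult scal.feval_letter rep_op_bracket[OF xy(2,3)] by simp
    qed
    thus "p \<in> ?J" using p so_relations by blast
  qed
  ultimately have "env_ideal (so_algebra N) \<subseteq> ?J" by (rule so.I_minimal)
  thus "p \<in> env_ideal (so_algebra N) \<Longrightarrow> ev p = 0" by blast
qed

lemma word_vac:
  assumes "set ws \<subseteq> so_algebra N" "v \<in> V"
  shows "foldr \<rho> ws v \<in> V \<and> Rep_fock_op (prod_list (map rep_op ws)) (vac (coords v)) = vac (coords (foldr \<rho> ws v))"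
  using assms(1) by (induction ws) (simp_all add: assms(2) Rep_fock_op_simps rho_in rep_op_vac)

lemma ev_vac:
  assumes p: "p \<in> words_in (so_algebra N)" and v: "v \<in> V"
  shows "free_action scale \<rho> p v \<in> V"
    and "Rep_fock_op (ev p) (vac (coords v)) = vac (coords (free_action scale \<rho> p v))"
proof -
  have w: "foldr \<rho> (letters w) v \<in> V"
    "Rep_fock_op (prod_list (map rep_op (letters w))) (vac (coords v)) = vac (coords (foldr \<rho> (letters w) v))"
    if "w \<in> Poly_Mapping.keys p" for w
    using word_vac[OF _ v, of "letters w"] p that unfolding words_in_def by blast+
  have i: "scale (Poly_Mapping.lookup p w) (foldr \<rho> (letters w) v) \<in> V" if "w \<in> Poly_Mapping.keys p" for w
    by (rule subspace_scale[OF V_sub w(1)[OF that]])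
  show "free_action scale \<rho> p v \<in> V"
    unfolding free_action_def by (rule subspace_sum[OF V_sub i])
  have vs': "vac (\<Sum>i\<in>A. h i) S = (\<Sum>i\<in>A. vac (h i) S)" for A S and h :: "complex mat fmon \<Rightarrow> 'v \<Rightarrow>\<^sub>0 complex"
    by (simp add: vac_def)
  show "Rep_fock_op (ev p) (vac (coords v)) = vac (coords (free_action scale \<rho> p v))"
  proof
    fix S
    have "Rep_fock_op (ev p) (vac (coords v)) S =
      (\<Sum>w\<in>Poly_Mapping.keys p. vac (coords (scale (Poly_Mapping.lookup p w) (foldr \<rho> (letters w) v))) S)"
      unfolding feval_def Rep_fock_op_sum
      by (rule sum.cong[OF refl]) (simp add: Rep_fock_op_mult w scal_vac coords_scale)
    also have "\<dots> = vac (coords (free_action scale \<rho> p v)) S"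
    proof -
      have "coords (free_action scale \<rho> p v) =
        (\<Sum>w\<in>Poly_Mapping.keys p. coords (scale (Poly_Mapping.lookup p w) (foldr \<rho> (letters w) v)))"
        unfolding free_action_def by (rule coords_sum[OF i])
      thus ?thesis by (simp only: vs')
    qed
    finally show "Rep_fock_op (ev p) (vac (coords v)) S = vac (coords (free_action scale \<rho> p v)) S" .
  qed
qed

lemma vac_coords_inj: "v \<in> V \<Longrightarrow> w \<in> V \<Longrightarrow> vac (coords v) = vac (coords w) \<Longrightarrow> v = w"
proof -
  assume v: "v \<in> V" "w \<in> V" "vac (coords v) = vac (coords w)"
  have "coords v = coords w" using fun_cong[OF v(3), of "{}"] by (simp add: vac_def)
  thus "v = w" using vect_coords v by metis
qed

text \<open>All representatives act alike, because \<open>ev\<close> kills the ideal and a vector of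
  V is determined by its vacuum state. This makes \<open>the_elem\<close> meaningful.\<close>

lemma env_action_class:
  assumes p: "p \<in> words_in (so_algebra N)" and v: "v \<in> V"
  shows "env_action scale \<rho> (env_class (so_algebra N) p) v = free_action scale \<rho> p v"
proof -
  have "free_action scale \<rho> (h + p) v = free_action scale \<rho> p v" if h: "h \<in> env_ideal (so_algebra N)" for h
  proof -
    have w: "h + p \<in> words_in (so_algebra N)" by (rule words_in_add[OF so.I_C[OF h] p])
    have "ev (h + p) = ev p" by (simp add: scal.feval_add ev_ideal[OF h])
    hence "vac (coords (free_action scale \<rho> (h + p) v)) = vac (coords (free_action scale \<rho> p v))"
      using ev_vac(2)[OF w v] ev_vac(2)[OF p v] by simp
    thus ?thesis by (rule vac_coords_inj[OF ev_vac(1)[OF w v] ev_vac(1)[OF p v]])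
  qed
  hence "(\<lambda>p. free_action scale \<rho> p v) ` env_class (so_algebra N) p = {free_action scale \<rho> p v}"
    unfolding so.env_class_eq image_image using so.I_zero[of N] by auto
  thus ?thesis unfolding env_action_def by simp
qed

text \<open>Zero outside the index range, where \<open>so_gen\<close> need not lie in the
  algebra.\<close>

definition Fop :: "nat \<Rightarrow> nat \<Rightarrow> 'v fock_op" where
  "Fop i j = (if i \<in> {1..N} \<and> j \<in> {1..N} then rep_op (so_gen N i j) else 0)"

lemma Fop_in: "i \<in> {1..N} \<Longrightarrow> j \<in> {1..N} \<Longrightarrow> Fop i j = rep_op (so_gen N i j)" unfolding Fop_def by simp

lemma Fop_crea: "Fop k l * crea i = crea i * Fop k l" unfolding Fop_def rep_op_def by (simp add: lift_op_crea)
lemma Fop_anni: "Fop k l * anni i = anni i * Fop k l" unfolding Fop_def rep_op_def by (simp add: lift_op_anni)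

lemma scal_if: "scal (if P then 1 else 0) * x = (if P then x else 0)" "scal (if P then - 1 else 0) * x = (if P then - x else 0)"
  for x :: "'v fock_op"
proof -
  have z: "scal 0 = (0 :: 'v fock_op)" by (rule scal.s_zero)
  have "scal (- 1 + 1) = scal (- 1) + (scal 1 :: 'v fock_op)" by (rule scal.s_add)
  hence "scal (- 1) + 1 = (0 :: 'v fock_op)" unfolding add.left_inverse z scal.s_one by (rule sym)
  hence m: "scal (- 1) = (- 1 :: 'v fock_op)" by (rule eq_neg_iff_add_eq_0[THEN iffD2])
  show "scal (if P then 1 else 0) * x = (if P then x else 0)" "scal (if P then - 1 else 0) * x = (if P then - x else 0)"
    by (simp_all add: z m scal.s_one)
qed

lemma Fop_skew:
  assumes ij: "i \<in> {1..N}" "j \<in> {1..N}" shows "Fop (flip N j) (flip N i) = - Fop i j"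
proof -
  have "so_gen N (flip N j) (flip N i) = (- 1) \<cdot>\<^sub>m so_gen N i j"
  proof (rule ent_ext[of _ N])
    fix p q assume pq: "p \<in> {1..N}" "q \<in> {1..N}"
    show "ent (so_gen N (flip N j) (flip N i)) p q = ent ((- 1) \<cdot>\<^sub>m so_gen N i j) p q"
      unfolding ent_smult[OF so_gen_carrier pq] ent_so_gen[OF pq] flip_flip[OF ij(1)] flip_flip[OF ij(2)]
      by (simp only: mult_minus_left mult_1_left minus_diff_eq)
  qed (rule so_gen_carrier, rule smult_carrier_mat[OF so_gen_carrier])
  thus ?thesis
    unfolding Fop_in[OF ij] Fop_in[OF flip_in[OF ij(2)] flip_in[OF ij(1)]]
    using rep_op_smult[OF so_gen_in[OF ij], of "- 1"] scal_if(2)[of True] by simp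
qed

lemma Fop_comm:
  assumes ij: "i \<in> {1..N}" "j \<in> {1..N}" "k \<in> {1..N}" "l \<in> {1..N}"
  shows "Fop i j * Fop k l - Fop k l * Fop i j =
        (if k = j then Fop i l else 0) - (if i = l then Fop k j else 0)
        - (if k = flip N i then Fop (flip N j) l else 0)
        + (if l = flip N j then Fop k (flip N i) else 0)"
proof -
  note fi = flip_in[OF ij(1)] and fj = flip_in[OF ij(2)]
  note g = so_gen_in[OF ij(1,4)] so_gen_in[OF ij(3,2)] so_gen_in[OF fj ij(4)] so_gen_in[OF ij(3) fi]
  have "Fop i j * Fop k l - Fop k l * Fop i j = rep_op (so_gen N i j * so_gen N k l - so_gen N k l * so_gen N i j)"
    unfolding Fop_in[OF ij(1,2)] Fop_in[OF ij(3,4)] by (rule rep_op_bracket[OF so_gen_in[OF ij(1,2)] so_gen_in[OF ij(3,4)], symmetric])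
  also have "\<dots> = (if k = j then Fop i l else 0) + (if i = l then - Fop k j else 0)
        + ((if k = flip N i then - Fop (flip N j) l else 0)
        + (if l = flip N j then Fop k (flip N i) else 0))"
    unfolding so_gen_comm[OF ij]
      rep_op_add[OF so_add[OF so_smult[OF g(1)] so_smult[OF g(2)]] so_add[OF so_smult[OF g(3)] so_smult[OF g(4)]]]
      rep_op_add[OF so_smult[OF g(1)] so_smult[OF g(2)]] rep_op_add[OF so_smult[OF g(3)] so_smult[OF g(4)]]
      rep_op_smult[OF g(1)] rep_op_smult[OF g(2)] rep_op_smult[OF g(3)] rep_op_smult[OF g(4)] scal_if
      Fop_in[OF ij(1,4)] Fop_in[OF ij(3,2)] Fop_in[OF fj ij(4)] Fop_in[OF ij(3) fi] ..
  also have "\<dots> = (if k = j then Fop i l else 0) - (if i = l then Fop k j else 0)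
        - (if k = flip N i then Fop (flip N j) l else 0)
        + (if l = flip N j then Fop k (flip N i) else 0)"
  proof -
    have n: "(if P then - x else 0) = - (if P then x else 0)" for P and x :: "'v fock_op" by simp
    show ?thesis unfolding n by (simp only: diff_conv_add_uminus add.assoc)
  qed
  finally show ?thesis .
qed

abbreviation "e_op i \<equiv> crea (2 * i) :: 'v fock_op"
abbreviation "f_op i \<equiv> crea (2 * i + 1) :: 'v fock_op"
abbreviation "de_op i \<equiv> anni (2 * i) :: 'v fock_op"
abbreviation "df_op i \<equiv> anni (2 * i + 1) :: 'v fock_op"

sublocale fock: so_fock N scal Fop e_op f_op de_op df_op
proof
  fix i j :: nat
  \<comment> \<open>The e occupy even and the f odd positions, so an e and an f are always different
    generators.\<close>
  have "2 * i \<noteq> 2 * j + 1" "2 * i + 1 \<noteq> 2 * j" by presburger+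
  thus "de_op i * f_op j = - (f_op j * de_op i)" "df_op i * e_op j = - (e_op j * df_op i)"
    unfolding anni_crea by simp_all
qed (rule scal.s_add scal.s_mult scal.s_one scal.s_central crea_anticomm crea_sq Fop_crea Fop_anni
  | (rule Fop_skew Fop_comm; assumption) | (simp add: anni_crea))+

definition ann :: "'v \<Rightarrow> 'v fock_op set" where "ann v = {A. \<forall>S. Rep_fock_op A (vac (coords v)) S = 0}"

lemma so_vac_ann: "so_vac N scal Fop e_op f_op de_op df_op (ann v)"
proof -
  interpret left_ideal "ann v" unfolding ann_def by (rule left_ideal_annihilator)
  show ?thesis by unfold_locales (simp_all add: ann_def anni_vac)
qed

lemma ev_casimir: "ev (casimir_word N k) = fock.cas (\<lambda>a. of_nat a - of_nat k) (2 * k)"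
  unfolding casimir_word_def fock.cas_def scal.feval_sum scal.feval_mult scal.feval_const scal.feval_prod_list map_map comp_def
proof (intro sum.cong refl arg_cong2[where f = "(*)"] arg_cong[where f = prod_list] map_cong)
  fix I K a assume "I \<in> multi_indices N (2 * k)" "K \<in> multi_indices N (2 * k)" "a \<in> set [1..<2 * k + 1]"
  hence "I a \<in> {1..N}" "K a \<in> {1..N}" using multi_indices_in[of _ N "2 * k" a] by auto
  thus "ev (shifted_gen N k a (I a) (K a)) = Fop (I a) (K a) + scal ((of_nat a - of_nat k) * (if I a = K a then 1 else 0))"
    by (simp only: shifted_gen_def scal.feval_add scal.feval_letter scal.feval_const Fop_in)
qed

lemma cas_commutes_with_odd:
  "fock.cas u m * crea i = crea i * fock.cas u m" "fock.cas u m * anni i = anni i * fock.cas u m"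
  by (rule fock.cas_comm[symmetric], simp add: Fop_crea) (rule fock.cas_comm[symmetric], simp add: Fop_anni)

text \<open>Centrality is known after multiplication by \<open>vol\<close>; the commutator commutes
  with all odd operators, so \<open>strip_vol\<close> removes that factor on every vacuum
  state.\<close>

lemma cas_central_ann:
  assumes kl: "k \<in> {1..N}" "l \<in> {1..N}" and m: "m \<le> N"
  shows "Fop k l * fock.cas u m - fock.cas u m * Fop k l \<in> ann v"
proof -
  interpret vc: so_vac N scal Fop e_op f_op de_op df_op "ann v" by (rule so_vac_ann)
  let ?x = "Fop k l * fock.cas u m - fock.cas u m * Fop k l"
  have c: "?x * y = y * ?x" if "Fop k l * y = y * Fop k l" "fock.cas u m * y = y * fock.cas u m" for y
  proof -
    have t: "a * b * y = y * (a * b)" if "a * y = y * a" "b * y = y * b" for a b :: "'v fock_op"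
    proof -
      have "a * b * y = a * (y * b)" unfolding mult.assoc that(2) ..
      also have "\<dots> = y * (a * b)" unfolding mult.assoc[symmetric] that(1) ..
      finally show ?thesis .
    qed
    show ?thesis unfolding left_diff_distrib right_diff_distrib t[OF that] t[OF that(2,1)] ..
  qed
  show ?thesis
  proof (rule vc.strip_vol)
    show "?x * fock.vol \<in> ann v" unfolding fock.cas_central[OF kl m] by (rule vc.L_zero)
  qed (rule c[OF Fop_crea cas_commutes_with_odd(1)] c[OF Fop_anni cas_commutes_with_odd(2)])+
qed

lemma rep_op_expand:
  assumes x: "x \<in> so_algebra N"
  shows "rep_op x = (\<Sum>i=1..N. \<Sum>j=1..N. scal (ent x i j / 2) * Fop i j)"
proof -
  have "so.cong_env N (letter x) (\<Sum>i=1..N. \<Sum>j=1..N. const (ent x i j / 2) * letter (so_gen N i j))"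
  proof (rule letter_expand[OF x])
    fix r s assume rs: "r \<in> {1..N}" "s \<in> {1..N}"
    have "ent x (flip N s) (flip N r) = - ent x r s" using x rs unfolding so_algebra_iff by blast
    thus "ent x r s = (\<Sum>i=1..N. \<Sum>j=1..N. ent x i j / 2 * ent (so_gen N i j) r s)"
      unfolding sum_ent_so_gen[OF rs] by simp
  qed
  hence "letter x - (\<Sum>i=1..N. \<Sum>j=1..N. const (ent x i j / 2) * letter (so_gen N i j)) \<in> env_ideal (so_algebra N)"
    unfolding so.cong_env_def by blast
  hence "ev (letter x) - ev (\<Sum>i=1..N. \<Sum>j=1..N. const (ent x i j / 2) * letter (so_gen N i j)) = 0"
    unfolding scal.feval_diff[symmetric] by (rule ev_ideal)
  hence "ev (letter x) = ev (\<Sum>i=1..N. \<Sum>j=1..N. const (ent x i j / 2) * letter (so_gen N i j))"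
    by (rule right_minus_eq[THEN iffD1])
  also have "\<dots> = (\<Sum>i=1..N. \<Sum>j=1..N. scal (ent x i j / 2) * Fop i j)"
    unfolding scal.feval_sum scal.feval_mult scal.feval_const scal.feval_letter
    by (intro sum.cong refl) (simp only: Fop_in)
  finally show ?thesis unfolding scal.feval_letter .
qed

lemma cas_central_rep_op:
  assumes x: "x \<in> so_algebra N" and m: "m \<le> N"
  shows "rep_op x * fock.cas u m - fock.cas u m * rep_op x \<in> ann v"
proof -
  interpret vc: so_vac N scal Fop e_op f_op de_op df_op "ann v" by (rule so_vac_ann)
  have s: "(\<And>i. i \<in> A \<Longrightarrow> h i \<in> ann v) \<Longrightarrow> (\<Sum>i\<in>A. h i) \<in> ann v" for A :: "nat set" and h
    by (induction A rule: infinite_finite_induct) (auto intro: vc.L_zero vc.L_add)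
  have t: "scal c * Fop i j * fock.cas u m - fock.cas u m * (scal c * Fop i j) =
      scal c * (Fop i j * fock.cas u m - fock.cas u m * Fop i j)" for c i j
  proof -
    have "fock.cas u m * (scal c * Fop i j) = scal c * (fock.cas u m * Fop i j)"
      unfolding mult.assoc[symmetric] scal.s_central[of "fock.cas u m"] ..
    thus ?thesis unfolding right_diff_distrib mult.assoc by simp
  qed
  have e: "rep_op x * fock.cas u m - fock.cas u m * rep_op x =
    (\<Sum>i=1..N. \<Sum>j=1..N. scal (ent x i j / 2) * (Fop i j * fock.cas u m - fock.cas u m * Fop i j))"
    unfolding rep_op_expand[OF x] sum_distrib_right sum_distrib_left sum_subtractf[symmetric] t ..
  show ?thesis
    unfolding e by (intro s vc.L_mult cas_central_ann m)
qed

text \<open>The annihilator of the highest weight vector in the vacuum satisfies the hypotheses of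
  both \<open>so_hw\<close> and \<open>so_vac\<close>: the first gives the eigenvalue times
  \<open>vol\<close>, the second cancels \<open>vol\<close>.\<close>

lemma casimir_highest:
  assumes xi: "\<xi> \<in> V" and raise: "\<And>i j. 1 \<le> i \<Longrightarrow> i < j \<Longrightarrow> j \<le> N \<Longrightarrow> \<rho> (so_gen N i j) \<xi> = 0"
    and weight: "\<And>i. 1 \<le> i \<Longrightarrow> i \<le> N div 2 \<Longrightarrow> \<rho> (so_gen N i i) \<xi> = scale (lam i) \<xi>"
    and k: "1 \<le> k" "k \<le> N div 2"
  shows "free_action scale \<rho> (casimir_word N k) \<xi> = scale ((- 1) ^ k * EE N lam (N div 2) k) \<xi>"
proof -
  let ?u = "\<lambda>a. of_nat a - of_nat k :: complex" and ?c = "(- 1) ^ k * EE N lam (N div 2) k"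
  interpret vc: so_vac N scal Fop e_op f_op de_op df_op "ann \<xi>" by (rule so_vac_ann)
  interpret hw: so_hw N scal Fop e_op f_op de_op df_op "ann \<xi>" lam
  proof
    fix i j assume ij: "1 \<le> i" "i < j" "j \<le> N"
    have i: "i \<in> {1..N}" "j \<in> {1..N}" using ij by auto
    show "Fop i j \<in> ann \<xi>"
      unfolding ann_def mem_Collect_eq Fop_in[OF i] rep_op_vac[OF so_gen_in[OF i] xi] raise[OF ij] by (simp add: coords_zero vac_def)
  next
    fix i assume ij: "1 \<le> i" "i \<le> N div 2"
    have i: "i \<in> {1..N}" using ij by auto
    show "Fop i i - scal (lam i) \<in> ann \<xi>"
      unfolding ann_def mem_Collect_eq Fop_in[OF i i] Rep_fock_op_diff rep_op_vac[OF so_gen_in[OF i i] xi] weight[OF ij]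
        scal_vac coords_scale[OF xi] by simp
  qed
  let ?x = "fock.cas ?u (2 * k) - scal ?c"
  have c: "?x * y = y * ?x" if "fock.cas ?u (2 * k) * y = y * fock.cas ?u (2 * k)" for y
    unfolding left_diff_distrib right_diff_distrib that scal.s_central[of y] ..
  have "?x \<in> ann \<xi>"
  proof (rule vc.strip_vol)
    show "?x * fock.vol \<in> ann \<xi>" by (rule hw.eigen_cas[OF k])
  qed (rule c[OF cas_commutes_with_odd(1)] c[OF cas_commutes_with_odd(2)])+
  hence "Rep_fock_op (ev (casimir_word N k)) (vac (coords \<xi>)) = Rep_fock_op (scal ?c) (vac (coords \<xi>))"
    unfolding ev_casimir ann_def mem_Collect_eq Rep_fock_op_diff by (intro ext) simp
  hence "vac (coords (free_action scale \<rho> (casimir_word N k) \<xi>)) = vac (coords (scale ?c \<xi>))"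
    unfolding ev_vac(2)[OF words_in_casimir xi] scal_vac coords_scale[OF xi] .
  thus ?thesis by (rule vac_coords_inj[OF ev_vac(1)[OF words_in_casimir xi] subspace_scale[OF V_sub xi]])
qed

lemma casimir_subrep:
  assumes k: "2 * k \<le> N"
  shows "subrepresentation (so_algebra N) scale V \<rho> {v \<in> V. free_action scale \<rho> (casimir_word N k) v = scale c v}"
    (is "subrepresentation _ _ _ _ ?W")
proof -
  let ?a = "free_action scale \<rho> (casimir_word N k)"
  let ?z = "ev (casimir_word N k)"
  have fa: "Rep_fock_op ?z (vac (coords v)) = vac (coords (?a v))" if "v \<in> V" for v
    by (rule ev_vac(2)[OF words_in_casimir that])
  have fi: "?a v \<in> V" if "v \<in> V" for v by (rule ev_vac(1)[OF words_in_casimir that])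
  have va: "vac (u + w) = (\<lambda>S. vac u S + vac w S)" "vac (smul c u) = (\<lambda>S. smul c (vac u S))" for u w c
    by (auto simp: vac_def smul_simps)
  have aadd: "?a (v + w) = ?a v + ?a w" if "v \<in> V" "w \<in> V" for v w
  proof (rule vac_coords_inj)
    have vw: "v + w \<in> V" by (rule subspace_add[OF V_sub that])
    show "?a (v + w) \<in> V" by (rule fi[OF vw])
    show "?a v + ?a w \<in> V" by (rule subspace_add[OF V_sub fi[OF that(1)] fi[OF that(2)]])
    show "vac (coords (?a (v + w))) = vac (coords (?a v + ?a w))"
      unfolding fa[OF vw, symmetric] coords_add[OF fi[OF that(1)] fi[OF that(2)]] coords_add[OF that] va
        lin_addD[OF Rep_lin] fa[OF that(1)] fa[OF that(2)] ..
  qed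
  have ascale: "?a (scale d v) = scale d (?a v)" if "v \<in> V" for v d
  proof (rule vac_coords_inj)
    have vw: "scale d v \<in> V" by (rule subspace_scale[OF V_sub that])
    show "?a (scale d v) \<in> V" by (rule fi[OF vw])
    show "scale d (?a v) \<in> V" by (rule subspace_scale[OF V_sub fi[OF that]])
    show "vac (coords (?a (scale d v))) = vac (coords (scale d (?a v)))"
      unfolding fa[OF vw, symmetric] coords_scale[OF fi[OF that]] coords_scale[OF that] va
        lin_smulD[OF Rep_lin] fa[OF that] ..
  qed
  have arho: "?a (\<rho> x v) = \<rho> x (?a v)" if x: "x \<in> so_algebra N" and v: "v \<in> V" for x v
  proof (rule vac_coords_inj)
    show "?a (\<rho> x v) \<in> V" by (rule fi[OF rho_in[OF x v]])
    show "\<rho> x (?a v) \<in> V" by (rule rho_in[OF x fi[OF v]])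
    have "rep_op x * ?z - ?z * rep_op x \<in> ann v"
      unfolding ev_casimir by (rule cas_central_rep_op[OF x k])
    hence "Rep_fock_op (rep_op x) (Rep_fock_op ?z (vac (coords v))) = Rep_fock_op ?z (Rep_fock_op (rep_op x) (vac (coords v)))"
      unfolding ann_def mem_Collect_eq Rep_fock_op_diff Rep_fock_op_mult by (intro ext) simp
    thus "vac (coords (?a (\<rho> x v))) = vac (coords (\<rho> x (?a v)))"
      unfolding fa[OF v] rep_op_vac[OF x v] rep_op_vac[OF x fi[OF v]] fa[OF rho_in[OF x v]] by (rule sym)
  qed
  have "subspace ?W"
  proof (rule subspaceI)
    have "?a 0 = 0" using ascale[OF subspace_0[OF V_sub], of 0] by simp
    thus "0 \<in> ?W" using subspace_0[OF V_sub] by simp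
  next
    fix v w assume "v \<in> ?W" "w \<in> ?W"
    hence v: "v \<in> V" "w \<in> V" "?a v = scale c v" "?a w = scale c w" by auto
    show "v + w \<in> ?W"
      using subspace_add[OF V_sub v(1,2)] unfolding mem_Collect_eq aadd[OF v(1,2)] v(3,4) scale_right_distrib by simp
  next
    fix d v assume "v \<in> ?W"
    hence v: "v \<in> V" "?a v = scale c v" by auto
    show "scale d v \<in> ?W"
      using subspace_scale[OF V_sub v(1)] unfolding mem_Collect_eq ascale[OF v(1)] v(2) by (simp add: mult.commute)
  qed
  moreover have "\<rho> x v \<in> ?W" if x: "x \<in> so_algebra N" and v: "v \<in> ?W" for x v
  proof -
    have v: "v \<in> V" "?a v = scale c v" using v by auto
    show ?thesis using rho_in[OF x v(1)] unfolding mem_Collect_eq arho[OF x v(1)] v(2) rho_scale[OF x v(1)] by simp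
  qed
  ultimately show ?thesis unfolding subrepresentation_def by blast
qed

end

text \<open>The eigenspace for the eigenvalue of the highest weight vector is a subrepresentation
  containing this vector, hence all of V. The basis is a maximal independent subset, so the
  dimension may be infinite.\<close>

lemma casimir_acts:
  assumes hw: "highest_weight_irrep N lam scale V \<rho> \<xi>" and k: "1 \<le> k" "k \<le> N div 2" and v: "v \<in> V"
  shows "env_action scale \<rho> (casimir N k) v = scale ((- 1) ^ k * EE N lam (N div 2) k) v"
proof -
  have rep: "lie_representation (so_algebra N) scale V \<rho>" and xi: "\<xi> \<in> V"
    and gen: "\<And>W. subrepresentation (so_algebra N) scale V \<rho> W \<Longrightarrow> \<xi> \<in> W \<Longrightarrow> W = V"
    and raise: "\<And>i j. 1 \<le> i \<Longrightarrow> i < j \<Longrightarrow> j \<le> N \<Longrightarrow> \<rho> (so_gen N i j) \<xi> = 0"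
    and weight: "\<And>i. 1 \<le> i \<Longrightarrow> i \<le> N div 2 \<Longrightarrow> \<rho> (so_gen N i i) \<xi> = scale (lam i) \<xi>"
    using hw unfolding highest_weight_irrep_def irreducible_representation_def by blast+
  interpret vector_space scale using rep unfolding lie_representation_def by blast
  obtain B where B: "B \<subseteq> V" "independent B" "V \<subseteq> span B" by (rule maximal_independent_subset)
  interpret so_rep scale N V B \<rho> by unfold_locales (rule rep B)+
  let ?c = "(- 1) ^ k * EE N lam (N div 2) k"
  have "{v \<in> V. free_action scale \<rho> (casimir_word N k) v = scale ?c v} = V"
  proof (rule gen[OF casimir_subrep])
    show "2 * k \<le> N" using k by simp
    show "\<xi> \<in> {v \<in> V. free_action scale \<rho> (casimir_word N k) v = scale ?c v}"
      using casimir_highest[OF xi raise weight k] xi by simp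
  qed
  thus ?thesis unfolding casimir_class env_action_class[OF words_in_casimir v] using v by blast
qed

theorem theorem3p6:
  fixes N n k :: nat
  assumes "N = 2 * n \<or> N = 2 * n + 1"
    and "n \<ge> 1"
    and "1 \<le> k" and "k \<le> n"
  shows "casimir N k \<in> orthogonal_invariants N \<and>
    harish_chandra_image TYPE('v::ab_group_add) N (casimir N k)
      (\<lambda>lam. (-1) ^ k *
         factorial_elem_sym n k (\<lambda>i. (shifted_weight N lam i)\<^sup>2) (shift_sequence N))"
proof
  have n: "N div 2 = n" using assms(1) by auto
  show "casimir N k \<in> orthogonal_invariants N" by (rule casimir_invariant)
  show "harish_chandra_image TYPE('v) N (casimir N k)
      (\<lambda>lam. (-1) ^ k * factorial_elem_sym n k (\<lambda>i. (shifted_weight N lam i)\<^sup>2) (shift_sequence N))"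
    unfolding harish_chandra_image_def
  proof (intro allI impI ballI)
    fix lam scale and V :: "'v set" and \<rho> \<xi> v
    assume hw: "highest_weight_irrep N lam scale V \<rho> \<xi>" and v: "v \<in> V"
    have "k \<le> N div 2" unfolding n by (rule assms(4))
    from casimir_acts[OF hw assms(3) this v]
    show "env_action scale \<rho> (casimir N k) v =
        scale ((-1) ^ k * factorial_elem_sym n k (\<lambda>i. (shifted_weight N lam i)\<^sup>2) (shift_sequence N)) v"
      unfolding EE_harish_chandra unfolding n .
  qed
qed

end
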